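(* Let $d,L\in\mathbb{N}^*$ and let $f_0,f_1,f_2$ be analytic vector fields on a neighborhood of $0$ in $\mathbb{R}^d$ with $f_0(0)=0$. Assume that $r:=\dim\left(S_1(f)(0)\right)<d$ and that there exist brackets $b_{r+1},\dots,b_d\in\mathcal{B}_{2,good}$ such that $\max_{r+1\leq i\leq d}|b_i|=L$ and $$S_1(f)(0)\oplus\mathrm{Span}(f_{b_{r+1}}(0),\dots,f_{b_d}(0))=\mathbb{R}^d.$$ 1. Let $j\in\{r+1,\dots,d\}$ and assume that $f_b(0)\in S_1(f)(0)$ for all $b\in\mathcal{B}_{2,bad}$ such that $|b|\leq|b_j|$. Then, for every $m\in\mathbb{N}$, the vector $f_{b_j}(0)$ is a small-time $W^{m,\infty}_0$-continuously approximately reachable vector for the system $x'=f_0(x)+u(t)f_1(x)+v(t)f_2(x)$. 2. Consequently, if $f_b(0)\in S_1(f)(0)$ for all $b\in\mathcal{B}_{2,bad}$ such that $|b|\leq L$, then the system $x'=f_0(x)+u(t)f_1(x)+v(t)f_2(x)$ is smooth-STLC.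
   Context: Brackets. $X=\{X_0,X_1,X_2\}$ is a set of three non-commuting indeterminates; $\mathrm{Br}(X)$ is the free magma over $X$ (iterated formal brackets: each $X_i\in\mathrm{Br}(X)$ and $(a,b)\in\mathrm{Br}(X)$ if $a,b\in\mathrm{Br}(X)$). $|b|$ is the length of $b$, $n_i(b)$ the number of occurrences of $X_i$ in $b$, $n(b)=n_1(b)+n_2(b)$. $b0^\nu$ denotes $(\cdots((b,X_0),X_0),\dots,X_0)$ with $\nu$ occurrences of $X_0$ appended. For $b=(b',b'')$, $(-1)^jb$ means $(b'',b')$ if $j$ is odd and $b$ if $j$ is even. Put $M^i_k=X_i0^k$ for $i\in\{1,2\}$, $k\in\mathbb{N}=\{0,1,\dots\}$, and $$\mathcal{B}_{2,bad}=\{W^i_{j,l}=(M^i_{j-1},M^i_j)0^l:\ i\in\{1,2\},\ j\in\mathbb{N}^*,\ l\in\mathbb{N}\},$$ $$\mathcal{B}_{2,good}=\{C_{j,l}=\big((-1)^j(M^1_{\lfloor\frac{j+1}{2}\rfloor},M^2_{\lfloor\frac j2\rfloor})\big)0^l:\ j,l\in\mathbb{N}\}.$$ Evaluation. $\mathcal{L}(X)$ is the free Lie algebra over $\mathbb{R}$ generated by $X$; each $b\in\mathrm{Br}(X)$ evaluates to $\mathrm{e}(b)\in\mathcal{L}(X)$ by replacing formal brackets by Lie brackets. For vector fields, $[f,g](x)=Dg(x)f(x)-Df(x)g(x)$. $\Lambda$ is the Lie algebra homomorphism from $\mathcal{L}(X)$ to vector fields with $\Lambda(X_i)=f_i$,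 and $f_b=\Lambda(\mathrm{e}(b))$. $S_1(X)=\mathrm{Span}\{\mathrm{e}(b):\ b\in\mathrm{Br}(X),\ n(b)=1\}$ and $S_1(f)(0)=\{\Lambda(a)(0):a\in S_1(X)\}\subseteq\mathbb{R}^d$. Control notions. $x(\cdot;(u,v),p)$ is the solution of $x'=f_0(x)+uf_1(x)+vf_2(x)$ with $x(0)=p$. $W^{m,\infty}_0((0,T),\mathbb{R})$ is the space of $w\in W^{m,\infty}((0,T),\mathbb{R})$ with $w^{(k)}(0)=w^{(k)}(T)=0$ for $0\leq k<m$. The system is $W^{m,\infty}_0$-STLC if for every $T,\varepsilon>0$ there is $\delta>0$ such that for every $x_f\in B(0,\delta)$ there exist $u,v\in W^{m,\infty}_0((0,T),\mathbb{R})$ with $\|(u,v)\|_{W^{m,\infty}}\leq\varepsilon$ and $x(T;(u,v),0)=x_f$. It is smooth-STLC if it is $W^{m,\infty}_0$-STLC for every $m\in\mathbb{N}$. A vector $\xi\in\mathbb{R}^d$ is a small-time $W^{m,\infty}_0$-continuously approximately reachable vector if there is a continuous map $\Xi:[0,+\infty)\to\mathbb{R}^d$ with $\Xi(0)=\xi$ such that for all $T>0$ there exist $C,\rho,s>0$ and a continuous map $z\in(-\rho,\rho)\mapsto(u_z,v_z)\in W^{m,\infty}_0((0,T),\mathbb{R})^2$ with, for all $z\in(-\rho,\rho)$, $\|x(T;(u_z,v_z),0)-z\,\Xi(T)\|\leq C|z|^{1+s}$ and $\|(u_z,v_z)\|_{W^{m,\infty}}\leq C|z|^s$. *)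

theory Defs
  imports "HOL-Analysis.Analysis" "HOL-Probability.Essential_Supremum"
begin

section \<open>Formal brackets\<close>

datatype indet = X0 | X1 | X2

datatype br = Ind indet | Brk br br

fun len :: "br \<Rightarrow> nat" where
  "len (Ind g) = 1"
| "len (Brk a b) = len a + len b"

fun occ :: "indet \<Rightarrow> br \<Rightarrow> nat" where
  "occ g (Ind h) = (if h = g then 1 else 0)"
| "occ g (Brk a b) = occ g a + occ g b"

definition occ12 :: "br \<Rightarrow> nat" where
  "occ12 b = occ X1 b + occ X2 b"

definition app0 :: "br \<Rightarrow> nat \<Rightarrow> br" where
  "app0 b \<nu> = ((\<lambda>a. Brk a (Ind X0)) ^^ \<nu>) b"

text \<open>The bracket \<open>(-1)\<^sup>j b\<close>; it is only used for \<open>b\<close> of length at least two.\<close>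

fun signed :: "nat \<Rightarrow> br \<Rightarrow> br" where
  "signed j (Ind g) = Ind g"
| "signed j (Brk a b) = (if odd j then Brk b a else Brk a b)"

definition M_br :: "indet \<Rightarrow> nat \<Rightarrow> br" where
  "M_br i k = app0 (Ind i) k"

definition W_br :: "indet \<Rightarrow> nat \<Rightarrow> nat \<Rightarrow> br" where
  "W_br i j l = app0 (Brk (M_br i (j - 1)) (M_br i j)) l"

definition C_br :: "nat \<Rightarrow> nat \<Rightarrow> br" where
  "C_br j l = app0 (signed j (Brk (M_br X1 ((j + 1) div 2)) (M_br X2 (j div 2)))) l"

definition B2_bad :: "br set" where
  "B2_bad = {W_br i j l |i j l. i \<in> {X1, X2} \<and> 1 \<le> j}"

definition B2_good :: "br set" where
  "B2_good = {C_br j l |j l. True}"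


section \<open>The free real Lie algebra over \<open>X\<^sub>0, X\<^sub>1, X\<^sub>2\<close>\<close>

text \<open>
  It is constructed as the algebra of Lie terms modulo the least congruence that contains
  the real vector space axioms, the bilinearity and the alternation of the bracket, and
  the Jacobi identity.
\<close>

datatype lterm =
  LZero | LGen indet | LAdd lterm lterm | LScale real lterm | LBr lterm lterm

inductive lie_eq :: "lterm \<Rightarrow> lterm \<Rightarrow> bool" where
  refl: "lie_eq s s"
| sym: "lie_eq s t \<Longrightarrow> lie_eq t s"
| trans: "lie_eq s t \<Longrightarrow> lie_eq t u \<Longrightarrow> lie_eq s u"
| cong_add: "lie_eq s s' \<Longrightarrow> lie_eq t t' \<Longrightarrow> lie_eq (LAdd s t) (LAdd s' t')"
| cong_scale: "lie_eq s s' \<Longrightarrow> lie_eq (LScale c s) (LScale c s')"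
| cong_br: "lie_eq s s' \<Longrightarrow> lie_eq t t' \<Longrightarrow> lie_eq (LBr s t) (LBr s' t')"
| add_assoc: "lie_eq (LAdd (LAdd s t) u) (LAdd s (LAdd t u))"
| add_commute: "lie_eq (LAdd s t) (LAdd t s)"
| add_zero: "lie_eq (LAdd LZero s) s"
| add_inverse: "lie_eq (LAdd (LScale (- 1) s) s) LZero"
| scale_add_right: "lie_eq (LScale c (LAdd s t)) (LAdd (LScale c s) (LScale c t))"
| scale_add_left: "lie_eq (LScale (c + d) s) (LAdd (LScale c s) (LScale d s))"
| scale_scale: "lie_eq (LScale c (LScale d s)) (LScale (c * d) s)"
| scale_one: "lie_eq (LScale 1 s) s"
| br_add_left: "lie_eq (LBr (LAdd s t) u) (LAdd (LBr s u) (LBr t u))"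
| br_add_right: "lie_eq (LBr s (LAdd t u)) (LAdd (LBr s t) (LBr s u))"
| br_scale_left: "lie_eq (LBr (LScale c s) t) (LScale c (LBr s t))"
| br_scale_right: "lie_eq (LBr s (LScale c t)) (LScale c (LBr s t))"
| br_alt: "lie_eq (LBr s s) LZero"
| jacobi: "lie_eq (LAdd (LBr s (LBr t u)) (LAdd (LBr t (LBr u s)) (LBr u (LBr s t)))) LZero"

quotient_type free_lie = lterm / lie_eq
  by (rule equivpI) (auto intro: reflpI sympI transpI lie_eq.refl lie_eq.sym lie_eq.trans)

instantiation free_lie :: real_vector
begin

lift_definition zero_free_lie :: free_lie is LZero .

lift_definition plus_free_lie :: "free_lie \<Rightarrow> free_lie \<Rightarrow> free_lie" is LAdd
  by (rule lie_eq.cong_add)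

lift_definition scaleR_free_lie :: "real \<Rightarrow> free_lie \<Rightarrow> free_lie" is LScale
  by (rule lie_eq.cong_scale)

lift_definition uminus_free_lie :: "free_lie \<Rightarrow> free_lie" is "LScale (- 1)"
  by (rule lie_eq.cong_scale)

lift_definition minus_free_lie :: "free_lie \<Rightarrow> free_lie \<Rightarrow> free_lie"
  is "\<lambda>s t. LAdd s (LScale (- 1) t)"
  by (intro lie_eq.cong_add lie_eq.cong_scale)

instance
proof
  fix x y z :: free_lie and c d :: real
  show "x + y + z = x + (y + z)" by transfer (rule lie_eq.add_assoc)
  show "x + y = y + x" by transfer (rule lie_eq.add_commute)
  show "0 + x = x" by transfer (rule lie_eq.add_zero)
  show "- x + x = 0" by transfer (rule lie_eq.add_inverse)
  show "x - y = x + - y" by transfer (rule lie_eq.refl)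
  show "c *\<^sub>R (x + y) = c *\<^sub>R x + c *\<^sub>R y" by transfer (rule lie_eq.scale_add_right)
  show "(c + d) *\<^sub>R x = c *\<^sub>R x + d *\<^sub>R x" by transfer (rule lie_eq.scale_add_left)
  show "c *\<^sub>R d *\<^sub>R x = (c * d) *\<^sub>R x" by transfer (rule lie_eq.scale_scale)
  show "1 *\<^sub>R x = x" by transfer (rule lie_eq.scale_one)
qed

end

lift_definition lie_gen :: "indet \<Rightarrow> free_lie" is LGen .

lift_definition lie_bracket :: "free_lie \<Rightarrow> free_lie \<Rightarrow> free_lie" is LBr
  by (rule lie_eq.cong_br)

lemma lie_bracket_simps:
  "lie_bracket (a + b) c = lie_bracket a c + lie_bracket b c"
  "lie_bracket a (b + c) = lie_bracket a b + lie_bracket a c"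
  "lie_bracket (r *\<^sub>R a) b = r *\<^sub>R lie_bracket a b"
  "lie_bracket a (r *\<^sub>R b) = r *\<^sub>R lie_bracket a b"
  "lie_bracket a a = 0"
  by (transfer; rule lie_eq.br_add_left lie_eq.br_add_right lie_eq.br_scale_left
      lie_eq.br_scale_right lie_eq.br_alt)+

lemma lie_bracket_jacobi:
  "lie_bracket a (lie_bracket b c) +
    (lie_bracket b (lie_bracket c a) + lie_bracket c (lie_bracket a b)) = 0"
  by transfer (rule lie_eq.jacobi)

fun e_br :: "br \<Rightarrow> free_lie" where
  "e_br (Ind g) = lie_gen g"
| "e_br (Brk a b) = lie_bracket (e_br a) (e_br b)"

definition S1_X :: "free_lie set" where
  "S1_X = span {e_br b |b. occ12 b = 1}"


section \<open>Analytic vector fields and evaluation of brackets\<close>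

text \<open>Power series in several variables; a multi-index is a map \<open>'n \<Rightarrow> nat\<close>.\<close>

definition real_analytic_on ::
    "(real ^ 'n \<Rightarrow> 'b::real_normed_vector) \<Rightarrow> (real ^ 'n) set \<Rightarrow> bool"
    (infix "real'_analytic'_on" 50) where
  "f real_analytic_on U \<longleftrightarrow>
    (\<forall>p\<in>U. \<exists>\<rho>>0. \<exists>c :: ('n \<Rightarrow> nat) \<Rightarrow> 'b. \<forall>x. (\<forall>i. \<bar>x $ i - p $ i\<bar> < \<rho>) \<longrightarrow>
      ((\<lambda>\<alpha>. (\<Prod>i\<in>UNIV. (x $ i - p $ i) ^ \<alpha> i) *\<^sub>R c \<alpha>) has_sum f x) UNIV)"

definition vf_bracket ::
    "('a::real_normed_vector \<Rightarrow> 'a) \<Rightarrow> ('a \<Rightarrow> 'a) \<Rightarrow> 'a \<Rightarrow> 'a" where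
  "vf_bracket f g x = frechet_derivative g (at x) (f x) - frechet_derivative f (at x) (g x)"

text \<open>
  Lie algebra homomorphisms into the analytic vector fields on the open set \<open>U\<close>. A vector
  field on \<open>U\<close> is a total function of which only the restriction to \<open>U\<close> matters.
\<close>

definition vf_lie_hom :: "(real ^ 'n) set \<Rightarrow> (free_lie \<Rightarrow> real ^ 'n \<Rightarrow> real ^ 'n) \<Rightarrow> bool" where
  "vf_lie_hom U \<Lambda> \<longleftrightarrow>
    (\<forall>a. \<Lambda> a real_analytic_on U) \<and>
    (\<forall>a b. \<forall>x\<in>U. \<Lambda> (a + b) x = \<Lambda> a x + \<Lambda> b x) \<and>
    (\<forall>r a. \<forall>x\<in>U. \<Lambda> (r *\<^sub>R a) x = r *\<^sub>R \<Lambda> a x) \<and>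
    (\<forall>a b. \<forall>x\<in>U. \<Lambda> (lie_bracket a b) x = vf_bracket (\<Lambda> a) (\<Lambda> b) x)"

text \<open>
  The homomorphism that maps \<open>X\<^sub>i\<close> to \<open>f\<^sub>i\<close>. For \<open>f\<^sub>i\<close> analytic on the open set \<open>U\<close>
  it exists by freeness, and \<open>\<Lambda> a\<close> is uniquely determined on \<open>U\<close>.
\<close>

definition Lam ::
    "(real ^ 'n) set \<Rightarrow> (real ^ 'n \<Rightarrow> real ^ 'n) \<Rightarrow> (real ^ 'n \<Rightarrow> real ^ 'n) \<Rightarrow>
      (real ^ 'n \<Rightarrow> real ^ 'n) \<Rightarrow> free_lie \<Rightarrow> real ^ 'n \<Rightarrow> real ^ 'n" where
  "Lam U f0 f1 f2 =
    (SOME \<Lambda>. vf_lie_hom U \<Lambda> \<and>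
      (\<forall>x\<in>U. \<Lambda> (lie_gen X0) x = f0 x \<and> \<Lambda> (lie_gen X1) x = f1 x \<and> \<Lambda> (lie_gen X2) x = f2 x))"

definition f_br ::
    "(real ^ 'n) set \<Rightarrow> (real ^ 'n \<Rightarrow> real ^ 'n) \<Rightarrow> (real ^ 'n \<Rightarrow> real ^ 'n) \<Rightarrow>
      (real ^ 'n \<Rightarrow> real ^ 'n) \<Rightarrow> br \<Rightarrow> real ^ 'n \<Rightarrow> real ^ 'n" where
  "f_br U f0 f1 f2 b = Lam U f0 f1 f2 (e_br b)"

definition S1_at0 ::
    "(real ^ 'n) set \<Rightarrow> (real ^ 'n \<Rightarrow> real ^ 'n) \<Rightarrow> (real ^ 'n \<Rightarrow> real ^ 'n) \<Rightarrow>
      (real ^ 'n \<Rightarrow> real ^ 'n) \<Rightarrow> (real ^ 'n) set" where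
  "S1_at0 U f0 f1 f2 = {Lam U f0 f1 f2 a 0 |a. a \<in> S1_X}"


section \<open>The Sobolev spaces \<open>W\<^sup>m\<^sup>,\<^sup>\<infinity>(0,T)\<close> and \<open>W\<^sub>0\<^sup>m\<^sup>,\<^sup>\<infinity>(0,T)\<close>\<close>

text \<open>Elements are represented by functions; values outside \<open>(0,T)\<close> are irrelevant.\<close>

definition Linf_norm :: "real \<Rightarrow> (real \<Rightarrow> real) \<Rightarrow> ennreal" where
  "Linf_norm T w = esssup (lebesgue_on {0<..<T}) (\<lambda>t. ennreal \<bar>w t\<bar>)"

definition Linf :: "real \<Rightarrow> (real \<Rightarrow> real) set" where
  "Linf T = {w. w \<in> borel_measurable (lebesgue_on {0<..<T}) \<and> Linf_norm T w < \<infinity>}"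

definition test_fun :: "real \<Rightarrow> (real \<Rightarrow> real) \<Rightarrow> bool" where
  "test_fun T \<phi> \<longleftrightarrow>
    (\<forall>k t. (deriv ^^ k) \<phi> field_differentiable (at t)) \<and>
    (\<exists>a b. 0 < a \<and> b < T \<and> (\<forall>t. t \<notin> {a..b} \<longrightarrow> \<phi> t = 0))"

definition has_weak_deriv ::
    "real \<Rightarrow> nat \<Rightarrow> (real \<Rightarrow> real) \<Rightarrow> (real \<Rightarrow> real) \<Rightarrow> bool" where
  "has_weak_deriv T k w g \<longleftrightarrow>
    (\<forall>\<phi>. test_fun T \<phi> \<longrightarrow>
      integral\<^sup>L (lebesgue_on {0<..<T}) (\<lambda>t. w t * (deriv ^^ k) \<phi> t) =
      (- 1) ^ k * integral\<^sup>L (lebesgue_on {0<..<T}) (\<lambda>t. g t * \<phi> t))"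

text \<open>The weak derivative is unique up to equality almost everywhere on \<open>(0,T)\<close>.\<close>

definition weak_deriv :: "real \<Rightarrow> nat \<Rightarrow> (real \<Rightarrow> real) \<Rightarrow> real \<Rightarrow> real" where
  "weak_deriv T k w = (SOME g. g \<in> Linf T \<and> has_weak_deriv T k w g)"

definition W_space :: "nat \<Rightarrow> real \<Rightarrow> (real \<Rightarrow> real) set" where
  "W_space m T = {w \<in> Linf T. \<forall>k\<le>m. \<exists>g\<in>Linf T. has_weak_deriv T k w g}"

text \<open>
  For \<open>k < m\<close> the boundary values of \<open>w\<^sup>(\<^sup>k\<^sup>)\<close> are those of its continuous representative
  on \<open>[0,T]\<close>.
\<close>

definition W0_space :: "nat \<Rightarrow> real \<Rightarrow> (real \<Rightarrow> real) set" where
  "W0_space m T = {w \<in> W_space m T. \<forall>k<m. \<exists>c. continuous_on {0..T} c \<and>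
      (AE t in lebesgue_on {0<..<T}. c t = weak_deriv T k w t) \<and> c 0 = 0 \<and> c T = 0}"

definition W_norm :: "nat \<Rightarrow> real \<Rightarrow> (real \<Rightarrow> real) \<Rightarrow> ennreal" where
  "W_norm m T w = (\<Sum>k\<le>m. Linf_norm T (weak_deriv T k w))"

definition W_norm2 :: "nat \<Rightarrow> real \<Rightarrow> (real \<Rightarrow> real) \<times> (real \<Rightarrow> real) \<Rightarrow> ennreal" where
  "W_norm2 m T w = W_norm m T (fst w) + W_norm m T (snd w)"

definition W_continuous_on ::
    "nat \<Rightarrow> real \<Rightarrow> real set \<Rightarrow> (real \<Rightarrow> (real \<Rightarrow> real) \<times> (real \<Rightarrow> real)) \<Rightarrow> bool" where
  "W_continuous_on m T Z w \<longleftrightarrow>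
    (\<forall>z\<in>Z. \<forall>\<epsilon>>0. \<exists>\<delta>>0. \<forall>y\<in>Z. \<bar>y - z\<bar> < \<delta> \<longrightarrow>
      W_norm2 m T (\<lambda>t. fst (w y) t - fst (w z) t, \<lambda>t. snd (w y) t - snd (w z) t) < ennreal \<epsilon>)"


section \<open>Controllability\<close>

text \<open>
  \<open>x\<close> is the (Caratheodory) solution on \<open>[0,T]\<close>, staying in the domain \<open>U\<close> of the
  vector fields. Since they are locally Lipschitz on \<open>U\<close>, it is unique if it exists.
\<close>

definition is_solution ::
    "(real ^ 'n) set \<Rightarrow> (real ^ 'n \<Rightarrow> real ^ 'n) \<Rightarrow> (real ^ 'n \<Rightarrow> real ^ 'n) \<Rightarrow>
      (real ^ 'n \<Rightarrow> real ^ 'n) \<Rightarrow> real \<Rightarrow> (real \<Rightarrow> real) \<times> (real \<Rightarrow> real) \<Rightarrow> real ^ 'n \<Rightarrow>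
      (real \<Rightarrow> real ^ 'n) \<Rightarrow> bool" where
  "is_solution U f0 f1 f2 T w p x \<longleftrightarrow>
    continuous_on {0..T} x \<and> x ` {0..T} \<subseteq> U \<and>
    (\<forall>t\<in>{0..T}.
      ((\<lambda>s. f0 (x s) + fst w s *\<^sub>R f1 (x s) + snd w s *\<^sub>R f2 (x s)) has_integral (x t - p)) {0..t})"

definition W0_STLC ::
    "(real ^ 'n) set \<Rightarrow> (real ^ 'n \<Rightarrow> real ^ 'n) \<Rightarrow> (real ^ 'n \<Rightarrow> real ^ 'n) \<Rightarrow>
      (real ^ 'n \<Rightarrow> real ^ 'n) \<Rightarrow> nat \<Rightarrow> bool" where
  "W0_STLC U f0 f1 f2 m \<longleftrightarrow>
    (\<forall>T>0. \<forall>\<epsilon>>0. \<exists>\<delta>>0. \<forall>xf\<in>ball 0 \<delta>.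
      \<exists>u\<in>W0_space m T. \<exists>v\<in>W0_space m T. \<exists>x.
        W_norm2 m T (u, v) \<le> ennreal \<epsilon> \<and>
        is_solution U f0 f1 f2 T (u, v) 0 x \<and> x T = xf)"

definition smooth_STLC ::
    "(real ^ 'n) set \<Rightarrow> (real ^ 'n \<Rightarrow> real ^ 'n) \<Rightarrow> (real ^ 'n \<Rightarrow> real ^ 'n) \<Rightarrow>
      (real ^ 'n \<Rightarrow> real ^ 'n) \<Rightarrow> bool" where
  "smooth_STLC U f0 f1 f2 \<longleftrightarrow> (\<forall>m. W0_STLC U f0 f1 f2 m)"

definition reachable_vector ::
    "(real ^ 'n) set \<Rightarrow> (real ^ 'n \<Rightarrow> real ^ 'n) \<Rightarrow> (real ^ 'n \<Rightarrow> real ^ 'n) \<Rightarrow>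
      (real ^ 'n \<Rightarrow> real ^ 'n) \<Rightarrow> nat \<Rightarrow> real ^ 'n \<Rightarrow> bool" where
  "reachable_vector U f0 f1 f2 m \<xi> \<longleftrightarrow>
    (\<exists>\<Xi> :: real \<Rightarrow> real ^ 'n. continuous_on {0..} \<Xi> \<and> \<Xi> 0 = \<xi> \<and>
      (\<forall>T>0. \<exists>C>0. \<exists>\<rho>>0. \<exists>s>0. \<exists>w :: real \<Rightarrow> (real \<Rightarrow> real) \<times> (real \<Rightarrow> real).
        (\<forall>z\<in>{-\<rho><..<\<rho>}. w z \<in> W0_space m T \<times> W0_space m T) \<and>
        W_continuous_on m T {-\<rho><..<\<rho>} w \<and>
        (\<forall>z\<in>{-\<rho><..<\<rho>}.
          (\<exists>x. is_solution U f0 f1 f2 T (w z) 0 x \<and>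
            norm (x T - z *\<^sub>R \<Xi> T) \<le> C * \<bar>z\<bar> powr (1 + s)) \<and>
          W_norm2 m T (w z) \<le> ennreal (C * \<bar>z\<bar> powr s))))"

end

theory Submission
  imports Defs
begin

text \<open>
  Call \<open>\<xi>\<close> reachable if pulses of amplitude and duration \<open>O(|z|\<^sup>s)\<close> ending at the final time lead from the
  origin to \<open>z \<xi> + O(|z|\<^sup>1\<^sup>+\<^sup>s)\<close>. Concatenating pulses shows that these vectors form a linear space. Acting
  with a pulse for \<open>-z/\<tau>\<close>, waiting for a time \<open>\<tau> = |z|\<^sup>\<sigma>\<close> and acting with a pulse for \<open>z/\<tau>\<close> shows that this
  space is invariant under \<open>A = Df\<^sub>0(0)\<close>; it contains \<open>f\<^sub>1(0)\<close> and \<open>f\<^sub>2(0)\<close>, hence all of \<open>S\<^sub>1(f)(0)\<close>.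

  For a good bracket take pulses of amplitude \<open>a = \<tau>\<^sup>p\<close>. Iterated integration by parts writes the
  quadratic part of the end point as a sum of products of primitives of the controls times the values at
  the origin of \<open>W\<^sup>i\<^sub>k\<^sub>,\<^sub>0\<close> and \<open>C\<^sub>k\<^sub>,\<^sub>0\<close>. Project along the space of reachable vectors, which contains all
  bad brackets and, by induction, all good ones of smaller length: the term of \<open>C\<^sub>j\<^sub>,\<^sub>0\<close> dominates. The other
  component of the end point is steered back by a further pulse.

  If all vectors are reachable, the end point map is a perturbation of the identity of order \<open>1 + s\<close>, and
  Brouwer's fixed point theorem shows that its image is a neighbourhood of the origin.
\<close>

section \<open>Smooth bumps and weak derivatives\<close>

text \<open>Final time is 0, and pulses vanish with m derivatives outside a short interval before 0.
  Hence extension by zero makes one family serve every \<open>T\<close>, the boundary conditions of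
  \<open>W0_space\<close> are automatic, and an earlier pulse is simply translated to the left.

  The obstacle is a mismatch of orders. With \<tau> = |z|^(1/N), N = 2p + j + 2 and a = \<tau>^p,
  the gain a^2 \<tau>^(j+2) is exactly |z|, whereas the whole end point is only known to be O(a^2).
  Steering back with a family of exponent s' leaves an error (a^2)^(1+s'), which is O(|z| \<tau>)
  once 2 p s' \<ge> j + 3. So p is fixed after s', and exponents may deteriorate from one bracket to
  the next. Cubic errors are harmless because a \<le> \<tau>^(j+2).

  The controls are high derivatives of one compactly supported profile, so all primitives that occur
  vanish at both ends and the changes of variable leave the end point untouched. The orders of
  differentiation make both factors of the leading monomial the same function up to sign and scale;
  its square has a positive integral, and the sign of z, put into one control, gives both
  directions.\<close>

fun ntimes_diff :: "nat \<Rightarrow> (real \<Rightarrow> real) \<Rightarrow> bool" where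
  "ntimes_diff 0 f \<longleftrightarrow> True"
| "ntimes_diff (Suc n) f \<longleftrightarrow> (\<exists>f'. (\<forall>t. (f has_real_derivative f' t) (at t)) \<and> ntimes_diff n f')"

lemma ntimes_diff_mono: "ntimes_diff (Suc n) f \<Longrightarrow> ntimes_diff n f"
proof (induction n arbitrary: f)
  case (Suc n)
  then obtain f' where "\<forall>t. (f has_real_derivative f' t) (at t)" "ntimes_diff (Suc n) f'" by auto
  with Suc.IH[of f'] show ?case by auto
qed simp

text \<open>Witness derivatives are combined directly, here and for products and substitutions; this
  is why \<open>ntimes_diff\<close> quantifies over a derivative instead of iterating
  \<open>deriv\<close>.\<close>

lemma ntimes_diff_add: "ntimes_diff n f \<Longrightarrow> ntimes_diff n g \<Longrightarrow> ntimes_diff n (\<lambda>t. f t + g t)"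
proof (induction n arbitrary: f g)
  case (Suc n)
  then obtain f' g' where "\<And>t. (f has_real_derivative f' t) (at t)" "ntimes_diff n f'"
     "\<And>t. (g has_real_derivative g' t) (at t)" "ntimes_diff n g'" by auto
  thus ?case using Suc.IH by (auto intro!: exI[of _ "\<lambda>t. f' t + g' t"] DERIV_add)
qed simp

lemma ntimes_diff_mult: "ntimes_diff n f \<Longrightarrow> ntimes_diff n g \<Longrightarrow> ntimes_diff n (\<lambda>t. f t * g t)"
proof (induction n arbitrary: f g)
  case (Suc n)
  obtain f' where f: "\<And>t. (f has_real_derivative f' t) (at t)" "ntimes_diff n f'" using Suc.prems(1) by auto
  obtain g' where g: "\<And>t. (g has_real_derivative g' t) (at t)" "ntimes_diff n g'" using Suc.prems(2) by auto
  have "ntimes_diff n (\<lambda>t. f' t * g t + g' t * f t)"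
    using f(2) g(2) Suc.prems[THEN ntimes_diff_mono] by (intro ntimes_diff_add Suc.IH)
  moreover have "\<forall>t. ((\<lambda>t. f t * g t) has_real_derivative f' t * g t + g' t * f t) (at t)"
    using DERIV_mult[OF f(1) g(1)] by blast
  ultimately show ?case by auto
qed simp

lemma ntimes_diff_affine: "ntimes_diff n f \<Longrightarrow> ntimes_diff n (\<lambda>t. f (c * t + d))"
proof (induction n arbitrary: f)
  case (Suc n)
  obtain f' where f: "\<And>t. (f has_real_derivative f' t) (at t)" "ntimes_diff n f'" using Suc.prems(1) by auto
  have c: "ntimes_diff k (\<lambda>_. c)" for k c
    by (induction k arbitrary: c) (auto intro!: exI[of _ "\<lambda>_. 0"] derivative_eq_intros)
  have "\<forall>t. ((\<lambda>t. f (c * t + d)) has_real_derivative f' (c * t + d) * c) (at t)"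
    by (intro allI DERIV_chain'[OF _ f(1)]) (auto intro!: derivative_eq_intros)
  moreover have "ntimes_diff n (\<lambda>t. f' (c * t + d) * c)"
    by (rule ntimes_diff_mult[OF Suc.IH[OF f(2)] c])
  ultimately show ?case by auto
qed simp

text \<open>Returns to iterated \<open>deriv\<close>, the form in which \<open>test_fun\<close>
  speaks of smoothness: by uniqueness of derivatives the witness provided by
  \<open>ntimes_diff\<close> is \<open>deriv\<close>.\<close>

lemma ntimes_diff_deriv_iter:
  assumes "\<And>n. ntimes_diff n f"
  shows "((deriv ^^ k) f has_real_derivative (deriv ^^ Suc k) f t) (at t)"
proof -
  have "ntimes_diff n ((deriv ^^ k) f)" for n k
  proof (induction k arbitrary: n)
    case (Suc k)
    obtain g where g: "\<And>t. ((deriv ^^ k) f has_real_derivative g t) (at t)" "ntimes_diff n g"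
      using Suc.IH[of "Suc n"] by auto
    have "deriv ((deriv ^^ k) f) = g" using g(1) by (intro ext DERIV_imp_deriv)
    with g show ?case by simp
  qed (use assms in simp)
  from this[of 1 k] obtain g where "\<And>t. ((deriv ^^ k) f has_real_derivative g t) (at t)" by auto
  hence "((deriv ^^ k) f has_real_derivative g t) (at t)" "deriv ((deriv ^^ k) f) t = g t" 
    by (auto intro: DERIV_imp_deriv)
  thus ?thesis by simp
qed

definition flat_exp :: "real \<Rightarrow> real" where
  "flat_exp t = (if t > 0 then exp (- (1 / t)) else 0)"

lemma poly_times_exp_neg_tendsto_0: "((\<lambda>y :: real. poly p y * exp (- y)) \<longlongrightarrow> 0) at_top"
proof -
  have "((\<lambda>y :: real. \<Sum>i\<le>degree p. coeff p i * (y ^ i / exp y)) \<longlongrightarrow> (\<Sum>i\<le>degree p. coeff p i * 0)) at_top"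
    by (intro tendsto_intros tendsto_power_div_exp_0)
  moreover have "(\<Sum>i\<le>degree p. coeff p i * (y ^ i / exp y)) = poly p y * exp (- y)" for y :: real
    unfolding poly_altdef sum_distrib_right by (simp add: exp_minus divide_inverse mult_ac)
  ultimately show ?thesis by simp
qed

text \<open>The functions p(1/t) exp(-1/t), extended by 0, are closed under differentiation: the
  polynomial p becomes x^2 (p - p'). At 0 the difference quotient is again of this kind, with x p in
  place of p, and tends to 0.\<close>

lemma ntimes_diff_poly_flat_exp:
  "ntimes_diff n (\<lambda>t. if t > 0 then poly p (1 / t) * exp (- (1 / t)) else 0)"
proof (induction n arbitrary: p)
  case (Suc n)
  define q where "q = monom 1 2 * (p - pderiv p)"
  let ?f = "\<lambda>p t :: real. if t > 0 then poly p (1 / t) * exp (- (1 / t)) else 0"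
  have "(?f p has_real_derivative ?f q t) (at t)" for t
  proof -
    consider "t > 0" | "t < 0" | "t = 0" by linarith
    thus ?thesis
    proof cases
      case 1
      have "((\<lambda>t. poly p (1 / t) * exp (- (1 / t))) has_real_derivative poly q (1 / t) * exp (- (1 / t))) (at t)"
        using 1 by (auto intro!: derivative_eq_intros simp: q_def poly_monom field_simps power2_eq_square)
      hence "(?f p has_real_derivative poly q (1 / t) * exp (- (1 / t))) (at t)"
        by (rule has_field_derivative_transform_within_open[where S = "{0<..}"]) (use 1 in auto)
      thus ?thesis using 1 by simp
    next
      case 2
      have "(?f p has_real_derivative 0) (at t)"
        by (rule has_field_derivative_transform_within_open[of "\<lambda>_. 0" _ _ "{..<0}"]) (use 2 in auto)
      thus ?thesis using 2 by simp
    next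
      case 3
      have "((\<lambda>h. ?f p h / h) \<longlongrightarrow> 0) (at_right 0)"
      proof -
        have "((\<lambda>h :: real. poly (monom 1 1 * p) (inverse h) * exp (- (inverse h))) \<longlongrightarrow> 0) (at_right 0)"
          by (rule filterlim_compose[OF poly_times_exp_neg_tendsto_0 filterlim_inverse_at_top_right])
        thus ?thesis
          by (rule Lim_transform_eventually)
             (auto simp: eventually_at_right_less poly_monom divide_inverse mult_ac intro!: eventually_mono[OF eventually_at_right_less])
      qed
      moreover have "((\<lambda>h. ?f p h / h) \<longlongrightarrow> 0) (at_left 0)"
        by (rule Lim_transform_eventually[OF tendsto_const])
           (auto simp: eventually_at_filter)
      ultimately have "((\<lambda>h. ?f p h / h) \<longlongrightarrow> 0) (at 0)" by (simp add: filterlim_split_at)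
      hence "(?f p has_real_derivative 0) (at 0)"
        unfolding DERIV_def by (simp cong: if_cong)
      thus ?thesis using 3 by simp
    qed
  qed
  with Suc.IH[of q] show ?case unfolding ntimes_diff.simps by (intro exI[of _ "?f q"] conjI allI)
qed simp

lemma ntimes_diff_flat_exp: "ntimes_diff n flat_exp"
  using ntimes_diff_poly_flat_exp[of n 1] unfolding flat_exp_def[abs_def] poly_1 mult_1_left .

text \<open>The slope c serves two purposes: with c = 1 the bump is the profile of the pulses, and
  as c tends to infinity the bumps approximate the indicator of the open interval from a to b, which
  yields enough test functions.\<close>

definition bump :: "real \<Rightarrow> real \<Rightarrow> real \<Rightarrow> real \<Rightarrow> real" where
  "bump c a b t = flat_exp (c * (t - a)) * flat_exp (c * (b - t))"

lemma bump_smooth: "((deriv ^^ k) (bump c a b) has_real_derivative (deriv ^^ Suc k) (bump c a b) t) (at t)"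
proof (rule ntimes_diff_deriv_iter)
  fix n
  have "ntimes_diff n (\<lambda>t. flat_exp (c * t + (- (c * a))) * flat_exp ((- c) * t + c * b))"
    by (intro ntimes_diff_mult ntimes_diff_affine ntimes_diff_flat_exp)
  thus "ntimes_diff n (bump c a b)"
    by (simp add: bump_def[abs_def] right_diff_distrib add.commute)
qed

lemma deriv_iter_bump_eq_0:
  assumes "0 < c" "t \<notin> {a<..<b}" shows "(deriv ^^ k) (bump c a b) t = 0"
proof -
  have open_zero: "(deriv ^^ k) (bump c a b) s = 0" if "s \<in> {..<a} \<union> {b<..}" for s k
    using that
  proof (induction k arbitrary: s)
    case 0
    hence "c * (s - a) \<le> 0 \<or> c * (b - s) \<le> 0" using assms(1) by (auto simp: mult_le_0_iff)
    thus ?case by (auto simp: bump_def flat_exp_def)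
  next
    case (Suc k)
    have "((deriv ^^ k) (bump c a b) has_real_derivative 0) (at s)"
      by (rule has_field_derivative_transform_within_open[of "\<lambda>_. 0" _ _ "{..<a} \<union> {b<..}"])
         (use Suc in auto)
    thus ?case using DERIV_imp_deriv by simp
  qed
  \<comment> \<open>The induction covers the open complement of [a, b]; the two end points follow by
    continuity.\<close>
  have "closure ({..<a} \<union> {b<..}) = {..a} \<union> {b..}" by (simp add: closure_Un)
  moreover have "continuous_on S ((deriv ^^ k) (bump c a b))" for S
    by (rule DERIV_continuous_on[OF has_field_derivative_at_within[OF bump_smooth]])
  ultimately show ?thesis
    using continuous_constant_on_closure[of "{..<a} \<union> {b<..}" "(deriv ^^ k) (bump c a b)" 0 t] open_zero assms(2)
    by auto
qed

lemma flat_exp_bounds: "0 \<le> flat_exp t" "flat_exp t \<le> 1"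
  by (auto simp: flat_exp_def)

lemma bump_bounds: "0 \<le> bump c a b t" "bump c a b t \<le> 1"
  using flat_exp_bounds by (auto simp: bump_def intro: mult_le_one)

lemma bump_pos: "0 < c \<Longrightarrow> a < t \<Longrightarrow> t < b \<Longrightarrow> 0 < bump c a b t"
  by (simp add: bump_def flat_exp_def)

lemma bump_tendsto_indicator: "(\<lambda>n. bump (Suc n) a b t) \<longlonglongrightarrow> indicator {a<..<b} t"
proof (cases "t \<in> {a<..<b}")
  case False
  thus ?thesis using deriv_iter_bump_eq_0[of _ t a b 0] by simp
next
  case True
  have *: "(\<lambda>n. flat_exp (Suc n * x)) \<longlonglongrightarrow> 1" if "0 < x" for x :: real
  proof -
    have "(\<lambda>n. exp (- ((1 / x) * (1 / real (Suc n))))) \<longlonglongrightarrow> exp (- ((1 / x) * 0))"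
      by (intro tendsto_intros lim_1_over_n[THEN LIMSEQ_Suc])
    moreover have "flat_exp (Suc n * x) = exp (- ((1 / x) * (1 / real (Suc n))))" for n
      using that by (simp add: flat_exp_def mult.commute)
    ultimately show ?thesis by simp
  qed
  have "(\<lambda>n. flat_exp (Suc n * (t - a)) * flat_exp (Suc n * (b - t))) \<longlonglongrightarrow> 1 * 1"
    by (intro tendsto_mult *) (use True in auto)
  thus ?thesis using True by (simp add: bump_def)
qed

lemma test_fun_bump: "0 < c \<Longrightarrow> 0 < a \<Longrightarrow> b < T \<Longrightarrow> test_fun T (bump c a b)"
  unfolding test_fun_def
proof (intro conjI allI exI impI)
  show "(deriv ^^ k) (bump c a b) field_differentiable at t" for k t
    using bump_smooth field_differentiable_def by blast
  show "bump c a b t = 0" if "0 < c" "t \<notin> {a..b}" for t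
    using deriv_iter_bump_eq_0[of c t a b 0] that by auto
qed

section \<open>Essentially bounded functions and uniqueness of weak derivatives\<close>

lemma finite_measure_Ioo: "finite_measure (lebesgue_on {0<..<T::real})"
  by (rule finite_measure_lebesgue_on) simp

lemma Linf_AE_bound:
  assumes "w \<in> Linf T"
  obtains B where "0 \<le> B" "AE t in lebesgue_on {0<..<T}. \<bar>w t\<bar> \<le> B"
proof -
  define B where "B = enn2real (Linf_norm T w)"
  have "Linf_norm T w < \<infinity>" using assms by (simp add: Linf_def)
  hence B: "Linf_norm T w = ennreal B" by (simp add: B_def)
  have "AE t in lebesgue_on {0<..<T}. ennreal \<bar>w t\<bar> \<le> Linf_norm T w"
    unfolding Linf_norm_def by (rule esssup_AE)
  hence "AE t in lebesgue_on {0<..<T}. \<bar>w t\<bar> \<le> B"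
    unfolding B by eventually_elim (simp add: B_def)
  thus ?thesis using that[of B] by (simp add: B_def)
qed

lemma Linf_integrable:
  assumes "w \<in> Linf T" shows "integrable (lebesgue_on {0<..<T}) w"
proof -
  interpret finite_measure "lebesgue_on {0<..<T}" by (rule finite_measure_Ioo)
  obtain B where "AE t in lebesgue_on {0<..<T}. \<bar>w t\<bar> \<le> B" using assms by (rule Linf_AE_bound)
  thus ?thesis using assms by (intro integrable_const_bound[of _ B]) (auto simp: Linf_def)
qed

lemma integrable_on_subset_lebesgue:
  fixes g :: "real \<Rightarrow> real"
  assumes "integrable (lebesgue_on S) g" "T \<subseteq> S" "S \<in> sets lebesgue" "T \<in> sets lebesgue"
  shows "integrable (lebesgue_on T) g"
proof -
  have "set_integrable lebesgue S g"
    using assms by (simp add: set_integrable_def integrable_restrict_space)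
  hence "set_integrable lebesgue T g" by (rule set_integrable_subset) (use assms in auto)
  thus ?thesis using assms by (simp add: set_integrable_def integrable_restrict_space)
qed

text \<open>Fundamental lemma of the calculus of variations. Steeper and steeper bumps show by
  dominated convergence that g has integral 0 over [a, b] whenever 0 < a and b < T, and g is almost
  everywhere the limit of its averages over shrinking intervals.\<close>

lemma test_fun_orthogonal_imp_AE_0:
  assumes g: "integrable (lebesgue_on {0<..<T}) g"
    and orth: "\<And>\<phi>. test_fun T \<phi> \<Longrightarrow> integral\<^sup>L (lebesgue_on {0<..<T}) (\<lambda>t. g t * \<phi> t) = 0"
  shows "AE t in lebesgue_on {0<..<T}. g t = 0"
proof -
  have int0: "integral {a..b} g = 0" if ab: "0 < a" "b < T" for a b
  proof -
    have lim: "(\<lambda>n. integral\<^sup>L (lebesgue_on {0<..<T}) (\<lambda>t. g t * bump (Suc n) a b t)) \<longlonglongrightarrow>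
       integral\<^sup>L (lebesgue_on {0<..<T}) (\<lambda>t. g t * indicator {a<..<b} t)"
    proof (rule integral_dominated_convergence[where w = "\<lambda>t. \<bar>g t\<bar>"])
      have bm: "bump c a b \<in> borel_measurable (lebesgue_on {0<..<T})" for c
        by (rule continuous_imp_measurable_on_sets_lebesgue[OF DERIV_continuous_on[OF has_field_derivative_at_within
            [OF bump_smooth[of 0, simplified]]]]) simp
      show "(\<lambda>t. g t * bump (Suc n) a b t) \<in> borel_measurable (lebesgue_on {0<..<T})" for n
        using g bm by (intro borel_measurable_times) auto
      have "indicator {a<..<b} \<in> borel_measurable (lebesgue_on {0<..<T})"
        by (intro measurable_restrict_space1 borel_measurable_indicator) simp
      thus "(\<lambda>t. g t * indicator {a<..<b} t) \<in> borel_measurable (lebesgue_on {0<..<T})"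
        using g by (intro borel_measurable_times) auto
      show "AE t in lebesgue_on {0<..<T}. (\<lambda>n. g t * bump (Suc n) a b t) \<longlonglongrightarrow> g t * indicator {a<..<b} t"
        by (intro AE_I2 tendsto_intros bump_tendsto_indicator)
      show "AE t in lebesgue_on {0<..<T}. norm (g t * bump (Suc n) a b t) \<le> \<bar>g t\<bar>" for n
        using bump_bounds by (intro AE_I2) (auto simp: abs_mult intro!: mult_left_le)
    qed (use g in auto)
    have zero: "integral\<^sup>L (lebesgue_on {0<..<T}) (\<lambda>t. g t * bump (Suc n) a b t) = 0" for n
      by (rule orth[OF test_fun_bump]) (use ab in auto)
    have "integral\<^sup>L (lebesgue_on {0<..<T}) (\<lambda>t. g t * indicator {a<..<b} t) = 0"
      by (rule LIMSEQ_unique[OF lim[unfolded zero] tendsto_const])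
    moreover have "(\<lambda>t. g t * indicator {a<..<b} t) = (\<lambda>t. if t \<in> {a<..<b} then g t else 0)" by (auto simp: indicator_def)
    ultimately have "integral\<^sup>L (lebesgue_on ({a<..<b} \<inter> {0<..<T})) g = 0"
      using Lebesgue_Measure.integral_restrict_Int[of "{a<..<b}" "{0<..<T}" g] by simp
    moreover have sub: "{a<..<b} \<inter> {0<..<T} = {a<..<b}" using ab by auto
    moreover have "integrable (lebesgue_on {a<..<b}) g"
      by (rule integrable_on_subset_lebesgue[OF g]) (use ab in auto)
    ultimately show ?thesis
      using lebesgue_integral_eq_integral[of "{a<..<b}" g] by (simp add: integral_open_interval_real)
  qed
  \<comment> \<open>Extension by 0 gives a function integrable over every interval of the line, as
    the differentiation theorem requires.\<close>
  define f where "f t = (if t \<in> {0<..<T} then g t else 0)" for t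
  have "f integrable_on UNIV"
    unfolding f_def Henstock_Kurzweil_Integration.integrable_restrict_UNIV
    by (rule integrable_on_lebesgue_on[OF g]) simp
  hence "f integrable_on cbox a b" for a b by (rule integrable_on_subcbox) simp
  then obtain N where N: "negligible N" "\<And>x e. x \<notin> N \<Longrightarrow> 0 < e \<Longrightarrow>
      \<exists>d>0. \<forall>h. 0 < h \<and> h < d \<longrightarrow> norm (integral (cbox x (x + h *\<^sub>R One)) f /\<^sub>R h ^ DIM(real) - f x) < e"
    using integrable_ccontinuous_explicit[of f] by metis
  have "g x = 0" if x: "x \<in> {0<..<T}" "x \<notin> N" for x
  proof (rule ccontr)
    assume "g x \<noteq> 0"
    then obtain d where d: "d > 0" "\<And>h. 0 < h \<Longrightarrow> h < d \<Longrightarrow> norm (integral (cbox x (x + h *\<^sub>R One)) f /\<^sub>R h ^ DIM(real) - f x) < \<bar>g x\<bar>"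
      using N(2)[OF x(2), of "\<bar>g x\<bar>"] by auto
    \<comment> \<open>The averaging interval has to end before T for \<open>int0\<close> to
      apply.\<close>
    define h where "h = min (d / 2) ((T - x) / 2)"
    have h: "0 < h" "h < d" "x + h < T" using d(1) x by (auto simp: h_def min_def field_simps)
    have "integral {x..x + h} f = integral {x..x + h} g"
      by (rule integral_cong) (use x h in \<open>auto simp: f_def\<close>)
    hence "integral (cbox x (x + h *\<^sub>R One)) f = 0" using int0[of x "x + h"] x h by simp
    with d(2)[OF h(1,2)] x(1) show False by (simp add: f_def)
  qed
  moreover have "AE x in lebesgue. x \<notin> N"
    using N(1) by (simp add: negligible_iff_null_sets AE_not_in)
  ultimately show ?thesis
    by (auto simp: AE_restrict_space_iff elim!: eventually_mono)
qed

lemma continuous_integral_Ioo: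
  fixes f :: "real \<Rightarrow> real"
  assumes "continuous_on {0..T} f"
  shows "integrable (lebesgue_on {0<..<T}) f"
    and "integral\<^sup>L (lebesgue_on {0<..<T}) f = integral {0..T} f"
proof -
  have "set_integrable lebesgue {0..T} f" using assms by (rule absolutely_integrable_continuous_real)
  hence "integrable (lebesgue_on {0..T}) f" by (simp add: set_integrable_def integrable_restrict_space)
  thus 1: "integrable (lebesgue_on {0<..<T}) f"
    by (rule integrable_on_subset_lebesgue) auto
  show "integral\<^sup>L (lebesgue_on {0<..<T}) f = integral {0..T} f"
    using lebesgue_integral_eq_integral[OF 1] by (simp add: integral_open_interval_real)
qed

lemma test_fun_deriv:
  assumes "test_fun T \<phi>"
  shows "test_fun T (deriv \<phi>)" and "(\<phi> has_real_derivative deriv \<phi> t) (at t)"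
    and "\<phi> 0 = 0" and "\<phi> T = 0"
proof -
  have d: "(deriv ^^ k) \<phi> field_differentiable (at t)" for k t using assms by (simp add: test_fun_def)
  obtain a b where ab: "0 < a" "b < T" "\<And>t. t \<notin> {a..b} \<Longrightarrow> \<phi> t = 0" using assms by (auto simp: test_fun_def)
  have "deriv \<phi> t = 0" if "t \<notin> {a..b}" for t
  proof -
    have "(\<phi> has_real_derivative 0) (at t)"
      by (rule has_field_derivative_transform_within_open[of "\<lambda>_. 0" _ _ "- {a..b}"]) (use that ab(3) in auto)
    thus ?thesis by (rule DERIV_imp_deriv)
  qed
  moreover have "(deriv ^^ k) (deriv \<phi>) field_differentiable (at t)" for k t
    using d[of "Suc k" t] by (simp add: funpow_swap1)
  ultimately show "test_fun T (deriv \<phi>)" using ab(1,2) unfolding test_fun_def by blast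
  show "(\<phi> has_real_derivative deriv \<phi> t) (at t)"
    using d[of 0 t] by (simp add: field_differentiable_derivI)
  show "\<phi> 0 = 0" "\<phi> T = 0" using ab by auto
qed

text \<open>D is a tower of classical derivatives. Each induction step moves one derivative from the
  test function to the tower by parts; the boundary terms vanish because test functions vanish at 0
  and T.\<close>

lemma has_weak_deriv_classical:
  assumes "\<And>i t. i < k \<Longrightarrow> (D i has_real_derivative D (Suc i) t) (at t)"
    and "\<And>i. i \<le> k \<Longrightarrow> continuous_on UNIV (D i)" and T: "0 < T"
  shows "has_weak_deriv T k (D 0) (D k)"
  using assms(1,2)
proof (induction k)
  case 0 thus ?case by (simp add: has_weak_deriv_def)
next
  case (Suc k)
  show ?case unfolding has_weak_deriv_def
  proof (intro allI impI)
    fix \<phi> assume \<phi>: "test_fun T \<phi>"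
    note \<phi>' = test_fun_deriv[OF \<phi>]
    have c\<phi>: "continuous_on S \<psi>" if "test_fun T \<psi>" for \<psi> S
      by (rule DERIV_continuous_on[OF has_field_derivative_at_within[OF test_fun_deriv(2)[OF that]]])
    have cD: "continuous_on S (D i)" if "i \<le> Suc k" for i S
      using continuous_on_subset[OF Suc.prems(2)[OF that]] by blast
    have "integral\<^sup>L (lebesgue_on {0<..<T}) (\<lambda>t. D 0 t * (deriv ^^ Suc k) \<phi> t) =
      integral\<^sup>L (lebesgue_on {0<..<T}) (\<lambda>t. D 0 t * (deriv ^^ k) (deriv \<phi>) t)"
      by (simp add: funpow_swap1)
    also have "\<dots> = (- 1) ^ k * integral\<^sup>L (lebesgue_on {0<..<T}) (\<lambda>t. D k t * deriv \<phi> t)"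
      using Suc.IH[OF Suc.prems] \<phi>'(1) by (simp add: has_weak_deriv_def)
    also have "integral\<^sup>L (lebesgue_on {0<..<T}) (\<lambda>t. D k t * deriv \<phi> t) =
      - integral\<^sup>L (lebesgue_on {0<..<T}) (\<lambda>t. D (Suc k) t * \<phi> t)"
    proof -
      have 1: "continuous_on {0..T} (\<lambda>t. D k t * deriv \<phi> t)"
        by (intro continuous_on_mult cD c\<phi> \<phi>'(1)) simp
      have 2: "continuous_on {0..T} (\<lambda>t. D (Suc k) t * \<phi> t)"
        by (intro continuous_on_mult cD c\<phi> \<phi>) simp
      have "((\<lambda>t. D (Suc k) t * \<phi> t + D k t * deriv \<phi> t) has_integral (D k T * \<phi> T - D k 0 * \<phi> 0)) {0..T}"
      proof (rule fundamental_theorem_of_calculus)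
        fix t
        have "((\<lambda>t. D k t * \<phi> t) has_real_derivative D (Suc k) t * \<phi> t + deriv \<phi> t * D k t) (at t)"
          by (rule DERIV_mult[OF Suc.prems(1) \<phi>'(2)]) simp
        thus "((\<lambda>t. D k t * \<phi> t) has_vector_derivative D (Suc k) t * \<phi> t + D k t * deriv \<phi> t) (at t within {0..T})"
          unfolding has_real_derivative_iff_has_vector_derivative mult.commute[of "deriv \<phi> t"]
          by (rule has_vector_derivative_at_within)
      qed (use T in simp)
      hence "integral {0..T} (\<lambda>t. D (Suc k) t * \<phi> t + D k t * deriv \<phi> t) = 0"
        using \<phi>'(3,4) by (simp add: integral_unique)
      moreover have "integral {0..T} (\<lambda>t. D (Suc k) t * \<phi> t + D k t * deriv \<phi> t) =
         integral {0..T} (\<lambda>t. D (Suc k) t * \<phi> t) + integral {0..T} (\<lambda>t. D k t * deriv \<phi> t)"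
        by (intro Henstock_Kurzweil_Integration.integral_add integrable_continuous_interval 1 2)
      ultimately show ?thesis
        by (simp add: continuous_integral_Ioo(2)[OF 1] continuous_integral_Ioo(2)[OF 2])
    qed
    finally show "integral\<^sup>L (lebesgue_on {0<..<T}) (\<lambda>t. D 0 t * (deriv ^^ Suc k) \<phi> t) =
      (- 1) ^ Suc k * integral\<^sup>L (lebesgue_on {0<..<T}) (\<lambda>t. D (Suc k) t * \<phi> t)" by simp
  qed
qed

lemma Linf_continuous:
  assumes "continuous_on UNIV w" "\<And>t. \<bar>w t\<bar> \<le> B"
  shows "w \<in> Linf T" and "Linf_norm T w \<le> ennreal B"
proof -
  have m: "w \<in> borel_measurable (lebesgue_on {0<..<T})"
    by (rule continuous_imp_measurable_on_sets_lebesgue[OF continuous_on_subset[OF assms(1)]]) auto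
  show le: "Linf_norm T w \<le> ennreal B"
    unfolding Linf_norm_def by (rule esssup_I) (use m assms(2) in \<open>auto intro!: AE_I2 ennreal_leI\<close>)
  thus "w \<in> Linf T" using m by (simp add: Linf_def less_top[symmetric] top_unique) (metis ennreal_neq_top neq_top_trans)
qed

text \<open>\<open>weak_deriv\<close> is an arbitrary representative, so agreement with the
  classical derivative can be expected only almost everywhere. It follows by testing the difference
  of the two, and it carries the uniform bound over to the essential supremum.\<close>

lemma weak_deriv_classical:
  assumes der: "\<And>i t. i < k \<Longrightarrow> (D i has_real_derivative D (Suc i) t) (at t)"
    and cont: "\<And>i. i \<le> k \<Longrightarrow> continuous_on UNIV (D i)" and T: "0 < T" and B: "\<And>t. \<bar>D k t\<bar> \<le> B"
  shows "AE t in lebesgue_on {0<..<T}. D k t = weak_deriv T k (D 0) t"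
    and "Linf_norm T (weak_deriv T k (D 0)) \<le> ennreal B"
proof -
  have Dk: "D k \<in> Linf T" "has_weak_deriv T k (D 0) (D k)"
    using Linf_continuous(1)[OF cont B] has_weak_deriv_classical[where D = D, OF der cont T] by auto
  hence "\<exists>g. g \<in> Linf T \<and> has_weak_deriv T k (D 0) g" by blast
  from someI_ex[OF this] have g: "weak_deriv T k (D 0) \<in> Linf T" "has_weak_deriv T k (D 0) (weak_deriv T k (D 0))"
    by (auto simp: weak_deriv_def)
  let ?g = "weak_deriv T k (D 0)"
  have "AE t in lebesgue_on {0<..<T}. D k t - ?g t = 0"
  proof (rule test_fun_orthogonal_imp_AE_0)
    show "integrable (lebesgue_on {0<..<T}) (\<lambda>t. D k t - ?g t)"
      by (intro Bochner_Integration.integrable_diff Linf_integrable Dk g)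
    fix \<phi> assume \<phi>: "test_fun T \<phi>"
    have c: "continuous_on {0..T} \<phi>"
      by (rule DERIV_continuous_on[OF has_field_derivative_at_within[OF test_fun_deriv(2)[OF \<phi>]]])
    have "bounded (\<phi> ` {0..T})" by (intro compact_imp_bounded compact_continuous_image c) simp
    then obtain M where M: "\<forall>t\<in>{0..T}. \<bar>\<phi> t\<bar> \<le> M" by (auto simp: bounded_iff)
    have m: "\<phi> \<in> borel_measurable (lebesgue_on {0<..<T})"
      by (rule continuous_imp_measurable_on_sets_lebesgue[OF continuous_on_subset[OF c]]) auto
    have int: "integrable (lebesgue_on {0<..<T}) (\<lambda>t. w t * \<phi> t)" if w: "w \<in> Linf T" for w
    proof (rule Bochner_Integration.integrable_bound[OF integrable_mult_left[OF Linf_integrable[OF w], of M]])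
      show "(\<lambda>t. w t * \<phi> t) \<in> borel_measurable (lebesgue_on {0<..<T})"
        using w m by (intro borel_measurable_times) (auto simp: Linf_def)
      show "AE t in lebesgue_on {0<..<T}. norm (w t * \<phi> t) \<le> norm (w t * M)"
      proof (rule AE_I2)
        fix t assume "t \<in> space (lebesgue_on {0<..<T})"
        hence "\<bar>\<phi> t\<bar> \<le> \<bar>M\<bar>" using M[rule_format, of t] by auto
        thus "norm (w t * \<phi> t) \<le> norm (w t * M)" by (simp add: abs_mult mult_left_mono)
      qed
    qed
    have "(- 1) ^ k * integral\<^sup>L (lebesgue_on {0<..<T}) (\<lambda>t. D k t * \<phi> t) =
        (- 1) ^ k * integral\<^sup>L (lebesgue_on {0<..<T}) (\<lambda>t. ?g t * \<phi> t)"
      by (rule HOL.trans[OF Dk(2)[unfolded has_weak_deriv_def, rule_format, OF \<phi>, symmetric]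
          g(2)[unfolded has_weak_deriv_def, rule_format, OF \<phi>]])
    hence eq: "integral\<^sup>L (lebesgue_on {0<..<T}) (\<lambda>t. D k t * \<phi> t) = integral\<^sup>L (lebesgue_on {0<..<T}) (\<lambda>t. ?g t * \<phi> t)"
      by simp
    have "integral\<^sup>L (lebesgue_on {0<..<T}) (\<lambda>t. (D k t - ?g t) * \<phi> t) =
       integral\<^sup>L (lebesgue_on {0<..<T}) (\<lambda>t. D k t * \<phi> t - ?g t * \<phi> t)" by (simp add: left_diff_distrib)
    thus "integral\<^sup>L (lebesgue_on {0<..<T}) (\<lambda>t. (D k t - ?g t) * \<phi> t) = 0"
      using Bochner_Integration.integral_diff[OF int[OF Dk(1)] int[OF g(1)]] eq by simp
  qed
  thus AE: "AE t in lebesgue_on {0<..<T}. D k t = ?g t" by eventually_elim simp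
  show "Linf_norm T ?g \<le> ennreal B"
    unfolding Linf_norm_def
  proof (rule esssup_I)
    show "(\<lambda>t. ennreal \<bar>?g t\<bar>) \<in> borel_measurable (lebesgue_on {0<..<T})" using g(1) by (auto simp: Linf_def)
    show "AE t in lebesgue_on {0<..<T}. ennreal \<bar>?g t\<bar> \<le> ennreal B"
      using AE by eventually_elim (metis B ennreal_leI)
  qed
qed

lemma W0_space_classical:
  assumes der: "\<And>k t. k < m \<Longrightarrow> (D k has_real_derivative D (Suc k) t) (at t)"
    and cont: "\<And>k. k \<le> m \<Longrightarrow> continuous_on UNIV (D k)" and T: "0 < T"
    and B: "\<And>k t. k \<le> m \<Longrightarrow> \<bar>D k t\<bar> \<le> B"
    and bdry: "\<And>k. k < m \<Longrightarrow> D k 0 = 0" "\<And>k. k < m \<Longrightarrow> D k T = 0"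
  shows "D 0 \<in> W0_space m T" and W_norm_classical: "W_norm m T (D 0) \<le> ennreal (real (m + 1) * B)"
proof -
  have wd: "AE t in lebesgue_on {0<..<T}. D k t = weak_deriv T k (D 0) t"
    "Linf_norm T (weak_deriv T k (D 0)) \<le> ennreal B" if "k \<le> m" for k
    using weak_deriv_classical[of k D T B] that der cont T B by auto
  have "D 0 \<in> W_space m T"
    unfolding W_space_def
  proof (intro CollectI conjI allI impI)
    show "D 0 \<in> Linf T" using Linf_continuous(1)[OF cont B] by simp
    fix k assume k: "k \<le> m"
    show "\<exists>g\<in>Linf T. has_weak_deriv T k (D 0) g"
      using Linf_continuous(1)[OF cont[OF k] B[OF k]] has_weak_deriv_classical[of k D T] der cont T k by auto
  qed
  \<comment> \<open>The continuous representative demanded by \<open>W0_space\<close> is the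
    classical derivative \<open>D k\<close> itself.\<close>
  thus "D 0 \<in> W0_space m T"
    unfolding W0_space_def using wd(1) bdry continuous_on_subset[OF cont]
    by (auto intro!: exI[of _ "D _"])
  have "W_norm m T (D 0) \<le> (\<Sum>k\<le>m. ennreal B)"
    unfolding W_norm_def by (rule sum_mono) (use wd(2) in auto)
  also have "\<dots> = ennreal (real (m + 1) * B)"
    using B[of 0 0] by (simp add: ennreal_mult'' ennreal_of_nat_eq_real_of_nat)
  finally show "W_norm m T (D 0) \<le> ennreal (real (m + 1) * B)" .
qed

section \<open>Trajectories for small controls\<close>

lemma vector_derivative_increment_le:
  fixes y :: "real \<Rightarrow> 'v::real_normed_vector"
  assumes "\<And>t. t \<in> {a..b} \<Longrightarrow> (y has_vector_derivative y' t) (at t within {a..b})"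
    and "\<And>t. t \<in> {a..b} \<Longrightarrow> norm (y' t) \<le> B" and "s \<in> {a..b}" "t \<in> {a..b}"
  shows "norm (y t - y s) \<le> B * \<bar>t - s\<bar>"
proof -
  have "norm (y t - y s) \<le> B * norm (t - s)"
  proof (rule differentiable_bound[of "{a..b}" y "\<lambda>t h. h *\<^sub>R y' t"])
    show "(y has_derivative (\<lambda>h. h *\<^sub>R y' t)) (at t within {a..b})" if "t \<in> {a..b}" for t
      using assms(1)[OF that] by (simp add: has_vector_derivative_def)
    show "onorm (\<lambda>h. h *\<^sub>R y' t) \<le> B" if "t \<in> {a..b}" for t
      by (rule onorm_le) (use assms(2)[OF that] in \<open>simp add: mult_right_mono mult.commute[of B]  mult_left_mono\<close>)
  qed (use assms in auto)
  thus ?thesis by simp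
qed

text \<open>On short intervals this replaces Gronwall's lemma.\<close>

lemma short_time_bound:
  fixes y :: "real \<Rightarrow> 'v::real_normed_vector"
  assumes der: "\<And>t. t \<in> {a..b} \<Longrightarrow> (y has_vector_derivative y' t) (at t within {a..b})"
    and bd: "\<And>t. t \<in> {a..b} \<Longrightarrow> norm (y' t) \<le> K * norm (y t) + \<eta>"
    and K: "0 \<le> K" "K * (b - a) \<le> 1 / 2" and \<eta>: "0 \<le> \<eta>" and t: "t \<in> {a..b}"
  shows "norm (y t) \<le> 2 * (norm (y a) + (b - a) * \<eta>)"
proof -
  have "continuous_on {a..b} (\<lambda>t. norm (y t))"
    by (intro continuous_on_norm continuous_on_vector_derivative[OF der])
  \<comment> \<open>At a maximum point m of the norm the increment estimate reads |y m| \<le> |y a|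
    + |y m| / 2 + (b - a) \<eta>, so the term with |y m| can be absorbed.\<close>
  then obtain m where m: "m \<in> {a..b}" "\<And>t. t \<in> {a..b} \<Longrightarrow> norm (y t) \<le> norm (y m)"
    using continuous_attains_sup[of "{a..b}" "\<lambda>t. norm (y t)"] t by auto
  have "norm (y m - y a) \<le> (K * norm (y m) + \<eta>) * \<bar>m - a\<bar>"
  proof (rule vector_derivative_increment_le[OF der])
    fix t assume t: "t \<in> {a..b}"
    have "K * norm (y t) \<le> K * norm (y m)" using m(2)[OF t] K by (intro mult_left_mono) auto
    thus "norm (y' t) \<le> K * norm (y m) + \<eta>" using bd[OF t] by linarith
  qed (use m t in auto)
  also have "\<dots> \<le> (K * norm (y m) + \<eta>) * (b - a)"
    using m(1) K \<eta> by (intro mult_left_mono) auto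
  also have "\<dots> = (K * (b - a)) * norm (y m) + (b - a) * \<eta>" by (simp add: algebra_simps)
  also have "\<dots> \<le> (1/2) * norm (y m) + (b - a) * \<eta>"
    using K by (intro add_right_mono mult_right_mono) auto
  finally have "norm (y m) \<le> norm (y a) + (1/2) * norm (y m) + (b - a) * \<eta>"
    using norm_triangle_sub[of "y m" "y a"] by linarith
  hence "norm (y m) \<le> 2 * (norm (y a) + (b - a) * \<eta>)" by (simp add: distrib_left)
  with m(2)[OF t] show ?thesis by (rule order_trans)
qed

text \<open>Everything about trajectories and end points uses only these bounds on one ball, with
  the Taylor data at 0 as parameters: A is the derivative and Q the second derivative of f0 (hence
  the factor 1/2), and b_i, B_i are value and derivative of f_i.\<close>

locale control_system =
  fixes f0 f1 f2 :: "'v::euclidean_space \<Rightarrow> 'v" and A :: "'v \<Rightarrow> 'v" and Q :: "'v \<Rightarrow> 'v \<Rightarrow> 'v"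
    and b1 b2 :: 'v and B1 B2 :: "'v \<Rightarrow> 'v" and R K :: real
  assumes R_pos: "0 < R" and K_ge1: "1 \<le> K" and f0_0: "f0 0 = 0"
    and lip0: "\<And>x y. norm x \<le> R \<Longrightarrow> norm y \<le> R \<Longrightarrow> norm (f0 x - f0 y) \<le> K * norm (x - y)"
    and lip1: "\<And>x y. norm x \<le> R \<Longrightarrow> norm y \<le> R \<Longrightarrow> norm (f1 x - f1 y) \<le> K * norm (x - y)"
    and lip2: "\<And>x y. norm x \<le> R \<Longrightarrow> norm y \<le> R \<Longrightarrow> norm (f2 x - f2 y) \<le> K * norm (x - y)"
    and bd1: "\<And>x. norm x \<le> R \<Longrightarrow> norm (f1 x) \<le> K"
    and bd2: "\<And>x. norm x \<le> R \<Longrightarrow> norm (f2 x) \<le> K"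
    and linA: "linear A" and linB1: "linear B1" and linB2: "linear B2"
    and bilQ: "bounded_bilinear Q" and symQ: "\<And>x y. Q x y = Q y x"
    and tay0: "\<And>x. norm x \<le> R \<Longrightarrow> norm (f0 x - A x - (1/2) *\<^sub>R Q x x) \<le> K * norm x ^ 3"
    and tay0': "\<And>x. norm x \<le> R \<Longrightarrow> norm (f0 x - A x) \<le> K * norm x ^ 2"
    and tay1: "\<And>x. norm x \<le> R \<Longrightarrow> norm (f1 x - b1 - B1 x) \<le> K * norm x ^ 2"
    and tay2: "\<And>x. norm x \<le> R \<Longrightarrow> norm (f2 x - b2 - B2 x) \<le> K * norm x ^ 2"
    and bdA: "\<And>x. norm (A x) \<le> K * norm x"
begin

definition F :: "'v \<Rightarrow> real \<times> real \<Rightarrow> 'v" where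
  "F x w = f0 x + fst w *\<^sub>R f1 x + snd w *\<^sub>R f2 x"

text \<open>3 K is a Lipschitz constant of F in the state when the control is bounded by 1; \<theta>
  is the longest duration for which \<open>short_time_bound\<close> applies with it.\<close>

definition \<theta> :: real where "\<theta> = 1 / (6 * K)"

text \<open>A control of size at most \<eta>0 acting for the time \<theta> from the origin moves the
  state by at most (2/3) \<eta>0, hence inside the ball of radius R.\<close>

definition \<eta>0 :: real where "\<eta>0 = min 1 R"

lemma \<theta>_pos: "0 < \<theta>" and K\<theta>: "3 * K * \<theta> = 1 / 2"
  using K_ge1 by (auto simp: \<theta>_def field_simps)

lemma \<eta>0_pos: "0 < \<eta>0" and \<eta>0_le1: "\<eta>0 \<le> 1" and \<eta>0_leR: "\<eta>0 \<le> R"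
  using R_pos by (auto simp: \<eta>0_def)

lemma fst_le: "\<bar>fst (w :: real \<times> real)\<bar> \<le> norm w" and snd_le: "\<bar>snd w\<bar> \<le> norm (w :: real \<times> real)"
  using norm_fst_le[of "fst w" "snd w"] norm_snd_le[of "snd w" "fst w"] by auto

lemma norm_f0: "norm x \<le> R \<Longrightarrow> norm (f0 x) \<le> K * norm x"
  using lip0[of x 0] R_pos by (simp add: f0_0)

lemma F_lip:
  assumes "norm x \<le> R" "norm y \<le> R" "norm w \<le> 1"
  shows "norm (F x w - F y w) \<le> 3 * K * norm (x - y)"
proof -
  have "F x w - F y w = (f0 x - f0 y) + fst w *\<^sub>R (f1 x - f1 y) + snd w *\<^sub>R (f2 x - f2 y)"
    by (simp add: F_def algebra_simps)
  also have "norm \<dots> \<le> norm (f0 x - f0 y) + \<bar>fst w\<bar> * norm (f1 x - f1 y) + \<bar>snd w\<bar> * norm (f2 x - f2 y)"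
    by (intro order_trans[OF norm_triangle_ineq] add_mono) auto
  also have "\<dots> \<le> K * norm (x - y) + 1 * (K * norm (x - y)) + 1 * (K * norm (x - y))"
    using fst_le[of w] snd_le[of w] assms K_ge1 by (intro add_mono mult_mono lip0 lip1 lip2) auto
  finally show ?thesis by simp
qed

lemma F_lip_control:
  assumes "norm x \<le> R"
  shows "norm (F x w - F x w') \<le> 2 * K * norm (w - w')"
proof -
  have "F x w - F x w' = fst (w - w') *\<^sub>R f1 x + snd (w - w') *\<^sub>R f2 x"
    by (simp add: F_def algebra_simps)
  also have "norm \<dots> \<le> \<bar>fst (w - w')\<bar> * norm (f1 x) + \<bar>snd (w - w')\<bar> * norm (f2 x)"
    by (intro order_trans[OF norm_triangle_ineq] add_mono) auto
  also have "\<dots> \<le> norm (w - w') * K + norm (w - w') * K"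
    by (intro add_mono mult_mono bd1 bd2 assms fst_le snd_le) auto
  finally show ?thesis by simp
qed

lemma F_0: "F 0 (0, 0) = 0" "F 0 0 = 0" by (simp_all add: F_def f0_0)

lemma F_bound:
  assumes "norm x \<le> R"
  shows "norm (F x w) \<le> K * norm x + 2 * K * norm w"
proof -
  have "norm (F x w) \<le> norm (F x w - F x 0) + norm (F x 0)" using norm_triangle_sub by (simp add: add.commute)
  moreover have "norm (F x 0) \<le> K * norm x" using norm_f0[OF assms] by (simp add: F_def)
  ultimately show ?thesis using F_lip_control[OF assms, of w 0] by simp
qed

definition sol :: "(real \<Rightarrow> real \<times> real) \<Rightarrow> real \<Rightarrow> real \<Rightarrow> (real \<Rightarrow> 'v) \<Rightarrow> bool" where
  "sol w a b x \<longleftrightarrow> (\<forall>t\<in>{a..b}. (x has_vector_derivative F (x t) (w t)) (at t within {a..b}) \<and> norm (x t) \<le> R)"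

lemma sol_subinterval:
  assumes "sol w a b x" "a \<le> c" "d \<le> b" shows "sol w c d x"
proof -
  have sub: "{c..d} \<subseteq> {a..b}" using assms(2,3) by auto
  show ?thesis unfolding sol_def
  proof
    fix t assume "t \<in> {c..d}"
    with sub have "t \<in> {a..b}" by blast
    with assms(1) show "(x has_vector_derivative F (x t) (w t)) (at t within {c..d}) \<and> norm (x t) \<le> R"
      unfolding sol_def using has_vector_derivative_within_subset[OF _ sub] by blast
  qed
qed

lemma sol_cong: "sol w a b x \<Longrightarrow> (\<And>t. t \<in> {a..b} \<Longrightarrow> w t = w' t) \<Longrightarrow> sol w' a b x"
  unfolding sol_def by auto

lemma sol_zero: "sol (\<lambda>_. 0) a b (\<lambda>_. 0)"
  unfolding sol_def using R_pos by (auto simp: F_0 intro!: derivative_eq_intros)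

lemma sol_shift:
  assumes "sol w (a + c) (b + c) x"
  shows "sol (\<lambda>t. w (t + c)) a b (\<lambda>t. x (t + c))"
  unfolding sol_def
proof (intro ballI conjI)
  fix t assume t: "t \<in> {a..b}"
  have im: "(\<lambda>t. t + c) ` {a..b} = {a + c..b + c}"
    by (simp add: add.commute[of _ c])
  have 1: "(x has_vector_derivative F (x (t + c)) (w (t + c))) (at (t + c) within (\<lambda>t. t + c) ` {a..b})"
    unfolding im using assms t by (auto simp: sol_def)
  have 2: "((\<lambda>t. t + c) has_vector_derivative 1) (at t within {a..b})"
    by (auto intro!: derivative_eq_intros)
  show "((\<lambda>t. x (t + c)) has_vector_derivative F (x (t + c)) (w (t + c))) (at t within {a..b})"
    using vector_diff_chain_within[OF 2 1] by (simp add: o_def)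
  show "norm (x (t + c)) \<le> R" using assms t by (auto simp: sol_def)
qed

lemma sol_diff_le:
  assumes x: "sol w a b x" and y: "sol w' a b y" and len: "b - a \<le> \<theta>" and t: "t \<in> {a..b}"
    and w: "\<And>t. t \<in> {a..b} \<Longrightarrow> norm (w t) \<le> 1"
    and \<eta>: "\<And>t. t \<in> {a..b} \<Longrightarrow> norm (w t - w' t) \<le> \<eta>"
  shows "norm (x t - y t) \<le> 2 * (norm (x a - y a) + (b - a) * (2 * K * \<eta>))"
proof (rule short_time_bound[of a b "\<lambda>t. x t - y t" "\<lambda>t. F (x t) (w t) - F (y t) (w' t)" "3 * K" "2 * K * \<eta>"])
  fix t assume t: "t \<in> {a..b}"
  show "((\<lambda>t. x t - y t) has_vector_derivative F (x t) (w t) - F (y t) (w' t)) (at t within {a..b})"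
    using x y t by (auto simp: sol_def intro!: has_vector_derivative_diff)
  have xy: "norm (x t) \<le> R" "norm (y t) \<le> R" using x y t by (auto simp: sol_def)
  have "norm (F (x t) (w t) - F (y t) (w' t)) \<le> norm (F (x t) (w t) - F (y t) (w t)) + norm (F (y t) (w t) - F (y t) (w' t))"
    using norm_triangle_ineq[of "F (x t) (w t) - F (y t) (w t)" "F (y t) (w t) - F (y t) (w' t)"] by simp
  also have "\<dots> \<le> 3 * K * norm (x t - y t) + 2 * K * norm (w t - w' t)"
    by (intro add_mono F_lip F_lip_control xy w t)
  also have "\<dots> \<le> 3 * K * norm (x t - y t) + 2 * K * \<eta>"
    using \<eta>[OF t] K_ge1 by auto
  finally show "norm (F (x t) (w t) - F (y t) (w' t)) \<le> 3 * K * norm (x t - y t) + 2 * K * \<eta>" .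
next
  show "3 * K * (b - a) \<le> 1 / 2" using mult_left_mono[OF len, of "3 * K"] K\<theta> K_ge1 by auto
  have "0 \<le> \<eta>" using \<eta>[OF t] norm_ge_zero[of "w t - w' t"] by linarith
  thus "0 \<le> 2 * K * \<eta>" using K_ge1 by simp
qed (use K_ge1 t in auto)

lemma sol_unique:
  assumes "sol w a b x" "sol w a b y" "b - a \<le> \<theta>" "t \<in> {a..b}" "x a = y a"
    and "\<And>t. t \<in> {a..b} \<Longrightarrow> norm (w t) \<le> 1"
  shows "x t = y t"
  using sol_diff_le[OF assms(1-4,6), of 0] assms(5) by simp

lemma sol_norm_le:
  assumes x: "sol w a b x" and len: "b - a \<le> \<theta>" and t: "t \<in> {a..b}"
    and \<eta>: "\<And>t. t \<in> {a..b} \<Longrightarrow> norm (w t) \<le> \<eta>" and "\<eta> \<le> 1"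
  shows "norm (x t) \<le> 2 * (norm (x a) + (b - a) * (2 * K * \<eta>))"
proof -
  have "norm (x t - 0) \<le> 2 * (norm (x a - 0) + (b - a) * (2 * K * \<eta>))"
  proof (rule sol_diff_le[OF x sol_zero len t])
    fix t assume t: "t \<in> {a..b}"
    show "norm (w t) \<le> 1" using \<eta>[OF t] assms(5) by (rule order_trans)
    show "norm (w t - 0) \<le> \<eta>" using \<eta>[OF t] by simp
  qed
  thus ?thesis by simp
qed

text \<open>Picard iteration. Composing with the nearest-point map onto the ball makes the
  right-hand side globally Lipschitz, so the integral operator contracts with factor 3 K \<theta> =
  1/2 on bounded continuous functions. The a priori bound then keeps the fixed point in the ball,
  where the nearest-point map is the identity.\<close>

lemma sol_exists:
  assumes ab: "a \<le> b" and len: "b - a \<le> \<theta>" and w: "continuous_on {a..b} w"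
    and \<eta>: "\<And>t. t \<in> {a..b} \<Longrightarrow> norm (w t) \<le> \<eta>" and "\<eta> \<le> 1"
    and small: "2 * (norm p + (b - a) * (2 * K * \<eta>)) \<le> R"
  shows "\<exists>x. sol w a b x \<and> x a = p"
proof -
  define cp where "cp = closest_point (cball (0 :: 'v) R)"
  have cpR: "norm (cp v) \<le> R" for v
    using closest_point_in_set[of "cball (0 :: 'v) R" v] R_pos by (simp add: cp_def)
  have cp_lip: "norm (cp u - cp v) \<le> norm (u - v)" for u v
    using closest_point_lipschitz[of "cball (0 :: 'v) R" u v] R_pos by (simp add: cp_def dist_norm)
  have cp_id: "norm v \<le> R \<Longrightarrow> cp v = v" for v
    unfolding cp_def by (rule closest_point_self) simp
  have cp0: "cp 0 = 0" using cp_id R_pos by simp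
  \<comment> \<open>Bounded continuous functions live on the whole line; \<open>c\<close> clamps the
    time to [a, b] so that the operator acts on them.\<close>
  define c where "c t = max a (min b t)" for t
  have c: "c t \<in> {a..b}" for t using ab by (auto simp: c_def)
  have c_id: "t \<in> {a..b} \<Longrightarrow> c t = t" for t by (auto simp: c_def)
  have cont_F: "continuous_on S (\<lambda>s. F (cp (y s)) (w s))" if "continuous_on S y" "S \<subseteq> {a..b}" for y S
  proof -
    have cpc: "continuous_on UNIV cp"
      unfolding cp_def by (rule continuous_on_closest_point) (use R_pos in auto)
    have fc: "continuous_on (cball 0 R) f0" "continuous_on (cball 0 R) f1" "continuous_on (cball 0 R) f2"
      by (intro lipschitz_on_continuous_on[of K] lipschitz_onI; use lip0 lip1 lip2 K_ge1 in \<open>simp add: dist_norm\<close>)+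
    have y: "continuous_on S (\<lambda>s. cp (y s))"
      by (rule continuous_on_compose2[OF cpc that(1)]) auto
    have *: "continuous_on S (\<lambda>s. f (cp (y s)))" if "continuous_on (cball 0 R) f" for f :: "'v \<Rightarrow> 'v"
      by (rule continuous_on_compose2[OF that y]) (use cpR in auto)
    show ?thesis unfolding F_def
      by (intro continuous_intros * fc continuous_on_subset[OF w that(2)])
  qed
  define I where "I y t = p + integral {a..c t} (\<lambda>s. F (cp (apply_bcontfun y s)) (w s))" for y t
  have int: "(\<lambda>s. F (cp (apply_bcontfun y s)) (w s)) integrable_on {a..t}" if "t \<le> b" for y t
    by (rule integrable_continuous_interval, rule cont_F) (use that in auto)
  have I: "I y \<in> bcontfun" for y
  proof -
    have 1: "continuous_on {a..b} (\<lambda>t. p + integral {a..t} (\<lambda>s. F (cp (apply_bcontfun y s)) (w s)))"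
      by (intro continuous_intros indefinite_integral_continuous_1 int) auto
    have 2: "continuous_on UNIV c" unfolding c_def by (intro continuous_intros)
    have "continuous_on UNIV (I y)" unfolding I_def
      by (rule continuous_on_compose2[OF 1 2]) (use c in auto)
    moreover have "bounded (range (I y))"
    proof (rule bounded_subset[OF compact_imp_bounded[OF compact_continuous_image[OF 1]]])
      show "range (I y) \<subseteq> (\<lambda>t. p + integral {a..t} (\<lambda>s. F (cp (apply_bcontfun y s)) (w s))) ` {a..b}"
        using c by (auto simp: I_def)
    qed auto
    ultimately show ?thesis by (simp add: bcontfun_def)
  qed
  define T where "T y = Bcontfun (I y)" for y
  have T: "apply_bcontfun (T y) = I y" for y
    unfolding T_def using I by (simp add: Bcontfun_inverse)
  have "\<exists>!y. T y = y"
  proof (rule banach_fix_type[of "1/2"])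
    show "\<forall>y z. dist (T y) (T z) \<le> 1 / 2 * dist y z"
    proof (intro allI dist_bound)
      fix y z t
      have "norm (I y t - I z t) = norm (integral {a..c t} (\<lambda>s. F (cp (apply_bcontfun y s)) (w s) - F (cp (apply_bcontfun z s)) (w s)))"
        unfolding I_def using c[of t] by (simp add: integral_diff int)
      also have "\<dots> \<le> integral {a..c t} (\<lambda>s. 3 * K * dist y z)"
      proof (rule integral_norm_bound_integral)
        fix s assume s: "s \<in> {a..c t}"
        hence s': "s \<in> {a..b}" using c[of t] by auto
        have "norm (F (cp (apply_bcontfun y s)) (w s) - F (cp (apply_bcontfun z s)) (w s)) \<le>
           3 * K * norm (cp (apply_bcontfun y s) - cp (apply_bcontfun z s))"
          using \<eta>[OF s'] assms(5) by (intro F_lip cpR) auto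
        also have "\<dots> \<le> 3 * K * dist y z"
          using cp_lip[of "apply_bcontfun y s" "apply_bcontfun z s"] dist_bounded[of y s z] K_ge1
          by (intro mult_left_mono) (auto simp: dist_norm)
        finally show "norm (F (cp (apply_bcontfun y s)) (w s) - F (cp (apply_bcontfun z s)) (w s)) \<le> 3 * K * dist y z" .
      qed (use c[of t] in \<open>auto intro!: integrable_diff int\<close>)
      also have "\<dots> = (3 * K * (c t - a)) * dist y z" using c[of t] by simp
      also have "\<dots> \<le> (3 * K * \<theta>) * dist y z"
        using c[of t] len K_ge1 by (intro mult_right_mono mult_left_mono) auto
      finally show "dist (apply_bcontfun (T y) t) (apply_bcontfun (T z) t) \<le> 1 / 2 * dist y z"
        unfolding T K\<theta> by (simp add: dist_norm)
    qed
  qed auto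
  then obtain y where y: "T y = y" by auto
  define x where "x = apply_bcontfun y"
  have x: "x t = p + integral {a..t} (\<lambda>s. F (cp (x s)) (w s))" if "t \<in> {a..b}" for t
    using fun_cong[OF T[of y], of t] unfolding y I_def c_id[OF that] x_def .
  have der: "(x has_vector_derivative F (cp (x t)) (w t)) (at t within {a..b})" if "t \<in> {a..b}" for t
  proof -
    have "((\<lambda>t. p + integral {a..t} (\<lambda>s. F (cp (x s)) (w s))) has_vector_derivative 0 + F (cp (x t)) (w t)) (at t within {a..b})"
      by (intro has_vector_derivative_add has_vector_derivative_const integral_has_vector_derivative cont_F that)
         (auto simp: x_def)
    thus ?thesis
      by (intro has_vector_derivative_transform[OF that x]) auto
  qed
  have xa: "x a = p" using x[of a] ab by simp
  have bound: "norm (x t) \<le> R" if t: "t \<in> {a..b}" for t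
  proof -
    have "norm (x t) \<le> 2 * (norm (x a) + (b - a) * (2 * K * \<eta>))"
    proof (rule short_time_bound[OF der])
      fix t assume t: "t \<in> {a..b}"
      have "norm (F (cp (x t)) (w t)) \<le> K * norm (cp (x t)) + 2 * K * norm (w t)"
        by (rule F_bound[OF cpR])
      also have "\<dots> \<le> K * norm (x t) + 2 * K * \<eta>"
        using cp_lip[of "x t" 0] cp0 \<eta>[OF t] K_ge1 by (intro add_mono mult_left_mono) auto
      finally show "norm (F (cp (x t)) (w t)) \<le> K * norm (x t) + 2 * K * \<eta>" .
    next
      have "K * (b - a) \<le> K * \<theta>" using len K_ge1 by (intro mult_left_mono) auto
      thus "K * (b - a) \<le> 1 / 2" using K\<theta> by linarith
      have "0 \<le> \<eta>" using \<eta>[OF t] norm_ge_zero[of "w t"] by linarith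
      thus "0 \<le> 2 * K * \<eta>" using K_ge1 by simp
    qed (use K_ge1 t in auto)
    with small xa show ?thesis by simp
  qed
  have "sol w a b x" unfolding sol_def using der bound cp_id by simp
  with xa show ?thesis by blast
qed

section \<open>Trajectories from rest and composition of pulses\<close>

definition admissible :: "(real \<Rightarrow> real \<times> real) \<Rightarrow> bool" where
  "admissible w \<longleftrightarrow> continuous_on UNIV w \<and> (\<forall>t. norm (w t) \<le> \<eta>0)"

text \<open>The interval has length \<theta>, on which \<open>sol_unique\<close> determines the
  chosen solution.\<close>

definition traj :: "(real \<Rightarrow> real \<times> real) \<Rightarrow> real \<Rightarrow> 'v" where
  "traj w = (SOME x. sol w (- \<theta>) 0 x \<and> x (- \<theta>) = 0)"

definition End :: "(real \<Rightarrow> real \<times> real) \<Rightarrow> 'v" where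
  "End w = traj w 0"

lemma admissible_le1: "admissible w \<Longrightarrow> norm (w t) \<le> 1"
  using \<eta>0_le1 unfolding admissible_def by (meson order_trans)

lemma K\<theta>_mult: "2 * (\<theta> * (2 * K * \<eta>)) = (2 / 3) * \<eta>"
proof -
  have "2 * (\<theta> * (2 * K * \<eta>)) = (4 / 3) * (3 * K * \<theta>) * \<eta>" by simp
  thus ?thesis unfolding K\<theta> by simp
qed

lemma traj:
  assumes "admissible w"
  shows "sol w (- \<theta>) 0 (traj w)" and "traj w (- \<theta>) = 0"
proof -
  have "\<exists>x. sol w (- \<theta>) 0 x \<and> x (- \<theta>) = 0"
  proof (rule sol_exists[of _ _ w \<eta>0])
    have "2 * (\<theta> * (2 * K * \<eta>0)) \<le> R"
      using K\<theta>_mult[of \<eta>0] \<eta>0_leR \<eta>0_pos by linarith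
    thus "2 * (norm (0 :: 'v) + (0 - - \<theta>) * (2 * K * \<eta>0)) \<le> R"
      by simp
  qed (use assms \<theta>_pos \<eta>0_le1 in \<open>auto simp: admissible_def intro: continuous_on_subset\<close>)
  from someI_ex[OF this] show "sol w (- \<theta>) 0 (traj w)" "traj w (- \<theta>) = 0"
    by (auto simp: traj_def)
qed

lemma traj_before:
  assumes w: "admissible w" and z: "\<And>t. t \<le> - \<delta> \<Longrightarrow> w t = 0" and \<delta>: "0 \<le> \<delta>" "\<delta> \<le> \<theta>" and t: "t \<in> {- \<theta>..- \<delta>}"
  shows "traj w t = 0"
proof -
  have 1: "sol (\<lambda>_. 0) (- \<theta>) (- \<delta>) (traj w)"
    by (rule sol_cong[OF sol_subinterval[OF traj(1)[OF w]]]) (use z \<delta> in auto)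
  show ?thesis
    using sol_unique[OF 1 sol_zero _ t] traj(2)[OF w] \<delta> by simp
qed

lemma traj_bound:
  assumes w: "admissible w" and z: "\<And>t. t \<le> - \<delta> \<Longrightarrow> w t = 0" and \<delta>: "0 \<le> \<delta>" "\<delta> \<le> \<theta>" and t: "t \<in> {- \<delta>..0}"
    and \<eta>: "\<And>t. norm (w t) \<le> \<eta>"  "\<eta> \<le> 1"
  shows "norm (traj w t) \<le> 4 * K * \<delta> * \<eta>"
proof -
  have "sol w (- \<delta>) 0 (traj w)" by (rule sol_subinterval[OF traj(1)[OF w]]) (use \<delta> in auto)
  from sol_norm_le[OF this _ t \<eta>] have "norm (traj w t) \<le> 2 * (norm (traj w (- \<delta>)) + (0 - - \<delta>) * (2 * K * \<eta>))"
    using \<delta> by simp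
  moreover have "traj w (- \<delta>) = 0" by (rule traj_before[OF w z \<delta>]) (use \<delta> in auto)
  ultimately show ?thesis by (simp add: mult_ac)
qed

text \<open>Over the duration \<theta> the factor 4 K \<theta> equals 2/3, so the end point depends
  on the control with a Lipschitz constant below 1. This is the source of its continuity in the
  parameter.\<close>

lemma End_diff:
  assumes w: "admissible w" "admissible w'" and \<eta>: "\<And>t. norm (w t - w' t) \<le> \<eta>"
  shows "norm (End w - End w') \<le> \<eta>"
proof -
  have "norm (End w - End w') \<le> 2 * (norm (traj w (- \<theta>) - traj w' (- \<theta>)) + (0 - - \<theta>) * (2 * K * \<eta>))"
    unfolding End_def
    by (rule sol_diff_le[OF traj(1)[OF w(1)] traj(1)[OF w(2)]]) (use \<theta>_pos \<eta> admissible_le1[OF w(1)] in auto)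
  also have "\<dots> = (2 / 3) * \<eta>" using K\<theta>_mult[of \<eta>] by (simp add: traj(2)[OF w(1)] traj(2)[OF w(2)])
  also have "\<dots> \<le> \<eta>" using \<eta>[of 0] norm_ge_zero[of "w 0 - w' 0"] by linarith
  finally show ?thesis .
qed

lemma admissible_zero: "admissible (\<lambda>_. 0)"
  using \<eta>0_pos by (simp add: admissible_def)

lemma End_zero: "End (\<lambda>_. 0) = 0"
  unfolding End_def by (rule traj_before[OF admissible_zero, of 0]) (use \<theta>_pos in auto)

text \<open>By invariance under time translation and uniqueness, a pulse that is played \<sigma>
  earlier has at time -\<sigma> done exactly what it would have done at time 0.\<close>

lemma traj_shift:
  assumes w1: "admissible w1" and z: "\<And>t. t \<le> - \<delta> \<Longrightarrow> w1 t = 0" and \<delta>: "0 \<le> \<delta>" "0 \<le> \<sigma>" "\<delta> + \<sigma> \<le> \<theta>"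
    and w: "admissible w" and eq: "\<And>t. t \<le> - \<sigma> \<Longrightarrow> w t = w1 (t + \<sigma>)"
  shows "traj w (- \<sigma>) = End w1"
proof -
  have 1: "sol (\<lambda>t. w1 (t + \<sigma>)) (- \<theta>) (- \<sigma>) (\<lambda>t. traj w1 (t + \<sigma>))"
    by (rule sol_shift, rule sol_subinterval[OF traj(1)[OF w1]]) (use \<delta> in auto)
  have 2: "sol (\<lambda>t. w1 (t + \<sigma>)) (- \<theta>) (- \<sigma>) (traj w)"
    by (rule sol_cong[OF sol_subinterval[OF traj(1)[OF w]]]) (use \<delta> eq in auto)
  have 3: "traj w1 (- \<theta> + \<sigma>) = 0"
    by (rule traj_before[where \<delta> = \<delta>, OF w1 z]) (use \<delta> in auto)
  have "traj w (- \<sigma>) = (\<lambda>t. traj w1 (t + \<sigma>)) (- \<sigma>)"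
  proof (rule sol_unique[OF 2 1])
    show "- \<sigma> - - \<theta> \<le> \<theta>" "- \<sigma> \<in> {- \<theta>..- \<sigma>}" using \<delta> by auto
    show "traj w (- \<theta>) = traj w1 (- \<theta> + \<sigma>)" unfolding 3 by (rule traj(2)[OF w])
    show "norm (w1 (t + \<sigma>)) \<le> 1" for t by (rule admissible_le1[OF w1])
  qed
  thus ?thesis by (simp add: End_def)
qed

text \<open>On the last interval both trajectories obey the same equation with control w2, one
  starting from \<open>End w1\<close>, the other from 0. Their difference stays below 2 |End w1|, so
  its derivative is at most 6 K |End w1|, and it drifts by at most that times \<delta>2.\<close>

lemma End_concat:
  assumes w1: "admissible w1" and z1: "\<And>t. t \<le> - \<delta>1 \<or> 0 \<le> t \<Longrightarrow> w1 t = 0"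
    and w2: "admissible w2" and z2: "\<And>t. t \<le> - \<delta>2 \<Longrightarrow> w2 t = 0"
    and \<delta>: "0 \<le> \<delta>1" "0 \<le> \<delta>2" "\<delta>1 + \<delta>2 \<le> \<theta>"
    and w: "admissible w" and eq: "\<And>t. w t = w1 (t + \<delta>2) + w2 t"
  shows "norm (End w - End w1 - End w2) \<le> 6 * K * \<delta>2 * norm (End w1)"
proof -
  have y1: "traj w (- \<delta>2) = End w1"
    by (rule traj_shift[OF w1 z1 \<delta>(1,2,3) w]) (use eq z2 in auto)
  have y2: "traj w2 (- \<delta>2) = 0"
    by (rule traj_before[where \<delta> = \<delta>2, OF w2 z2]) (use \<delta> in auto)
  have s1: "sol w2 (- \<delta>2) 0 (traj w)"
    by (rule sol_cong[OF sol_subinterval[OF traj(1)[OF w]]]) (use \<delta> eq z1 in auto)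
  have s2: "sol w2 (- \<delta>2) 0 (traj w2)"
    by (rule sol_subinterval[OF traj(1)[OF w2]]) (use \<delta> in auto)
  define d where "d t = traj w t - traj w2 t" for t
  define d' where "d' t = F (traj w t) (w2 t) - F (traj w2 t) (w2 t)" for t
  have d_le: "norm (d t) \<le> 2 * norm (End w1)" if "t \<in> {- \<delta>2..0}" for t
    using sol_diff_le[OF s1 s2 _ that, of 0] \<delta> admissible_le1[OF w2] by (simp add: d_def y1 y2)
  have "norm (d 0 - d (- \<delta>2)) \<le> (3 * K * (2 * norm (End w1))) * \<bar>0 - - \<delta>2\<bar>"
  proof (rule vector_derivative_increment_le)
    fix t assume t: "t \<in> {- \<delta>2..0}"
    show "(d has_vector_derivative d' t) (at t within {- \<delta>2..0})"
      using s1 s2 t unfolding d_def[abs_def] d'_def sol_def by (auto intro!: has_vector_derivative_diff)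
    have "norm (d' t) \<le> 3 * K * norm (d t)"
      unfolding d'_def d_def using s1 s2 t admissible_le1[OF w2] by (intro F_lip) (auto simp: sol_def)
    also have "\<dots> \<le> 3 * K * (2 * norm (End w1))"
      using d_le[OF t] K_ge1 by (intro mult_left_mono) auto
    finally show "norm (d' t) \<le> 3 * K * (2 * norm (End w1))" .
  qed (use \<delta> in auto)
  thus ?thesis using \<delta> by (simp add: d_def y1 y2 End_def[of w] End_def[of w2] algebra_simps)
qed

text \<open>While the control is 0 the state satisfies x' = f0 x with |x| \<le> 2 |e| and |x - e|
  \<le> 2 K |e| \<sigma>, where e is the end point of w1. Replacing f0 x by A e therefore costs K
  |x|^2 + K |x - e|, integrated over \<sigma>.\<close>

lemma End_wait:
  assumes w1: "admissible w1" and z1: "\<And>t. t \<le> - \<delta>1 \<or> 0 \<le> t \<Longrightarrow> w1 t = 0"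
    and \<delta>: "0 \<le> \<delta>1" "0 \<le> \<sigma>" "\<delta>1 + \<sigma> \<le> \<theta>"
    and w: "admissible w" and eq: "\<And>t. w t = w1 (t + \<sigma>)"
  shows "norm (End w - End w1 - \<sigma> *\<^sub>R A (End w1)) \<le>
    2 * K\<^sup>2 * \<sigma>\<^sup>2 * norm (End w1) + 4 * K * \<sigma> * (norm (End w1))\<^sup>2"
proof -
  define e where "e = End w1"
  have y1: "traj w (- \<sigma>) = e"
    unfolding e_def by (rule traj_shift[OF w1 z1 \<delta>(1,2,3) w]) (use eq in auto)
  have s: "sol (\<lambda>_. 0) (- \<sigma>) 0 (traj w)"
    by (rule sol_cong[OF sol_subinterval[OF traj(1)[OF w]]]) (use \<delta> eq z1 in auto)
  have x_le: "norm (traj w t) \<le> 2 * norm e" if "t \<in> {- \<sigma>..0}" for t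
    using sol_norm_le[OF s _ that, of 0] \<delta> by (simp add: y1)
  have xR: "norm (traj w t) \<le> R" if "t \<in> {- \<sigma>..0}" for t using s that by (auto simp: sol_def)
  have der: "(traj w has_vector_derivative f0 (traj w t)) (at t within {- \<sigma>..0})" if "t \<in> {- \<sigma>..0}" for t
    using s that by (auto simp: sol_def F_def)
  have inc: "norm (traj w t - e) \<le> 2 * K * norm e * \<sigma>" if t: "t \<in> {- \<sigma>..0}" for t
  proof -
    have "norm (traj w t - traj w (- \<sigma>)) \<le> (2 * K * norm e) * \<bar>t - - \<sigma>\<bar>"
    proof (rule vector_derivative_increment_le[OF der])
      fix t assume t: "t \<in> {- \<sigma>..0}"
      have "norm (f0 (traj w t)) \<le> K * norm (traj w t)" by (rule norm_f0[OF xR[OF t]])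
      also have "\<dots> \<le> K * (2 * norm e)" using x_le[OF t] K_ge1 by (intro mult_left_mono) auto
      finally show "norm (f0 (traj w t)) \<le> 2 * K * norm e" by simp
    qed (use t in auto)
    also have "\<dots> \<le> (2 * K * norm e) * \<sigma>" using t K_ge1 by (intro mult_left_mono) auto
    finally show ?thesis using y1 by simp
  qed
  define B where "B = 4 * K * (norm e)\<^sup>2 + 2 * K\<^sup>2 * \<sigma> * norm e"
  have "norm ((traj w 0 - (0 - - \<sigma>) *\<^sub>R A e) - (traj w (- \<sigma>) - (- \<sigma> - - \<sigma>) *\<^sub>R A e)) \<le> B * \<bar>0 - - \<sigma>\<bar>"
  proof (rule vector_derivative_increment_le[where y = "\<lambda>t. traj w t - (t - - \<sigma>) *\<^sub>R A e"
        and y' = "\<lambda>t. f0 (traj w t) - A e" and b = 0 and a = "- \<sigma>"])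
    fix t assume t: "t \<in> {- \<sigma>..0}"
    show "((\<lambda>t. traj w t - (t - - \<sigma>) *\<^sub>R A e) has_vector_derivative f0 (traj w t) - A e) (at t within {- \<sigma>..0})"
      by (auto intro!: derivative_eq_intros der[OF t])
    have eq: "f0 (traj w t) - A e = (f0 (traj w t) - A (traj w t)) + A (traj w t - e)"
      by (simp add: linear_diff[OF linA])
    have "norm (f0 (traj w t) - A e) \<le> K * (norm (traj w t))\<^sup>2 + K * norm (traj w t - e)"
      unfolding eq by (intro order_trans[OF norm_triangle_ineq] add_mono tay0' xR t bdA)
    also have "\<dots> \<le> K * (2 * norm e)\<^sup>2 + K * (2 * K * norm e * \<sigma>)"
    proof -
      have K0: "0 \<le> K" using K_ge1 by simp
      have 1: "K * (norm (traj w t))\<^sup>2 \<le> K * (2 * norm e)\<^sup>2"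
        using power_mono[OF x_le[OF t] norm_ge_zero] K0 by (rule mult_left_mono)
      have 2: "K * norm (traj w t - e) \<le> K * (2 * K * norm e * \<sigma>)"
        using inc[OF t] K0 by (rule mult_left_mono)
      show ?thesis using 1 2 by (rule add_mono)
    qed
    also have "\<dots> = B" by (simp add: B_def power2_eq_square algebra_simps)
    finally show "norm (f0 (traj w t) - A e) \<le> B" .
  qed (use \<delta> in auto)
  thus ?thesis using \<delta> by (simp add: y1 End_def[of w] B_def e_def power2_eq_square algebra_simps)
qed

end

text \<open>\<open>D k z\<close> is the \<open>k\<close>-th time derivative of the pair of controls with parameter \<open>z\<close>; the final time is \<open>0\<close>.\<close>

definition pulse_family :: "nat \<Rightarrow> real \<Rightarrow> real \<Rightarrow> real \<Rightarrow> (nat \<Rightarrow> 'a::euclidean_space \<Rightarrow> real \<Rightarrow> real \<times> real) \<Rightarrow> bool" where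
  "pulse_family m \<rho> C s D \<longleftrightarrow> 0 < \<rho> \<and> 0 < C \<and> 0 < s \<and>
   (\<forall>k<m. \<forall>z\<in>cball 0 \<rho>. \<forall>t. (D k z has_vector_derivative D (Suc k) z t) (at t)) \<and>
   (\<forall>k\<le>m. continuous_on (cball 0 \<rho> \<times> UNIV) (\<lambda>(z, t). D k z t)) \<and>
   (\<forall>k\<le>m. \<forall>z\<in>cball 0 \<rho>. \<forall>t. norm (D k z t) \<le> C * norm z powr s) \<and>
   (\<forall>k\<le>m. \<forall>z\<in>cball 0 \<rho>. \<forall>t. t \<notin> {- (C * norm z powr s)<..<0} \<longrightarrow> D k z t = 0)"

lemma pulse_familyD:
  assumes "pulse_family m \<rho> C s D"
  shows "0 < \<rho>" "0 < C" "0 < s"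
    and "\<And>k z t. k < m \<Longrightarrow> norm z \<le> \<rho> \<Longrightarrow> (D k z has_vector_derivative D (Suc k) z t) (at t)"
    and "\<And>k. k \<le> m \<Longrightarrow> continuous_on (cball 0 \<rho> \<times> UNIV) (\<lambda>(z, t). D k z t)"
    and "\<And>k z t. k \<le> m \<Longrightarrow> norm z \<le> \<rho> \<Longrightarrow> norm (D k z t) \<le> C * norm z powr s"
    and "\<And>k z t. k \<le> m \<Longrightarrow> norm z \<le> \<rho> \<Longrightarrow> t \<le> - (C * norm z powr s) \<or> 0 \<le> t \<Longrightarrow> D k z t = 0"
  using assms unfolding pulse_family_def by auto

lemma pulse_familyI:
  assumes "0 < \<rho>" "0 < C" "0 < s"
    and "\<And>k z t. k < m \<Longrightarrow> norm z \<le> \<rho> \<Longrightarrow> (D k z has_vector_derivative D (Suc k) z t) (at t)"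
    and "\<And>k. k \<le> m \<Longrightarrow> continuous_on (cball 0 \<rho> \<times> UNIV) (\<lambda>(z, t). D k z t)"
    and "\<And>k z t. k \<le> m \<Longrightarrow> norm z \<le> \<rho> \<Longrightarrow> norm (D k z t) \<le> C * norm z powr s"
    and "\<And>k z t. k \<le> m \<Longrightarrow> norm z \<le> \<rho> \<Longrightarrow> t \<le> - (C * norm z powr s) \<or> 0 \<le> t \<Longrightarrow> D k z t = 0"
  shows "pulse_family m \<rho> C s D"
  using assms unfolding pulse_family_def by auto

section \<open>Operations on families of pulses\<close>

lemma pulse_family_mono:
  assumes D: "pulse_family m \<rho> C s D" and "0 < \<rho>'" "\<rho>' \<le> \<rho>" "\<rho>' \<le> 1" "C \<le> C'" "0 < s'" "s' \<le> s"
  shows "pulse_family m \<rho>' C' s' D"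
proof (rule pulse_familyI)
  have le: "C * norm z powr s \<le> C' * norm z powr s'" if "norm z \<le> \<rho>'" for z :: 'a
  proof (intro mult_mono)
    show "norm z powr s \<le> norm z powr s'"
      using powr_mono'[of s' s "norm z"] that assms by simp
  qed (use assms pulse_familyD(2)[OF D] in auto)
  show "norm (D k z t) \<le> C' * norm z powr s'" if "k \<le> m" "norm z \<le> \<rho>'" for k z t
    using pulse_familyD(6)[OF D, of k z t] le[of z] that assms by linarith
  show "D k z t = 0" if "k \<le> m" "norm z \<le> \<rho>'" "t \<le> - (C' * norm z powr s') \<or> 0 \<le> t" for k z t
    using pulse_familyD(7)[OF D, of k z t] le[of z] that assms by linarith
  show "continuous_on (cball 0 \<rho>' \<times> UNIV) (\<lambda>(z, t). D k z t)" if "k \<le> m" for k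
    by (rule continuous_on_subset[OF pulse_familyD(5)[OF D that]]) (use assms in auto)
qed (use assms pulse_familyD(1-4)[OF D] in auto)

lemma powr_small:
  assumes "0 < C" "0 < s" "0 < \<epsilon>"
  obtains \<rho> where "0 < \<rho>" "\<And>z :: 'a::real_normed_vector. norm z \<le> \<rho> \<Longrightarrow> C * norm z powr s \<le> \<epsilon>"
proof
  show "0 < (\<epsilon> / C) powr (1 / s)" using assms by simp
  fix z :: 'a assume "norm z \<le> (\<epsilon> / C) powr (1 / s)"
  hence "norm z powr s \<le> ((\<epsilon> / C) powr (1 / s)) powr s" using assms by (intro powr_mono2) auto
  also have "\<dots> = \<epsilon> / C" using assms by (simp add: powr_powr)
  finally show "C * norm z powr s \<le> \<epsilon>" using assms by (simp add: field_simps)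
qed

lemma pulse_family_zero: "0 < \<rho> \<Longrightarrow> 0 < C \<Longrightarrow> 0 < s \<Longrightarrow> pulse_family m \<rho> C s (\<lambda>_ _ _. 0)"
  by (rule pulse_familyI) (auto simp: case_prod_unfold intro!: derivative_eq_intros)

text \<open>One lemma for two uses: with \<sigma> z the length of the second pulse it concatenates,
  with D2 = 0 it waits for the time \<sigma> z.\<close>

lemma pulse_family_shift_add:
  assumes D1: "pulse_family m \<rho> C s D1" and D2: "pulse_family m \<rho> C s D2"
    and \<sigma>: "continuous_on (cball 0 \<rho>) \<sigma>" "\<And>z. norm z \<le> \<rho> \<Longrightarrow> 0 \<le> \<sigma> z" "\<And>z. norm z \<le> \<rho> \<Longrightarrow> \<sigma> z \<le> C' * norm z powr s"
    and "0 \<le> C'"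
  shows "pulse_family m \<rho> (2 * C + C') s (\<lambda>k z t. D1 k z (t + \<sigma> z) + D2 k z t)"
proof (rule pulse_familyI)
  have C: "0 < C" using pulse_familyD(2)[OF D1] .
  show "0 < 2 * C + C'" using C assms(6) by simp
  fix k and z :: 'a and t
  { assume "k < m" "norm z \<le> \<rho>"
    have "((\<lambda>t. D1 k z (t + \<sigma> z)) has_vector_derivative 1 *\<^sub>R D1 (Suc k) z (t + \<sigma> z)) (at t)"
    proof -
      have "((\<lambda>t. t + \<sigma> z) has_vector_derivative 1) (at t)" by (auto intro!: derivative_eq_intros)
      from vector_diff_chain_at[OF this pulse_familyD(4)[OF D1 \<open>k < m\<close> \<open>norm z \<le> \<rho>\<close>]]
      show ?thesis by (simp add: o_def)
    qed
    thus "((\<lambda>t. D1 k z (t + \<sigma> z) + D2 k z t) has_vector_derivative D1 (Suc k) z (t + \<sigma> z) + D2 (Suc k) z t) (at t)"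
      using pulse_familyD(4)[OF D2 \<open>k < m\<close> \<open>norm z \<le> \<rho>\<close>] by (auto intro!: has_vector_derivative_add) }
  { assume k: "k \<le> m"
    have "continuous_on (cball 0 \<rho> \<times> UNIV) (\<lambda>p. (\<lambda>(z, t). D1 k z t) (fst p, snd p + \<sigma> (fst p)))"
      by (rule continuous_on_compose2[OF pulse_familyD(5)[OF D1 k]])
         (auto intro!: continuous_intros continuous_on_compose2[OF \<sigma>(1)])
    thus "continuous_on (cball 0 \<rho> \<times> UNIV) (\<lambda>(z, t). D1 k z (t + \<sigma> z) + D2 k z t)"
      using pulse_familyD(5)[OF D2 k] by (auto simp: case_prod_unfold intro!: continuous_on_add) }
  assume k: "k \<le> m" and z: "norm z \<le> \<rho>"
  have "norm (D1 k z (t + \<sigma> z) + D2 k z t) \<le> C * norm z powr s + C * norm z powr s"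
    by (rule order_trans[OF norm_triangle_ineq add_mono[OF pulse_familyD(6)[OF D1 k z] pulse_familyD(6)[OF D2 k z]]])
  also have "\<dots> \<le> (2 * C + C') * norm z powr s" using assms(6) by (simp add: algebra_simps)
  finally show "norm (D1 k z (t + \<sigma> z) + D2 k z t) \<le> (2 * C + C') * norm z powr s" .
  assume t: "t \<le> - ((2 * C + C') * norm z powr s) \<or> 0 \<le> t"
  have "0 \<le> C * norm z powr s" "0 \<le> C' * norm z powr s" using C assms(6) by auto
  moreover have "(2 * C + C') * norm z powr s = C * norm z powr s + C * norm z powr s + C' * norm z powr s"
    by (simp add: algebra_simps)
  ultimately show "D1 k z (t + \<sigma> z) + D2 k z t = 0"
    using pulse_familyD(7)[OF D1 k z, of "t + \<sigma> z"] pulse_familyD(7)[OF D2 k z, of t] \<sigma>(2,3)[OF z] t by fastforce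
qed (use pulse_familyD(1,3)[OF D1] in auto)

text \<open>The substitution multiplies the exponent by \<kappa>. With \<kappa> < 1 it inserts
  amplitudes larger than |z|, such as z divided by a waiting time or a component that has to be
  steered back.\<close>

lemma pulse_family_reparam:
  fixes p :: "'b::euclidean_space \<Rightarrow> 'a::euclidean_space"
  assumes D: "pulse_family m \<rho> C s D" and p: "continuous_on (cball 0 \<rho>1) p"
    "\<And>z. norm z \<le> \<rho>1 \<Longrightarrow> norm (p z) \<le> C1 * norm z powr \<kappa>" and pos: "0 < \<rho>1" "0 < C1" "0 < \<kappa>"
  shows "\<exists>\<rho>' C'. pulse_family m \<rho>' C' (\<kappa> * s) (\<lambda>k z. D k (p z))"
proof -
  obtain \<rho>2 where \<rho>2: "0 < \<rho>2" "\<And>z :: 'b. norm z \<le> \<rho>2 \<Longrightarrow> C1 * norm z powr \<kappa> \<le> \<rho>"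
    using powr_small[OF pos(2,3) pulse_familyD(1)[OF D]] by blast
  define \<rho>' where "\<rho>' = min \<rho>1 \<rho>2"
  have p\<rho>: "norm (p z) \<le> \<rho>" if "norm z \<le> \<rho>'" for z
    using p(2)[of z] \<rho>2(2)[of z] that by (simp add: \<rho>'_def)
  define C' where "C' = C * C1 powr s"
  have C: "0 < C" using pulse_familyD(2)[OF D] .
  have le: "C * norm (p z) powr s \<le> C' * norm z powr (\<kappa> * s)" if "norm z \<le> \<rho>'" for z
  proof -
    have "norm (p z) powr s \<le> (C1 * norm z powr \<kappa>) powr s"
      using p(2)[of z] that pulse_familyD(3)[OF D] by (intro powr_mono2) (auto simp: \<rho>'_def)
    also have "\<dots> = C1 powr s * norm z powr (\<kappa> * s)" using pos by (simp add: powr_mult powr_powr)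
    finally show ?thesis using C by (simp add: C'_def)
  qed
  have "pulse_family m \<rho>' C' (\<kappa> * s) (\<lambda>k z. D k (p z))"
  proof (rule pulse_familyI)
    show "0 < \<rho>'" "0 < C'" "0 < \<kappa> * s" using \<rho>2 pos C pulse_familyD(3)[OF D] by (auto simp: \<rho>'_def C'_def)
    fix k and z :: 'b and t
    show "(D k (p z) has_vector_derivative D (Suc k) (p z) t) (at t)" if "k < m" "norm z \<le> \<rho>'"
      using pulse_familyD(4)[OF D that(1) p\<rho>[OF that(2)]] .
    show "continuous_on (cball 0 \<rho>' \<times> UNIV) (\<lambda>(z, t). D k (p z) t)" if "k \<le> m"
    proof -
      have "continuous_on (cball 0 \<rho>' \<times> (UNIV :: real set)) (\<lambda>q. (\<lambda>(z, t). D k z t) (p (fst q), snd q))"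
        by (rule continuous_on_compose2[OF pulse_familyD(5)[OF D that]])
           (auto intro!: continuous_intros continuous_on_compose2[OF p(1)] p\<rho> simp: \<rho>'_def)
      thus ?thesis by (simp add: case_prod_unfold)
    qed
    show "norm (D k (p z) t) \<le> C' * norm z powr (\<kappa> * s)" if "k \<le> m" "norm z \<le> \<rho>'"
      using pulse_familyD(6)[OF D that(1) p\<rho>[OF that(2)], of t] le[OF that(2)] by linarith
    show "D k (p z) t = 0" if "k \<le> m" "norm z \<le> \<rho>'" "t \<le> - (C' * norm z powr (\<kappa> * s)) \<or> 0 \<le> t"
      using pulse_familyD(7)[OF D that(1) p\<rho>[OF that(2)], of t] le[OF that(2)] that(3) by linarith
  qed
  thus ?thesis by blast
qed

text \<open>The estimate is uniform in t over the whole line because all pulses of the family vanish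
  outside one compact interval, where uniform continuity applies.\<close>

lemma pulse_family_equicontinuous:
  assumes D: "pulse_family m \<rho> C s D" and k: "k \<le> m" and "0 < \<epsilon>"
  shows "\<exists>\<delta>>0. \<forall>y z. norm y \<le> \<rho> \<longrightarrow> norm z \<le> \<rho> \<longrightarrow> dist y z < \<delta> \<longrightarrow> (\<forall>t. norm (D k y t - D k z t) < \<epsilon>)"
proof -
  define T where "T = C * \<rho> powr s"
  have "uniformly_continuous_on (cball 0 \<rho> \<times> {-T..0}) (\<lambda>(z, t). D k z t)"
    by (rule compact_uniformly_continuous[OF continuous_on_subset[OF pulse_familyD(5)[OF D k]]])
       (auto intro: compact_Times)
  then obtain \<delta> where \<delta>: "\<delta> > 0" "\<And>p q. p \<in> cball 0 \<rho> \<times> {-T..0} \<Longrightarrow> q \<in> cball 0 \<rho> \<times> {-T..0} \<Longrightarrow> dist p q < \<delta> \<Longrightarrow>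
      dist ((\<lambda>(z, t). D k z t) p) ((\<lambda>(z, t). D k z t) q) < \<epsilon>"
    using \<open>0 < \<epsilon>\<close> unfolding uniformly_continuous_on_def by metis
  have zero: "D k z t = 0" if "norm z \<le> \<rho>" "t \<notin> {-T..0}" for z t
  proof (rule pulse_familyD(7)[OF D k that(1)])
    have "C * norm z powr s \<le> T" unfolding T_def using pulse_familyD(1-3)[OF D] that by (intro mult_left_mono powr_mono2) auto
    thus "t \<le> - (C * norm z powr s) \<or> 0 \<le> t" using that by auto
  qed
  have "norm (D k y t - D k z t) < \<epsilon>" if "norm y \<le> \<rho>" "norm z \<le> \<rho>" "dist y z < \<delta>" for y z t
  proof (cases "t \<in> {-T..0}")
    case True
    have "dist (y, t) (z, t) < \<delta>" using that by (simp add: dist_Pair_Pair)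
    from \<delta>(2)[OF _ _ this] show ?thesis using that True by (simp add: dist_norm)
  qed (use zero that \<open>0 < \<epsilon>\<close> in simp)
  thus ?thesis using \<delta>(1) by blast
qed

section \<open>Vectors reached by families of pulses\<close>

text \<open>This is O(|z|^a) as z tends to 0. The filter \<open>nhds\<close> includes z = 0, where
  the bound forces f 0 = 0 because \<open>0 powr a = 0\<close>.\<close>

definition bigo0 :: "real \<Rightarrow> ('a::real_normed_vector \<Rightarrow> 'b::real_normed_vector) \<Rightarrow> bool" where
  "bigo0 a f \<longleftrightarrow> (\<exists>M\<ge>0. \<forall>\<^sub>F z in nhds 0. norm (f z) \<le> M * norm z powr a)"

lemma bigo0I:
  assumes "\<forall>\<^sub>F z in nhds 0. norm (f z) \<le> M * norm z powr a"
  shows "bigo0 a f"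
  unfolding bigo0_def
proof (intro exI conjI)
  show "0 \<le> max M 0" by simp
  show "\<forall>\<^sub>F z in nhds 0. norm (f z) \<le> max M 0 * norm z powr a"
    using assms by eventually_elim (erule order_trans, intro mult_right_mono, auto)
qed

lemma bigo0E:
  assumes "bigo0 a f"
  obtains M where "0 \<le> M" "\<forall>\<^sub>F z in nhds 0. norm (f z) \<le> M * norm z powr a"
  using assms unfolding bigo0_def by blast

lemma eventually_norm_le: "0 < \<rho> \<Longrightarrow> \<forall>\<^sub>F z :: 'a::real_normed_vector in nhds 0. norm z \<le> \<rho>"
  unfolding eventually_nhds_metric by (intro exI[of _ \<rho>]) (auto simp: dist_norm)

lemma bigo0_mono:
  assumes "bigo0 a f" "b \<le> a"
  shows "bigo0 b f"
proof -
  obtain M where M: "0 \<le> M" "\<forall>\<^sub>F z in nhds 0. norm (f z) \<le> M * norm z powr a" using assms(1) by (rule bigo0E)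
  show ?thesis
  proof (rule bigo0I)
    show "\<forall>\<^sub>F z in nhds 0. norm (f z) \<le> M * norm z powr b"
      using M(2) eventually_norm_le[OF zero_less_one]
    proof eventually_elim
      case (elim z)
      have "norm z powr a \<le> norm z powr b" using elim(2) assms(2) by (intro powr_mono') auto
      hence "M * norm z powr a \<le> M * norm z powr b" using M(1) by (rule mult_left_mono)
      with elim(1) show ?case by (rule order_trans)
    qed
  qed
qed

lemma bigo0_add:
  assumes "bigo0 a f" "bigo0 a g" shows "bigo0 a (\<lambda>z. f z + g z)"
proof -
  obtain M where M: "\<forall>\<^sub>F z in nhds 0. norm (f z) \<le> M * norm z powr a" using assms(1) by (rule bigo0E)
  obtain N where N: "\<forall>\<^sub>F z in nhds 0. norm (g z) \<le> N * norm z powr a" using assms(2) by (rule bigo0E)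
  show ?thesis
  proof (rule bigo0I)
    show "\<forall>\<^sub>F z in nhds 0. norm (f z + g z) \<le> (M + N) * norm z powr a"
      using M N by eventually_elim (unfold distrib_right, rule order_trans[OF norm_triangle_ineq add_mono])
  qed
qed

lemma bigo0_minus: "bigo0 a f \<Longrightarrow> bigo0 a (\<lambda>z. - f z)"
  unfolding bigo0_def by simp

lemma bigo0_diff: "bigo0 a f \<Longrightarrow> bigo0 a g \<Longrightarrow> bigo0 a (\<lambda>z. f z - g z)"
  using bigo0_add[OF _ bigo0_minus] by fastforce

lemma bigo0_bound:
  assumes "bigo0 a g" "\<forall>\<^sub>F z in nhds 0. norm (f z) \<le> c * norm (g z)" "0 \<le> c"
  shows "bigo0 a f"
proof -
  obtain M where M: "\<forall>\<^sub>F z in nhds 0. norm (g z) \<le> M * norm z powr a" using assms(1) by (rule bigo0E)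
  show ?thesis
  proof (rule bigo0I)
    show "\<forall>\<^sub>F z in nhds 0. norm (f z) \<le> (c * M) * norm z powr a"
      using M assms(2)
    proof eventually_elim
      case (elim z)
      have "c * norm (g z) \<le> c * (M * norm z powr a)" by (rule mult_left_mono[OF elim(1) assms(3)])
      with elim(2) show ?case unfolding mult.assoc by (rule order_trans)
    qed
  qed
qed

lemma bigo0_mult:
  assumes "bigo0 a f" "bigo0 b g"
  shows "bigo0 (a + b) (\<lambda>z. norm (f z) * norm (g z))"
proof -
  obtain M where M: "0 \<le> M" "\<forall>\<^sub>F z in nhds 0. norm (f z) \<le> M * norm z powr a" using assms(1) by (rule bigo0E)
  obtain N where N: "0 \<le> N" "\<forall>\<^sub>F z in nhds 0. norm (g z) \<le> N * norm z powr b" using assms(2) by (rule bigo0E)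
  show ?thesis
  proof (rule bigo0I)
    show "\<forall>\<^sub>F z in nhds 0. norm (norm (f z) * norm (g z)) \<le> (M * N) * norm z powr (a + b)"
      using M(2) N(2)
    proof eventually_elim
      case (elim z)
      have "norm (f z) * norm (g z) \<le> (M * norm z powr a) * (N * norm z powr b)"
        by (intro mult_mono elim) (use M N in auto)
      thus ?case by (simp add: powr_add mult_ac)
    qed
  qed
qed

lemma bigo0_powr: "bigo0 a (\<lambda>z. norm z powr a)"
  by (rule bigo0I[of _ 1]) simp

lemma bigo0_reparam:
  fixes p :: "'b::real_normed_vector \<Rightarrow> 'a::real_normed_vector"
  assumes f: "bigo0 a f" and p: "bigo0 \<kappa> p" and pos: "0 < \<kappa>" "0 \<le> a"
  shows "bigo0 (\<kappa> * a) (\<lambda>z. f (p z))"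
proof -
  obtain M where M: "0 \<le> M" "\<forall>\<^sub>F z in nhds 0. norm (f z) \<le> M * norm z powr a" using f by (rule bigo0E)
  obtain N where N: "0 \<le> N" "\<forall>\<^sub>F z in nhds 0. norm (p z) \<le> N * norm z powr \<kappa>" using p by (rule bigo0E)
  obtain \<epsilon> where \<epsilon>: "\<epsilon> > 0" "\<And>z. norm z < \<epsilon> \<Longrightarrow> norm (f z) \<le> M * norm z powr a"
    using M(2) unfolding eventually_nhds_metric by (auto simp: dist_norm)
  obtain \<rho> where \<rho>: "0 < \<rho>" "\<And>z :: 'b. norm z \<le> \<rho> \<Longrightarrow> (N + 1) * norm z powr \<kappa> \<le> \<epsilon> / 2"
    using powr_small[of "N + 1" \<kappa> "\<epsilon> / 2"] N pos \<epsilon> by auto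
  show ?thesis
  proof (rule bigo0I)
    show "\<forall>\<^sub>F z in nhds 0. norm (f (p z)) \<le> (M * N powr a) * norm z powr (\<kappa> * a)"
      using N(2) eventually_norm_le[OF \<rho>(1)]
    proof eventually_elim
      case (elim z)
      have "N * norm z powr \<kappa> \<le> (N + 1) * norm z powr \<kappa>" by (intro mult_right_mono) auto
      hence "norm (p z) < \<epsilon>" using \<rho>(2)[OF elim(2)] elim(1) \<epsilon>(1) by linarith
      hence "norm (f (p z)) \<le> M * norm (p z) powr a" by (rule \<epsilon>(2))
      also have "\<dots> \<le> M * (N * norm z powr \<kappa>) powr a"
        using elim(1) M pos by (intro mult_left_mono powr_mono2) auto
      also have "\<dots> = (M * N powr a) * norm z powr (\<kappa> * a)"
        using N by (simp add: powr_mult powr_powr)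
      finally show ?case .
    qed
  qed
qed

lemma bigo0_linear:
  assumes "bounded_linear h" "bigo0 a f" shows "bigo0 a (\<lambda>z. h (f z))"
proof -
  obtain c where c: "0 < c" "\<And>x. norm (h x) \<le> norm x * c" using bounded_linear.pos_bounded[OF assms(1)] by blast
  show ?thesis by (rule bigo0_bound[OF assms(2), of _ c]) (use c in \<open>auto simp: mult.commute\<close>)
qed

lemma continuous_on_norm_powr: "0 < s \<Longrightarrow> continuous_on S (\<lambda>z :: 'a::real_normed_vector. norm z powr s)"
  by (intro continuous_on_powr' continuous_intros) auto

text \<open>The signed power is a difference of powers of the positive and the negative part, each
  of them continuous at 0.\<close>

lemma continuous_on_sgn_powr: "0 < s \<Longrightarrow> continuous_on S (\<lambda>z :: real. sgn z * \<bar>z\<bar> powr s)"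
proof -
  assume s: "0 < s"
  have "sgn z * \<bar>z\<bar> powr s = (max z 0) powr s - (max (- z) 0) powr s" for z :: real
    by (auto simp: sgn_if max_def)
  moreover have "continuous_on S (\<lambda>z :: real. (max z 0) powr s - (max (- z) 0) powr s)"
    using s by (intro continuous_intros continuous_on_powr') auto
  ultimately show ?thesis by simp
qed

section \<open>Linear operations on reachable vectors\<close>

context control_system
begin

lemma pulse_family_continuous:
  assumes "pulse_family m \<rho> C s D" "norm z \<le> \<rho>" "k \<le> m" shows "continuous_on UNIV (D k z)"
proof -
  have "continuous_on UNIV (\<lambda>t. (\<lambda>(z, t). D k z t) (z, t))"
    by (rule continuous_on_compose2[OF pulse_familyD(5)[OF assms(1,3)]]) (use assms in \<open>auto intro!: continuous_intros\<close>)
  thus ?thesis by simp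
qed

lemma pulse_family_admissible:
  assumes "pulse_family m \<rho> C s D" "norm z \<le> \<rho>" "C * norm z powr s \<le> \<eta>0"
  shows "admissible (D 0 z)"
  unfolding admissible_def using pulse_family_continuous[OF assms(1,2), of 0] pulse_familyD(6)[OF assms(1) _ assms(2), of 0] assms(3)
  by (auto intro: order_trans)

text \<open>The bound \<theta> / 2 lets two pulses, or a pulse and a waiting time, follow each other
  within [-\<theta>, 0].\<close>

lemma pulse_family_eventually:
  fixes D :: "nat \<Rightarrow> 'a::euclidean_space \<Rightarrow> real \<Rightarrow> real \<times> real"
  assumes "pulse_family m \<rho> C s D"
  shows "\<forall>\<^sub>F z in nhds 0. norm z \<le> \<rho> \<and> admissible (D 0 z) \<and> C * norm z powr s \<le> \<theta> / 2"
proof -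
  obtain \<rho>' where \<rho>': "0 < \<rho>'" "\<And>z :: 'a. norm z \<le> \<rho>' \<Longrightarrow> C * norm z powr s \<le> min \<eta>0 (\<theta> / 2)"
    using powr_small[OF pulse_familyD(2,3)[OF assms], of "min \<eta>0 (\<theta> / 2)"] \<eta>0_pos \<theta>_pos by auto
  show ?thesis
    using eventually_norm_le[OF pulse_familyD(1)[OF assms]] eventually_norm_le[OF \<rho>'(1)]
    by eventually_elim (use \<rho>'(2) pulse_family_admissible[OF assms] in fastforce)
qed

lemma pulse_family_concat:
  fixes D1 D2 :: "nat \<Rightarrow> 'a::euclidean_space \<Rightarrow> real \<Rightarrow> real \<times> real"
  assumes D1: "pulse_family m \<rho>1 C1 s1 D1" and D2: "pulse_family m \<rho>2 C2 s2 D2"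
  shows "\<exists>\<rho> C D. pulse_family m \<rho> C (min s1 s2) D \<and>
    (\<forall>\<^sub>F z in nhds 0. norm (End (D 0 z) - End (D1 0 z) - End (D2 0 z)) \<le> (6 * K * C2) * (norm z powr s2 * norm (End (D1 0 z))))"
proof -
  define \<rho> where "\<rho> = min 1 (min \<rho>1 \<rho>2)"
  define C where "C = max C1 C2"
  define s where "s = min s1 s2"
  note pos = pulse_familyD(1-3)[OF D1] pulse_familyD(1-3)[OF D2]
  have D1': "pulse_family m \<rho> C s D1" by (rule pulse_family_mono[OF D1]) (use pos in \<open>auto simp: \<rho>_def C_def s_def\<close>)
  have D2': "pulse_family m \<rho> C s D2" by (rule pulse_family_mono[OF D2]) (use pos in \<open>auto simp: \<rho>_def C_def s_def\<close>)
  \<comment> \<open>The first pulse is moved back by the whole length allotted to the second,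
    whatever the support of the latter really is.\<close>
  define \<sigma> where "\<sigma> z = C2 * norm z powr s2" for z :: 'a
  define D where "D = (\<lambda>k z t. D1 k z (t + \<sigma> z) + D2 k z t)"
  have D: "pulse_family m \<rho> (2 * C + C2) s D"
    unfolding D_def
  proof (rule pulse_family_shift_add[OF D1' D2'])
    show "continuous_on (cball 0 \<rho>) \<sigma>" unfolding \<sigma>_def using pos by (intro continuous_intros continuous_on_norm_powr)
    show "\<sigma> z \<le> C2 * norm z powr s" if "norm z \<le> \<rho>" for z
      unfolding \<sigma>_def using pos that by (intro mult_left_mono powr_mono') (auto simp: s_def \<rho>_def)
  qed (use pos in \<open>auto simp: \<sigma>_def\<close>)
  have "\<forall>\<^sub>F z in nhds 0. norm (End (D 0 z) - End (D1 0 z) - End (D2 0 z)) \<le> (6 * K * C2) * (norm z powr s2 * norm (End (D1 0 z)))"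
    using pulse_family_eventually[OF D1] pulse_family_eventually[OF D2] pulse_family_eventually[OF D]
  proof eventually_elim
    case (elim z)
    have "norm (End (D 0 z) - End (D1 0 z) - End (D2 0 z)) \<le> 6 * K * \<sigma> z * norm (End (D1 0 z))"
    proof (rule End_concat[where ?\<delta>1.0 = "C1 * norm z powr s1"])
      show "D1 0 z t = 0" if "t \<le> - (C1 * norm z powr s1) \<or> 0 \<le> t" for t
        using pulse_familyD(7)[OF D1 _ _ that] elim by simp
      show "D2 0 z t = 0" if "t \<le> - \<sigma> z" for t
        using pulse_familyD(7)[OF D2, of 0 z t] that elim by (simp add: \<sigma>_def)
      show "C1 * norm z powr s1 + \<sigma> z \<le> \<theta>" using elim by (simp add: \<sigma>_def)
    qed (use elim pos in \<open>auto simp: D_def \<sigma>_def\<close>)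
    thus ?case by (simp add: \<sigma>_def mult_ac)
  qed
  with D show ?thesis unfolding s_def by blast
qed

lemma pulse_family_wait:
  fixes D1 :: "nat \<Rightarrow> 'a::euclidean_space \<Rightarrow> real \<Rightarrow> real \<times> real"
  assumes D1: "pulse_family m \<rho>1 C1 s1 D1" and "0 < \<kappa>"
  shows "\<exists>\<rho> C D. pulse_family m \<rho> C (min s1 \<kappa>) D \<and>
    (\<forall>\<^sub>F z in nhds 0. norm (End (D 0 z) - End (D1 0 z) - (norm z powr \<kappa>) *\<^sub>R A (End (D1 0 z))) \<le>
      2 * K\<^sup>2 * (norm z powr \<kappa>)\<^sup>2 * norm (End (D1 0 z)) + 4 * K * norm z powr \<kappa> * (norm (End (D1 0 z)))\<^sup>2)"
proof -
  define \<rho> where "\<rho> = min 1 \<rho>1"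
  define s where "s = min s1 \<kappa>"
  note pos = pulse_familyD(1-3)[OF D1]
  have D1': "pulse_family m \<rho> C1 s D1" by (rule pulse_family_mono[OF D1]) (use pos assms(2) in \<open>auto simp: \<rho>_def s_def\<close>)
  have D2': "pulse_family m \<rho> C1 s (\<lambda>_ _ _. 0)" by (rule pulse_family_zero) (use pos assms(2) in \<open>auto simp: \<rho>_def s_def\<close>)
  define \<sigma> where "\<sigma> z = norm z powr \<kappa>" for z :: 'a
  define D where "D = (\<lambda>k z t. D1 k z (t + \<sigma> z) + 0)"
  have D: "pulse_family m \<rho> (2 * C1 + 1) s D"
    unfolding D_def
  proof (rule pulse_family_shift_add[OF D1' D2'])
    show "continuous_on (cball 0 \<rho>) \<sigma>" unfolding \<sigma>_def using assms(2) by (intro continuous_on_norm_powr)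
    show "\<sigma> z \<le> 1 * norm z powr s" if "norm z \<le> \<rho>" for z
      unfolding \<sigma>_def using that powr_mono'[of s \<kappa> "norm z"] by (auto simp: s_def \<rho>_def)
  qed (auto simp: \<sigma>_def)
  obtain \<rho>' where \<rho>': "0 < \<rho>'" "\<And>z :: 'a. norm z \<le> \<rho>' \<Longrightarrow> 1 * norm z powr \<kappa> \<le> \<theta> / 2"
    using powr_small[of 1 \<kappa> "\<theta> / 2"] \<theta>_pos assms(2) by auto
  have "\<forall>\<^sub>F z in nhds 0. norm (End (D 0 z) - End (D1 0 z) - (norm z powr \<kappa>) *\<^sub>R A (End (D1 0 z))) \<le>
      2 * K\<^sup>2 * (norm z powr \<kappa>)\<^sup>2 * norm (End (D1 0 z)) + 4 * K * norm z powr \<kappa> * (norm (End (D1 0 z)))\<^sup>2"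
    using pulse_family_eventually[OF D1] pulse_family_eventually[OF D] eventually_norm_le[OF \<rho>'(1)]
  proof eventually_elim
    case (elim z)
    show ?case
    proof (rule End_wait[where ?\<delta>1.0 = "C1 * norm z powr s1"])
      show "D1 0 z t = 0" if "t \<le> - (C1 * norm z powr s1) \<or> 0 \<le> t" for t
        using pulse_familyD(7)[OF D1 _ _ that] elim by simp
      show "C1 * norm z powr s1 + norm z powr \<kappa> \<le> \<theta>" using elim(1) \<rho>'(2)[OF elim(3)] by simp
    qed (use elim pos in \<open>auto simp: D_def \<sigma>_def\<close>)
  qed
  with D show ?thesis unfolding s_def by blast
qed

lemma continuous_on_End_pulse_family:
  fixes D :: "nat \<Rightarrow> 'a::euclidean_space \<Rightarrow> real \<Rightarrow> real \<times> real"
  assumes D: "pulse_family m \<rho> C s D" and "C * \<rho> powr s \<le> \<eta>0"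
  shows "continuous_on (cball 0 \<rho>) (\<lambda>z. End (D 0 z))"
proof -
  have adm: "admissible (D 0 z)" if "norm z \<le> \<rho>" for z :: 'a
  proof (rule pulse_family_admissible[OF D that])
    have "C * norm z powr s \<le> C * \<rho> powr s" using that pulse_familyD(1-3)[OF D] by (intro mult_left_mono powr_mono2) auto
    with assms(2) show "C * norm z powr s \<le> \<eta>0" by simp
  qed
  show ?thesis unfolding continuous_on_iff
  proof (intro ballI allI impI)
    fix z :: 'a and \<epsilon> assume z: "z \<in> cball 0 \<rho>" and "0 < (\<epsilon> :: real)"
    obtain \<delta> where \<delta>: "\<delta> > 0" "\<And>y z t. norm y \<le> \<rho> \<Longrightarrow> norm z \<le> \<rho> \<Longrightarrow> dist y z < \<delta> \<Longrightarrow> norm (D 0 y t - D 0 z t) < \<epsilon> / 2"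
      using pulse_family_equicontinuous[OF D, of 0 "\<epsilon> / 2"] \<open>0 < \<epsilon>\<close> by auto
    have "dist (End (D 0 y)) (End (D 0 z)) < \<epsilon>" if y: "y \<in> cball 0 \<rho>" "dist y z < \<delta>" for y
    proof -
      have "norm (End (D 0 y) - End (D 0 z)) \<le> \<epsilon> / 2"
        by (rule End_diff[OF adm adm]) (use y z \<delta>(2)[of y z] in \<open>auto simp: less_imp_le\<close>)
      thus ?thesis using \<open>0 < \<epsilon>\<close> by (simp add: dist_norm)
    qed
    thus "\<exists>d>0. \<forall>x'\<in>cball 0 \<rho>. dist x' z < d \<longrightarrow> dist (End (D 0 x')) (End (D 0 z)) < \<epsilon>" using \<delta>(1) by blast
  qed
qed

text \<open>Stated for maps of a parameter in an arbitrary Euclidean space: a real parameter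
  describes a single vector, while steering corrections and the fixed point argument use a parameter
  in the state space.\<close>

definition reachable_map :: "nat \<Rightarrow> ('a::euclidean_space \<Rightarrow> 'v) \<Rightarrow> bool" where
  "reachable_map m L \<longleftrightarrow> (\<exists>\<rho> C s D. pulse_family m \<rho> C s D \<and> bigo0 (1 + s) (\<lambda>z. End (D 0 z) - L z))"

lemma reachable_mapE:
  assumes "reachable_map m L"
  obtains \<rho> C s D where "pulse_family m \<rho> C s D" "bigo0 (1 + s) (\<lambda>z. End (D 0 z) - L z)" "0 < s" "s \<le> 1"
proof -
  obtain \<rho> C s D where D: "pulse_family m \<rho> C s D" "bigo0 (1 + s) (\<lambda>z. End (D 0 z) - L z)"
    using assms unfolding reachable_map_def by blast
  have s: "0 < s" using pulse_familyD(3)[OF D(1)] .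
  have "pulse_family m (min 1 \<rho>) C (min 1 s) D" by (rule pulse_family_mono[OF D(1)]) (use pulse_familyD(1-3)[OF D(1)] in auto)
  moreover have "bigo0 (1 + min 1 s) (\<lambda>z. End (D 0 z) - L z)" by (rule bigo0_mono[OF D(2)]) simp
  ultimately show ?thesis using that s by auto
qed

lemma bigo0_one: "(\<And>z. norm (L z) \<le> c * norm z) \<Longrightarrow> bigo0 1 L"
  by (rule bigo0I[of _ c]) auto

text \<open>The interaction of the two pulses is O(|z|^s2) times the first end point, which is
  O(|z|); hence a growth condition on L1 alone.\<close>

lemma reachable_map_add:
  assumes 1: "reachable_map m L1" and 2: "reachable_map m L2" and L1: "bigo0 1 L1"
  shows "reachable_map m (\<lambda>z. L1 z + L2 z)"
proof -
  obtain \<rho>1 C1 s1 D1 where D1: "pulse_family m \<rho>1 C1 s1 D1" "bigo0 (1 + s1) (\<lambda>z. End (D1 0 z) - L1 z)" "0 < s1"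
    using 1 by (rule reachable_mapE)
  obtain \<rho>2 C2 s2 D2 where D2: "pulse_family m \<rho>2 C2 s2 D2" "bigo0 (1 + s2) (\<lambda>z. End (D2 0 z) - L2 z)" "0 < s2"
    using 2 by (rule reachable_mapE)
  obtain \<rho> C D where D: "pulse_family m \<rho> C (min s1 s2) D"
    "\<forall>\<^sub>F z in nhds 0. norm (End (D 0 z) - End (D1 0 z) - End (D2 0 z)) \<le> (6 * K * C2) * (norm z powr s2 * norm (End (D1 0 z)))"
    using pulse_family_concat[OF D1(1) D2(1)] by blast
  define s where "s = min s1 s2"
  have "bigo0 1 (\<lambda>z. (End (D1 0 z) - L1 z) + L1 z)"
    by (rule bigo0_add[OF bigo0_mono[OF D1(2)] L1]) (use D1(3) in simp)
  hence e1: "bigo0 1 (\<lambda>z. End (D1 0 z))" by simp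
  have "bigo0 (s2 + 1) (\<lambda>z. norm (norm z powr s2) * norm (End (D1 0 z)))" by (rule bigo0_mult[OF bigo0_powr e1])
  hence "bigo0 (s2 + 1) (\<lambda>z. End (D 0 z) - End (D1 0 z) - End (D2 0 z))"
    by (rule bigo0_bound[where c = "6 * K * C2"]) (use D(2) K_ge1 pulse_familyD(2)[OF D2(1)] in auto)
  hence "bigo0 (1 + s) (\<lambda>z. (End (D 0 z) - End (D1 0 z) - End (D2 0 z)) + ((End (D1 0 z) - L1 z) + (End (D2 0 z) - L2 z)))"
    using D1(2) D2(2) by (intro bigo0_add) (auto elim!: bigo0_mono simp: s_def)
  hence "bigo0 (1 + s) (\<lambda>z. End (D 0 z) - (L1 z + L2 z))" by (simp add: algebra_simps)
  with D(1) show ?thesis unfolding reachable_map_def s_def by blast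
qed

lemma reachable_map_reparam:
  fixes p :: "'b::euclidean_space \<Rightarrow> 'a::euclidean_space"
  assumes "reachable_map m L" and p: "bounded_linear p"
  shows "reachable_map m (\<lambda>z. L (p z))"
proof -
  obtain \<rho> C s D where D: "pulse_family m \<rho> C s D" "bigo0 (1 + s) (\<lambda>z. End (D 0 z) - L z)" "0 < s"
    using assms(1) by (rule reachable_mapE)
  obtain c where c: "0 < c" "\<And>x. norm (p x) \<le> norm x * c" using bounded_linear.pos_bounded[OF p] by blast
  have 1: "\<exists>\<rho>' C'. pulse_family m \<rho>' C' (1 * s) (\<lambda>k z. D k (p z))"
    by (rule pulse_family_reparam[OF D(1), of 1 _ c]) (use c p in \<open>auto intro: linear_continuous_on simp: mult.commute\<close>)
  have "bigo0 1 p" by (rule bigo0_one[of _ c]) (use c in \<open>auto simp: mult.commute\<close>)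
  from bigo0_reparam[OF D(2) this] D(3) have "bigo0 (1 + s) (\<lambda>z. End (D 0 (p z)) - L (p z))" by simp
  with 1 show ?thesis unfolding reachable_map_def by auto
qed

definition reachable_set :: "nat \<Rightarrow> 'v set" where
  "reachable_set m = {\<xi>. reachable_map m (\<lambda>z :: real. z *\<^sub>R \<xi>)}"

lemma bigo0_scaleR_id: "bigo0 1 (\<lambda>z :: real. z *\<^sub>R \<xi>)"
  by (rule bigo0_one[of _ "norm \<xi>"]) simp

lemma reachable_map_zero: "reachable_map m (\<lambda>z. 0)"
  unfolding reachable_map_def
  by (intro exI[of _ 1] exI[of _ "\<lambda>_ _ _. 0"] conjI pulse_family_zero bigo0I[of _ 0]) (auto simp: End_zero)

lemma subspace_reachable_set: "subspace (reachable_set m)"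
proof (rule subspaceI)
  show "0 \<in> reachable_set m" unfolding reachable_set_def using reachable_map_zero by simp
  fix x y assume "x \<in> reachable_set m" "y \<in> reachable_set m"
  thus "x + y \<in> reachable_set m"
    using reachable_map_add[OF _ _ bigo0_scaleR_id] by (fastforce simp: reachable_set_def scaleR_add_right)
next
  fix c x assume "x \<in> reachable_set m"
  thus "c *\<^sub>R x \<in> reachable_set m"
    using reachable_map_reparam[OF _ bounded_linear_mult_right[of c]] by (fastforce simp: reachable_set_def mult.commute)
qed

text \<open>One family for all directions at once is obtained by steering the coordinates of z one
  after the other. This turns reachability of single vectors into the uniform statement used with
  the projection and with Brouwer's theorem.\<close>

lemma reachable_map_linear:
  fixes L :: "'a::euclidean_space \<Rightarrow> 'v"
  assumes L: "linear L" and range: "\<And>z. L z \<in> reachable_set m"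
  shows "reachable_map m L"
proof -
  have "reachable_map m (\<lambda>z. \<Sum>b\<in>B. (z \<bullet> b) *\<^sub>R L b)" if "finite B" for B
    using that
  proof (induction B rule: finite_induct)
    case empty thus ?case using reachable_map_zero by simp
  next
    case (insert b B)
    have "reachable_map m (\<lambda>z :: real. z *\<^sub>R L b)" using range by (simp add: reachable_set_def)
    from reachable_map_reparam[OF this bounded_linear_inner_left[of b]]
    have 1: "reachable_map m (\<lambda>z. (z \<bullet> b) *\<^sub>R L b)" by simp
    have "bigo0 1 (\<lambda>z. (z \<bullet> b) *\<^sub>R L b)"
    proof (rule bigo0_one)
      fix z
      have "\<bar>z \<bullet> b\<bar> * norm (L b) \<le> (norm z * norm b) * norm (L b)"
        by (intro mult_right_mono Cauchy_Schwarz_ineq2) simp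
      thus "norm ((z \<bullet> b) *\<^sub>R L b) \<le> (norm b * norm (L b)) * norm z" by (simp add: mult_ac)
    qed
    from reachable_map_add[OF 1 insert.IH this] insert.hyps show ?case by simp
  qed
  from this[OF finite_Basis] have "reachable_map m (\<lambda>z. \<Sum>b\<in>Basis. (z \<bullet> b) *\<^sub>R L b)" .
  moreover have "(\<Sum>b\<in>Basis. (z \<bullet> b) *\<^sub>R L b) = L z" for z
  proof -
    have "L z = L (\<Sum>b\<in>Basis. (z \<bullet> b) *\<^sub>R b)" by (simp add: euclidean_representation)
    thus ?thesis by (simp add: linear_sum[OF L] linear_scale[OF L])
  qed
  ultimately show ?thesis by simp
qed

lemma bounded_linear_A: "bounded_linear A"
  using linA by (simp add: linear_conv_bounded_linear)

text \<open>With |p z| = |z|^\<kappa>, \<kappa> = 1 - \<sigma>, and waiting time |z|^\<sigma>,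
  amplitude times waiting time is |z|. The errors are |z|^(\<kappa>(1+s)) from each pulse and from
  the concatenation, and |z|^(2\<sigma>+\<kappa>) and |z|^(\<sigma>+2\<kappa>) from waiting; all
  have to be O(|z|^(1+\<sigma>)).\<close>

lemma reachable_set_A:
  assumes "\<xi> \<in> reachable_set m"
  shows "A \<xi> \<in> reachable_set m"
proof -
  have "reachable_map m (\<lambda>z :: real. z *\<^sub>R \<xi>)" using assms by (simp add: reachable_set_def)
  then obtain \<rho> C s D where D: "pulse_family m \<rho> C s (D :: nat \<Rightarrow> real \<Rightarrow> real \<Rightarrow> real \<times> real)"
    "bigo0 (1 + s) (\<lambda>z. End (D 0 z) - z *\<^sub>R \<xi>)" and s: "0 < s" "s \<le> 1"
    by (rule reachable_mapE)
  \<comment> \<open>This is small enough for \<kappa>(1 + s) \<ge> 1 + \<sigma>; the other exponents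
    are at least 1 + \<sigma> since \<sigma> \<le> 1/4.\<close>
  define \<sigma> where "\<sigma> = s / 4"
  define \<kappa> where "\<kappa> = 1 - \<sigma>"
  have \<sigma>: "0 < \<sigma>" "\<sigma> \<le> 1 / 4" and \<kappa>: "0 < \<kappa>" using s by (auto simp: \<sigma>_def \<kappa>_def)
  have \<kappa>s: "1 + \<sigma> \<le> \<kappa> * (1 + s)" "\<sigma> \<le> \<kappa> * s"
  proof -
    have ss: "s * s \<le> s * 1" using s by (intro mult_left_mono) auto
    have "\<kappa> * (1 + s) = 1 + s - s / 4 - (s * s) / 4" "\<kappa> * s = s - (s * s) / 4"
      by (simp_all add: \<kappa>_def \<sigma>_def field_simps)
    thus "1 + \<sigma> \<le> \<kappa> * (1 + s)" "\<sigma> \<le> \<kappa> * s" using s ss unfolding \<sigma>_def by linarith+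
  qed
  define p where "p z = sgn z * \<bar>z\<bar> powr \<kappa>" for z :: real
  have p_norm: "norm (p z) = norm z powr \<kappa>" for z using \<kappa> by (auto simp: p_def abs_mult sgn_if)
  have p_cont: "continuous_on S p" for S unfolding p_def by (rule continuous_on_sgn_powr[OF \<kappa>])
  have BOp: "bigo0 \<kappa> p" "bigo0 \<kappa> (\<lambda>z. - p z)" by (auto intro!: bigo0I[of _ 1] simp: p_norm simp del: real_norm_def)
  obtain \<rho>2 C2 where D2: "pulse_family m \<rho>2 C2 (\<kappa> * s) (\<lambda>k z. D k (p z))"
    using pulse_family_reparam[OF D(1) p_cont[of "cball 0 1"], of 1 \<kappa>] \<kappa> p_norm by auto
  obtain \<rho>1 C1 where D1: "pulse_family m \<rho>1 C1 (\<kappa> * s) (\<lambda>k z. D k (- p z))"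
    using pulse_family_reparam[OF D(1) continuous_on_minus[OF p_cont[of "cball 0 1"]], of 1 \<kappa>] \<kappa> p_norm by auto
  obtain \<rho>3 C3 D3 where D3: "pulse_family m \<rho>3 C3 (min (\<kappa> * s) \<sigma>) D3"
    "\<forall>\<^sub>F z in nhds 0. norm (End (D3 0 z) - End (D 0 (- p z)) - (norm z powr \<sigma>) *\<^sub>R A (End (D 0 (- p z)))) \<le>
      2 * K\<^sup>2 * (norm z powr \<sigma>)\<^sup>2 * norm (End (D 0 (- p z))) + 4 * K * norm z powr \<sigma> * (norm (End (D 0 (- p z))))\<^sup>2"
    using pulse_family_wait[OF D1 \<sigma>(1)] by auto
  obtain \<rho>4 C4 D4 where D4: "pulse_family m \<rho>4 C4 (min (min (\<kappa> * s) \<sigma>) (\<kappa> * s)) D4"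
    "\<forall>\<^sub>F z in nhds 0. norm (End (D4 0 z) - End (D3 0 z) - End (D 0 (p z))) \<le>
       (6 * K * C2) * (norm z powr (\<kappa> * s) * norm (End (D3 0 z)))"
    using pulse_family_concat[OF D3(1) D2] by auto
  have mn: "min (min (\<kappa> * s) \<sigma>) (\<kappa> * s) = \<sigma>" using \<kappa>s by simp
  have b1: "bigo0 (1 + \<sigma>) (\<lambda>z. End (D 0 (- p z)) - (- p z) *\<^sub>R \<xi>)"
    by (rule bigo0_mono[OF bigo0_reparam[OF D(2) BOp(2) \<kappa>] \<kappa>s(1)]) (use s in simp)
  have b2: "bigo0 (1 + \<sigma>) (\<lambda>z. End (D 0 (p z)) - p z *\<^sub>R \<xi>)"
    by (rule bigo0_mono[OF bigo0_reparam[OF D(2) BOp(1) \<kappa>] \<kappa>s(1)]) (use s in simp)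
  have pxi: "bigo0 \<kappa> (\<lambda>z. (- p z) *\<^sub>R \<xi>)"
    by (rule bigo0_linear[OF bounded_linear_scaleR_left BOp(2)])
  have "bigo0 \<kappa> (\<lambda>z. (End (D 0 (- p z)) - (- p z) *\<^sub>R \<xi>) + (- p z) *\<^sub>R \<xi>)"
    by (rule bigo0_add[OF bigo0_mono[OF b1] pxi]) (use \<sigma> in \<open>simp add: \<kappa>_def\<close>)
  hence e1: "bigo0 \<kappa> (\<lambda>z. End (D 0 (- p z)))" by simp
  have w: "bigo0 (1 + \<sigma>) (\<lambda>z. End (D3 0 z) - End (D 0 (- p z)) - (norm z powr \<sigma>) *\<^sub>R A (End (D 0 (- p z))))"
  proof -
    have q1: "bigo0 (\<sigma> + \<sigma>) (\<lambda>z :: real. norm (norm z powr \<sigma>) * norm (norm z powr \<sigma>))"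
      by (rule bigo0_mult[OF bigo0_powr bigo0_powr])
    have q2: "bigo0 (\<sigma> + \<sigma> + \<kappa>) (\<lambda>z :: real. norm (norm (norm z powr \<sigma>) * norm (norm z powr \<sigma>)) * norm (End (D 0 (- p z))))"
      by (rule bigo0_mult[OF q1 e1])
    have q3: "bigo0 (\<kappa> + \<kappa>) (\<lambda>z :: real. norm (End (D 0 (- p z))) * norm (End (D 0 (- p z))))"
      by (rule bigo0_mult[OF e1 e1])
    have q4: "bigo0 (\<sigma> + (\<kappa> + \<kappa>)) (\<lambda>z :: real. norm (norm z powr \<sigma>) * norm (norm (End (D 0 (- p z))) * norm (End (D 0 (- p z)))))"
      by (rule bigo0_mult[OF bigo0_powr q3])
    have "bigo0 (1 + \<sigma>) (\<lambda>z :: real. norm (norm (norm z powr \<sigma>) * norm (norm z powr \<sigma>)) * norm (End (D 0 (- p z))) +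
        norm (norm z powr \<sigma>) * norm (norm (End (D 0 (- p z))) * norm (End (D 0 (- p z)))))"
      by (rule bigo0_add[OF bigo0_mono[OF q2] bigo0_mono[OF q4]]) (use \<sigma> in \<open>auto simp: \<kappa>_def\<close>)
    thus ?thesis
    proof (rule bigo0_bound[where c = "4 * K\<^sup>2"])
      show "\<forall>\<^sub>F z in nhds 0. norm (End (D3 0 z) - End (D 0 (- p z)) - (norm z powr \<sigma>) *\<^sub>R A (End (D 0 (- p z))))
        \<le> 4 * K\<^sup>2 * norm (norm (norm (norm z powr \<sigma>) * norm (norm z powr \<sigma>)) * norm (End (D 0 (- p z))) +
        norm (norm z powr \<sigma>) * norm (norm (End (D 0 (- p z))) * norm (End (D 0 (- p z)))))"
        using D3(2)
      proof eventually_elim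
        case (elim z)
        define a where "a = norm z powr \<sigma>"
        define e where "e = norm (End (D 0 (- p z)))"
        have nn: "0 \<le> a" "0 \<le> e" by (auto simp: a_def e_def)
        have "2 * K\<^sup>2 * a\<^sup>2 * e + 4 * K * a * e\<^sup>2 \<le> 4 * K\<^sup>2 * (a * a * e) + 4 * K\<^sup>2 * (a * (e * e))"
        proof (rule add_mono)
          have "(2 * K\<^sup>2) * (a * a * e) \<le> (4 * K\<^sup>2) * (a * a * e)" by (rule mult_right_mono) (use nn in auto)
          thus "2 * K\<^sup>2 * a\<^sup>2 * e \<le> 4 * K\<^sup>2 * (a * a * e)" by (simp add: power2_eq_square mult_ac)
          have "K * 1 \<le> K * K" using K_ge1 by (intro mult_left_mono) auto
          hence "(4 * K) * (a * (e * e)) \<le> (4 * K\<^sup>2) * (a * (e * e))"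
            using nn by (intro mult_right_mono) (auto simp: power2_eq_square)
          thus "4 * K * a * e\<^sup>2 \<le> 4 * K\<^sup>2 * (a * (e * e))" by (simp add: power2_eq_square mult_ac)
        qed
        moreover have "norm (norm (norm a * norm a) * norm e + norm a * norm (norm e * norm e)) = a * a * e + a * (e * e)"
          using nn by simp
        ultimately show ?case using elim unfolding a_def[symmetric] e_def[symmetric]
          using nn by (simp add: distrib_left)
      qed
    qed simp
  qed
  have Ae: "bigo0 (1 + \<sigma>) (\<lambda>z. (norm z powr \<sigma>) *\<^sub>R A (End (D 0 (- p z)) - (- p z) *\<^sub>R \<xi>))"
  proof (rule bigo0_bound[OF bigo0_linear[OF bounded_linear_A b1], of _ 1])
    show "\<forall>\<^sub>F z in nhds 0. norm ((norm z powr \<sigma>) *\<^sub>R A (End (D 0 (- p z)) - (- p z) *\<^sub>R \<xi>)) \<le> 1 * norm (A (End (D 0 (- p z)) - (- p z) *\<^sub>R \<xi>))"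
      using eventually_norm_le[OF zero_less_one]
    proof eventually_elim
      case (elim z)
      have "norm z powr \<sigma> \<le> 1 powr \<sigma>" using elim \<sigma> by (intro powr_mono2) auto
      thus ?case unfolding norm_scaleR by (intro mult_right_mono) auto
    qed
  qed simp
  have AE: "bigo0 \<kappa> (\<lambda>z. A (End (D 0 (- p z))))" by (rule bigo0_linear[OF bounded_linear_A e1])
  have e3: "bigo0 \<kappa> (\<lambda>z. End (D3 0 z))"
  proof -
    have 1: "bigo0 \<kappa> (\<lambda>z. (norm z powr \<sigma>) *\<^sub>R A (End (D 0 (- p z))))"
    proof (rule bigo0_bound[OF AE, of _ 1])
      show "\<forall>\<^sub>F z in nhds 0. norm ((norm z powr \<sigma>) *\<^sub>R A (End (D 0 (- p z)))) \<le> 1 * norm (A (End (D 0 (- p z))))"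
        using eventually_norm_le[OF zero_less_one]
      proof eventually_elim
        case (elim z)
        have "norm z powr \<sigma> \<le> 1 powr \<sigma>" using elim \<sigma> by (intro powr_mono2) auto
        thus ?case unfolding norm_scaleR by (intro mult_right_mono) auto
      qed
    qed simp
    have "bigo0 \<kappa> (\<lambda>z. (End (D3 0 z) - End (D 0 (- p z)) - (norm z powr \<sigma>) *\<^sub>R A (End (D 0 (- p z)))) +
        (End (D 0 (- p z)) + (norm z powr \<sigma>) *\<^sub>R A (End (D 0 (- p z)))))"
      by (rule bigo0_add[OF bigo0_mono[OF w] bigo0_add[OF e1 1]]) (use \<sigma> in \<open>simp add: \<kappa>_def\<close>)
    thus ?thesis by simp
  qed
  have c: "bigo0 (1 + \<sigma>) (\<lambda>z. End (D4 0 z) - End (D3 0 z) - End (D 0 (p z)))"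
  proof (rule bigo0_bound[OF bigo0_mono[OF bigo0_mult[OF bigo0_powr[of "\<kappa> * s"] e3]]])
    show "1 + \<sigma> \<le> \<kappa> * s + \<kappa>" using \<kappa>s(1) by (simp add: algebra_simps)
    show "\<forall>\<^sub>F z in nhds 0. norm (End (D4 0 z) - End (D3 0 z) - End (D 0 (p z)))
      \<le> (6 * K * C2) * norm (norm (norm z powr (\<kappa> * s)) * norm (End (D3 0 z)))"
      using D4(2) by eventually_elim simp
    show "0 \<le> 6 * K * C2" using K_ge1 pulse_familyD(2)[OF D2] by simp
  qed
  \<comment> \<open>In this sum the contributions p z \<xi> of the two pulses cancel; what the wait
    has added to the first one is -|z|^\<sigma> p z A \<xi> = -z A \<xi>. The sign is removed at the
    end by linearity.\<close>
  have "bigo0 (1 + \<sigma>) (\<lambda>z. (End (D4 0 z) - End (D3 0 z) - End (D 0 (p z))) +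
     ((End (D3 0 z) - End (D 0 (- p z)) - (norm z powr \<sigma>) *\<^sub>R A (End (D 0 (- p z)))) +
      ((norm z powr \<sigma>) *\<^sub>R A (End (D 0 (- p z)) - (- p z) *\<^sub>R \<xi>) +
       ((End (D 0 (- p z)) - (- p z) *\<^sub>R \<xi>) + (End (D 0 (p z)) - p z *\<^sub>R \<xi>)))))"
    by (rule bigo0_add[OF c bigo0_add[OF w bigo0_add[OF Ae bigo0_add[OF b1 b2]]]])
  also have "(\<lambda>z. (End (D4 0 z) - End (D3 0 z) - End (D 0 (p z))) +
     ((End (D3 0 z) - End (D 0 (- p z)) - (norm z powr \<sigma>) *\<^sub>R A (End (D 0 (- p z)))) +
      ((norm z powr \<sigma>) *\<^sub>R A (End (D 0 (- p z)) - (- p z) *\<^sub>R \<xi>) +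
       ((End (D 0 (- p z)) - (- p z) *\<^sub>R \<xi>) + (End (D 0 (p z)) - p z *\<^sub>R \<xi>))))) = (\<lambda>z. End (D4 0 z) - z *\<^sub>R (- A \<xi>))"
  proof
    fix z :: real
    have "norm z powr \<sigma> * p z = z"
      by (cases "z = 0") (auto simp: p_def \<kappa>_def powr_add[symmetric] mult.left_commute sgn_mult_abs)
    hence z: "z *\<^sub>R A \<xi> = (norm z powr \<sigma>) *\<^sub>R A (p z *\<^sub>R \<xi>)"
      by (simp add: linear_scale[OF linA] scaleR_scaleR)
    show "(End (D4 0 z) - End (D3 0 z) - End (D 0 (p z))) +
     ((End (D3 0 z) - End (D 0 (- p z)) - (norm z powr \<sigma>) *\<^sub>R A (End (D 0 (- p z)))) +
      ((norm z powr \<sigma>) *\<^sub>R A (End (D 0 (- p z)) - (- p z) *\<^sub>R \<xi>) +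
       ((End (D 0 (- p z)) - (- p z) *\<^sub>R \<xi>) + (End (D 0 (p z)) - p z *\<^sub>R \<xi>)))) = End (D4 0 z) - z *\<^sub>R (- A \<xi>)"
      unfolding scaleR_minus_right z
      by (simp add: linear_diff[OF linA] linear_add[OF linA] linear_neg[OF linA] scaleR_diff_right scaleR_add_right)
  qed
  finally have "bigo0 (1 + \<sigma>) (\<lambda>z. End (D4 0 z) - z *\<^sub>R (- A \<xi>))" .
  hence "- A \<xi> \<in> reachable_set m"
    using D4(1) unfolding mn reachable_set_def reachable_map_def by blast
  thus ?thesis using subspace_neg[OF subspace_reachable_set] by fastforce
qed

section \<open>Expansion of the end point to second order\<close>

text \<open>Here \<open>ci k\<close> and \<open>Ji k\<close> are the value and the derivative at \<open>0\<close> of the vector field of \<open>M\<^sup>i\<^sub>k\<close>;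
  \<open>Wvec\<close>, \<open>Ceven\<close> and \<open>Codd\<close> are the values of \<open>W\<^sup>i\<^sub>k\<^sub>+\<^sub>1\<^sub>,\<^sub>0\<close>, \<open>C\<^sub>2\<^sub>k\<^sub>,\<^sub>0\<close> and \<open>C\<^sub>2\<^sub>k\<^sub>+\<^sub>1\<^sub>,\<^sub>0\<close>.\<close>

definition c1 :: "nat \<Rightarrow> 'v" where "c1 k = (A ^^ k) b1"
definition c2 :: "nat \<Rightarrow> 'v" where "c2 k = (A ^^ k) b2"

primrec J1 :: "nat \<Rightarrow> 'v \<Rightarrow> 'v" where
  "J1 0 = B1"
| "J1 (Suc k) = (\<lambda>x. Q (c1 k) x + A (J1 k x) - J1 k (A x))"

primrec J2 :: "nat \<Rightarrow> 'v \<Rightarrow> 'v" where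
  "J2 0 = B2"
| "J2 (Suc k) = (\<lambda>x. Q (c2 k) x + A (J2 k x) - J2 k (A x))"

definition Wvec1 :: "nat \<Rightarrow> 'v" where "Wvec1 k = J1 (Suc k) (c1 k) - J1 k (c1 (Suc k))"
definition Wvec2 :: "nat \<Rightarrow> 'v" where "Wvec2 k = J2 (Suc k) (c2 k) - J2 k (c2 (Suc k))"
definition Ceven :: "nat \<Rightarrow> 'v" where "Ceven k = J2 k (c1 k) - J1 k (c2 k)"
definition Codd :: "nat \<Rightarrow> 'v" where "Codd k = J1 (Suc k) (c2 k) - J2 k (c1 (Suc k))"

lemma c_0: "c1 0 = b1" "c2 0 = b2" by (simp_all add: c1_def c2_def)
lemma c_Suc: "c1 (Suc k) = A (c1 k)" "c2 (Suc k) = A (c2 k)" by (simp_all add: c1_def c2_def)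

lemma linear_Q: "linear (Q x)" "linear (\<lambda>x. Q x y)"
  using bounded_bilinear.bounded_linear_right[OF bilQ] bounded_bilinear.bounded_linear_left[OF bilQ]
  by (auto intro: bounded_linear.linear)

lemma linear_J1: "linear (J1 k)"
proof (induction k)
  case (Suc k)
  show ?case unfolding J1.simps
    by (intro linear_compose_add linear_compose_sub linear_Q linear_compose[OF Suc linA, unfolded o_def]
      linear_compose[OF linA Suc, unfolded o_def])
qed (simp add: linB1)

lemma linear_J2: "linear (J2 k)"
proof (induction k)
  case (Suc k)
  show ?case unfolding J2.simps
    by (intro linear_compose_add linear_compose_sub linear_Q linear_compose[OF Suc linA, unfolded o_def]
      linear_compose[OF linA Suc, unfolded o_def])
qed (simp add: linB2)

lemmas A_simps = linear_add[OF linA] linear_diff[OF linA] linear_scale[OF linA] linear_neg[OF linA]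
lemmas J_simps = linear_add[OF linear_J1] linear_diff[OF linear_J1] linear_scale[OF linear_J1] linear_neg[OF linear_J1]
  linear_add[OF linear_J2] linear_diff[OF linear_J2] linear_scale[OF linear_J2] linear_neg[OF linear_J2]
lemmas Q_simps = linear_add[OF linear_Q(1)] linear_diff[OF linear_Q(1)] linear_scale[OF linear_Q(1)] linear_neg[OF linear_Q(1)]
  linear_add[OF linear_Q(2)] linear_diff[OF linear_Q(2)] linear_scale[OF linear_Q(2)] linear_neg[OF linear_Q(2)]

text \<open>\<open>uu k\<close> and \<open>vv k\<close> are \<open>k\<close>-th primitives of the controls. Subtracting from the state the terms in which
  they occur lets the controls enter through their \<open>k\<close>-th primitives only, to first order for
  \<open>linear_reduced\<close> and to second order for \<open>quad_reduced\<close>; the quadratic terms that cannot be removed in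
  this way are collected in \<open>quad_terms\<close>.\<close>

primrec linear_reduced :: "(nat \<Rightarrow> real \<Rightarrow> real) \<Rightarrow> (nat \<Rightarrow> real \<Rightarrow> real) \<Rightarrow> (real \<Rightarrow> 'v) \<Rightarrow> nat \<Rightarrow> real \<Rightarrow> 'v" where
  "linear_reduced uu vv x 0 = x"
| "linear_reduced uu vv x (Suc k) = (\<lambda>t. linear_reduced uu vv x k t - uu (Suc k) t *\<^sub>R c1 k - vv (Suc k) t *\<^sub>R c2 k)"

primrec quad_reduced :: "(nat \<Rightarrow> real \<Rightarrow> real) \<Rightarrow> (nat \<Rightarrow> real \<Rightarrow> real) \<Rightarrow> (real \<Rightarrow> 'v) \<Rightarrow> nat \<Rightarrow> real \<Rightarrow> 'v" where
  "quad_reduced uu vv x 0 = x"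
| "quad_reduced uu vv x (Suc k) = (\<lambda>t. quad_reduced uu vv x k t - uu (Suc k) t *\<^sub>R c1 k - vv (Suc k) t *\<^sub>R c2 k
    - uu (Suc k) t *\<^sub>R J1 k (linear_reduced uu vv x k t) - vv (Suc k) t *\<^sub>R J2 k (linear_reduced uu vv x k t)
    + (1/2 * (uu (Suc k) t * uu (Suc k) t)) *\<^sub>R J1 k (c1 k)
    + (1/2 * (vv (Suc k) t * vv (Suc k) t)) *\<^sub>R J2 k (c2 k)
    + (uu (Suc k) t * vv (Suc k) t) *\<^sub>R J2 k (c1 k))"

definition quad_terms :: "(nat \<Rightarrow> real \<Rightarrow> real) \<Rightarrow> (nat \<Rightarrow> real \<Rightarrow> real) \<Rightarrow> nat \<Rightarrow> real \<Rightarrow> 'v" where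
  "quad_terms uu vv n t = (\<Sum>k<n. (1/2 * (uu (Suc k) t * uu (Suc k) t)) *\<^sub>R Wvec1 k + (1/2 * (vv (Suc k) t * vv (Suc k) t)) *\<^sub>R Wvec2 k
     + (uu (Suc k) t * vv k t) *\<^sub>R Ceven k + (uu (Suc k) t * vv (Suc k) t) *\<^sub>R Codd k)"

text \<open>\<open>e\<close> and \<open>r0\<close> are the errors of the first and second order
  expansions of the equation. Each further step subtracts J_k applied to the linearly reduced state,
  whose derivative still contains \<open>e\<close>; this accounts for the added terms.\<close>

primrec remainder :: "(nat \<Rightarrow> real) \<Rightarrow> (nat \<Rightarrow> real) \<Rightarrow> 'v \<Rightarrow> 'v \<Rightarrow> nat \<Rightarrow> 'v" where
  "remainder u v e r0 0 = r0"
| "remainder u v e r0 (Suc k) = remainder u v e r0 k - u (Suc k) *\<^sub>R J1 k e - v (Suc k) *\<^sub>R J2 k e"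

text \<open>Subtracting u_(k+1) c_k removes u_k c_k from the equation and leaves u_(k+1) A c_k
  through the linear part, which is u_(k+1) c_(k+1).\<close>

lemma linear_reduced_derivative:
  assumes uu: "\<And>k t. k < n \<Longrightarrow> t \<in> S \<Longrightarrow> (uu (Suc k) has_real_derivative uu k t) (at t within S)"
    and vv: "\<And>k t. k < n \<Longrightarrow> t \<in> S \<Longrightarrow> (vv (Suc k) has_real_derivative vv k t) (at t within S)"
    and x: "\<And>t. t \<in> S \<Longrightarrow> (x has_vector_derivative x' t) (at t within S)"
    and e: "\<And>t. e t = x' t - A (x t) - uu 0 t *\<^sub>R b1 - vv 0 t *\<^sub>R b2"
    and "k \<le> n" "t \<in> S"
  shows "(linear_reduced uu vv x k has_vector_derivative (A (linear_reduced uu vv x k t) + uu k t *\<^sub>R c1 k + vv k t *\<^sub>R c2 k + e t)) (at t within S)"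
  using \<open>k \<le> n\<close>
proof (induction k)
  case 0
  thus ?case using x[OF \<open>t \<in> S\<close>] by (simp add: e c_0)
next
  case (Suc k)
  have d: "((\<lambda>t. linear_reduced uu vv x k t - uu (Suc k) t *\<^sub>R c1 k - vv (Suc k) t *\<^sub>R c2 k) has_vector_derivative
     ((A (linear_reduced uu vv x k t) + uu k t *\<^sub>R c1 k + vv k t *\<^sub>R c2 k + e t) - (uu (Suc k) t *\<^sub>R 0 + uu k t *\<^sub>R c1 k) - (vv (Suc k) t *\<^sub>R 0 + vv k t *\<^sub>R c2 k))) (at t within S)"
    by (intro has_vector_derivative_diff has_vector_derivative_scaleR has_vector_derivative_const uu vv \<open>t \<in> S\<close> Suc.IH) (use Suc.prems in auto)
  show ?case unfolding linear_reduced.simps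
    by (rule has_vector_derivative_eq_rhs[OF d]) (simp add: A_simps c_Suc)
qed

text \<open>Inductive step of the reduction, with u0, u1 for the k-th and (k+1)-st primitives of the
  first control and v0, v1 for the second. Differentiating the products with J_k z produces u0 u1,
  v0 v1, u0 v1 and u1 v0. The first two are derivatives of halved squares; u0 v1 is traded for -u1
  v0 through the product u1 v1, which completes the coefficient of u1 v0 to the even bracket.
  Rewriting A, Q and J at the new reduced state yields the other brackets.\<close>

lemma expansion_step:
  fixes z :: 'v and u0 v0 u1 v1 :: real
  shows "(A Y + u0 *\<^sub>R c1 k + v0 *\<^sub>R c2 k + (1/2) *\<^sub>R Q z z + u0 *\<^sub>R J1 k z + v0 *\<^sub>R J2 k z + S + r)
     - u0 *\<^sub>R c1 k - v0 *\<^sub>R c2 k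
     - (u1 *\<^sub>R J1 k (A z + u0 *\<^sub>R c1 k + v0 *\<^sub>R c2 k + e) + u0 *\<^sub>R J1 k z)
     - (v1 *\<^sub>R J2 k (A z + u0 *\<^sub>R c1 k + v0 *\<^sub>R c2 k + e) + v0 *\<^sub>R J2 k z)
     + (u1 * u0) *\<^sub>R J1 k (c1 k) + (v1 * v0) *\<^sub>R J2 k (c2 k) + (u0 * v1 + u1 * v0) *\<^sub>R J2 k (c1 k)
   = A (Y - u1 *\<^sub>R c1 k - v1 *\<^sub>R c2 k - u1 *\<^sub>R J1 k z - v1 *\<^sub>R J2 k z + (1/2 * (u1 * u1)) *\<^sub>R J1 k (c1 k)
       + (1/2 * (v1 * v1)) *\<^sub>R J2 k (c2 k) + (u1 * v1) *\<^sub>R J2 k (c1 k))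
     + u1 *\<^sub>R c1 (Suc k) + v1 *\<^sub>R c2 (Suc k)
     + (1/2) *\<^sub>R Q (z - u1 *\<^sub>R c1 k - v1 *\<^sub>R c2 k) (z - u1 *\<^sub>R c1 k - v1 *\<^sub>R c2 k)
     + u1 *\<^sub>R J1 (Suc k) (z - u1 *\<^sub>R c1 k - v1 *\<^sub>R c2 k) + v1 *\<^sub>R J2 (Suc k) (z - u1 *\<^sub>R c1 k - v1 *\<^sub>R c2 k)
     + (S + ((1/2 * (u1 * u1)) *\<^sub>R Wvec1 k + (1/2 * (v1 * v1)) *\<^sub>R Wvec2 k + (u1 * v0) *\<^sub>R Ceven k + (u1 * v1) *\<^sub>R Codd k))
     + (r - u1 *\<^sub>R J1 k e - v1 *\<^sub>R J2 k e)" (is "?lhs = ?rhs")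
proof -
  have q: "Q z (c1 k) = Q (c1 k) z" "Q z (c2 k) = Q (c2 k) z" "Q (c2 k) (c1 k) = Q (c1 k) (c2 k)"
    by (rule symQ)+
  show ?thesis
  proof (rule euclidean_eqI)
    fix b :: 'v
    show "?lhs \<bullet> b = ?rhs \<bullet> b"
      by (simp add: A_simps J_simps Q_simps c_Suc Wvec1_def Wvec2_def Ceven_def Codd_def q inner_add_left inner_diff_left)
         (simp add: field_simps)
  qed
qed

text \<open>The equation has at every k the form it has at k = 0, with the primitives in place of
  the controls and c_k, J_k in place of b_i, B_i; this makes the induction close.\<close>

lemma quad_reduced_derivative:
  assumes uu: "\<And>k t. k < n \<Longrightarrow> t \<in> S \<Longrightarrow> (uu (Suc k) has_real_derivative uu k t) (at t within S)"
    and vv: "\<And>k t. k < n \<Longrightarrow> t \<in> S \<Longrightarrow> (vv (Suc k) has_real_derivative vv k t) (at t within S)"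
    and x: "\<And>t. t \<in> S \<Longrightarrow> (x has_vector_derivative x' t) (at t within S)"
    and e: "\<And>t. e t = x' t - A (x t) - uu 0 t *\<^sub>R b1 - vv 0 t *\<^sub>R b2"
    and r0: "\<And>t. r0 t = e t - (1/2) *\<^sub>R Q (x t) (x t) - uu 0 t *\<^sub>R B1 (x t) - vv 0 t *\<^sub>R B2 (x t)"
    and "k \<le> n" "t \<in> S"
  shows "(quad_reduced uu vv x k has_vector_derivative
     (A (quad_reduced uu vv x k t) + uu k t *\<^sub>R c1 k + vv k t *\<^sub>R c2 k + (1/2) *\<^sub>R Q (linear_reduced uu vv x k t) (linear_reduced uu vv x k t)
      + uu k t *\<^sub>R J1 k (linear_reduced uu vv x k t) + vv k t *\<^sub>R J2 k (linear_reduced uu vv x k t) + quad_terms uu vv k t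
      + remainder (\<lambda>i. uu i t) (\<lambda>i. vv i t) (e t) (r0 t) k)) (at t within S)"
  using \<open>k \<le> n\<close>
proof (induction k)
  case 0
  show ?case unfolding quad_reduced.simps(1)
    by (rule has_vector_derivative_eq_rhs[OF x[OF \<open>t \<in> S\<close>]]) (simp add: quad_terms_def r0 e c_0)
next
  case (Suc k)
  have k: "k < n" "k \<le> n" using Suc.prems by auto
  have bl: "bounded_linear (J1 k)" "bounded_linear (J2 k)"
    using linear_J1 linear_J2 by (auto simp: linear_conv_bounded_linear)
  note u = uu[OF k(1) \<open>t \<in> S\<close>] and v = vv[OF k(1) \<open>t \<in> S\<close>]
  have z: "(linear_reduced uu vv x k has_vector_derivative (A (linear_reduced uu vv x k t) + uu k t *\<^sub>R c1 k + vv k t *\<^sub>R c2 k + e t)) (at t within S)"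
    using uu vv x e k(2) \<open>t \<in> S\<close> by (rule linear_reduced_derivative)
  have uu2: "((\<lambda>t. 1/2 * (uu (Suc k) t * uu (Suc k) t)) has_real_derivative uu (Suc k) t * uu k t) (at t within S)"
    by (rule DERIV_cong[OF DERIV_cmult[OF DERIV_mult[OF u u]]]) simp
  have vv2: "((\<lambda>t. 1/2 * (vv (Suc k) t * vv (Suc k) t)) has_real_derivative vv (Suc k) t * vv k t) (at t within S)"
    by (rule DERIV_cong[OF DERIV_cmult[OF DERIV_mult[OF v v]]]) simp
  have uv: "((\<lambda>t. uu (Suc k) t * vv (Suc k) t) has_real_derivative uu k t * vv (Suc k) t + uu (Suc k) t * vv k t) (at t within S)"
    by (rule DERIV_cong[OF DERIV_mult[OF u v]]) simp
  have sc: "((\<lambda>t. f t *\<^sub>R c) has_vector_derivative d *\<^sub>R c) (at t within S)"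
    if "(f has_real_derivative d) (at t within S)" for f d and c :: 'v
    using has_vector_derivative_scaleR[OF that has_vector_derivative_const[of c]] by simp
  note d = has_vector_derivative_add[OF has_vector_derivative_add[OF has_vector_derivative_add[OF
     has_vector_derivative_diff[OF has_vector_derivative_diff[OF has_vector_derivative_diff[OF has_vector_derivative_diff[OF
       Suc.IH[OF k(2)] sc[OF u, of "c1 k"]] sc[OF v, of "c2 k"]]
       has_vector_derivative_scaleR[OF u bounded_linear.has_vector_derivative[OF bl(1) z]]]
       has_vector_derivative_scaleR[OF v bounded_linear.has_vector_derivative[OF bl(2) z]]]
       sc[OF uu2, of "J1 k (c1 k)"]] sc[OF vv2, of "J2 k (c2 k)"]] sc[OF uv, of "J2 k (c1 k)"]]
  have quad_terms_Suc: "quad_terms uu vv (Suc k) t = quad_terms uu vv k t + ((1/2 * (uu (Suc k) t * uu (Suc k) t)) *\<^sub>R Wvec1 k + (1/2 * (vv (Suc k) t * vv (Suc k) t)) *\<^sub>R Wvec2 k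
     + (uu (Suc k) t * vv k t) *\<^sub>R Ceven k + (uu (Suc k) t * vv (Suc k) t) *\<^sub>R Codd k)"
    by (simp add: quad_terms_def)
  show ?case unfolding quad_reduced.simps(2) remainder.simps(2) quad_terms_Suc linear_reduced.simps(2)
    by (rule has_vector_derivative_eq_rhs[OF d], rule expansion_step)
qed

section \<open>Bounds for the terms of the expansion\<close>

lemma linear_bound: "linear f \<Longrightarrow> \<exists>c\<ge>0. \<forall>x. norm (f x) \<le> c * norm x" for f :: "'v \<Rightarrow> 'v"
  unfolding linear_conv_bounded_linear
  by (metis bounded_linear.nonneg_bounded mult.commute)

definition Cvec :: "nat \<Rightarrow> 'v" where
  "Cvec j = (if even j then Ceven (j div 2) else Codd (j div 2))"

lemma abs_mult_bound: "\<bar>a\<bar> \<le> a' \<Longrightarrow> \<bar>b\<bar> \<le> b' \<Longrightarrow> \<bar>a * b\<bar> \<le> a' * (b' :: real)"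
  unfolding abs_mult by (rule mult_mono) auto

lemma norm_scaleR_bound: "\<bar>a\<bar> \<le> a' \<Longrightarrow> norm x \<le> b' \<Longrightarrow> norm (a *\<^sub>R x) \<le> a' * b'"
  unfolding norm_scaleR by (rule mult_mono) auto

text \<open>One constant for all data with index up to n, so that the constants of the final
  estimate depend on n but not on the pulse.\<close>

lemma uniform_constant:
  fixes P :: "'v \<Rightarrow> 'v"
  assumes "linear P"
  shows "\<exists>H\<ge>1. K \<le> H \<and> (\<forall>k\<le>n. \<forall>x. norm (J1 k x) \<le> H * norm x) \<and> (\<forall>k\<le>n. \<forall>x. norm (J2 k x) \<le> H * norm x) \<and>
    (\<forall>x y. norm (Q x y) \<le> H * norm x * norm y) \<and> (\<forall>x. norm (P x) \<le> H * norm x) \<and> (\<forall>x. norm (P (A x)) \<le> H * norm x) \<and>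
    (\<forall>k\<le>n. norm (c1 k) \<le> H \<and> norm (c2 k) \<le> H \<and> norm (Wvec1 k) \<le> H \<and> norm (Wvec2 k) \<le> H \<and> norm (Ceven k) \<le> H \<and> norm (Codd k) \<le> H)"
proof -
  obtain h1 where h1: "\<And>k. 0 \<le> h1 k" "\<And>k x. norm (J1 k x) \<le> h1 k * norm x" using linear_bound[OF linear_J1] by metis
  obtain h2 where h2: "\<And>k. 0 \<le> h2 k" "\<And>k x. norm (J2 k x) \<le> h2 k * norm x" using linear_bound[OF linear_J2] by metis
  obtain hQ where hQ: "0 \<le> hQ" "\<And>x y. norm (Q x y) \<le> norm x * norm y * hQ" using bounded_bilinear.nonneg_bounded[OF bilQ] by blast
  obtain hP where hP: "0 \<le> hP" "\<And>x. norm (P x) \<le> hP * norm x" using linear_bound[OF assms] by blast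
  define g where "g k = h1 k + h2 k + norm (c1 k) + norm (c2 k) + norm (Wvec1 k) + norm (Wvec2 k) + norm (Ceven k) + norm (Codd k)" for k
  have g0: "0 \<le> g k" for k unfolding g_def using h1(1) h2(1) by (intro add_nonneg_nonneg) auto
  define H where "H = 1 + K + hQ + hP + hP * K + (\<Sum>k\<le>n. g k)"
  have sg: "0 \<le> (\<Sum>k\<le>n. g k)" by (rule sum_nonneg) (rule g0)
  have hPK: "0 \<le> hP * K" using hP K_ge1 by simp
  have gH: "g k \<le> H" if "k \<le> n" for k
  proof -
    have "g k \<le> (\<Sum>k\<le>n. g k)" by (rule member_le_sum) (use that g0 in auto)
    thus ?thesis unfolding H_def using hQ hP hPK K_ge1 by linarith
  qed
  have nn: "0 \<le> norm (c1 k)" "0 \<le> norm (c2 k)" "0 \<le> norm (Wvec1 k)" "0 \<le> norm (Wvec2 k)" "0 \<le> norm (Ceven k)" "0 \<le> norm (Codd k)" for k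
    by auto
  show ?thesis
  proof (intro exI[of _ H] conjI allI impI)
    show "1 \<le> H" "K \<le> H" unfolding H_def using hQ hP hPK K_ge1 sg by linarith+
    show "norm (J1 k x) \<le> H * norm x" if "k \<le> n" for k x
    proof -
      have "h1 k \<le> H" using gH[OF that] h1(1)[of k] h2(1)[of k] nn[of k] unfolding g_def by linarith
      thus ?thesis using h1(2)[of k x] by (meson mult_right_mono norm_ge_zero order_trans)
    qed
    show "norm (J2 k x) \<le> H * norm x" if "k \<le> n" for k x
    proof -
      have "h2 k \<le> H" using gH[OF that] h1(1)[of k] h2(1)[of k] nn[of k] unfolding g_def by linarith
      thus ?thesis using h2(2)[of k x] by (meson mult_right_mono norm_ge_zero order_trans)
    qed
    show "norm (Q x y) \<le> H * norm x * norm y" for x y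
    proof -
      have "hQ \<le> H" unfolding H_def using hQ hP hPK K_ge1 sg by linarith
      hence "norm x * norm y * hQ \<le> norm x * norm y * H" by (intro mult_left_mono) auto
      with hQ(2)[of x y] show ?thesis by (simp add: mult_ac)
    qed
    show "norm (P x) \<le> H * norm x" for x
    proof -
      have "hP \<le> H" unfolding H_def using hQ hP hPK K_ge1 sg by linarith
      thus ?thesis using hP(2)[of x] by (meson mult_right_mono norm_ge_zero order_trans)
    qed
    show "norm (P (A x)) \<le> H * norm x" for x
    proof -
      have "norm (P (A x)) \<le> hP * (K * norm x)"
        by (rule order_trans[OF hP(2) mult_left_mono[OF bdA hP(1)]])
      moreover have "hP * K \<le> H" unfolding H_def using hQ hP hPK K_ge1 sg by linarith
      hence "(hP * K) * norm x \<le> H * norm x" by (rule mult_right_mono) simp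
      ultimately show ?thesis by (simp add: mult.assoc)
    qed
    fix k assume "k \<le> n"
    from gH[OF this] h1(1)[of k] h2(1)[of k] nn[of k]
    show "norm (c1 k) \<le> H" "norm (c2 k) \<le> H" "norm (Wvec1 k) \<le> H" "norm (Wvec2 k) \<le> H" "norm (Ceven k) \<le> H" "norm (Codd k) \<le> H"
      unfolding g_def by linarith+
  qed
qed

text \<open>Bounds for the errors \<open>e\<close> and \<open>r0\<close> of the expansion: they are
  of order 2 and 3 in the joint size of state and control.\<close>

lemma F_residuals:
  assumes x: "norm x \<le> R" and u: "\<bar>u\<bar> \<le> \<eta>" and v: "\<bar>v\<bar> \<le> \<eta>"
  shows "norm (F x (u, v) - A x - u *\<^sub>R b1 - v *\<^sub>R b2) \<le> K * norm x ^ 2 + 2 * \<eta> * K * norm x"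
    and "norm (F x (u, v) - A x - u *\<^sub>R b1 - v *\<^sub>R b2 - (1/2) *\<^sub>R Q x x - u *\<^sub>R B1 x - v *\<^sub>R B2 x) \<le>
      K * norm x ^ 3 + 2 * \<eta> * (K * norm x ^ 2)"
proof -
  have 0: "f1 0 = b1" "f2 0 = b2"
    using tay1[of 0] tay2[of 0] R_pos linear_0[OF linB1] linear_0[OF linB2] by auto
  have l: "norm (f1 x - b1) \<le> K * norm x" "norm (f2 x - b2) \<le> K * norm x"
    using lip1[OF x, of 0] lip2[OF x, of 0] R_pos 0 by auto
  have e1: "F x (u, v) - A x - u *\<^sub>R b1 - v *\<^sub>R b2 = (f0 x - A x) + (u *\<^sub>R (f1 x - b1) + v *\<^sub>R (f2 x - b2))"
    by (simp add: F_def algebra_simps)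
  have "norm ((f0 x - A x) + (u *\<^sub>R (f1 x - b1) + v *\<^sub>R (f2 x - b2))) \<le> K * norm x ^ 2 + (\<eta> * (K * norm x) + \<eta> * (K * norm x))"
    by (rule order_trans[OF norm_triangle_ineq add_mono[OF tay0'[OF x] order_trans[OF norm_triangle_ineq add_mono[OF
       norm_scaleR_bound[OF u l(1)] norm_scaleR_bound[OF v l(2)]]]]])
  thus "norm (F x (u, v) - A x - u *\<^sub>R b1 - v *\<^sub>R b2) \<le> K * norm x ^ 2 + 2 * \<eta> * K * norm x"
    unfolding e1 by (simp add: mult_ac)
  have e2: "F x (u, v) - A x - u *\<^sub>R b1 - v *\<^sub>R b2 - (1/2) *\<^sub>R Q x x - u *\<^sub>R B1 x - v *\<^sub>R B2 x =
     (f0 x - A x - (1/2) *\<^sub>R Q x x) + (u *\<^sub>R (f1 x - b1 - B1 x) + v *\<^sub>R (f2 x - b2 - B2 x))"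
    by (simp add: F_def algebra_simps)
  have "norm ((f0 x - A x - (1/2) *\<^sub>R Q x x) + (u *\<^sub>R (f1 x - b1 - B1 x) + v *\<^sub>R (f2 x - b2 - B2 x)))
     \<le> K * norm x ^ 3 + (\<eta> * (K * norm x ^ 2) + \<eta> * (K * norm x ^ 2))"
    by (rule order_trans[OF norm_triangle_ineq add_mono[OF tay0[OF x] order_trans[OF norm_triangle_ineq add_mono[OF
       norm_scaleR_bound[OF u tay1[OF x]] norm_scaleR_bound[OF v tay2[OF x]]]]]])
  thus "norm (F x (u, v) - A x - u *\<^sub>R b1 - v *\<^sub>R b2 - (1/2) *\<^sub>R Q x x - u *\<^sub>R B1 x - v *\<^sub>R B2 x) \<le>
      K * norm x ^ 3 + 2 * \<eta> * (K * norm x ^ 2)"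
    unfolding e2 by (simp add: mult_ac)
qed

text \<open>In the application \<open>e\<close> is O(a^2) and every primitive is O(a), so each added
  term is O(a^3), like \<open>r0\<close>.\<close>

lemma norm_remainder_le:
  assumes "\<And>k x. k < n \<Longrightarrow> norm (J1 k x) \<le> H * norm x" "\<And>k x. k < n \<Longrightarrow> norm (J2 k x) \<le> H * norm x"
    and "\<And>k. k \<le> n \<Longrightarrow> \<bar>u k\<bar> \<le> m" "\<And>k. k \<le> n \<Longrightarrow> \<bar>v k\<bar> \<le> m" and "norm e \<le> E" and H: "0 \<le> H"
  shows "norm (remainder u v e r0 n) \<le> norm r0 + real n * (2 * (m * (H * E)))"
  using assms(1-4)
proof (induction n)
  case (Suc n)
  have j: "norm (J1 n e) \<le> H * E" "norm (J2 n e) \<le> H * E"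
    using Suc.prems(1,2)[of n e] mult_left_mono[OF assms(5) H] by auto
  have "norm (remainder u v e r0 (Suc n)) \<le> norm (remainder u v e r0 n) + m * (H * E) + m * (H * E)"
    unfolding remainder.simps
    by (intro order_trans[OF norm_triangle_ineq4] add_mono norm_scaleR_bound j order_refl Suc.prems order_refl)
  also have "norm (remainder u v e r0 n) \<le> norm r0 + real n * (2 * (m * (H * E)))"
    by (rule Suc.IH) (use Suc.prems in auto)
  finally show ?case by (simp add: algebra_simps)
qed simp

lemma norm_Pair_le2: "norm (a, b) \<le> \<bar>a\<bar> + \<bar>b :: real\<bar>" for a :: real
  using norm_Pair_le[of a b] by simp

lemma norm_add4: "norm (a + b + c + d :: 'v) \<le> norm a + norm b + norm c + norm d"
  by (intro order_trans[OF norm_triangle_ineq] add_mono order_refl)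

lemma norm_quad_terms_le:
  assumes "\<And>k. k < n \<Longrightarrow> norm (Wvec1 k) \<le> H \<and> norm (Wvec2 k) \<le> H \<and> norm (Ceven k) \<le> H \<and> norm (Codd k) \<le> H"
    and "\<And>k. k \<le> n \<Longrightarrow> \<bar>uu k t\<bar> \<le> m" "\<And>k. k \<le> n \<Longrightarrow> \<bar>vv k t\<bar> \<le> m"
  shows "norm (quad_terms uu vv n t) \<le> real n * (4 * (m * m * H))"
proof -
  have "norm (quad_terms uu vv n t) \<le> (\<Sum>k<n. 4 * (m * m * H))"
    unfolding quad_terms_def
  proof (rule sum_norm_le)
    fix k assume "k \<in> {..<n}"
    hence k: "k < n" "k \<le> n" "Suc k \<le> n" by auto
    note u = assms(2)[OF k(2)] assms(2)[OF k(3)] assms(3)[OF k(2)] assms(3)[OF k(3)]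
    have m: "0 \<le> m" using u(1) by linarith
    have half: "\<bar>1 / 2 * y\<bar> \<le> m * m" if "\<bar>y\<bar> \<le> m * m" for y using that by (simp add: abs_mult)
    note b = assms(1)[OF k(1)]
    have 1: "norm ((1/2 * (uu (Suc k) t * uu (Suc k) t)) *\<^sub>R Wvec1 k) \<le> m * m * H"
      by (intro norm_scaleR_bound half abs_mult_bound u) (use b in simp)
    have 2: "norm ((1/2 * (vv (Suc k) t * vv (Suc k) t)) *\<^sub>R Wvec2 k) \<le> m * m * H"
      by (intro norm_scaleR_bound half abs_mult_bound u) (use b in simp)
    have 3: "norm ((uu (Suc k) t * vv k t) *\<^sub>R Ceven k) \<le> m * m * H"
      by (intro norm_scaleR_bound abs_mult_bound u) (use b in simp)
    have 4: "norm ((uu (Suc k) t * vv (Suc k) t) *\<^sub>R Codd k) \<le> m * m * H"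
      by (intro norm_scaleR_bound abs_mult_bound u) (use b in simp)
    show "norm ((1/2 * (uu (Suc k) t * uu (Suc k) t)) *\<^sub>R Wvec1 k + (1/2 * (vv (Suc k) t * vv (Suc k) t)) *\<^sub>R Wvec2 k
     + (uu (Suc k) t * vv k t) *\<^sub>R Ceven k + (uu (Suc k) t * vv (Suc k) t) *\<^sub>R Codd k) \<le> 4 * (m * m * H)"
      using order_trans[OF norm_add4 add_mono[OF add_mono[OF add_mono[OF 1 2] 3] 4]] by (simp add: mult_ac)
  qed
  thus ?thesis by simp
qed

text \<open>Modulo the kernel of \<open>P\<close> only the monomial of index \<open>j\<close> survives at order
  \<open>a\<^sup>2 \<tau>\<^sup>j\<^sup>+\<^sup>1\<close>: all earlier ones are killed and all later ones carry an additional factor \<open>\<tau>\<close>.\<close>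

lemma quad_terms_leading_term:
  fixes P :: "'v \<Rightarrow> 'v"
  assumes P: "linear P" and j: "j < 2 * n"
    and kill_W: "\<And>k. 2 * k + 3 \<le> j + 2 \<Longrightarrow> P (Wvec1 k) = 0 \<and> P (Wvec2 k) = 0"
    and kill_C: "\<And>i. i < j \<Longrightarrow> P (Cvec i) = 0"
    and b: "\<And>k. k < n \<Longrightarrow> norm (P (Wvec1 k)) \<le> H \<and> norm (P (Wvec2 k)) \<le> H \<and> norm (P (Ceven k)) \<le> H \<and> norm (P (Codd k)) \<le> H"
    and u: "\<And>k. k \<le> n \<Longrightarrow> \<bar>uu k t\<bar> \<le> m * \<tau> ^ k" and v: "\<And>k. k \<le> n \<Longrightarrow> \<bar>vv k t\<bar> \<le> m * \<tau> ^ k"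
    and \<tau>: "0 \<le> \<tau>" "\<tau> \<le> 1" and m: "0 \<le> m" and H: "0 \<le> H"
  shows "norm (P (quad_terms uu vv n t) - (uu (Suc (j div 2)) t * vv ((j + 1) div 2) t) *\<^sub>R P (Cvec j)) \<le>
    real n * (4 * (m * m * \<tau> ^ (j + 2) * H))"
proof -
  let ?B = "m * m * \<tau> ^ (j + 2) * H"
  have B0: "0 \<le> ?B" using \<tau> m H by auto
  \<comment> \<open>This is the projected k-th summand without the leading monomial, which sits in
    the summand k = j div 2, at \<open>Ceven\<close> or at \<open>Codd\<close> according to the
    parity of j.\<close>
  define T where "T k = (1/2 * (uu (Suc k) t * uu (Suc k) t)) *\<^sub>R P (Wvec1 k) + (1/2 * (vv (Suc k) t * vv (Suc k) t)) *\<^sub>R P (Wvec2 k)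
     + (if 2 * k = j then 0 else (uu (Suc k) t * vv k t) *\<^sub>R P (Ceven k))
     + (if 2 * k + 1 = j then 0 else (uu (Suc k) t * vv (Suc k) t) *\<^sub>R P (Codd k))" for k
  have mon: "\<bar>p * q\<bar> \<le> m * m * \<tau> ^ (j + 2)"
    if "\<bar>p\<bar> \<le> m * \<tau> ^ i" "\<bar>q\<bar> \<le> m * \<tau> ^ l" "j + 2 \<le> i + l" for p q i l
  proof -
    have "\<bar>p * q\<bar> \<le> (m * \<tau> ^ i) * (m * \<tau> ^ l)" by (rule abs_mult_bound[OF that(1,2)])
    also have "\<dots> = m * m * \<tau> ^ (i + l)" by (simp add: power_add mult_ac)
    also have "\<dots> \<le> m * m * \<tau> ^ (j + 2)"
      using \<tau> m that(3) by (intro mult_left_mono power_decreasing) auto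
    finally show ?thesis .
  qed
  have TB: "norm (T k) \<le> 4 * ?B" if k: "k < n" for k
  proof -
    note uk = u[of k] u[of "Suc k"] v[of k] v[of "Suc k"]
    note bk = b[OF k]
    have half: "\<bar>1 / 2 * y\<bar> \<le> w" if "\<bar>y\<bar> \<le> w" for y w :: real using that by (simp add: abs_mult)
    \<comment> \<open>The bracket has length 2 k + 3 but its monomial has order \<tau>^(2 k + 2). A
      length above j + 2 therefore still gives the order j + 2.\<close>
    have 1: "norm ((1/2 * (uu (Suc k) t * uu (Suc k) t)) *\<^sub>R P (Wvec1 k)) \<le> ?B"
    proof (cases "2 * k + 3 \<le> j + 2")
      case False
      thus ?thesis by (intro norm_scaleR_bound half mon[of _ "Suc k" _ "Suc k"]) (use uk k bk in auto)
    qed (use kill_W B0 in simp)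
    have 2: "norm ((1/2 * (vv (Suc k) t * vv (Suc k) t)) *\<^sub>R P (Wvec2 k)) \<le> ?B"
    proof (cases "2 * k + 3 \<le> j + 2")
      case False
      thus ?thesis by (intro norm_scaleR_bound half mon[of _ "Suc k" _ "Suc k"]) (use uk k bk in auto)
    qed (use kill_W B0 in simp)
    have 3: "norm (if 2 * k = j then 0 else (uu (Suc k) t * vv k t) *\<^sub>R P (Ceven k)) \<le> ?B"
    proof -
      consider "2 * k = j" | "2 * k < j" | "j < 2 * k" by linarith
      thus ?thesis
      proof cases
        case 2 thus ?thesis using kill_C[of "2 * k"] B0 by (simp add: Cvec_def)
      next
        case 3
        hence "norm ((uu (Suc k) t * vv k t) *\<^sub>R P (Ceven k)) \<le> ?B"
          by (intro norm_scaleR_bound mon[of _ "Suc k" _ k]) (use uk k bk in auto)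
        thus ?thesis using 3 by simp
      qed (use B0 in simp)
    qed
    have 4: "norm (if 2 * k + 1 = j then 0 else (uu (Suc k) t * vv (Suc k) t) *\<^sub>R P (Codd k)) \<le> ?B"
    proof -
      consider "2 * k + 1 = j" | "2 * k + 1 < j" | "j < 2 * k + 1" by linarith
      thus ?thesis
      proof cases
        case 2 thus ?thesis using kill_C[of "2 * k + 1"] B0 by (simp add: Cvec_def)
      next
        case 3
        hence "norm ((uu (Suc k) t * vv (Suc k) t) *\<^sub>R P (Codd k)) \<le> ?B"
          by (intro norm_scaleR_bound mon[of _ "Suc k" _ "Suc k"]) (use uk k bk in auto)
        thus ?thesis using 3 by simp
      qed (use B0 in simp)
    qed
    show ?thesis unfolding T_def
      using order_trans[OF norm_add4 add_mono[OF add_mono[OF add_mono[OF 1 2] 3] 4]] by (simp add: mult_ac)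
  qed
  have eq: "P (quad_terms uu vv n t) - (uu (Suc (j div 2)) t * vv ((j + 1) div 2) t) *\<^sub>R P (Cvec j) = (\<Sum>k<n. T k)"
  proof -
    have jn: "j div 2 < n" using j by auto
    have "P (quad_terms uu vv n t) = (\<Sum>k<n. (1/2 * (uu (Suc k) t * uu (Suc k) t)) *\<^sub>R P (Wvec1 k) + (1/2 * (vv (Suc k) t * vv (Suc k) t)) *\<^sub>R P (Wvec2 k)
     + (uu (Suc k) t * vv k t) *\<^sub>R P (Ceven k) + (uu (Suc k) t * vv (Suc k) t) *\<^sub>R P (Codd k))"
      unfolding quad_terms_def linear_sum[OF P] by (simp only: linear_add[OF P] linear_scale[OF P])
    also have "\<dots> = (\<Sum>k<n. T k + (if k = j div 2 then (uu (Suc (j div 2)) t * vv ((j + 1) div 2) t) *\<^sub>R P (Cvec j) else 0))"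
    proof (rule sum.cong[OF HOL.refl])
      fix k
      consider "2 * k = j" | "2 * k + 1 = j" | "k \<noteq> j div 2" by linarith
      thus "(1/2 * (uu (Suc k) t * uu (Suc k) t)) *\<^sub>R P (Wvec1 k) + (1/2 * (vv (Suc k) t * vv (Suc k) t)) *\<^sub>R P (Wvec2 k)
     + (uu (Suc k) t * vv k t) *\<^sub>R P (Ceven k) + (uu (Suc k) t * vv (Suc k) t) *\<^sub>R P (Codd k)
       = T k + (if k = j div 2 then (uu (Suc (j div 2)) t * vv ((j + 1) div 2) t) *\<^sub>R P (Cvec j) else 0)"
      proof cases
        case 1 thus ?thesis by (auto simp: T_def Cvec_def)
      next
        case 2
        hence "j = Suc (2 * k)" by simp
        thus ?thesis by (simp add: T_def Cvec_def)
      next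
        case 3
        hence "2 * k \<noteq> j" "2 * k + 1 \<noteq> j" by auto
        thus ?thesis using 3 by (simp add: T_def)
      qed
    qed
    also have "\<dots> = (\<Sum>k<n. T k) + (uu (Suc (j div 2)) t * vv ((j + 1) div 2) t) *\<^sub>R P (Cvec j)"
      using jn by (simp add: sum.distrib)
    finally show ?thesis by simp
  qed
  have "norm (\<Sum>k<n. T k) \<le> (\<Sum>k<n. 4 * ?B)" by (rule sum_norm_le) (use TB in simp)
  thus ?thesis unfolding eq by simp
qed

text \<open>A predicate in C and \<tau>0, because these must be chosen before the pulse. The
  condition a \<le> \<tau>^(j+2) makes cubic errors as small as a^2 \<tau>^(j+2), and \<tau>^n \<le>
  a makes the n-th primitives O(a^2). G is the primitive of the leading monomial.\<close>

definition pulse_estimate :: "nat \<Rightarrow> nat \<Rightarrow> real \<Rightarrow> ('v \<Rightarrow> 'v) \<Rightarrow> real \<Rightarrow> real \<Rightarrow> bool" where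
  "pulse_estimate n j M P C \<tau>0 \<longleftrightarrow> (\<forall>\<tau> a uu vv x G. 0 < \<tau> \<longrightarrow> \<tau> \<le> \<tau>0 \<longrightarrow> 0 < a \<longrightarrow> a \<le> \<tau> ^ (j + 2) \<longrightarrow> \<tau> ^ n \<le> a \<longrightarrow>
     (\<forall>k<n. \<forall>t\<in>{-\<tau>..0}. (uu (Suc k) has_real_derivative uu k t) (at t within {-\<tau>..0})) \<longrightarrow>
     (\<forall>k<n. \<forall>t\<in>{-\<tau>..0}. (vv (Suc k) has_real_derivative vv k t) (at t within {-\<tau>..0})) \<longrightarrow>
     (\<forall>k\<le>n. \<forall>t\<in>{-\<tau>..0}. \<bar>uu k t\<bar> \<le> M * a * \<tau> ^ k \<and> \<bar>vv k t\<bar> \<le> M * a * \<tau> ^ k) \<longrightarrow>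
     (\<forall>k<n. uu (Suc k) (- \<tau>) = 0 \<and> vv (Suc k) (- \<tau>) = 0 \<and> uu (Suc k) 0 = 0 \<and> vv (Suc k) 0 = 0) \<longrightarrow>
     sol (\<lambda>t. (uu 0 t, vv 0 t)) (- \<tau>) 0 x \<longrightarrow> x (- \<tau>) = 0 \<longrightarrow>
     (\<forall>t\<in>{-\<tau>..0}. (G has_real_derivative uu (Suc (j div 2)) t * vv ((j + 1) div 2) t) (at t within {-\<tau>..0})) \<longrightarrow> G (- \<tau>) = 0 \<longrightarrow>
     norm (P (x 0) - G 0 *\<^sub>R P (Cvec j)) \<le> C * (a\<^sup>2 * \<tau> ^ (j + 3)) \<and> norm (x 0) \<le> C * a\<^sup>2)"

text \<open>At time 0 all primitives vanish, so the reduced state has the same end point as x. Its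
  projection y satisfies y' = P A y + \<omega> P(C_j) + O(a^2 \<tau>^(j+2)), an equation closed by
  hypothesis \<open>PA\<close>. Since \<omega> = O(a^2 \<tau>^(j+1)), y is O(a^2 \<tau>^(j+2)) on an
  interval of length \<tau>, and one more integration gives the error a^2 \<tau>^(j+3).\<close>

lemma quadratic_estimate:
  fixes P :: "'v \<Rightarrow> 'v"
  assumes P: "linear P" and PA: "\<And>x. P (A x) = P (A (P x))" and M: "1 \<le> M" and j: "j < 2 * n"
    and kill_c: "P (c1 n) = 0" "P (c2 n) = 0"
    and kill_W: "\<And>k. 2 * k + 3 \<le> j + 2 \<Longrightarrow> P (Wvec1 k) = 0 \<and> P (Wvec2 k) = 0"
    and kill_C: "\<And>i. i < j \<Longrightarrow> P (Cvec i) = 0"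
  shows "\<exists>C>0. \<exists>\<tau>0>0. pulse_estimate n j M P C \<tau>0"
proof -
  obtain H where H': "1 \<le> H \<and> K \<le> H \<and> (\<forall>k\<le>n. \<forall>x. norm (J1 k x) \<le> H * norm x) \<and> (\<forall>k\<le>n. \<forall>x. norm (J2 k x) \<le> H * norm x) \<and>
    (\<forall>x y. norm (Q x y) \<le> H * norm x * norm y) \<and> (\<forall>x. norm (P x) \<le> H * norm x) \<and> (\<forall>x. norm (P (A x)) \<le> H * norm x) \<and>
    (\<forall>k\<le>n. norm (c1 k) \<le> H \<and> norm (c2 k) \<le> H \<and> norm (Wvec1 k) \<le> H \<and> norm (Wvec2 k) \<le> H \<and> norm (Ceven k) \<le> H \<and> norm (Codd k) \<le> H)"
    by (rule exE[OF uniform_constant[OF P, of n]])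
  have H: "1 \<le> H" "K \<le> H" "\<And>k x. k \<le> n \<Longrightarrow> norm (J1 k x) \<le> H * norm x" "\<And>k x. k \<le> n \<Longrightarrow> norm (J2 k x) \<le> H * norm x"
    "\<And>x y. norm (Q x y) \<le> H * norm x * norm y" "\<And>x. norm (P x) \<le> H * norm x" "\<And>x. norm (P (A x)) \<le> H * norm x"
    "\<And>k. k \<le> n \<Longrightarrow> norm (c1 k) \<le> H \<and> norm (c2 k) \<le> H \<and> norm (Wvec1 k) \<le> H \<and> norm (Wvec2 k) \<le> H \<and> norm (Ceven k) \<le> H \<and> norm (Codd k) \<le> H"
    using H' by simp_all
  have H0: "0 \<le> H" using H(1) by simp
  have M0: "0 \<le> M" using M by simp
  have K0: "0 \<le> K" using K_ge1 by simp
  \<comment> \<open>In turn these bound x by X a, \<open>e\<close> by E a^2, \<open>r0\<close> by R0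
    a^3, the linearly reduced state by Z a^2, the remainder by Rn a^3, \<open>quad_terms\<close> by
    Sn a^2 and the quadratically reduced state by 2 Y a^2. After projection, Gt bounds the
    inhomogeneity and Ct the derivative of y minus its leading part, both in units of a^2
    \<tau>^(j+2).\<close>
  define X where "X = 8 * H * M"
  define E where "E = H * X\<^sup>2 + 2 * M * H * X"
  define R0 where "R0 = H * X ^ 3 + 2 * M * (H * X\<^sup>2)"
  define Z where "Z = 2 * (2 * M * H + E)"
  define Rn where "Rn = R0 + real n * (2 * (M * (H * E)))"
  define Sn where "Sn = real n * (4 * (M * M * H))"
  define Y where "Y = 2 * M * H + H * Z\<^sup>2 + 2 * (M * (H * Z)) + Sn + Rn"
  define G1 where "G1 = H * (H * Z\<^sup>2 + 2 * (M * (H * Z)) + Rn)"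
  define Gt where "Gt = G1 + real n * (4 * (M * M * (H * H)))"
  define Ct where "Ct = 2 * H * (Gt + M * M * (H * H)) + Gt"
  have nn: "0 \<le> X" "0 \<le> E" "0 \<le> R0" "0 \<le> Z" "0 \<le> Rn" "0 \<le> Sn" "0 \<le> Y" "0 \<le> G1" "0 \<le> Gt" "0 \<le> Ct"
    unfolding Ct_def Gt_def G1_def Y_def Sn_def Rn_def Z_def R0_def E_def X_def using H0 M0 by auto
  define C where "C = 1 + Ct + 2 * Y"
  \<comment> \<open>\<theta> and 1 / (2 H) make the interval short for the state equation and for
    the projected one; 1 / (2 M) keeps the controls, of size at most 2 M a with a \<le> \<tau>,
    below 1.\<close>
  define \<tau>0 where "\<tau>0 = min (min 1 \<theta>) (min (1 / (2 * H)) (1 / (2 * M)))"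
  have "0 < C" using nn by (simp add: C_def)
  moreover have "0 < \<tau>0" using \<theta>_pos H(1) M by (simp add: \<tau>0_def)
  moreover have "norm (P (x 0) - G 0 *\<^sub>R P (Cvec j)) \<le> C * (a\<^sup>2 * \<tau> ^ (j + 3)) \<and> norm (x 0) \<le> C * a\<^sup>2"
    if \<tau>: "0 < \<tau>" "\<tau> \<le> \<tau>0" and a: "0 < a" "a \<le> \<tau> ^ (j + 2)" "\<tau> ^ n \<le> a"
      and uu': "\<forall>k<n. \<forall>t\<in>{-\<tau>..0}. (uu (Suc k) has_real_derivative uu k t) (at t within {-\<tau>..0})"
      and vv': "\<forall>k<n. \<forall>t\<in>{-\<tau>..0}. (vv (Suc k) has_real_derivative vv k t) (at t within {-\<tau>..0})"
      and bd: "\<forall>k\<le>n. \<forall>t\<in>{-\<tau>..0}. \<bar>uu k t\<bar> \<le> M * a * \<tau> ^ k \<and> \<bar>vv k t\<bar> \<le> M * a * \<tau> ^ k"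
      and ends: "\<forall>k<n. uu (Suc k) (- \<tau>) = 0 \<and> vv (Suc k) (- \<tau>) = 0 \<and> uu (Suc k) 0 = 0 \<and> vv (Suc k) 0 = 0"
      and x: "sol (\<lambda>t. (uu 0 t, vv 0 t)) (- \<tau>) 0 x" "x (- \<tau>) = 0"
      and G: "\<forall>t\<in>{-\<tau>..0}. (G has_real_derivative uu (Suc (j div 2)) t * vv ((j + 1) div 2) t) (at t within {-\<tau>..0})"
        "G (- \<tau>) = 0"
    for \<tau> a uu vv x G
  proof -
    have \<tau>1: "\<tau> \<le> 1" "\<tau> \<le> \<theta>" "H * \<tau> \<le> 1 / 2" "2 * M * \<tau> \<le> 1"
      using \<tau>(2) H(1) M by (auto simp: \<tau>0_def field_simps)
    have K\<tau>: "K * \<tau> \<le> 1 / 2" using \<tau>1(3) mult_right_mono[OF H(2), of \<tau>] \<tau>(1) by linarith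
    have pow1: "\<tau> ^ k \<le> 1" for k using \<tau> \<tau>1 by (simp add: power_le_one)
    have a1: "a \<le> 1" using a(2) pow1 by (rule order_trans)
    have a\<tau>: "a \<le> \<tau>"
    proof -
      have "\<tau> ^ (j + 2) \<le> \<tau> ^ 1" using \<tau> \<tau>1 by (intro power_decreasing) auto
      with a(2) show ?thesis by simp
    qed
    have Ma: "2 * M * a \<le> 1" using mult_left_mono[OF a\<tau>, of "2 * M"] \<tau>1(4) M0 by simp
    have a0: "0 \<le> a" using a(1) by simp
    have a2: "a\<^sup>2 \<le> a" "a ^ 3 \<le> a\<^sup>2" "a ^ 4 \<le> a ^ 3" "a ^ 3 \<le> a\<^sup>2 * \<tau> ^ (j + 2)"
    proof -
      show "a\<^sup>2 \<le> a" using power_decreasing[of 1 2 a] a0 a1 by simp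
      show "a ^ 3 \<le> a\<^sup>2" "a ^ 4 \<le> a ^ 3" using a0 a1 by (auto intro: power_decreasing)
      have "a\<^sup>2 * a \<le> a\<^sup>2 * \<tau> ^ (j + 2)" using a(2) by (intro mult_left_mono) auto
      thus "a ^ 3 \<le> a\<^sup>2 * \<tau> ^ (j + 2)" by (simp add: power3_eq_cube power2_eq_square)
    qed
    have u: "\<bar>uu k t\<bar> \<le> M * a" "\<bar>vv k t\<bar> \<le> M * a" if "k \<le> n" "t \<in> {-\<tau>..0}" for k t
    proof -
      have "M * a * \<tau> ^ k \<le> M * a * 1" using M0 a0 pow1 by (intro mult_left_mono) auto
      thus "\<bar>uu k t\<bar> \<le> M * a" "\<bar>vv k t\<bar> \<le> M * a" using bd that by fastforce+
    qed
    \<comment> \<open>Here \<tau>^n \<le> a turns the n-th primitives into terms of the size of the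
      quadratic ones.\<close>
    have un: "\<bar>uu n t\<bar> \<le> M * a\<^sup>2" "\<bar>vv n t\<bar> \<le> M * a\<^sup>2" if "t \<in> {-\<tau>..0}" for t
    proof -
      have "M * a * \<tau> ^ n \<le> M * a * a" using M0 a0 a(3) by (intro mult_left_mono) auto
      thus "\<bar>uu n t\<bar> \<le> M * a\<^sup>2" "\<bar>vv n t\<bar> \<le> M * a\<^sup>2" using bd that by (fastforce simp: power2_eq_square mult.assoc)+
    qed
    have xX: "norm (x t) \<le> X * a" if t: "t \<in> {-\<tau>..0}" for t
    proof -
      have "norm (x t) \<le> 2 * (norm (x (- \<tau>)) + (0 - - \<tau>) * (2 * K * (2 * M * a)))"
      proof (rule sol_norm_le[OF x(1) _ t])
        fix t assume "t \<in> {-\<tau>..0}"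
        from u[OF _ this, of 0] norm_Pair_le2[of "uu 0 t" "vv 0 t"]
        show "norm (uu 0 t, vv 0 t) \<le> 2 * M * a" by simp
      qed (use \<tau>1 Ma in auto)
      also have "\<dots> = 8 * (K * \<tau>) * (M * a)" using x(2) by simp
      also have "\<dots> \<le> 8 * (H * 1) * (M * a)"
        using \<tau> \<tau>1 H(1,2) K0 M0 a0 by (intro mult_right_mono mult_left_mono mult_mono) auto
      finally show ?thesis by (simp add: X_def mult_ac)
    qed
    have xR: "norm (x t) \<le> R" if "t \<in> {-\<tau>..0}" for t using x(1) that by (auto simp: sol_def)
    define x' where "x' t = F (x t) (uu 0 t, vv 0 t)" for t
    define e where "e t = x' t - A (x t) - uu 0 t *\<^sub>R b1 - vv 0 t *\<^sub>R b2" for t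
    define r0 where "r0 t = e t - (1/2) *\<^sub>R Q (x t) (x t) - uu 0 t *\<^sub>R B1 (x t) - vv 0 t *\<^sub>R B2 (x t)" for t
    have der: "(x has_vector_derivative x' t) (at t within {-\<tau>..0})" if "t \<in> {-\<tau>..0}" for t
      using x(1) that by (auto simp: sol_def x'_def)
    have eE: "norm (e t) \<le> E * a\<^sup>2" if t: "t \<in> {-\<tau>..0}" for t
    proof -
      have "norm (e t) \<le> K * norm (x t) ^ 2 + 2 * (M * a) * K * norm (x t)"
        unfolding e_def x'_def by (rule F_residuals(1)[OF xR[OF t] u(1)[OF _ t] u(2)[OF _ t]]) auto
      also have "\<dots> \<le> H * (X * a) ^ 2 + 2 * (M * a) * H * (X * a)"
        using xX[OF t] H(2) H0 K0 M0 a0 nn(1) by (intro add_mono mult_mono power_mono mult_nonneg_nonneg order_refl) auto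
      also have "\<dots> = E * a\<^sup>2" by (simp add: E_def power2_eq_square algebra_simps)
      finally show ?thesis .
    qed
    have rR: "norm (r0 t) \<le> R0 * a ^ 3" if t: "t \<in> {-\<tau>..0}" for t
    proof -
      have "norm (r0 t) \<le> K * norm (x t) ^ 3 + 2 * (M * a) * (K * norm (x t) ^ 2)"
        unfolding r0_def e_def x'_def by (rule F_residuals(2)[OF xR[OF t] u(1)[OF _ t] u(2)[OF _ t]]) auto
      also have "\<dots> \<le> H * (X * a) ^ 3 + 2 * (M * a) * (H * (X * a) ^ 2)"
        using xX[OF t] H(2) H0 K0 M0 a0 nn(1) by (intro add_mono mult_mono power_mono mult_nonneg_nonneg order_refl) auto
      also have "\<dots> = R0 * a ^ 3" by (simp add: R0_def power2_eq_square power3_eq_cube algebra_simps)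
      finally show ?thesis .
    qed
    let ?z = "linear_reduced uu vv x n" and ?Y = "quad_reduced uu vv x n"
    let ?r = "\<lambda>t. remainder (\<lambda>i. uu i t) (\<lambda>i. vv i t) (e t) (r0 t) n"
    have zz0: "linear_reduced uu vv x k (- \<tau>) = 0" if "k \<le> n" for k
      using that by (induction k) (use ends x(2) in auto)
    have zder: "(?z has_vector_derivative (A (?z t) + uu n t *\<^sub>R c1 n + vv n t *\<^sub>R c2 n + e t)) (at t within {-\<tau>..0})"
      if "t \<in> {-\<tau>..0}" for t
      by (rule linear_reduced_derivative[where n = n and x' = x']) (use uu' vv' der that e_def in auto)
    have zZ: "norm (?z t) \<le> Z * a\<^sup>2" if t: "t \<in> {-\<tau>..0}" for t
    proof -
      have "norm (?z t) \<le> 2 * (norm (?z (- \<tau>)) + (0 - - \<tau>) * ((2 * M * H + E) * a\<^sup>2))"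
      proof (rule short_time_bound[OF zder])
        fix t assume t: "t \<in> {-\<tau>..0}"
        have 1: "norm (uu n t *\<^sub>R c1 n) \<le> M * a\<^sup>2 * H" "norm (vv n t *\<^sub>R c2 n) \<le> M * a\<^sup>2 * H"
          using un[OF t] H(8)[of n] by (auto intro!: norm_scaleR_bound simp del: norm_scaleR)
        have "norm (A (?z t) + uu n t *\<^sub>R c1 n + vv n t *\<^sub>R c2 n + e t) \<le> K * norm (?z t) + M * a\<^sup>2 * H + M * a\<^sup>2 * H + E * a\<^sup>2"
          by (rule order_trans[OF norm_add4 add_mono[OF add_mono[OF add_mono[OF bdA 1(1)] 1(2)] eE[OF t]]])
        thus "norm (A (?z t) + uu n t *\<^sub>R c1 n + vv n t *\<^sub>R c2 n + e t) \<le> K * norm (?z t) + (2 * M * H + E) * a\<^sup>2"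
          by (simp add: algebra_simps)
      qed (use K0 K\<tau> nn M0 H0 t in auto)
      also have "\<dots> = \<tau> * (Z * a\<^sup>2)" using zz0[of n] by (simp add: Z_def)
      also have "\<dots> \<le> 1 * (Z * a\<^sup>2)" using \<tau>1 nn by (intro mult_right_mono) auto
      finally show ?thesis by simp
    qed
    have rRn: "norm (?r t) \<le> Rn * a ^ 3" if t: "t \<in> {-\<tau>..0}" for t
    proof -
      have "norm (?r t) \<le> norm (r0 t) + real n * (2 * ((M * a) * (H * (E * a\<^sup>2))))"
        by (rule norm_remainder_le) (use H(3,4) u[OF _ t] eE[OF t] H0 in auto)
      also have "\<dots> \<le> R0 * a ^ 3 + real n * (2 * ((M * a) * (H * (E * a\<^sup>2))))"
        using rR[OF t] by simp
      also have "\<dots> = Rn * a ^ 3" by (simp add: Rn_def power2_eq_square power3_eq_cube algebra_simps)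
      finally show ?thesis .
    qed
    have SSn: "norm (quad_terms uu vv n t) \<le> Sn * a\<^sup>2" if t: "t \<in> {-\<tau>..0}" for t
    proof -
      have "norm (quad_terms uu vv n t) \<le> real n * (4 * ((M * a) * (M * a) * H))"
        by (rule norm_quad_terms_le) (use H(8) u[OF _ t] in auto)
      also have "\<dots> = Sn * a\<^sup>2" by (simp add: Sn_def power2_eq_square algebra_simps)
      finally show ?thesis .
    qed
    let ?q = "\<lambda>t. (1/2) *\<^sub>R Q (?z t) (?z t)" and ?j1 = "\<lambda>t. uu n t *\<^sub>R J1 n (?z t)" and ?j2 = "\<lambda>t. vv n t *\<^sub>R J2 n (?z t)"
    have q: "norm (?q t) \<le> H * Z\<^sup>2 * a ^ 4" if t: "t \<in> {-\<tau>..0}" for t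
    proof -
      have "norm (?q t) \<le> norm (Q (?z t) (?z t))" by simp
      also have "\<dots> \<le> H * norm (?z t) * norm (?z t)" by (rule H(5))
      also have "\<dots> \<le> H * (Z * a\<^sup>2) * (Z * a\<^sup>2)"
        using zZ[OF t] H0 nn by (intro mult_mono) auto
      also have "\<dots> = H * Z\<^sup>2 * a ^ 4" by (simp add: power2_eq_square power4_eq_xxxx algebra_simps)
      finally show ?thesis .
    qed
    have jj: "norm (?j1 t) \<le> M * (H * Z) * a ^ 4" "norm (?j2 t) \<le> M * (H * Z) * a ^ 4" if t: "t \<in> {-\<tau>..0}" for t
    proof -
      have "norm (J1 n (?z t)) \<le> H * (Z * a\<^sup>2)" "norm (J2 n (?z t)) \<le> H * (Z * a\<^sup>2)"
        using order_trans[OF H(3) mult_left_mono[OF zZ[OF t] H0]] order_trans[OF H(4) mult_left_mono[OF zZ[OF t] H0]] by auto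
      hence "norm (?j1 t) \<le> (M * a\<^sup>2) * (H * (Z * a\<^sup>2))" "norm (?j2 t) \<le> (M * a\<^sup>2) * (H * (Z * a\<^sup>2))"
        using un[OF t] by (auto intro!: norm_scaleR_bound simp del: norm_scaleR)
      moreover have "(M * a\<^sup>2) * (H * (Z * a\<^sup>2)) = M * (H * Z) * a ^ 4"
        by (simp add: power2_eq_square power4_eq_xxxx algebra_simps)
      ultimately show "norm (?j1 t) \<le> M * (H * Z) * a ^ 4" "norm (?j2 t) \<le> M * (H * Z) * a ^ 4" by simp_all
    qed
    have Yder: "(?Y has_vector_derivative (A (?Y t) + uu n t *\<^sub>R c1 n + vv n t *\<^sub>R c2 n + ?q t + ?j1 t + ?j2 t + quad_terms uu vv n t + ?r t)) (at t within {-\<tau>..0})"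
      if "t \<in> {-\<tau>..0}" for t
      by (rule quad_reduced_derivative[where n = n and x' = x']) (use uu' vv' der that e_def r0_def in auto)
    have Y0: "quad_reduced uu vv x k (- \<tau>) = 0" if "k \<le> n" for k
      using that by (induction k) (use ends x(2) in auto)
    have Yend: "quad_reduced uu vv x k 0 = x 0" if "k \<le> n" for k
      using that by (induction k) (use ends in auto)
    have quad_reduced: "norm (?Y t) \<le> 2 * Y * a\<^sup>2" if t: "t \<in> {-\<tau>..0}" for t
    proof -
      have "norm (?Y t) \<le> 2 * (norm (?Y (- \<tau>)) + (0 - - \<tau>) * (Y * a\<^sup>2))"
      proof (rule short_time_bound[OF Yder])
        fix t assume t: "t \<in> {-\<tau>..0}"
        have a42: "a ^ 4 \<le> a\<^sup>2" using a2 by linarith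
        have 1: "norm (uu n t *\<^sub>R c1 n) \<le> M * H * a\<^sup>2" "norm (vv n t *\<^sub>R c2 n) \<le> M * H * a\<^sup>2"
        proof -
          have "norm (uu n t *\<^sub>R c1 n) \<le> M * a\<^sup>2 * H" "norm (vv n t *\<^sub>R c2 n) \<le> M * a\<^sup>2 * H"
            using un[OF t] H(8)[of n] by (auto intro!: norm_scaleR_bound simp del: norm_scaleR)
          thus "norm (uu n t *\<^sub>R c1 n) \<le> M * H * a\<^sup>2" "norm (vv n t *\<^sub>R c2 n) \<le> M * H * a\<^sup>2" by (simp_all only: mult_ac)
        qed
        have 2: "H * Z\<^sup>2 * a ^ 4 \<le> H * Z\<^sup>2 * a\<^sup>2" using a42 H0 by (intro mult_left_mono) auto
        have 3: "M * (H * Z) * a ^ 4 \<le> M * (H * Z) * a\<^sup>2" using a42 H0 M0 nn by (intro mult_left_mono) auto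
        have 4: "Rn * a ^ 3 \<le> Rn * a\<^sup>2" using a2 nn by (intro mult_left_mono) auto
        have "norm (A (?Y t) + uu n t *\<^sub>R c1 n + vv n t *\<^sub>R c2 n + ?q t + ?j1 t + ?j2 t + quad_terms uu vv n t + ?r t)
          \<le> K * norm (?Y t) + M * H * a\<^sup>2 + M * H * a\<^sup>2 + H * Z\<^sup>2 * a\<^sup>2 + M * (H * Z) * a\<^sup>2 + M * (H * Z) * a\<^sup>2 + Sn * a\<^sup>2 + Rn * a\<^sup>2"
          by (intro order_trans[OF norm_triangle_ineq] add_mono bdA 1 order_trans[OF q[OF t] 2]
            order_trans[OF jj(1)[OF t] 3] order_trans[OF jj(2)[OF t] 3] SSn[OF t] order_trans[OF rRn[OF t] 4])
        also have "\<dots> = K * norm (?Y t) + Y * a\<^sup>2" by (simp add: Y_def algebra_simps)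
        finally show "norm (A (?Y t) + uu n t *\<^sub>R c1 n + vv n t *\<^sub>R c2 n + ?q t + ?j1 t + ?j2 t + quad_terms uu vv n t + ?r t)
          \<le> K * norm (?Y t) + Y * a\<^sup>2" .
      qed (use K0 K\<tau> nn t in auto)
      also have "\<dots> = \<tau> * (2 * Y * a\<^sup>2)" using Y0[of n] by simp
      also have "\<dots> \<le> 1 * (2 * Y * a\<^sup>2)" using \<tau>1 nn by (intro mult_right_mono) auto
      finally show ?thesis by simp
    qed
    have x0: "norm (x 0) \<le> C * a\<^sup>2"
    proof -
      have "norm (x 0) \<le> 2 * Y * a\<^sup>2" using quad_reduced[of 0] Yend[of n] \<tau>(1) by simp
      also have "\<dots> \<le> C * a\<^sup>2" using nn by (intro mult_right_mono) (auto simp: C_def)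
      finally show ?thesis .
    qed
    define \<omega> where "\<omega> t = uu (Suc (j div 2)) t * vv ((j + 1) div 2) t" for t
    define y where "y t = P (?Y t)" for t
    \<comment> \<open>Everything in the projected equation except P A y and the leading monomial;
      the terms with \<open>c1 n\<close> and \<open>c2 n\<close> are annihilated by P.\<close>
    define g where "g t = P (?q t + ?j1 t + ?j2 t + ?r t) + (P (quad_terms uu vv n t) - \<omega> t *\<^sub>R P (Cvec j))" for t
    have blP: "bounded_linear P" using P by (simp add: linear_conv_bounded_linear)
    have yder: "(y has_vector_derivative (P (A (y t)) + g t + \<omega> t *\<^sub>R P (Cvec j))) (at t within {-\<tau>..0})"
      if "t \<in> {-\<tau>..0}" for t
    proof -
      have "(y has_vector_derivative P (A (?Y t) + uu n t *\<^sub>R c1 n + vv n t *\<^sub>R c2 n + ?q t + ?j1 t + ?j2 t + quad_terms uu vv n t + ?r t)) (at t within {-\<tau>..0})"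
        unfolding y_def by (rule bounded_linear.has_vector_derivative[OF blP Yder[OF that]])
      moreover have "P (A (?Y t) + uu n t *\<^sub>R c1 n + vv n t *\<^sub>R c2 n + ?q t + ?j1 t + ?j2 t + quad_terms uu vv n t + ?r t) =
         P (A (y t)) + g t + \<omega> t *\<^sub>R P (Cvec j)"
        using PA[of "?Y t"] by (simp add: g_def y_def linear_add[OF P] linear_scale[OF P] kill_c)
      ultimately show ?thesis by simp
    qed
    have gG: "norm (g t) \<le> Gt * (a\<^sup>2 * \<tau> ^ (j + 2))" if t: "t \<in> {-\<tau>..0}" for t
    proof -
      have 2: "H * Z\<^sup>2 * a ^ 4 \<le> H * Z\<^sup>2 * a ^ 3" using a2 H0 by (intro mult_left_mono) auto
      have 3: "M * (H * Z) * a ^ 4 \<le> M * (H * Z) * a ^ 3" using a2 H0 M0 nn by (intro mult_left_mono) auto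
      have "norm (?q t + ?j1 t + ?j2 t + ?r t) \<le> H * Z\<^sup>2 * a ^ 3 + M * (H * Z) * a ^ 3 + M * (H * Z) * a ^ 3 + Rn * a ^ 3"
        by (rule order_trans[OF norm_add4 add_mono[OF add_mono[OF add_mono[OF order_trans[OF q[OF t] 2]
           order_trans[OF jj(1)[OF t] 3]] order_trans[OF jj(2)[OF t] 3]] rRn[OF t]]])
      hence "H * norm (?q t + ?j1 t + ?j2 t + ?r t) \<le> H * (H * Z\<^sup>2 * a ^ 3 + M * (H * Z) * a ^ 3 + M * (H * Z) * a ^ 3 + Rn * a ^ 3)"
        using H0 by (rule mult_left_mono)
      also have "\<dots> = G1 * a ^ 3" by (simp add: G1_def algebra_simps)
      also have "\<dots> \<le> G1 * (a\<^sup>2 * \<tau> ^ (j + 2))" using a2(4) nn by (intro mult_left_mono) auto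
      finally have 1: "norm (P (?q t + ?j1 t + ?j2 t + ?r t)) \<le> G1 * (a\<^sup>2 * \<tau> ^ (j + 2))"
        using H(6)[of "?q t + ?j1 t + ?j2 t + ?r t"] by linarith
      have Pb: "norm (P v) \<le> H * H" if "norm v \<le> H" for v
        using order_trans[OF H(6) mult_left_mono[OF that H0]] .
      have "norm (P (quad_terms uu vv n t) - \<omega> t *\<^sub>R P (Cvec j)) \<le> real n * (4 * ((M * a) * (M * a) * \<tau> ^ (j + 2) * (H * H)))"
        unfolding \<omega>_def
      proof (rule quad_terms_leading_term[OF P j kill_W kill_C])
        fix k assume "k < n"
        hence "k \<le> n" by simp
        from H(8)[OF this] show "norm (P (Wvec1 k)) \<le> H * H \<and> norm (P (Wvec2 k)) \<le> H * H \<and> norm (P (Ceven k)) \<le> H * H \<and> norm (P (Codd k)) \<le> H * H"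
          using Pb by blast
      qed (use bd t \<tau> \<tau>1 M0 a0 H0 in auto)
      also have "\<dots> = (real n * (4 * (M * M * (H * H)))) * (a\<^sup>2 * \<tau> ^ (j + 2))" by (simp only: power2_eq_square mult_ac)
      finally have 4: "norm (P (quad_terms uu vv n t) - \<omega> t *\<^sub>R P (Cvec j)) \<le> (real n * (4 * (M * M * (H * H)))) * (a\<^sup>2 * \<tau> ^ (j + 2))" .
      have "norm (g t) \<le> G1 * (a\<^sup>2 * \<tau> ^ (j + 2)) + (real n * (4 * (M * M * (H * H)))) * (a\<^sup>2 * \<tau> ^ (j + 2))"
        unfolding g_def by (rule order_trans[OF norm_triangle_ineq add_mono[OF 1 4]])
      thus ?thesis unfolding Gt_def by (simp only: distrib_right)
    qed
    have \<omega>C: "norm (\<omega> t *\<^sub>R P (Cvec j)) \<le> (M * M * (H * H)) * (a\<^sup>2 * \<tau> ^ (j + 1))" if t: "t \<in> {-\<tau>..0}" for t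
    proof -
      have jn: "Suc (j div 2) \<le> n" "(j + 1) div 2 \<le> n" "j div 2 \<le> n" using j by auto
      have "\<bar>\<omega> t\<bar> \<le> (M * a * \<tau> ^ Suc (j div 2)) * (M * a * \<tau> ^ ((j + 1) div 2))"
        unfolding \<omega>_def by (rule abs_mult_bound) (use bd t jn in auto)
      also have "\<dots> = M * M * (a\<^sup>2 * (\<tau> ^ (Suc (j div 2) + (j + 1) div 2)))"
        unfolding power_add power2_eq_square by (simp only: mult_ac)
      also have "Suc (j div 2) + (j + 1) div 2 = j + 1" by linarith
      finally have 1: "\<bar>\<omega> t\<bar> \<le> M * M * (a\<^sup>2 * \<tau> ^ (j + 1))" .
      have "norm (Cvec j) \<le> H" using H(8)[OF jn(3)] by (auto simp: Cvec_def)
      hence "norm (P (Cvec j)) \<le> H * H" using order_trans[OF H(6) mult_left_mono[OF _ H0]] by blast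
      from norm_scaleR_bound[OF 1 this] show ?thesis by (simp only: mult_ac)
    qed
    have y0: "y (- \<tau>) = 0" using Y0[of n] by (simp add: y_def linear_0[OF P])
    have yb: "norm (y t) \<le> 2 * (Gt + M * M * (H * H)) * (a\<^sup>2 * \<tau> ^ (j + 2))" if t: "t \<in> {-\<tau>..0}" for t
    proof -
      have "norm (y t) \<le> 2 * (norm (y (- \<tau>)) + (0 - - \<tau>) * ((Gt + M * M * (H * H)) * (a\<^sup>2 * \<tau> ^ (j + 1))))"
      proof (rule short_time_bound[OF yder])
        fix t assume t: "t \<in> {-\<tau>..0}"
        have "\<tau> ^ (j + 2) \<le> \<tau> ^ (j + 1)" using \<tau> \<tau>1 by (intro power_decreasing) auto
        hence 1: "Gt * (a\<^sup>2 * \<tau> ^ (j + 2)) \<le> Gt * (a\<^sup>2 * \<tau> ^ (j + 1))" using nn by (intro mult_left_mono) auto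
        have "norm (P (A (y t)) + g t + \<omega> t *\<^sub>R P (Cvec j)) \<le> H * norm (y t) + Gt * (a\<^sup>2 * \<tau> ^ (j + 1)) + (M * M * (H * H)) * (a\<^sup>2 * \<tau> ^ (j + 1))"
          by (rule order_trans[OF norm_triangle_ineq add_mono[OF order_trans[OF norm_triangle_ineq
             add_mono[OF H(7) order_trans[OF gG[OF t] 1]]] \<omega>C[OF t]]])
        thus "norm (P (A (y t)) + g t + \<omega> t *\<^sub>R P (Cvec j)) \<le> H * norm (y t) + (Gt + M * M * (H * H)) * (a\<^sup>2 * \<tau> ^ (j + 1))"
          unfolding distrib_right by (simp only: add.assoc)
      qed (use H0 \<tau>1 nn M0 t \<tau> in auto)
      also have "\<dots> = 2 * (Gt + M * M * (H * H)) * (a\<^sup>2 * (\<tau> * \<tau> ^ (j + 1)))" using y0 by simp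
      also have "\<tau> * \<tau> ^ (j + 1) = \<tau> ^ (j + 2)" by simp
      finally show ?thesis .
    qed
    have "norm ((y 0 - G 0 *\<^sub>R P (Cvec j)) - (y (- \<tau>) - G (- \<tau>) *\<^sub>R P (Cvec j))) \<le> (Ct * (a\<^sup>2 * \<tau> ^ (j + 2))) * \<bar>0 - - \<tau>\<bar>"
    proof (rule vector_derivative_increment_le[where y = "\<lambda>t. y t - G t *\<^sub>R P (Cvec j)" and y' = "\<lambda>t. P (A (y t)) + g t"
        and a = "- \<tau>" and b = 0])
      fix t assume t: "t \<in> {-\<tau>..0}"
      have "((\<lambda>t. y t - G t *\<^sub>R P (Cvec j)) has_vector_derivative
         (P (A (y t)) + g t + \<omega> t *\<^sub>R P (Cvec j)) - (G t *\<^sub>R 0 + \<omega> t *\<^sub>R P (Cvec j))) (at t within {-\<tau>..0})"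
        by (intro has_vector_derivative_diff yder[OF t] has_vector_derivative_scaleR has_vector_derivative_const)
           (use G(1) t in \<open>simp add: \<omega>_def\<close>)
      thus "((\<lambda>t. y t - G t *\<^sub>R P (Cvec j)) has_vector_derivative P (A (y t)) + g t) (at t within {-\<tau>..0})" by simp
      have "norm (P (A (y t)) + g t) \<le> H * (2 * (Gt + M * M * (H * H)) * (a\<^sup>2 * \<tau> ^ (j + 2))) + Gt * (a\<^sup>2 * \<tau> ^ (j + 2))"
        by (rule order_trans[OF norm_triangle_ineq add_mono[OF order_trans[OF H(7) mult_left_mono[OF yb[OF t] H0]] gG[OF t]]])
      also have "\<dots> = Ct * (a\<^sup>2 * \<tau> ^ (j + 2))"
        unfolding Ct_def distrib_right[of "2 * H * (Gt + M * M * (H * H))"] by (simp only: mult_ac)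
      finally show "norm (P (A (y t)) + g t) \<le> Ct * (a\<^sup>2 * \<tau> ^ (j + 2))" .
    qed (use \<tau> in auto)
    hence "norm (P (x 0) - G 0 *\<^sub>R P (Cvec j)) \<le> Ct * (a\<^sup>2 * (\<tau> * \<tau> ^ (j + 2)))"
      using y0 G(2) Yend[of n] \<tau>(1) by (simp add: y_def mult_ac)
    also have "\<tau> * \<tau> ^ (j + 2) = \<tau> ^ (j + 3)" by (simp add: eval_nat_numeral)
    also have "Ct * (a\<^sup>2 * \<tau> ^ (j + 3)) \<le> C * (a\<^sup>2 * \<tau> ^ (j + 3))"
      using nn \<tau> by (intro mult_right_mono) (auto simp: C_def)
    finally show ?thesis using x0 by blast
  qed
  ultimately show ?thesis unfolding pulse_estimate_def by blast
qed

end

section \<open>Rescaled pulses\<close>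

text \<open>\<open>k\<close>-th time derivative of the pulse built from the \<open>i\<close>-th derivative of the profile \<open>\<Phi> 0\<close>.\<close>

definition scaled :: "(nat \<Rightarrow> real \<Rightarrow> real) \<Rightarrow> (real \<Rightarrow> real) \<Rightarrow> nat \<Rightarrow> real \<Rightarrow> real \<Rightarrow> nat \<Rightarrow> real \<Rightarrow> real \<Rightarrow> real" where
  "scaled \<Phi> g i \<alpha> \<sigma> k z t = g z * \<bar>z\<bar> powr (\<alpha> - real k * \<sigma>) * \<Phi> (i + k) (t / \<bar>z\<bar> powr \<sigma>)"

text \<open>Every derivative of the profile has its support in [-1, 0]; hence a control built from a
  high derivative has many successive primitives that vanish at both ends.\<close>

locale profile =
  fixes \<Phi> :: "nat \<Rightarrow> real \<Rightarrow> real"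
  assumes der: "\<And>k t. (\<Phi> k has_real_derivative \<Phi> (Suc k) t) (at t)"
    and supp: "\<And>k t. t \<le> -1 \<or> 0 \<le> t \<Longrightarrow> \<Phi> k t = 0"
    and pos: "\<exists>t. \<Phi> 0 t \<noteq> 0"
begin

lemma cont: "continuous_on S (\<Phi> k)"
  by (rule DERIV_continuous_on[OF has_field_derivative_at_within[OF der]])

lemma bounded_each: "\<exists>M. \<forall>t. \<bar>\<Phi> k t\<bar> \<le> M"
proof -
  have "bounded (\<Phi> k ` {-1..0})" by (intro compact_imp_bounded compact_continuous_image cont) simp
  then obtain M where M: "\<forall>t\<in>{-1..0}. \<bar>\<Phi> k t\<bar> \<le> M" by (auto simp: bounded_iff)
  have "\<bar>\<Phi> k t\<bar> \<le> max M 0" for t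
    by (cases "t \<in> {-1..0}") (use M supp[of t k] in \<open>auto simp: le_max_iff_disj\<close>)
  thus ?thesis by blast
qed

lemma bounded_upto: "\<exists>M\<ge>1. \<forall>k\<le>N. \<forall>t. \<bar>\<Phi> k t\<bar> \<le> M"
proof (induction N)
  case 0
  obtain M where "\<forall>t. \<bar>\<Phi> 0 t\<bar> \<le> M" using bounded_each by blast
  thus ?case by (intro exI[of _ "max M 1"]) (auto simp: le_max_iff_disj)
next
  case (Suc N)
  then obtain M where M: "1 \<le> M" "\<forall>k\<le>N. \<forall>t. \<bar>\<Phi> k t\<bar> \<le> M" by blast
  obtain M' where M': "\<forall>t. \<bar>\<Phi> (Suc N) t\<bar> \<le> M'" using bounded_each by blast
  show ?case
  proof (intro exI[of _ "max M M'"] conjI allI impI)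
    show "1 \<le> max M M'" using M(1) by simp
    fix k t assume "k \<le> Suc N"
    thus "\<bar>\<Phi> k t\<bar> \<le> max M M'" using M(2) M' by (auto simp: le_Suc_eq le_max_iff_disj)
  qed
qed

text \<open>A vanishing derivative would make the preceding function constant, equal to its value 0
  at t = 1.\<close>

lemma nonzero: "\<exists>t. \<Phi> k t \<noteq> 0"
proof (induction k)
  case (Suc k)
  show ?case
  proof (rule ccontr)
    assume "\<not> ?thesis"
    hence "\<And>t. (\<Phi> k has_real_derivative 0) (at t)" using der[of k] by simp
    hence "\<Phi> k t = \<Phi> k 1" for t using DERIV_isconst_all[of "\<Phi> k" t 1] by blast
    thus False using Suc supp[of 1 k] by simp
  qed
qed (use pos in simp)

lemma integral_square_pos: "0 < integral {-1..0} (\<lambda>t. \<Phi> k t * \<Phi> k t)"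
proof -
  have c: "continuous_on {-1..0} (\<lambda>t. \<Phi> k t * \<Phi> k t)" by (intro continuous_intros cont)
  have nn: "0 \<le> integral {-1..0} (\<lambda>t. \<Phi> k t * \<Phi> k t)"
    by (rule integral_nonneg) (auto intro: integrable_continuous_interval c)
  moreover have "integral {-1..0} (\<lambda>t. \<Phi> k t * \<Phi> k t) \<noteq> 0"
  proof
    assume "integral {-1..0} (\<lambda>t. \<Phi> k t * \<Phi> k t) = 0"
    hence z: "\<Phi> k t * \<Phi> k t = 0" if "t \<in> {-1..0}" for t
      using integral_eq_0_iff[OF c] that by auto
    obtain t where "\<Phi> k t \<noteq> 0" using nonzero by blast
    thus False using z[of t] supp[of t k] by (cases "t \<in> {-1..0}") auto
  qed
  ultimately show ?thesis by simp
qed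

lemma scaled_derivative:
  "(scaled \<Phi> g i \<alpha> \<sigma> k z has_real_derivative scaled \<Phi> g i \<alpha> \<sigma> (Suc k) z t) (at t)"
proof (cases "z = 0")
  case True
  thus ?thesis by (simp add: scaled_def[abs_def])
next
  case False
  have "((\<lambda>t. g z * \<bar>z\<bar> powr (\<alpha> - real k * \<sigma>) * \<Phi> (i + k) (t / \<bar>z\<bar> powr \<sigma>)) has_real_derivative
     g z * \<bar>z\<bar> powr (\<alpha> - real k * \<sigma>) * (\<Phi> (Suc (i + k)) (t / \<bar>z\<bar> powr \<sigma>) * (1 / \<bar>z\<bar> powr \<sigma>))) (at t)"
    by (intro DERIV_cmult DERIV_chain'[where g = "\<Phi> (i + k)", OF _ der]) (use False in \<open>auto intro!: derivative_eq_intros\<close>)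
  moreover have "\<bar>z\<bar> powr (\<alpha> - real (Suc k) * \<sigma>) = \<bar>z\<bar> powr (\<alpha> - real k * \<sigma>) * (1 / \<bar>z\<bar> powr \<sigma>)"
    by (simp add: powr_diff[symmetric] distrib_right diff_diff_eq add.commute)
  ultimately show ?thesis by (simp add: scaled_def[abs_def] mult_ac)
qed

lemma scaled_bound:
  assumes "\<And>t. \<bar>\<Phi> (i + k) t\<bar> \<le> M" "\<bar>g z\<bar> \<le> 1"
  shows "\<bar>scaled \<Phi> g i \<alpha> \<sigma> k z t\<bar> \<le> M * \<bar>z\<bar> powr (\<alpha> - real k * \<sigma>)"
proof -
  have "\<bar>g z * \<bar>z\<bar> powr (\<alpha> - real k * \<sigma>) * \<Phi> (i + k) (t / \<bar>z\<bar> powr \<sigma>)\<bar> \<le> (1 * \<bar>z\<bar> powr (\<alpha> - real k * \<sigma>)) * M"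
    unfolding abs_mult using assms by (intro mult_mono) auto
  thus ?thesis by (simp add: scaled_def mult.commute)
qed

lemma scaled_support: "t \<le> - (\<bar>z\<bar> powr \<sigma>) \<or> 0 \<le> t \<Longrightarrow> scaled \<Phi> g i \<alpha> \<sigma> k z t = 0"
proof (cases "z = 0")
  case False
  assume "t \<le> - (\<bar>z\<bar> powr \<sigma>) \<or> 0 \<le> t"
  hence "t / \<bar>z\<bar> powr \<sigma> \<le> -1 \<or> 0 \<le> t / \<bar>z\<bar> powr \<sigma>" using False by (auto simp: divide_le_eq)
  thus ?thesis using supp by (simp add: scaled_def)
qed (simp add: scaled_def)

text \<open>Away from z = 0 the formula is continuous; at z = 0, where g may jump like
  \<open>sgn\<close> and the rescaling is singular, the positive power of |z| still forces the limit
  0.\<close>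

lemma scaled_continuous:
  assumes g: "continuous_on (- {0}) g" "\<And>z. \<bar>g z\<bar> \<le> 1" and pos: "0 < \<alpha> - real k * \<sigma>"
  shows "continuous_on S (\<lambda>(z, t). scaled \<Phi> g i \<alpha> \<sigma> k z t)"
proof (rule continuous_on_subset[OF _ subset_UNIV], unfold continuous_on_eq_continuous_at[OF open_UNIV], rule ballI)
  fix q :: "real \<times> real"
  obtain z0 t0 where q: "q = (z0, t0)" by (cases q)
  obtain M where M: "\<And>t. \<bar>\<Phi> (i + k) t\<bar> \<le> M" using bounded_each by blast
  show "isCont (\<lambda>(z, t). scaled \<Phi> g i \<alpha> \<sigma> k z t) q"
  proof (cases "z0 = 0")
    case False
    have op: "open ((- {0 :: real}) \<times> (UNIV :: real set))" by (intro open_Times open_Compl) auto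
    have "continuous_on ((- {0}) \<times> UNIV) (\<lambda>p :: real \<times> real. g (fst p) * \<bar>fst p\<bar> powr (\<alpha> - real k * \<sigma>) * \<Phi> (i + k) (snd p / \<bar>fst p\<bar> powr \<sigma>))"
      by (intro continuous_intros continuous_on_compose2[OF g(1)] continuous_on_compose2[OF cont[of UNIV]]) auto
    hence "continuous_on ((- {0}) \<times> UNIV) (\<lambda>(z, t). scaled \<Phi> g i \<alpha> \<sigma> k z t)"
      by (simp add: scaled_def case_prod_unfold)
    thus ?thesis using continuous_on_eq_continuous_at[OF op] False by (auto simp: q)
  next
    case True
    have "((\<lambda>p. (\<lambda>(z, t). scaled \<Phi> g i \<alpha> \<sigma> k z t) p) \<longlongrightarrow> 0) (at q)"
    proof (rule Lim_null_comparison)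
      show "\<forall>\<^sub>F p in at q. norm ((\<lambda>(z, t). scaled \<Phi> g i \<alpha> \<sigma> k z t) p) \<le> M * \<bar>fst p\<bar> powr (\<alpha> - real k * \<sigma>)"
        using scaled_bound[of i k M g, OF M g(2)] by (intro always_eventually) (auto simp: case_prod_unfold)
      have "continuous_on UNIV (\<lambda>p :: real \<times> real. M * \<bar>fst p\<bar> powr (\<alpha> - real k * \<sigma>))"
        using pos by (intro continuous_intros continuous_on_powr') auto
      hence "isCont (\<lambda>p :: real \<times> real. M * \<bar>fst p\<bar> powr (\<alpha> - real k * \<sigma>)) q"
        unfolding continuous_on_eq_continuous_at[OF open_UNIV] by blast
      thus "((\<lambda>p. M * \<bar>fst p\<bar> powr (\<alpha> - real k * \<sigma>)) \<longlongrightarrow> 0) (at q)"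
        using True by (simp add: isCont_def q)
    qed
    moreover have "(\<lambda>(z, t). scaled \<Phi> g i \<alpha> \<sigma> k z t) q = 0" using True by (simp add: q scaled_def)
    ultimately show ?thesis by (simp add: isCont_def)
  qed
qed

text \<open>Each time derivative costs a factor |z|^(-\<sigma>). The condition m \<sigma> + s \<le>
  \<alpha> leaves |z|^s after m of them, and s \<le> \<sigma> bounds the duration |z|^\<sigma> by
  |z|^s.\<close>

lemma scaled_fam:
  assumes g1: "continuous_on (- {0}) g1" "\<And>z. \<bar>g1 z\<bar> \<le> 1" and g2: "continuous_on (- {0}) g2" "\<And>z. \<bar>g2 z\<bar> \<le> 1"
    and \<sigma>: "0 < \<sigma>" and s: "0 < s" "s \<le> \<sigma>" "real m * \<sigma> + s \<le> \<alpha>"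
    and M: "1 \<le> M" "\<And>k t. k \<le> max i1 i2 + m \<Longrightarrow> \<bar>\<Phi> k t\<bar> \<le> M"
  shows "pulse_family m 1 (2 * M) s (\<lambda>k z t. (scaled \<Phi> g1 i1 \<alpha> \<sigma> k z t, scaled \<Phi> g2 i2 \<alpha> \<sigma> k z t))"
proof (rule pulse_familyI)
  fix k and z t :: real
  { assume "norm z \<le> 1"
    show "((\<lambda>t. (scaled \<Phi> g1 i1 \<alpha> \<sigma> k z t, scaled \<Phi> g2 i2 \<alpha> \<sigma> k z t)) has_vector_derivative
      (scaled \<Phi> g1 i1 \<alpha> \<sigma> (Suc k) z t, scaled \<Phi> g2 i2 \<alpha> \<sigma> (Suc k) z t)) (at t)"
      by (intro has_vector_derivative_Pair) (use scaled_derivative in \<open>simp_all add: has_real_derivative_iff_has_vector_derivative\<close>) }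
  have le: "s \<le> \<alpha> - real k * \<sigma>" if "k \<le> m"
  proof -
    have "real k * \<sigma> \<le> real m * \<sigma>" using that \<sigma> by simp
    thus ?thesis using s by linarith
  qed
  { assume k: "k \<le> m"
    have "0 < \<alpha> - real k * \<sigma>" using le[OF k] s by linarith
    from scaled_continuous[OF g1 this, of "cball 0 1 \<times> UNIV" i1] scaled_continuous[OF g2 this, of "cball 0 1 \<times> UNIV" i2]
    show "continuous_on (cball 0 1 \<times> UNIV) (\<lambda>(z, t). (scaled \<Phi> g1 i1 \<alpha> \<sigma> k z t, scaled \<Phi> g2 i2 \<alpha> \<sigma> k z t))"
      by (simp add: case_prod_unfold continuous_on_Pair) }
  assume k: "k \<le> m" and z: "norm z \<le> 1"
  have pw: "\<bar>z\<bar> powr (\<alpha> - real k * \<sigma>) \<le> \<bar>z\<bar> powr s" using le[OF k] z by (intro powr_mono') auto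
  have b: "\<bar>scaled \<Phi> g i \<alpha> \<sigma> k z t\<bar> \<le> M * \<bar>z\<bar> powr s" if "\<forall>z. \<bar>g z\<bar> \<le> 1" "i \<le> max i1 i2" for g i
  proof -
    have "\<bar>scaled \<Phi> g i \<alpha> \<sigma> k z t\<bar> \<le> M * \<bar>z\<bar> powr (\<alpha> - real k * \<sigma>)"
      by (rule scaled_bound) (use that M(2) k in auto)
    also have "\<dots> \<le> M * \<bar>z\<bar> powr s" using pw M(1) by (intro mult_left_mono) auto
    finally show ?thesis .
  qed
  have "norm (scaled \<Phi> g1 i1 \<alpha> \<sigma> k z t, scaled \<Phi> g2 i2 \<alpha> \<sigma> k z t) \<le> M * \<bar>z\<bar> powr s + M * \<bar>z\<bar> powr s"
    using norm_Pair_le[of "scaled \<Phi> g1 i1 \<alpha> \<sigma> k z t" "scaled \<Phi> g2 i2 \<alpha> \<sigma> k z t"] b[of g1 i1] b[of g2 i2] g1(2) g2(2) by auto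
  thus "norm (scaled \<Phi> g1 i1 \<alpha> \<sigma> k z t, scaled \<Phi> g2 i2 \<alpha> \<sigma> k z t) \<le> 2 * M * norm z powr s" by simp
  assume t: "t \<le> - (2 * M * norm z powr s) \<or> 0 \<le> t"
  have "1 * \<bar>z\<bar> powr \<sigma> \<le> 2 * M * \<bar>z\<bar> powr s" using s z M(1) by (intro mult_mono powr_mono') auto
  hence "t \<le> - (\<bar>z\<bar> powr \<sigma>) \<or> 0 \<le> t" using t by auto
  thus "(scaled \<Phi> g1 i1 \<alpha> \<sigma> k z t, scaled \<Phi> g2 i2 \<alpha> \<sigma> k z t) = 0"
    using scaled_support by (simp add: zero_prod_def)
qed (use s M in auto)

end

lemma antiderivative_scaled:
  fixes \<phi> :: "real \<Rightarrow> real"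
  assumes "continuous_on {-1..0} \<phi>" "0 < \<tau>" "t \<in> {-\<tau>..0}"
  shows "((\<lambda>t. \<tau> * integral {-1..t / \<tau>} \<phi>) has_real_derivative \<phi> (t / \<tau>)) (at t within {-\<tau>..0})"
proof -
  have t: "t / \<tau> \<in> {-1..0}" using assms(2,3) by (auto simp: field_simps)
  have sub: "(\<lambda>t. t / \<tau>) ` {-\<tau>..0} \<subseteq> {-1..0}" using assms(2) by (auto simp: field_simps)
  have 1: "((\<lambda>y. integral {-1..y} \<phi>) has_real_derivative \<phi> (t / \<tau>)) (at (t / \<tau>) within (\<lambda>t. t / \<tau>) ` {-\<tau>..0})"
    by (rule DERIV_subset[OF integral_has_real_derivative[OF assms(1) t] sub])
  have 2: "((\<lambda>t. t / \<tau>) has_real_derivative 1 / \<tau>) (at t within {-\<tau>..0})"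
    using assms(2) by (auto intro!: derivative_eq_intros)
  from DERIV_cmult[OF DERIV_image_chain[OF 1 2], of \<tau>] show ?thesis
    using assms(2) by (simp add: o_def)
qed

lemma profile_bump: "profile (\<lambda>k. (deriv ^^ k) (bump 1 (-1) 0))"
proof
  show "((deriv ^^ k) (bump 1 (- 1) 0) has_real_derivative (deriv ^^ Suc k) (bump 1 (- 1) 0) t) (at t)" for k t
    by (rule bump_smooth)
  show "(deriv ^^ k) (bump 1 (- 1) 0) t = 0" if "t \<le> - 1 \<or> 0 \<le> t" for k t
    by (rule deriv_iter_bump_eq_0) (use that in auto)
  show "\<exists>t. (deriv ^^ 0) (bump 1 (- 1) 0) t \<noteq> 0"
    using bump_pos[of 1 "-1" "-1/2" 0] by (intro exI[of _ "-1/2"]) simp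
qed

lemma continuous_on_sgn_real: "continuous_on (- {0}) (sgn :: real \<Rightarrow> real)"
  by (intro continuous_intros) auto

section \<open>Reachability of the control directions and of the good brackets\<close>

context control_system
begin

text \<open>The common factor of the two controls has integral z I, where I is the integral of the
  profile. The rest of the motion has derivative O(|z|), hence contributes O(|z| \<tau>) over the
  duration \<tau> = |z|^\<sigma>.\<close>

lemma End_scaled_linear:
  assumes e: "\<bar>e1\<bar> \<le> 1" "\<bar>e2\<bar> \<le> (1 :: real)"
  shows "e1 *\<^sub>R b1 + e2 *\<^sub>R b2 \<in> reachable_set m"
proof -
  define \<Phi> where "\<Phi> = (\<lambda>k. (deriv ^^ k) (bump 1 (-1) 0))"
  interpret profile \<Phi> unfolding \<Phi>_def by (rule profile_bump)
  obtain M where M: "1 \<le> M" "\<And>k t. k \<le> m \<Longrightarrow> \<bar>\<Phi> k t\<bar> \<le> M" using bounded_upto[of m] by blast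
  \<comment> \<open>Amplitude times duration must be |z|, that is \<alpha> + \<sigma> = 1, and m
    derivatives must stay O(|z|^\<sigma>), that is m \<sigma> + \<sigma> \<le> \<alpha>; this
    \<sigma> gives equality in both.\<close>
  define \<sigma> :: real where "\<sigma> = 1 / (real m + 2)"
  define \<alpha> where "\<alpha> = 1 - \<sigma>"
  have \<sigma>: "0 < \<sigma>" "real m * \<sigma> + \<sigma> = \<alpha>" "0 < \<alpha>"
    by (auto simp: \<sigma>_def \<alpha>_def field_simps)
  define g1 where "g1 z = e1 * sgn z" for z :: real
  define g2 where "g2 z = e2 * sgn z" for z :: real
  have gg: "continuous_on (- {0}) g1" "continuous_on (- {0}) g2" "\<bar>g1 z\<bar> \<le> 1" "\<bar>g2 z\<bar> \<le> 1" for z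
    unfolding g1_def g2_def using e
    by (intro continuous_on_mult continuous_on_const continuous_on_sgn_real | simp add: abs_mult sgn_if)+
  define D where "D = (\<lambda>k z t. (scaled \<Phi> g1 0 \<alpha> \<sigma> k z t, scaled \<Phi> g2 0 \<alpha> \<sigma> k z t))"
  have D: "pulse_family m 1 (2 * M) \<sigma> D"
    unfolding D_def by (rule scaled_fam) (use gg \<sigma> M in auto)
  define b where "b = e1 *\<^sub>R b1 + e2 *\<^sub>R b2"
  define I where "I = integral {-1..0} (\<Phi> 0)"
  have I: "I \<noteq> 0"
  proof
    assume "I = 0"
    hence "\<Phi> 0 t = 0" if "t \<in> {-1..0}" for t
      using integral_eq_0_iff[OF cont[of "{-1..0}" 0]] bump_bounds(1)[of 1 "-1" 0] that by (auto simp: I_def \<Phi>_def)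
    moreover obtain t where "\<Phi> 0 t \<noteq> 0" using pos by blast
    ultimately show False using supp[of t 0] by (cases "t \<in> {-1..0}") auto
  qed
  have M2: "0 < 2 * M" and KM: "0 < 8 * K * M" using M(1) K_ge1 by auto
  obtain \<rho>1 where \<rho>1: "0 < \<rho>1" "\<And>z :: real. norm z \<le> \<rho>1 \<Longrightarrow> (2 * M) * norm z powr \<alpha> \<le> 1"
    using powr_small[OF M2 \<sigma>(3) zero_less_one, where 'a = real] by blast
  obtain \<rho>2 where \<rho>2: "0 < \<rho>2" "\<And>z :: real. norm z \<le> \<rho>2 \<Longrightarrow> (8 * K * M) * norm z powr 1 \<le> 1"
    using powr_small[OF KM zero_less_one zero_less_one, where 'a = real] by blast
  have "\<forall>\<^sub>F z in nhds 0. norm (End (D 0 z) - z *\<^sub>R (I *\<^sub>R b)) \<le> (24 * K\<^sup>2 * M) * norm z powr (1 + \<sigma>)"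
    using pulse_family_eventually[OF D] eventually_norm_le[OF \<rho>1(1)] eventually_norm_le[OF \<rho>2(1)]
  proof eventually_elim
    case (elim z)
    show ?case
    proof (cases "z = 0")
      case True
      have "D 0 z = (\<lambda>_. 0)" using True by (simp add: D_def scaled_def fun_eq_iff zero_prod_def)
      thus ?thesis using True by (simp add: End_zero)
    next
      case False
      define \<tau> where "\<tau> = \<bar>z\<bar> powr \<sigma>"
      define a where "a = \<bar>z\<bar> powr \<alpha>"
      have pos: "0 < \<tau>" "0 < a" using False by (auto simp: \<tau>_def a_def)
      have \<tau>a: "\<tau> * a = \<bar>z\<bar>" using False by (simp add: \<tau>_def a_def \<alpha>_def powr_add[symmetric])
      have adm: "admissible (D 0 z)" using elim by simp
      have \<tau>\<theta>: "\<tau> \<le> \<theta>"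
      proof -
        have "1 * \<tau> \<le> 2 * M * \<tau>" using M(1) pos by (intro mult_right_mono) auto
        thus ?thesis using elim(1) \<theta>_pos by (simp add: \<tau>_def)
      qed
      define u where "u = (\<lambda>t. sgn z * a * \<Phi> 0 (t / \<tau>))"
      have D_u: "D 0 z t = (e1 * u t, e2 * u t)" for t
        by (simp add: D_def scaled_def u_def g1_def g2_def a_def \<tau>_def)
      have ub: "\<bar>u t\<bar> \<le> M * a" for t
      proof -
        have "\<bar>u t\<bar> = a * \<bar>\<Phi> 0 (t / \<tau>)\<bar>" using False pos by (simp add: u_def abs_mult sgn_if)
        also have "\<dots> \<le> a * M" using M(2)[of 0] pos by (intro mult_left_mono) auto
        finally show ?thesis by (simp add: mult.commute)
      qed
      have eu: "\<bar>e1 * u t\<bar> \<le> M * a" "\<bar>e2 * u t\<bar> \<le> M * a" for t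
        using abs_mult_bound[OF e(1) ub[of t]] abs_mult_bound[OF e(2) ub[of t]] by auto
      have Ma: "2 * M * a \<le> 1" using \<rho>1(2)[OF elim(2)] by (simp add: a_def)
      have zero: "D 0 z t = 0" if "t \<le> - \<tau>" for t
        using that scaled_support[of t z \<sigma>] by (simp add: D_def \<tau>_def zero_prod_def)
      let ?x = "traj (D 0 z)"
      have s: "sol (D 0 z) (- \<tau>) 0 ?x"
        by (rule sol_subinterval[OF traj(1)[OF adm]]) (use \<tau>\<theta> in auto)
      have x0: "?x (- \<tau>) = 0" by (rule traj_before[where \<delta> = \<tau>, OF adm zero]) (use pos \<tau>\<theta> in auto)
      have xb: "norm (?x t) \<le> 8 * K * M * \<bar>z\<bar>" if t: "t \<in> {-\<tau>..0}" for t
      proof -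
        have "norm (?x t) \<le> 4 * K * \<tau> * (2 * M * a)"
        proof (rule traj_bound[where \<delta> = \<tau>, OF adm zero])
          show "norm (D 0 z t) \<le> 2 * M * a" for t
            using norm_Pair_le2[of "e1 * u t" "e2 * u t"] eu[of t] by (simp add: D_u)
        qed (use pos \<tau>\<theta> t Ma in auto)
        thus ?thesis by (simp add: mult_ac flip: \<tau>a)
      qed
      have x1: "norm (?x t) \<le> 1" if "t \<in> {-\<tau>..0}" for t
        using xb[OF that] \<rho>2(2)[OF elim(3)] by simp
      define U where "U t = (sgn z * a) * (\<tau> * integral {-1..t / \<tau>} (\<Phi> 0))" for t
      have U': "(U has_real_derivative u t) (at t within {-\<tau>..0})" if "t \<in> {-\<tau>..0}" for t
        using DERIV_cmult[OF antiderivative_scaled[OF cont pos(1) that], of "sgn z * a" 0] by (simp add: U_def[abs_def] u_def)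
      have "norm ((?x 0 - U 0 *\<^sub>R b) - (?x (- \<tau>) - U (- \<tau>) *\<^sub>R b)) \<le> (3 * K * (8 * K * M * \<bar>z\<bar>)) * \<bar>0 - - \<tau>\<bar>"
      proof (rule vector_derivative_increment_le[where a = "- \<tau>" and b = 0 and y = "\<lambda>t. ?x t - U t *\<^sub>R b"
            and y' = "\<lambda>t. F (?x t) (e1 * u t, e2 * u t) - u t *\<^sub>R b"])
        fix t assume t: "t \<in> {-\<tau>..0}"
        have "((\<lambda>t. ?x t - U t *\<^sub>R b) has_vector_derivative F (?x t) (e1 * u t, e2 * u t) - (U t *\<^sub>R 0 + u t *\<^sub>R b)) (at t within {-\<tau>..0})"
          by (intro has_vector_derivative_diff has_vector_derivative_scaleR has_vector_derivative_const U' t)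
             (use s t in \<open>auto simp: sol_def D_u\<close>)
        thus "((\<lambda>t. ?x t - U t *\<^sub>R b) has_vector_derivative F (?x t) (e1 * u t, e2 * u t) - u t *\<^sub>R b) (at t within {-\<tau>..0})" by simp
        have xR: "norm (?x t) \<le> R" using s t by (auto simp: sol_def)
        let ?X = "norm (?x t)"
        have eq: "F (?x t) (e1 * u t, e2 * u t) - u t *\<^sub>R b = (F (?x t) (e1 * u t, e2 * u t) - A (?x t) - (e1 * u t) *\<^sub>R b1 - (e2 * u t) *\<^sub>R b2) + A (?x t)"
          by (simp add: b_def algebra_simps)
        have "norm (F (?x t) (e1 * u t, e2 * u t) - u t *\<^sub>R b) \<le> (K * ?X ^ 2 + 2 * (M * a) * K * ?X) + K * ?X"
          unfolding eq by (rule order_trans[OF norm_triangle_ineq add_mono[OF F_residuals(1)[OF xR eu] bdA]])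
        also have "\<dots> \<le> (K * ?X + 1 * (K * ?X)) + K * ?X"
        proof (intro add_mono order_refl)
          have "?X ^ 2 \<le> ?X" using x1[OF t] power_decreasing[of 1 2 ?X] by simp
          thus "K * ?X ^ 2 \<le> K * ?X" using K_ge1 by (intro mult_left_mono) auto
          have "(2 * M * a) * (K * ?X) \<le> 1 * (K * ?X)" using Ma K_ge1 by (intro mult_right_mono) auto
          thus "2 * (M * a) * K * ?X \<le> 1 * (K * ?X)" by (simp only: mult_ac)
        qed
        also have "\<dots> = 3 * K * ?X" by simp
        also have "\<dots> \<le> 3 * K * (8 * K * M * \<bar>z\<bar>)" using xb[OF t] K_ge1 by (intro mult_left_mono) auto
        finally show "norm (F (?x t) (e1 * u t, e2 * u t) - u t *\<^sub>R b) \<le> 3 * K * (8 * K * M * \<bar>z\<bar>)" .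
      qed (use pos in auto)
      moreover have "U (- \<tau>) = 0" using pos by (simp add: U_def)
      moreover have "U 0 = z * I"
        using \<tau>a by (simp add: U_def I_def mult.left_commute mult.commute[of a] flip: mult.assoc) (metis mult.assoc mult_sgn_abs sgn_mult_abs mult.commute)
      ultimately have "norm (End (D 0 z) - z *\<^sub>R (I *\<^sub>R b)) \<le> (24 * K\<^sup>2 * M) * (\<bar>z\<bar> * \<tau>)"
        using x0 pos by (simp add: End_def power2_eq_square mult_ac)
      thus ?thesis using False by (simp add: \<tau>_def powr_add)
    qed
  qed
  hence "bigo0 (1 + \<sigma>) (\<lambda>z. End (D 0 z) - z *\<^sub>R (I *\<^sub>R b))" by (rule bigo0I)
  hence "I *\<^sub>R b \<in> reachable_set m" using D unfolding reachable_set_def reachable_map_def by blast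
  from subspace_scale[OF subspace_reachable_set this, of "1 / I"] show ?thesis
    using I by (simp add: b_def)
qed

lemma b_reachable: "b1 \<in> reachable_set m" "b2 \<in> reachable_set m"
  using End_scaled_linear[of 1 0 m] End_scaled_linear[of 0 1 m] by auto

lemma c_reachable: "c1 k \<in> reachable_set m" "c2 k \<in> reachable_set m"
  by (induction k) (auto simp: c_0 c_Suc b_reachable reachable_set_A)

lemma projection_along:
  assumes V: "subspace V"
  obtains L :: "'v \<Rightarrow> 'v" where "linear L" "\<And>x. L x \<in> V" "\<And>x. x \<in> V \<Longrightarrow> L x = x"
proof -
  obtain B where B: "B \<subseteq> V" "pairwise orthogonal B" "\<And>x. x \<in> B \<Longrightarrow> norm x = 1" "independent B" "span B = V"
    using orthonormal_basis_subspace[OF V] by metis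
  have fin: "finite B" using B(4) independent_imp_finite by blast
  define L where "L x = (\<Sum>b\<in>B. (x \<bullet> b) *\<^sub>R b)" for x :: 'v
  have L: "linear L"
    unfolding L_def by (rule linearI) (simp_all add: inner_add_left scaleR_add_left sum.distrib scaleR_sum_right)
  show ?thesis
  proof (rule that[OF L])
    show "L x \<in> V" for x
      unfolding L_def using B(1) V by (auto intro!: subspace_sum subspace_scale)
    fix x assume "x \<in> V"
    hence "x \<in> span B" using B(5) by simp
    have "L b = id b" if b: "b \<in> B" for b
    proof -
      have "L b = (\<Sum>c\<in>B. if c = b then b else 0)"
        unfolding L_def
      proof (rule sum.cong[OF HOL.refl])
        fix c assume c: "c \<in> B"
        show "(b \<bullet> c) *\<^sub>R c = (if c = b then b else 0)"
        proof (cases "c = b")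
          case True
          thus ?thesis using B(3)[OF b] by (simp add: dot_square_norm)
        next
          case False
          hence "b \<bullet> c = 0" using B(2) b c by (auto simp: pairwise_def orthogonal_def)
          thus ?thesis using False by simp
        qed
      qed
      thus ?thesis using b fin by simp
    qed
    from linear_eq_on_span[OF L linear_id this \<open>x \<in> span B\<close>] show "L x = x" by simp
  qed
qed

text \<open>The controls are \<open>a \<Phi>\<^sup>(\<^sup>q\<^sup>)(t / \<tau>)\<close> with \<open>a = \<tau>\<^sup>p\<close>; the component of the end point along the
  vectors that are already known to be reachable is larger than the gain \<open>a\<^sup>2 \<tau>\<^sup>j\<^sup>+\<^sup>2\<close>, but for large \<open>p\<close> it
  can be steered back with a smaller error.\<close>

lemma Cvec_reachable_step:
  assumes W: "\<And>k. 2 * k + 3 \<le> j + 2 \<Longrightarrow> Wvec1 k \<in> reachable_set m \<and> Wvec2 k \<in> reachable_set m"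
    and Cv: "\<And>i. i < j \<Longrightarrow> Cvec i \<in> reachable_set m"
  shows "Cvec j \<in> reachable_set m"
proof -
  define \<Phi> where "\<Phi> = (\<lambda>k. (deriv ^^ k) (bump 1 (-1) 0))"
  interpret profile \<Phi> unfolding \<Phi>_def by (rule profile_bump)
  let ?V = "reachable_set m"
  obtain L where L: "linear L" "\<And>x. L x \<in> ?V" "\<And>x. x \<in> ?V \<Longrightarrow> L x = x"
    using projection_along[OF subspace_reachable_set[of m]] by blast
  define P where "P x = x - L x" for x
  have P: "linear P" unfolding P_def by (intro linear_compose_sub linear_id[unfolded id_def] L(1))
  have PV: "P x = 0" if "x \<in> ?V" for x using L(3)[OF that] by (simp add: P_def)
  \<comment> \<open>P vanishes on \<open>?V\<close>, which contains x - P x = L x and is invariant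
    under A.\<close>
  have PA: "P (A x) = P (A (P x))" for x
    using PV[OF reachable_set_A[OF L(2)[of x]]] by (simp add: P_def[of x] linear_diff[OF linA] linear_diff[OF P])
  have "reachable_map m L" by (rule reachable_map_linear[OF L(1,2)])
  then obtain \<rho>' C' s' D' where D': "pulse_family m \<rho>' C' s' (D' :: nat \<Rightarrow> 'v \<Rightarrow> real \<Rightarrow> real \<times> real)"
    "bigo0 (1 + s') (\<lambda>v. End (D' 0 v) - L v)" "0 < s'" "s' \<le> 1" by (rule reachable_mapE)
  obtain p0 :: nat where p0: "(real j + 3) / (2 * s') \<le> real p0" using real_arch_simple by blast
  \<comment> \<open>\<open>p0\<close> secures 2 p s' \<ge> j + 3, \<open>m\<close> the decay of m
    derivatives of the controls, and \<open>j + 2\<close> the condition a \<le>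
    \<tau>^(j+2).\<close>
  define p where "p = p0 + m + j + 2"
  define n where "n = p + j + 1"
  have pn: "m + 1 \<le> p" "j + 2 \<le> p" "p \<le> n" "j < 2 * n" by (auto simp: p_def n_def)
  have ps: "real j + 3 \<le> 2 * real p * s'"
  proof -
    have "(real j + 3) / (2 * s') \<le> real p" using p0 by (simp add: p_def)
    thus ?thesis using D'(3) by (simp add: field_simps)
  qed
  \<comment> \<open>With a = \<tau>^p the gain a^2 \<tau>^(j+2) is \<tau>^N; so \<tau> = |z|^(1/N)
    makes it |z|.\<close>
  define N where "N = 2 * real p + real j + 2"
  define \<sigma> where "\<sigma> = 1 / N"
  define \<alpha> where "\<alpha> = real p * \<sigma>"
  define \<kappa> where "\<kappa> = 2 * real p * \<sigma>"
  have N: "0 < N" by (simp add: N_def)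
  have \<sigma>: "0 < \<sigma>" using N by (simp add: \<sigma>_def)
  have \<alpha>: "real m * \<sigma> + \<sigma> \<le> \<alpha>"
  proof -
    have "(real m + 1) * \<sigma> \<le> real p * \<sigma>" using pn(1) \<sigma> by (intro mult_right_mono) auto
    thus ?thesis by (simp add: \<alpha>_def algebra_simps)
  qed
  have \<kappa>: "0 < \<kappa>" "\<kappa> \<le> 1" "1 + \<sigma> \<le> \<kappa> * (1 + s')"
  proof -
    show "0 < \<kappa>" "\<kappa> \<le> 1" using N pn by (auto simp: \<kappa>_def \<sigma>_def N_def)
    have "1 + \<sigma> = (N + 1) * \<sigma>" using N by (simp add: \<sigma>_def field_simps)
    also have "\<dots> \<le> (2 * real p * (1 + s')) * \<sigma>"
      using ps \<sigma> by (intro mult_right_mono) (auto simp: N_def algebra_simps)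
    finally show "1 + \<sigma> \<le> \<kappa> * (1 + s')" by (simp add: \<kappa>_def mult_ac)
  qed
  \<comment> \<open>The leading monomial pairs primitives of orders j/2 + 1 and j/2 for even j, and
    of equal orders for odd j. One extra derivative on the first control in the even case makes both
    factors multiples of the same function \<open>\<Phi> q\<close>.\<close>
  define i1 where "i1 = (if even j then n + 1 else n)"
  define q where "q = n - (j + 1) div 2"
  have jn: "(j + 1) div 2 \<le> n" "Suc (j div 2) \<le> i1" "Suc (j div 2) \<le> n" using pn(4) by (auto simp: i1_def)
  have q: "i1 - Suc (j div 2) = q" "n - (j + 1) div 2 = q"
    using jn by (auto simp: q_def i1_def elim!: evenE oddE)
  obtain M where M: "1 \<le> M" "\<And>k t. k \<le> n + 1 + m \<Longrightarrow> \<bar>\<Phi> k t\<bar> \<le> M" using bounded_upto[of "n + 1 + m"] by blast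
  \<comment> \<open>The sign of z enters one control only, since the leading monomial is a product
    of both.\<close>
  define D1 where "D1 = (\<lambda>k z t. (scaled \<Phi> (\<lambda>_. 1) i1 \<alpha> \<sigma> k z t, scaled \<Phi> sgn n \<alpha> \<sigma> k z t))"
  have M2: "0 < 2 * M" using M(1) by simp
  have D1: "pulse_family m 1 (2 * M) \<sigma> D1"
    unfolding D1_def
  proof (rule scaled_fam)
    show "\<bar>\<Phi> k t\<bar> \<le> M" if "k \<le> max i1 n + m" for k t
      by (rule M(2)) (use that in \<open>simp add: i1_def split: if_splits\<close>)
    show "continuous_on (- {0}) (sgn :: real \<Rightarrow> real)" by (rule continuous_on_sgn_real)
  qed (use \<sigma> \<alpha> M(1) in \<open>auto simp: abs_sgn_eq\<close>)
  define I where "I = integral {-1..0} (\<lambda>t. \<Phi> q t * \<Phi> q t)"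
  have I: "0 < I" unfolding I_def by (rule integral_square_pos)
  have kc: "P (c1 n) = 0" "P (c2 n) = 0" using PV c_reachable by auto
  have kW: "P (Wvec1 k) = 0 \<and> P (Wvec2 k) = 0" if "2 * k + 3 \<le> j + 2" for k using PV W[OF that] by auto
  have kC: "P (Cvec i) = 0" if "i < j" for i using PV Cv[OF that] by auto
  obtain Cq \<tau>0 where Cq: "0 < Cq" "0 < \<tau>0" and "pulse_estimate n j M P Cq \<tau>0"
    using quadratic_estimate[OF P PA M(1) pn(4) kc kW kC] by blast
  note est = this(3)[unfolded pulse_estimate_def]
  obtain \<rho>1 where \<rho>1: "0 < \<rho>1" "\<And>z :: real. norm z \<le> \<rho>1 \<Longrightarrow> 1 * norm z powr \<sigma> \<le> \<tau>0"
    using powr_small[OF zero_less_one \<sigma> Cq(2), where 'a = real] by blast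
  have main: "\<forall>\<^sub>F z in nhds 0. norm (P (End (D1 0 z)) - (z * I) *\<^sub>R P (Cvec j)) \<le> Cq * norm z powr (1 + \<sigma>) \<and>
      norm (End (D1 0 z)) \<le> Cq * norm z powr \<kappa>"
    using pulse_family_eventually[OF D1] eventually_norm_le[OF \<rho>1(1)]
  proof eventually_elim
    case (elim z)
    show ?case
    proof (cases "z = 0")
      case True
      have "D1 0 z = (\<lambda>_. 0)" using True by (simp add: D1_def scaled_def fun_eq_iff zero_prod_def)
      thus ?thesis using True by (simp add: End_zero linear_0[OF P])
    next
      case False
      define \<tau> where "\<tau> = \<bar>z\<bar> powr \<sigma>"
      define a where "a = \<tau> ^ p"
      have \<tau>: "0 < \<tau>" using False by (simp add: \<tau>_def)
      have \<tau>1: "\<tau> \<le> 1"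
        using elim(1) powr_mono2[of \<sigma> "\<bar>z\<bar>" 1] \<sigma> by (simp add: \<tau>_def)
      have \<tau>\<tau>0: "\<tau> \<le> \<tau>0" using \<rho>1(2)[OF elim(2)] by (simp add: \<tau>_def)
      have \<tau>\<theta>: "\<tau> \<le> \<theta>"
      proof -
        have "1 * \<tau> \<le> 2 * M * \<tau>" using M(1) \<tau> by (intro mult_right_mono) auto
        thus ?thesis using elim(1) \<theta>_pos by (simp add: \<tau>_def)
      qed
      have tp: "\<tau> ^ k = \<bar>z\<bar> powr (real k * \<sigma>)" for k
        using False by (simp add: \<tau>_def powr_realpow[symmetric] powr_powr mult.commute)
      have a_powr: "a = \<bar>z\<bar> powr \<alpha>" by (simp add: a_def tp \<alpha>_def)
      have z2: "a\<^sup>2 * \<tau> ^ (j + 2) = \<bar>z\<bar>"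
      proof -
        have "a\<^sup>2 * \<tau> ^ (j + 2) = \<tau> ^ (2 * p + (j + 2))"
          by (simp add: a_def power_add power_mult[symmetric] mult.commute)
        also have "\<dots> = \<bar>z\<bar> powr (N * \<sigma>)" unfolding tp by (simp add: N_def add_ac)
        also have "N * \<sigma> = 1" using N by (simp add: \<sigma>_def)
        finally show ?thesis by simp
      qed
      have adm: "admissible (D1 0 z)" using elim by simp
      have zero: "D1 0 z t = 0" if "t \<le> - \<tau>" for t
        using that scaled_support[of t z \<sigma>] by (simp add: D1_def \<tau>_def zero_prod_def)
      let ?x = "traj (D1 0 z)"
      define uu where "uu k t = a * \<tau> ^ k * \<Phi> (i1 - k) (t / \<tau>)" for k t
      define vv where "vv k t = sgn z * a * \<tau> ^ k * \<Phi> (n - k) (t / \<tau>)" for k t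
      have D1_uv: "D1 0 z = (\<lambda>t. (uu 0 t, vv 0 t))"
        by (simp add: D1_def scaled_def uu_def vv_def a_powr \<tau>_def fun_eq_iff)
      have chain: "((\<lambda>t. c * \<tau> ^ Suc k * \<Phi> (l - Suc k) (t / \<tau>)) has_real_derivative c * \<tau> ^ k * \<Phi> (l - k) (t / \<tau>)) (at t within S)"
        if "k < l" for c k l t S
      proof -
        have "((\<lambda>t. c * \<tau> ^ Suc k * \<Phi> (l - Suc k) (t / \<tau>)) has_real_derivative
           c * \<tau> ^ Suc k * (\<Phi> (Suc (l - Suc k)) (t / \<tau>) * (1 / \<tau>))) (at t within S)"
          by (intro DERIV_cmult DERIV_chain'[where g = "\<Phi> (l - Suc k)", OF _ der])
             (use \<tau> in \<open>auto intro!: derivative_eq_intros\<close>)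
        moreover have "Suc (l - Suc k) = l - k" using that by simp
        ultimately show ?thesis using \<tau> by (simp add: mult_ac)
      qed
      have bnd: "\<bar>c * a * \<tau> ^ k * \<Phi> l t\<bar> \<le> M * a * \<tau> ^ k" if "\<bar>c\<bar> = 1" "l \<le> n + 1" for c k l t
      proof -
        have "\<bar>c * a * \<tau> ^ k * \<Phi> l t\<bar> = (a * \<tau> ^ k) * \<bar>\<Phi> l t\<bar>" using that(1) \<tau> by (simp add: abs_mult a_def)
        also have "\<dots> \<le> (a * \<tau> ^ k) * M" using M(2)[of l t] that(2) \<tau> by (intro mult_left_mono) (auto simp: a_def)
        finally show ?thesis by (simp add: mult_ac)
      qed
      define G where "G t = (sgn z * a\<^sup>2 * \<tau> ^ (j + 1)) * (\<tau> * integral {-1..t / \<tau>} (\<lambda>t. \<Phi> q t * \<Phi> q t))" for t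
      have "norm (P (?x 0) - G 0 *\<^sub>R P (Cvec j)) \<le> Cq * (a\<^sup>2 * \<tau> ^ (j + 3)) \<and> norm (?x 0) \<le> Cq * a\<^sup>2"
      proof (rule est[THEN spec[of _ \<tau>], THEN spec[of _ a], THEN spec[of _ uu], THEN spec[of _ vv],
            THEN spec[of _ ?x], THEN spec[of _ G], THEN mp, THEN mp, THEN mp, THEN mp, THEN mp, THEN mp, THEN mp,
            THEN mp, THEN mp, THEN mp, THEN mp, THEN mp, THEN mp])
        show "0 < \<tau>" "\<tau> \<le> \<tau>0" by (rule \<tau> \<tau>\<tau>0)+
        show "0 < a" using \<tau> by (simp add: a_def)
        show "a \<le> \<tau> ^ (j + 2)" unfolding a_def by (rule power_decreasing[OF pn(2)]) (use \<tau> \<tau>1 in auto)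
        show "\<tau> ^ n \<le> a" unfolding a_def by (rule power_decreasing[OF pn(3)]) (use \<tau> \<tau>1 in auto)
        show "\<forall>k<n. \<forall>t\<in>{-\<tau>..0}. (uu (Suc k) has_real_derivative uu k t) (at t within {-\<tau>..0})"
          unfolding uu_def[abs_def] by (intro allI impI ballI chain) (simp add: i1_def)
        show "\<forall>k<n. \<forall>t\<in>{-\<tau>..0}. (vv (Suc k) has_real_derivative vv k t) (at t within {-\<tau>..0})"
          unfolding vv_def[abs_def] by (intro allI impI ballI chain)
        show "\<forall>k\<le>n. \<forall>t\<in>{-\<tau>..0}. \<bar>uu k t\<bar> \<le> M * a * \<tau> ^ k \<and> \<bar>vv k t\<bar> \<le> M * a * \<tau> ^ k"
          using bnd[of 1] bnd[of "sgn z"] False by (auto simp: uu_def vv_def i1_def abs_sgn_eq)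
        show "\<forall>k<n. uu (Suc k) (- \<tau>) = 0 \<and> vv (Suc k) (- \<tau>) = 0 \<and> uu (Suc k) 0 = 0 \<and> vv (Suc k) 0 = 0"
          using supp[of "-1"] supp[of 0] \<tau> by (simp add: uu_def vv_def)
        show "sol (\<lambda>t. (uu 0 t, vv 0 t)) (- \<tau>) 0 ?x"
          unfolding D1_uv[symmetric] by (rule sol_subinterval[OF traj(1)[OF adm]]) (use \<tau>\<theta> in auto)
        show "?x (- \<tau>) = 0" by (rule traj_before[where \<delta> = \<tau>, OF adm zero]) (use \<tau> \<tau>\<theta> in auto)
        show "G (- \<tau>) = 0" using \<tau> by (simp add: G_def)
        show "\<forall>t\<in>{-\<tau>..0}. (G has_real_derivative uu (Suc (j div 2)) t * vv ((j + 1) div 2) t) (at t within {-\<tau>..0})"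
        proof
          fix t assume t: "t \<in> {-\<tau>..0}"
          have "(G has_real_derivative (sgn z * a\<^sup>2 * \<tau> ^ (j + 1)) * (\<Phi> q (t / \<tau>) * \<Phi> q (t / \<tau>))) (at t within {-\<tau>..0})"
            unfolding G_def[abs_def]
            by (rule DERIV_cmult[OF antiderivative_scaled[OF _ \<tau> t]]) (intro continuous_intros cont)
          moreover have "uu (Suc (j div 2)) t * vv ((j + 1) div 2) t = (sgn z * a\<^sup>2 * (\<tau> ^ (Suc (j div 2) + (j + 1) div 2))) * (\<Phi> q (t / \<tau>) * \<Phi> q (t / \<tau>))"
            unfolding uu_def vv_def q power_add power2_eq_square by (simp only: mult_ac)
          moreover have "Suc (j div 2) + (j + 1) div 2 = j + 1" by linarith
          ultimately show "(G has_real_derivative uu (Suc (j div 2)) t * vv ((j + 1) div 2) t) (at t within {-\<tau>..0})" by simp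
        qed
      qed
      moreover have "G 0 = z * I"
      proof -
        have "G 0 = sgn z * (a\<^sup>2 * \<tau> ^ (j + 2)) * I" by (simp add: G_def I_def mult_ac)
        thus ?thesis unfolding z2 by (simp add: sgn_mult_abs)
      qed
      moreover have "a\<^sup>2 * \<tau> ^ (j + 3) = \<bar>z\<bar> powr (1 + \<sigma>)"
      proof -
        have "a\<^sup>2 * \<tau> ^ (j + 3) = (a\<^sup>2 * \<tau> ^ (j + 2)) * \<tau>" by (simp add: eval_nat_numeral)
        thus ?thesis unfolding z2 using False by (simp add: \<tau>_def powr_add)
      qed
      moreover have "a\<^sup>2 = \<bar>z\<bar> powr \<kappa>"
        by (simp add: a_powr \<kappa>_def \<alpha>_def power2_eq_square powr_add[symmetric] mult_ac)
      ultimately show ?thesis by (simp add: End_def)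
    qed
  qed
  have Pmain: "bigo0 (1 + \<sigma>) (\<lambda>z. P (End (D1 0 z)) - (z * I) *\<^sub>R P (Cvec j))"
    by (rule bigo0I[of _ Cq]) (use main in eventually_elim, blast)
  have e1: "bigo0 \<kappa> (\<lambda>z. End (D1 0 z))"
    by (rule bigo0I[of _ Cq]) (use main in eventually_elim, blast)
  \<comment> \<open>This cancels the component in \<open>?V\<close> of the deviation from the goal z
    I \<open>Cvec j\<close>. What remains of the deviation is its image under P, which
    \<open>Pmain\<close> controls.\<close>
  define v where "v z = - L (End (D1 0 z) - (z * I) *\<^sub>R Cvec j)" for z
  have zI: "bigo0 \<kappa> (\<lambda>z. (z * I) *\<^sub>R Cvec j)"
  proof -
    have "bigo0 1 (\<lambda>z. (z * I) *\<^sub>R Cvec j)"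
      by (rule bigo0_one[of _ "\<bar>I\<bar> * norm (Cvec j)"]) (simp add: abs_mult mult_ac)
    thus ?thesis using \<kappa>(2) by (rule bigo0_mono)
  qed
  have blL: "bounded_linear L" using L(1) by (simp add: linear_conv_bounded_linear)
  have BOv: "bigo0 \<kappa> v"
    unfolding v_def[abs_def] by (intro bigo0_minus bigo0_linear[OF blL] bigo0_diff e1 zI)
  \<comment> \<open>Reparametrisation by v requires its continuity on a ball, hence the restriction
    to radii for which the end point map is known to be continuous.\<close>
  have "\<exists>\<rho> M'. 0 < \<rho> \<and> 0 < M' \<and> continuous_on (cball 0 \<rho>) v \<and> (\<forall>z. norm z \<le> \<rho> \<longrightarrow> norm (v z) \<le> M' * norm z powr \<kappa>)"
  proof -
    obtain M' where M': "0 \<le> M'" "\<forall>\<^sub>F z in nhds 0. norm (v z) \<le> M' * norm z powr \<kappa>" using BOv by (rule bigo0E)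
    obtain \<epsilon> where \<epsilon>: "\<epsilon> > 0" "\<And>z. norm z < \<epsilon> \<Longrightarrow> norm (v z) \<le> M' * norm z powr \<kappa>"
      using M'(2) unfolding eventually_nhds_metric by (auto simp: dist_norm)
    obtain \<rho>2 where \<rho>2: "0 < \<rho>2" "\<And>z :: real. norm z \<le> \<rho>2 \<Longrightarrow> (2 * M) * norm z powr \<sigma> \<le> \<eta>0"
      using powr_small[OF M2 \<sigma> \<eta>0_pos, where 'a = real] by blast
    define \<rho> where "\<rho> = min (min 1 \<rho>2) (\<epsilon> / 2)"
    have \<rho>: "0 < \<rho>" "\<rho> \<le> 1" "\<rho> \<le> \<rho>2" "\<rho> < \<epsilon>" using \<epsilon>(1) \<rho>2(1) by (auto simp: \<rho>_def min_def)
    have "pulse_family m \<rho> (2 * M) \<sigma> D1" by (rule pulse_family_mono[OF D1]) (use \<rho> \<sigma> in auto)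
    moreover have "2 * M * \<rho> powr \<sigma> \<le> \<eta>0" using \<rho>2(2)[of \<rho>] \<rho> by simp
    ultimately have "continuous_on (cball 0 \<rho>) (\<lambda>z. End (D1 0 z))" by (rule continuous_on_End_pulse_family)
    hence "continuous_on (cball 0 \<rho>) v"
      unfolding v_def[abs_def]
      by (intro continuous_intros bounded_linear.continuous_on[OF blL])
    moreover have "norm (v z) \<le> (M' + 1) * norm z powr \<kappa>" if "norm z \<le> \<rho>" for z
    proof -
      have "norm (v z) \<le> M' * norm z powr \<kappa>" using \<epsilon>(2)[of z] that \<rho> by simp
      also have "\<dots> \<le> (M' + 1) * norm z powr \<kappa>" by (intro mult_right_mono) auto
      finally show ?thesis .
    qed
    ultimately show ?thesis using \<rho>(1) M'(1) by (intro exI[of _ \<rho>] exI[of _ "M' + 1"]) auto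
  qed
  then obtain \<rho> M' where v: "0 < \<rho>" "0 < M'" "continuous_on (cball 0 \<rho>) v" "\<And>z. norm z \<le> \<rho> \<Longrightarrow> norm (v z) \<le> M' * norm z powr \<kappa>"
    by blast
  obtain \<rho>3 C3 where D2: "pulse_family m \<rho>3 C3 (\<kappa> * s') (\<lambda>k z. D' k (v z))"
    using pulse_family_reparam[OF D'(1) v(3,4) v(1,2) \<kappa>(1)] by blast
  obtain \<rho>4 C4 D where D: "pulse_family m \<rho>4 C4 (min \<sigma> (\<kappa> * s')) D"
    "\<forall>\<^sub>F z in nhds 0. norm (End (D 0 z) - End (D1 0 z) - End (D' 0 (v z))) \<le> (6 * K * C3) * (norm z powr (\<kappa> * s') * norm (End (D1 0 z)))"
    using pulse_family_concat[OF D1 D2] by blast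
  have r1: "bigo0 (1 + \<sigma>) (\<lambda>z. End (D 0 z) - End (D1 0 z) - End (D' 0 (v z)))"
  proof (rule bigo0_bound[OF bigo0_mono[OF bigo0_mult[OF bigo0_powr[of "\<kappa> * s'"] e1]]])
    show "1 + \<sigma> \<le> \<kappa> * s' + \<kappa>" using \<kappa>(3) by (simp add: algebra_simps)
    show "\<forall>\<^sub>F z in nhds 0. norm (End (D 0 z) - End (D1 0 z) - End (D' 0 (v z)))
      \<le> (6 * K * C3) * norm (norm (norm z powr (\<kappa> * s')) * norm (End (D1 0 z)))"
      using D(2) by eventually_elim simp
    show "0 \<le> 6 * K * C3" using K_ge1 pulse_familyD(2)[OF D2] by simp
  qed
  have r2: "bigo0 (1 + \<sigma>) (\<lambda>z. End (D' 0 (v z)) - L (v z))"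
    by (rule bigo0_mono[OF bigo0_reparam[OF D'(2) BOv \<kappa>(1)] \<kappa>(3)]) (use D'(3) in simp)
  have "bigo0 (1 + \<sigma>) (\<lambda>z. (End (D 0 z) - End (D1 0 z) - End (D' 0 (v z))) + ((End (D' 0 (v z)) - L (v z)) + (P (End (D1 0 z)) - (z * I) *\<^sub>R P (Cvec j))))"
    by (intro bigo0_add r1 r2 Pmain)
  moreover have "(End (D 0 z) - End (D1 0 z) - End (D' 0 (v z))) + ((End (D' 0 (v z)) - L (v z)) + (P (End (D1 0 z)) - (z * I) *\<^sub>R P (Cvec j)))
     = End (D 0 z) - z *\<^sub>R (I *\<^sub>R Cvec j)" for z
  proof -
    have "L (v z) = v z"
      unfolding v_def by (rule L(3)[OF subspace_neg[OF subspace_reachable_set L(2)]])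
    thus ?thesis by (simp add: v_def P_def linear_diff[OF L(1)] linear_scale[OF L(1)] algebra_simps)
  qed
  ultimately have "bigo0 (1 + \<sigma>) (\<lambda>z. End (D 0 z) - z *\<^sub>R (I *\<^sub>R Cvec j))" by simp
  hence "bigo0 (1 + min \<sigma> (\<kappa> * s')) (\<lambda>z. End (D 0 z) - z *\<^sub>R (I *\<^sub>R Cvec j))" by (rule bigo0_mono) simp
  hence "I *\<^sub>R Cvec j \<in> ?V" using D(1) unfolding reachable_set_def reachable_map_def by blast
  from subspace_scale[OF subspace_reachable_set this, of "1 / I"] show ?thesis using I by simp
qed

text \<open>Strong induction on j: the bad brackets required for a smaller index are among those
  required for j.\<close>

lemma Cvec_reachable:
  assumes "\<And>k. 2 * k + 3 \<le> j + 2 \<Longrightarrow> Wvec1 k \<in> reachable_set m \<and> Wvec2 k \<in> reachable_set m"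
  shows "Cvec j \<in> reachable_set m"
  using assms
proof (induction j rule: less_induct)
  case (less j)
  show ?case
  proof (rule Cvec_reachable_step[OF less.prems])
    show "Cvec i \<in> reachable_set m" if "i < j" for i
      by (rule less.IH[OF that]) (use less.prems that in auto)
  qed
qed

end

section \<open>Real analytic functions and vector fields\<close>

definition mpow :: "('n::finite \<Rightarrow> nat) \<Rightarrow> real ^ 'n \<Rightarrow> real" where
  "mpow \<alpha> y = (\<Prod>i\<in>UNIV. (y $ i) ^ \<alpha> i)"

definition has_ps :: "(real ^ 'n \<Rightarrow> 'b::real_normed_vector) \<Rightarrow> real ^ 'n \<Rightarrow> real \<Rightarrow> (('n \<Rightarrow> nat) \<Rightarrow> 'b) \<Rightarrow> bool" where
  "has_ps f p \<rho> c \<longleftrightarrow> (\<forall>x. (\<forall>i. \<bar>x $ i - p $ i\<bar> < \<rho>) \<longrightarrow>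
      ((\<lambda>\<alpha>. mpow \<alpha> (x - p) *\<^sub>R c \<alpha>) has_sum f x) UNIV)"

lemma real_analytic_on_iff_has_ps:
  "f real_analytic_on U \<longleftrightarrow> (\<forall>p\<in>U. \<exists>\<rho>>0. \<exists>c. has_ps f p \<rho> c)"
  unfolding real_analytic_on_def has_ps_def mpow_def by simp

lemma has_psD:
  assumes "has_ps f p \<rho> c" "\<And>i. \<bar>x $ i - p $ i\<bar> < \<rho>"
  shows "((\<lambda>\<alpha>. mpow \<alpha> (x - p) *\<^sub>R c \<alpha>) has_sum f x) UNIV"
  using assms unfolding has_ps_def by blast

lemma has_ps_mono: "has_ps f p \<rho> c \<Longrightarrow> \<rho>' \<le> \<rho> \<Longrightarrow> has_ps f p \<rho>' c"
  unfolding has_ps_def by (meson order_less_le_trans)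

lemma mpow_const: "mpow \<alpha> (\<chi> i. r) = r ^ (\<Sum>i\<in>UNIV. \<alpha> i)"
  by (simp add: mpow_def power_sum)

lemma mpow_0 [simp]: "mpow (\<lambda>_. 0) y = 1"
  by (simp add: mpow_def)

lemma mpow_add: "mpow (\<lambda>i. \<alpha> i + \<beta> i) y = mpow \<alpha> y * mpow \<beta> y"
  by (simp add: mpow_def power_add prod.distrib)

lemma mpow_at_0: "\<alpha> \<noteq> (\<lambda>_. 0) \<Longrightarrow> mpow \<alpha> 0 = 0"
  unfolding mpow_def by (auto intro!: prod_zero simp: fun_eq_iff) 

lemma abs_mpow_le:
  assumes "\<And>i. \<bar>y $ i\<bar> \<le> r"
  shows "\<bar>mpow \<alpha> y\<bar> \<le> r ^ (\<Sum>i\<in>UNIV. \<alpha> i)"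
  unfolding mpow_def abs_prod power_sum
  by (intro prod_mono conjI) (auto simp: power_abs intro!: power_mono assms)

text \<open>In finite dimension unconditional summability implies absolute summability, coordinate
  by coordinate. This makes majorants available for power series given as unordered sums.\<close>

lemma abs_summable_euclidean:
  fixes f :: "'i \<Rightarrow> 'b::euclidean_space"
  assumes "f summable_on A"
  shows "(\<lambda>x. norm (f x)) summable_on A"
proof -
  have "(\<lambda>x. \<bar>f x \<bullet> b\<bar>) summable_on A" for b
  proof -
    have "(\<lambda>x. f x \<bullet> b) summable_on A"
      by (rule summable_on_bounded_linear[OF bounded_linear_inner_left assms])
    from summable_on_iff_abs_summable_on_real[THEN iffD1, OF this] show ?thesis by simp
  qed
  hence "(\<lambda>x. \<Sum>b\<in>Basis. \<bar>f x \<bullet> b\<bar>) summable_on A"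
  proof -
    have *: "(\<lambda>x. \<Sum>b\<in>B. \<bar>f x \<bullet> b\<bar>) summable_on A" if "finite B" for B
      using that
    proof (induction B rule: finite_induct)
      case (insert b B)
      thus ?case using \<open>\<And>b. (\<lambda>x. \<bar>f x \<bullet> b\<bar>) summable_on A\<close> by (simp add: summable_on_add)
    qed simp
    show ?thesis using *[OF finite_Basis] .
  qed
  thus ?thesis
    by (rule summable_on_comparison_test) (auto simp: norm_le_l1)
qed

text \<open>Evaluate at the diagonal point p + (r, ..., r), where every monomial is r to its total
  degree.\<close>

lemma has_ps_abs_summable:
  fixes f :: "real ^ 'n \<Rightarrow> 'b::euclidean_space"
  assumes "has_ps f p \<rho> c" "0 < r" "r < \<rho>"
  shows "(\<lambda>\<alpha>. r ^ (\<Sum>i\<in>UNIV. \<alpha> i) * norm (c \<alpha>)) summable_on UNIV"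
proof -
  have "((\<lambda>\<alpha>. mpow \<alpha> ((p + (\<chi> i. r)) - p) *\<^sub>R c \<alpha>) has_sum f (p + (\<chi> i. r))) UNIV"
    by (rule has_psD[OF assms(1)]) (use assms in auto)
  hence "(\<lambda>\<alpha>. r ^ (\<Sum>i\<in>UNIV. \<alpha> i) *\<^sub>R c \<alpha>) summable_on UNIV"
    by (simp add: mpow_const has_sum_imp_summable)
  from abs_summable_euclidean[OF this] show ?thesis
    using assms by simp
qed

lemma has_ps_center:
  fixes f :: "real ^ 'n \<Rightarrow> 'b::real_normed_vector"
  assumes "has_ps f p \<rho> c" "\<rho> > 0"
  shows "f p = c (\<lambda>_. 0)"
proof -
  have "((\<lambda>\<alpha>. mpow \<alpha> 0 *\<^sub>R c \<alpha>) has_sum f p) UNIV"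
    using has_psD[OF assms(1), of p] assms(2) by simp
  also have "?this \<longleftrightarrow> ((\<lambda>\<alpha>. mpow \<alpha> 0 *\<^sub>R c \<alpha>) has_sum f p) {\<lambda>_. 0}"
    by (rule has_sum_cong_neutral) (auto simp: mpow_at_0)
  finally show ?thesis by (simp add: has_sum_finite_iff)
qed

lemma has_ps_add: "has_ps f p \<rho> c \<Longrightarrow> has_ps g p \<rho> d \<Longrightarrow> has_ps (\<lambda>x. f x + g x) p \<rho> (\<lambda>\<alpha>. c \<alpha> + d \<alpha>)"
  unfolding has_ps_def by (auto simp: scaleR_add_right intro!: has_sum_add)

lemma has_ps_bounded_linear:
  assumes "bounded_linear h" "has_ps f p \<rho> c" shows "has_ps (\<lambda>x. h (f x)) p \<rho> (\<lambda>\<alpha>. h (c \<alpha>))"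
proof -
  interpret bounded_linear h by fact
  show ?thesis
    using assms(2) unfolding has_ps_def scaleR[symmetric]
    by (auto intro!: has_sum_bounded_linear[OF assms(1)])
qed

lemma finite_multi_le: "finite {\<alpha> :: 'n::finite \<Rightarrow> nat. \<forall>i. \<alpha> i \<le> \<gamma> i}"
proof -
  have "{\<alpha> :: 'n \<Rightarrow> nat. \<forall>i. \<alpha> i \<le> \<gamma> i} = PiE UNIV (\<lambda>i. {..\<gamma> i})" by (auto simp: PiE_def)
  thus ?thesis by (simp add: finite_PiE)
qed

text \<open>Cauchy product: the double family is absolutely summable, so it may be summed over
  \<beta> and then over \<alpha>, which gives the product, or along the finite fibres \<alpha> +
  \<beta> = \<gamma>, which gives a power series.\<close>

lemma has_ps_scaleR:
  fixes f :: "real ^ 'n \<Rightarrow> 'b::euclidean_space" and g :: "real ^ 'n \<Rightarrow> real"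
  assumes g: "has_ps g p \<rho> d" and f: "has_ps f p \<rho> c" and "\<rho> > 0"
  shows "\<exists>e. has_ps (\<lambda>x. g x *\<^sub>R f x) p (\<rho> / 2) e"
proof -
  define S where "S \<gamma> = {(\<alpha>, \<beta>). (\<lambda>i. \<alpha> i + \<beta> i) = \<gamma>}" for \<gamma> :: "'n \<Rightarrow> nat"
  define e where "e \<gamma> = (\<Sum>(\<alpha>, \<beta>)\<in>S \<gamma>. d \<alpha> *\<^sub>R c \<beta>)" for \<gamma>
  have finS: "finite (S \<gamma>)" for \<gamma>
    by (rule finite_subset[OF _ finite_cartesian_product[OF finite_multi_le[of \<gamma>] finite_multi_le[of \<gamma>]]])
       (auto simp: S_def)
  have "has_ps (\<lambda>x. g x *\<^sub>R f x) p (\<rho> / 2) e"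
    unfolding has_ps_def
  proof (intro allI impI)
    fix x assume x: "\<forall>i. \<bar>x $ i - p $ i\<bar> < \<rho> / 2"
    hence x': "\<bar>x $ i - p $ i\<bar> < \<rho>" for i using assms(3) spec[OF x, of i] by linarith
    define y where "y = x - p"
    define a where "a \<alpha> = mpow \<alpha> y * d \<alpha>" for \<alpha>
    define b where "b \<beta> = mpow \<beta> y *\<^sub>R c \<beta>" for \<beta>
    have a: "(a has_sum g x) UNIV" using has_psD[OF g x'] by (simp add: a_def[abs_def] y_def)
    have b: "(b has_sum f x) UNIV" using has_psD[OF f x'] by (simp add: b_def[abs_def] y_def)
    have na: "(\<lambda>\<alpha>. norm (a \<alpha>)) summable_on UNIV"
      using abs_summable_euclidean[OF has_sum_imp_summable[OF a]] .
    have nb: "(\<lambda>\<alpha>. norm (b \<alpha>)) summable_on UNIV"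
      using abs_summable_euclidean[OF has_sum_imp_summable[OF b]] .
    have "(\<lambda>q. norm (case q of (\<alpha>, \<beta>) \<Rightarrow> a \<alpha> *\<^sub>R b \<beta>)) summable_on (UNIV \<times> UNIV)"
      unfolding Infinite_Sum.abs_summable_on_Sigma_iff
    proof (intro conjI ballI)
      fix \<alpha> show "(\<lambda>y. norm (case (\<alpha>, y) of (\<alpha>, \<beta>) \<Rightarrow> a \<alpha> *\<^sub>R b \<beta>)) summable_on UNIV"
        using summable_on_cmult_right[OF nb, of "\<bar>a \<alpha>\<bar>"] by simp
    next
      have "(\<lambda>\<alpha>. \<bar>a \<alpha>\<bar> * (\<Sum>\<^sub>\<infinity>\<beta>. norm (b \<beta>))) summable_on UNIV"
        using summable_on_cmult_left[OF na] by simp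
      moreover have "(\<Sum>\<^sub>\<infinity>\<beta>. norm (a \<alpha> *\<^sub>R b \<beta>)) = \<bar>a \<alpha>\<bar> * (\<Sum>\<^sub>\<infinity>\<beta>. norm (b \<beta>))" for \<alpha>
        by (simp add: infsum_cmult_right')
      moreover have "0 \<le> (\<Sum>\<^sub>\<infinity>\<beta>. norm (b \<beta>))" by (rule infsum_nonneg) auto
      ultimately show "(\<lambda>x. norm (\<Sum>\<^sub>\<infinity>y\<in>UNIV. norm (case (x, y) of (\<alpha>, \<beta>) \<Rightarrow> a \<alpha> *\<^sub>R b \<beta>))) summable_on UNIV"
        by (simp add: abs_mult)
    qed
    hence sm: "(\<lambda>(\<alpha>, \<beta>). a \<alpha> *\<^sub>R b \<beta>) summable_on (UNIV \<times> UNIV)"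
      by (rule Infinite_Sum.abs_summable_summable)
    then obtain s where s: "((\<lambda>(\<alpha>, \<beta>). a \<alpha> *\<^sub>R b \<beta>) has_sum s) (UNIV \<times> UNIV)"
      by (auto simp: summable_on_def)
    have uc: "uniformly_continuous_on UNIV (\<lambda>(x::'b, y). x + y)"
      by (rule isUCont_plus)
    have "((\<lambda>\<alpha>. a \<alpha> *\<^sub>R f x) has_sum s) UNIV"
      by (rule has_sum_Sigma[OF uc s])
         (auto intro!: has_sum_bounded_linear[OF bounded_linear_scaleR_right b])
    moreover have "((\<lambda>\<alpha>. a \<alpha> *\<^sub>R f x) has_sum (g x *\<^sub>R f x)) UNIV"
      by (rule has_sum_bounded_linear[OF bounded_linear_scaleR_left a])
    ultimately have "s = g x *\<^sub>R f x" by (rule has_sum_unique)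
    with s have 1: "((\<lambda>(\<alpha>, \<beta>). a \<alpha> *\<^sub>R b \<beta>) has_sum (g x *\<^sub>R f x)) (UNIV \<times> UNIV)" by simp
    have "((\<lambda>(\<gamma>, \<alpha>, \<beta>). a \<alpha> *\<^sub>R b \<beta>) has_sum (g x *\<^sub>R f x)) (Sigma UNIV S)"
    proof -
      have "((\<lambda>(\<alpha>, \<beta>). a \<alpha> *\<^sub>R b \<beta>) has_sum (g x *\<^sub>R f x)) (UNIV \<times> UNIV) \<longleftrightarrow>
        ((\<lambda>(\<gamma>, \<alpha>, \<beta>). a \<alpha> *\<^sub>R b \<beta>) has_sum (g x *\<^sub>R f x)) (Sigma UNIV S)"
        by (rule has_sum_reindex_bij_witness[where i = snd and j = "\<lambda>(\<alpha>, \<beta>). (\<lambda>i. \<alpha> i + \<beta> i, \<alpha>, \<beta>)"])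
           (auto simp: S_def)
      with 1 show ?thesis by simp
    qed
    hence "((\<lambda>\<gamma>. \<Sum>(\<alpha>, \<beta>)\<in>S \<gamma>. a \<alpha> *\<^sub>R b \<beta>) has_sum (g x *\<^sub>R f x)) UNIV"
      by (rule has_sum_Sigma[OF uc]) (auto intro!: has_sum_finiteI finS)
    moreover have "(\<Sum>(\<alpha>, \<beta>)\<in>S \<gamma>. a \<alpha> *\<^sub>R b \<beta>) = mpow \<gamma> (x - p) *\<^sub>R e \<gamma>" for \<gamma>
      unfolding e_def scaleR_right.sum
      by (rule sum.cong) (auto simp: S_def a_def b_def y_def mpow_add mult_ac)
    ultimately show "((\<lambda>\<gamma>. mpow \<gamma> (x - p) *\<^sub>R e \<gamma>) has_sum g x *\<^sub>R f x) UNIV" by simp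
  qed
  thus ?thesis by blast
qed


section \<open>Termwise differentiation of power series\<close>

lemma has_derivative_mpow:
  "(mpow \<alpha> has_derivative (\<lambda>h. \<Sum>j\<in>UNIV. h $ j * (\<alpha> j * mpow (\<alpha>(j := \<alpha> j - 1)) y))) (at y within S)"
proof -
  have 1: "(mpow \<alpha> has_derivative (\<lambda>h. \<Sum>j\<in>UNIV. (real (\<alpha> j) * (h $ j) * (y $ j) ^ (\<alpha> j - 1)) * (\<Prod>i\<in>UNIV - {j}. (y $ i) ^ \<alpha> i))) (at y within S)"
    unfolding mpow_def
    by (rule has_derivative_prod)
       (auto intro!: derivative_eq_intros bounded_linear.has_derivative[OF bounded_linear_vec_nth])
  have 2: "mpow (\<alpha>(j := \<alpha> j - 1)) y = (y $ j) ^ (\<alpha> j - 1) * (\<Prod>i\<in>UNIV - {j}. (y $ i) ^ \<alpha> i)" for j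
    unfolding mpow_def by (subst prod.remove[of _ j]) (auto intro!: prod.cong)
  show ?thesis using 1 unfolding 2 by (simp add: mult_ac)
qed

lemma sum_dec: "\<alpha> j > 0 \<Longrightarrow> (\<Sum>i\<in>UNIV. (\<alpha>(j := \<alpha> j - 1)) i) = (\<Sum>i\<in>UNIV. \<alpha> i) - (1::nat)" for \<alpha> :: "'n::finite \<Rightarrow> nat"
  by (subst (1 2) sum.remove[of _ j]) (auto intro!: sum.cong)

text \<open>The factor \<alpha> j is at most 2 to the total degree, so it is absorbed by doubling
  the radius.\<close>

lemma dmpow_bound:
  assumes "\<And>i. \<bar>y $ i\<bar> \<le> s" "s > 0"
  shows "\<bar>\<alpha> j * mpow (\<alpha>(j := \<alpha> j - 1)) y\<bar> \<le> (1 / s) * (2 * s) ^ (\<Sum>i\<in>UNIV. \<alpha> i)"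
proof (cases "\<alpha> j = 0")
  case False
  define N where "N = (\<Sum>i\<in>UNIV. \<alpha> i)"
  have jN: "\<alpha> j \<le> N" unfolding N_def by (rule member_le_sum) auto
  have "\<bar>\<alpha> j * mpow (\<alpha>(j := \<alpha> j - 1)) y\<bar> = \<alpha> j * \<bar>mpow (\<alpha>(j := \<alpha> j - 1)) y\<bar>" by (simp add: abs_mult)
  also have "\<dots> \<le> \<alpha> j * s ^ (N - 1)"
    using abs_mpow_le[of y s "\<alpha>(j := \<alpha> j - 1)"] sum_dec[of \<alpha> j] False assms(1)
    by (intro mult_left_mono) (auto simp: N_def)
  also have "\<dots> \<le> 2 ^ N * s ^ (N - 1)"
  proof (intro mult_right_mono)
    have "\<alpha> j < 2 ^ N" using jN by (meson le_less_trans less_exp)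
    thus "real (\<alpha> j) \<le> 2 ^ N" by (metis less_imp_le of_nat_le_iff of_nat_numeral of_nat_power)
  qed (use assms in auto)
  also have "s ^ (N - 1) = (1 / s) * s ^ N"
    using False jN assms(2) by (cases N) auto
  finally show ?thesis by (simp add: N_def power_mult_distrib mult_ac del: fun_upd_apply)
qed (use assms in auto)

definition pd :: "'n \<Rightarrow> (real ^ 'n \<Rightarrow> 'b::real_normed_vector) \<Rightarrow> real ^ 'n \<Rightarrow> 'b" where
  "pd j f x = frechet_derivative f (at x) (axis j 1)"

text \<open>Weierstrass majorant with an explicit factor H, later the norm of the direction, in the
  form that the criterion for differentiating a series asks for.\<close>

lemma infsum_tail_le:
  fixes m :: "nat \<Rightarrow> real" and F :: "nat \<Rightarrow> 'b::banach"
  assumes "summable m" "\<And>n. norm (F n) \<le> m n * H"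
  shows "norm ((\<Sum>i<n. F i) - suminf F) \<le> (suminf m - (\<Sum>i<n. m i)) * H"
proof -
  have mH: "summable (\<lambda>n. m n * H)" using assms(1) by (rule summable_mult2)
  have sF: "summable (\<lambda>n. norm (F n))" by (rule summable_comparison_test'[OF mH, of 0]) (use assms in auto)
  hence F: "summable F" by (rule summable_norm_cancel)
  have "(\<Sum>i<n. F i) - suminf F = - (\<Sum>i. F (i + n))"
    using suminf_minus_initial_segment[OF F, of n] by simp
  hence "norm ((\<Sum>i<n. F i) - suminf F) = norm (\<Sum>i. F (i + n))" by simp
  also have "\<dots> \<le> (\<Sum>i. norm (F (i + n)))"
    by (rule summable_norm) (use sF in \<open>simp add: summable_iff_shift[of "\<lambda>n. norm (F n)"]\<close>)
  also have "\<dots> \<le> (\<Sum>i. m (i + n) * H)"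
    by (rule suminf_le) (use assms mH sF in \<open>auto simp: summable_iff_shift[of "\<lambda>n. norm (F n)"] summable_iff_shift[of "\<lambda>n. m n * H"]\<close>)
  also have "\<dots> = (\<Sum>i. m (i + n)) * H"
    by (rule suminf_mult2[symmetric]) (use assms in \<open>simp add: summable_iff_shift\<close>)
  also have "(\<Sum>i. m (i + n)) = suminf m - (\<Sum>i<n. m i)"
    by (rule suminf_minus_initial_segment[OF assms(1)])
  finally show ?thesis .
qed

text \<open>On the cube of half-width s = \<rho> / 4 the differentiated monomials are dominated by
  the series at radius 2 s < \<rho>, which is absolutely summable; so the series may be
  differentiated term by term.\<close>

lemma has_ps_derivative:
  fixes f :: "real ^ 'n \<Rightarrow> 'b::euclidean_space"
  assumes f: "has_ps f p \<rho> c" and "\<rho> > 0"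
  defines "c' \<equiv> \<lambda>j \<beta>. real (\<beta> j + 1) *\<^sub>R c (\<beta>(j := \<beta> j + 1))"
  shows "\<And>j. has_ps (pd j f) p (\<rho> / 4) (c' j)"
    and "\<And>x. (\<And>i. \<bar>x $ i - p $ i\<bar> < \<rho> / 4) \<Longrightarrow> (f has_derivative (\<lambda>h. \<Sum>j\<in>UNIV. h $ j *\<^sub>R pd j f x)) (at x)"
proof -
  define s where "s = \<rho> / 4"
  have s: "s > 0" "2 * s < \<rho>" using assms(2) by (auto simp: s_def)
  define S where "S = {x. \<forall>i. \<bar>x $ i - p $ i\<bar> < s}"
  have S_eq: "S = box (p - (\<chi> i. s)) (p + (\<chi> i. s))"
    unfolding S_def by (auto simp: mem_box_cart abs_less_iff algebra_simps; smt (verit))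
  have opS: "open S" and cvS: "convex S" unfolding S_eq by (auto simp: open_box)
  \<comment> \<open>The multi-indices are enumerated because the theorem on differentiating series
    speaks of sequences.\<close>
  define e :: "nat \<Rightarrow> 'n \<Rightarrow> nat" where "e = from_nat_into UNIV"
  have e: "bij_betw e UNIV UNIV"
    unfolding e_def
  proof (rule bij_betw_from_nat_into)
    have "inj (\<lambda>k::nat. \<lambda>_::'n. k)" by (rule injI) metis
    thus "infinite (UNIV :: ('n \<Rightarrow> nat) set)" by (meson finite_imageD finite_subset infinite_UNIV_nat top_greatest)
  qed auto
  define F where "F \<alpha> x h = (\<Sum>j\<in>UNIV. h $ j * (\<alpha> j * mpow (\<alpha>(j := \<alpha> j - 1)) (x - p))) *\<^sub>R c \<alpha>" for \<alpha> x h
  define G where "G x h = (\<Sum>n. F (e n) x h)" for x h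
  define b where "b \<alpha> = (1 / s) * ((2 * s) ^ (\<Sum>i\<in>UNIV. \<alpha> i) * norm (c \<alpha>))" for \<alpha>
  have b: "b summable_on UNIV"
    unfolding b_def by (rule summable_on_cmult_right[OF has_ps_abs_summable[OF f]]) (use s in auto)
  define m where "m n = real CARD('n) * b (e n)" for n
  have "(\<lambda>n. b (e n)) summable_on UNIV"
    using b summable_on_reindex_bij_betw[OF e, of b] by simp
  hence m: "summable m" unfolding m_def by (intro summable_mult summable_on_imp_summable)
  have F_axis: "F \<alpha> x (axis j 1) = (\<alpha> j * mpow (\<alpha>(j := \<alpha> j - 1)) (x - p)) *\<^sub>R c \<alpha>" for \<alpha> x j
    unfolding F_def by (subst sum.remove[of _ j]) (auto simp: axis_def intro!: sum.neutral)
  have bound1: "norm (F \<alpha> x (axis j 1)) \<le> b \<alpha>" if "x \<in> S" for \<alpha> x j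
  proof -
    have "norm (F \<alpha> x (axis j 1)) = \<bar>\<alpha> j * mpow (\<alpha>(j := \<alpha> j - 1)) (x - p)\<bar> * norm (c \<alpha>)"
      unfolding F_axis by simp
    also have "\<dots> \<le> ((1 / s) * (2 * s) ^ (\<Sum>i\<in>UNIV. \<alpha> i)) * norm (c \<alpha>)"
      by (intro mult_right_mono dmpow_bound) (use that s in \<open>auto simp: S_def less_imp_le\<close>)
    finally show ?thesis by (simp add: b_def mult_ac)
  qed
  have F_lin: "F \<alpha> x h = (\<Sum>j\<in>UNIV. h $ j *\<^sub>R F \<alpha> x (axis j 1))" for \<alpha> x h
    unfolding F_axis unfolding F_def by (simp add: scaleR_sum_left)
  have bound: "norm (F (e n) x h) \<le> m n * norm h" if "x \<in> S" for n x h
  proof -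
    have "norm (F (e n) x h) \<le> (\<Sum>j\<in>UNIV. \<bar>h $ j\<bar> * norm (F (e n) x (axis j 1)))"
      unfolding F_lin[of _ _ h] by (rule order_trans[OF norm_sum]) simp
    also have "\<dots> \<le> (\<Sum>j\<in>(UNIV::'n set). norm h * b (e n))"
      by (intro sum_mono mult_mono bound1 that component_le_norm_cart) auto
    finally show ?thesis by (simp add: m_def mult_ac)
  qed
  have der: "(f has_derivative G x) (at x)" if x: "x \<in> S" for x
  proof -
    have sumsf: "(\<lambda>n. mpow (e n) (x - p) *\<^sub>R c (e n)) sums f x" if "x \<in> S" for x
    proof -
      have "((\<lambda>\<alpha>. mpow \<alpha> (x - p) *\<^sub>R c \<alpha>) has_sum f x) UNIV"
      proof (rule has_psD[OF f])
        fix i have "\<bar>x $ i - p $ i\<bar> < s" using that by (simp add: S_def)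
        thus "\<bar>x $ i - p $ i\<bar> < \<rho>" using s by linarith
      qed
      with has_sum_reindex_bij_betw[OF e, of "\<lambda>\<alpha>. mpow \<alpha> (x - p) *\<^sub>R c \<alpha>"]
      show ?thesis by (intro has_sum_imp_sums) simp
    qed
    have "\<exists>g. \<forall>x\<in>S. (\<lambda>n. mpow (e n) (x - p) *\<^sub>R c (e n)) sums g x \<and> (g has_derivative G x) (at x within S)"
    proof (rule has_derivative_series[where f = "\<lambda>n x. mpow (e n) (x - p) *\<^sub>R c (e n)" and f' = "\<lambda>n. F (e n)" and g' = G, OF cvS _ _ x sumsf[OF x]])
      fix n x assume "x \<in> S"
      show "((\<lambda>x. mpow (e n) (x - p) *\<^sub>R c (e n)) has_derivative F (e n) x) (at x within S)"
        unfolding F_def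
        by (rule has_derivative_scaleR_left, rule has_derivative_compose[OF _ has_derivative_mpow])
           (auto intro!: derivative_eq_intros)
    next
      fix \<epsilon> :: real assume "\<epsilon> > 0"
      have "(\<lambda>n. suminf m - (\<Sum>i<n. m i)) \<longlonglongrightarrow> suminf m - suminf m"
        by (intro tendsto_intros summable_LIMSEQ m)
      hence "\<forall>\<^sub>F n in sequentially. suminf m - (\<Sum>i<n. m i) < \<epsilon>"
        by (rule order_tendstoD) (use \<open>\<epsilon> > 0\<close> in auto)
      thus "\<forall>\<^sub>F n in sequentially. \<forall>x\<in>S. \<forall>h. norm ((\<Sum>i<n. F (e i) x h) - G x h) \<le> \<epsilon> * norm h"
      proof eventually_elim
        case (elim n)
        show ?case
        proof (intro ballI allI)
          fix x h assume "x \<in> S"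
          have "norm ((\<Sum>i<n. F (e i) x h) - G x h) \<le> (suminf m - (\<Sum>i<n. m i)) * norm h"
            unfolding G_def by (rule infsum_tail_le[OF m bound[OF \<open>x \<in> S\<close>]])
          also have "\<dots> \<le> \<epsilon> * norm h" using elim by (intro mult_right_mono) auto
          finally show "norm ((\<Sum>i<n. F (e i) x h) - G x h) \<le> \<epsilon> * norm h" .
        qed
      qed
    qed
    then obtain g where g: "\<And>x. x \<in> S \<Longrightarrow> (\<lambda>n. mpow (e n) (x - p) *\<^sub>R c (e n)) sums g x"
        "\<And>x. x \<in> S \<Longrightarrow> (g has_derivative G x) (at x within S)" by blast
    have "g y = f y" if "y \<in> S" for y using sums_unique2[OF g(1) sumsf] that by blast
    hence "(f has_derivative G x) (at x within S)"
      by (intro has_derivative_transform[OF x _ g(2)[OF x]]) auto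
    thus ?thesis unfolding at_within_open[OF x opS] .
  qed
  have pd: "pd j f x = G x (axis j 1)" if "x \<in> S" for x j
    unfolding pd_def using frechet_derivative_at[OF der[OF that]] by simp
  show "(f has_derivative (\<lambda>h. \<Sum>j\<in>UNIV. h $ j *\<^sub>R pd j f x)) (at x)"
    if "\<And>i. \<bar>x $ i - p $ i\<bar> < \<rho> / 4" for x
  proof -
    have x: "x \<in> S" using that by (simp add: S_def s_def)
    interpret linear "G x" using der[OF x] by (rule has_derivative_linear)
    have "G x h = (\<Sum>j\<in>UNIV. h $ j *\<^sub>R pd j f x)" for h
    proof -
      have "G x h = G x (\<Sum>j\<in>UNIV. h $ j *\<^sub>R axis j 1)"
        using basis_expansion[of h] by (simp add: scalar_mult_eq_scaleR)
      thus ?thesis by (simp add: sum scaleR pd[OF x])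
    qed
    hence "G x = (\<lambda>h. \<Sum>j\<in>UNIV. h $ j *\<^sub>R pd j f x)" by blast
    thus ?thesis using der[OF x] by simp
  qed
  show "has_ps (pd j f) p (\<rho> / 4) (c' j)" for j
    unfolding has_ps_def
  proof (intro allI impI)
    fix x assume "\<forall>i. \<bar>x $ i - p $ i\<bar> < \<rho> / 4"
    hence x: "x \<in> S" by (simp add: S_def s_def)
    have "(\<lambda>\<alpha>. norm (F \<alpha> x (axis j 1))) summable_on UNIV"
      by (rule summable_on_comparison_test[OF b bound1[OF x]]) auto
    hence "(\<lambda>\<alpha>. F \<alpha> x (axis j 1)) summable_on UNIV" by (rule Infinite_Sum.abs_summable_summable)
    then obtain T where T: "((\<lambda>\<alpha>. F \<alpha> x (axis j 1)) has_sum T) UNIV" by (auto simp: summable_on_def)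
    hence "(\<lambda>n. F (e n) x (axis j 1)) sums T"
      using has_sum_reindex_bij_betw[OF e, of "\<lambda>\<alpha>. F \<alpha> x (axis j 1)"] by (intro has_sum_imp_sums) simp
    hence "T = pd j f x" unfolding pd[OF x] G_def by (simp add: sums_iff)
    with T have "((\<lambda>\<alpha>. F \<alpha> x (axis j 1)) has_sum pd j f x) UNIV" by simp
    \<comment> \<open>Terms with \<alpha> j = 0 vanish; lowering \<alpha> j by one maps the others
      bijectively onto all multi-indices.\<close>
    also have "?this \<longleftrightarrow> ((\<lambda>\<alpha>. F \<alpha> x (axis j 1)) has_sum pd j f x) {\<alpha>. \<alpha> j > 0}"
      by (rule has_sum_cong_neutral) (auto simp: F_axis)
    also have "\<dots> \<longleftrightarrow> ((\<lambda>\<beta>. mpow \<beta> (x - p) *\<^sub>R c' j \<beta>) has_sum pd j f x) UNIV"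
      by (rule has_sum_reindex_bij_witness[where j = "\<lambda>\<alpha>. \<alpha>(j := \<alpha> j - 1)" and i = "\<lambda>\<beta>. \<beta>(j := \<beta> j + 1)"])
         (auto simp: F_axis c'_def fun_eq_iff)
    finally show "((\<lambda>\<beta>. mpow \<beta> (x - p) *\<^sub>R c' j \<beta>) has_sum pd j f x) UNIV" .
  qed
qed

section \<open>Closure properties of analytic maps\<close>

lemma real_analytic_has_psE:
  assumes "f real_analytic_on U" "p \<in> U"
  obtains \<rho> c where "\<rho> > 0" "has_ps f p \<rho> c"
  using assms unfolding real_analytic_on_iff_has_ps by blast

lemma real_analytic_on_add:
  assumes "f real_analytic_on U" "g real_analytic_on U"
  shows "(\<lambda>x. f x + g x) real_analytic_on U"
  unfolding real_analytic_on_iff_has_ps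
proof
  fix p assume "p \<in> U"
  with assms obtain \<rho>1 c1 \<rho>2 c2 where "\<rho>1 > 0" "has_ps f p \<rho>1 c1" "\<rho>2 > 0" "has_ps g p \<rho>2 c2"
    by (meson real_analytic_has_psE)
  hence "min \<rho>1 \<rho>2 > 0" "has_ps f p (min \<rho>1 \<rho>2) c1" "has_ps g p (min \<rho>1 \<rho>2) c2"
    by (auto intro: has_ps_mono)
  thus "\<exists>\<rho>>0. \<exists>c. has_ps (\<lambda>x. f x + g x) p \<rho> c" using has_ps_add by blast
qed

lemma real_analytic_on_bounded_linear:
  assumes "bounded_linear h" "f real_analytic_on U"
  shows "(\<lambda>x. h (f x)) real_analytic_on U"
  using assms(2) has_ps_bounded_linear[OF assms(1)] unfolding real_analytic_on_iff_has_ps by blast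

lemma real_analytic_on_scaleR:
  fixes f :: "real ^ 'n \<Rightarrow> 'b::euclidean_space" and g :: "real ^ 'n \<Rightarrow> real"
  assumes "f real_analytic_on U" "g real_analytic_on U"
  shows "(\<lambda>x. g x *\<^sub>R f x) real_analytic_on U"
  unfolding real_analytic_on_iff_has_ps
proof
  fix p assume "p \<in> U"
  with assms obtain \<rho>1 c1 \<rho>2 c2 where "\<rho>1 > 0" "has_ps f p \<rho>1 c1" "\<rho>2 > 0" "has_ps g p \<rho>2 c2"
    by (meson real_analytic_has_psE)
  hence *: "min \<rho>1 \<rho>2 > 0" "has_ps f p (min \<rho>1 \<rho>2) c1" "has_ps g p (min \<rho>1 \<rho>2) c2"
    by (auto intro: has_ps_mono)
  have "min \<rho>1 \<rho>2 / 2 > 0" using *(1) by simp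
  thus "\<exists>\<rho>>0. \<exists>c. has_ps (\<lambda>x. g x *\<^sub>R f x) p \<rho> c" using has_ps_scaleR[OF *(3,2,1)] by blast
qed

lemma real_analytic_on_zero: "(\<lambda>x. 0) real_analytic_on U"
  unfolding real_analytic_on_iff_has_ps has_ps_def
  by (intro ballI exI[of _ 1] conjI exI[of _ "\<lambda>_. 0"]) auto

lemma real_analytic_on_sum:
  assumes "\<And>i. i \<in> I \<Longrightarrow> f i real_analytic_on U"
  shows "(\<lambda>x. \<Sum>i\<in>I. f i x) real_analytic_on U"
  using assms
  by (induction I rule: infinite_finite_induct) (auto intro: real_analytic_on_zero real_analytic_on_add)

lemma real_analytic_on_pd:
  fixes f :: "real ^ 'n \<Rightarrow> 'b::euclidean_space"
  assumes "f real_analytic_on U"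
  shows "pd j f real_analytic_on U"
  unfolding real_analytic_on_iff_has_ps
proof
  fix p assume "p \<in> U"
  with assms obtain \<rho> c where *: "\<rho> > 0" "has_ps f p \<rho> c" by (rule real_analytic_has_psE)
  have "\<rho> / 4 > 0" using *(1) by simp
  thus "\<exists>\<rho>>0. \<exists>c. has_ps (pd j f) p \<rho> c" using has_ps_derivative(1)[OF *(2,1)] by blast
qed

section \<open>First and second derivatives and the bracket of vector fields\<close>

definition D1 :: "(real ^ 'n \<Rightarrow> 'b::real_normed_vector) \<Rightarrow> real ^ 'n \<Rightarrow> real ^ 'n \<Rightarrow> 'b" where
  "D1 f x v = (\<Sum>j\<in>UNIV. v $ j *\<^sub>R pd j f x)"

text \<open>Built from the partial derivatives, which are again analytic, so that the facts about
  \<open>D1\<close> can be applied a second time.\<close>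

definition D2 :: "(real ^ 'n \<Rightarrow> 'b::real_normed_vector) \<Rightarrow> real ^ 'n \<Rightarrow> real ^ 'n \<Rightarrow> real ^ 'n \<Rightarrow> 'b" where
  "D2 f x v w = (\<Sum>j\<in>UNIV. v $ j *\<^sub>R D1 (pd j f) x w)"

lemma has_derivative_D1:
  fixes f :: "real ^ 'n \<Rightarrow> 'b::euclidean_space"
  assumes "f real_analytic_on U" "x \<in> U"
  shows "(f has_derivative D1 f x) (at x within S)"
proof -
  obtain \<rho> c where *: "\<rho> > 0" "has_ps f x \<rho> c" using assms by (rule real_analytic_has_psE)
  show ?thesis unfolding D1_def[abs_def]
    by (rule has_derivative_at_withinI, rule has_ps_derivative(2)[OF *(2,1)]) (use * in auto)
qed

lemma frechet_derivative_D1: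
  fixes f :: "real ^ 'n \<Rightarrow> 'b::euclidean_space"
  assumes "f real_analytic_on U" "x \<in> U"
  shows "frechet_derivative f (at x) = D1 f x"
  using frechet_derivative_at[OF has_derivative_D1[OF assms, of UNIV]] by simp

text \<open>For distinct i and j both mixed derivatives are the same coefficient of the power series
  centred at x.\<close>

lemma pd_commute:
  fixes f :: "real ^ 'n \<Rightarrow> 'b::euclidean_space"
  assumes "f real_analytic_on U" "x \<in> U"
  shows "pd i (pd j f) x = pd j (pd i f) x"
proof -
  obtain \<rho> c where *: "\<rho> > 0" "has_ps f x \<rho> c" using assms by (rule real_analytic_has_psE)
  have *: "pd i (pd j f) x = real (((\<lambda>_. 0)(i := 1)) j + 1) *\<^sub>R c ((\<lambda>_. 0)(i := 1, j := ((\<lambda>_. 0)(i := 1)) j + 1))" for i j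
  proof -
    have 1: "has_ps (pd j f) x (\<rho> / 4) (\<lambda>\<beta>. real (\<beta> j + 1) *\<^sub>R c (\<beta>(j := \<beta> j + 1)))"
      using has_ps_derivative(1)[OF *(2,1)] by simp
    have "\<rho> / 4 > 0" "\<rho> / 4 / 4 > 0" using * by auto
    with has_ps_center[OF has_ps_derivative(1)[OF 1], of i] show ?thesis by simp
  qed
  show ?thesis
    by (cases "i = j") (auto simp: * fun_upd_twist)
qed

lemma linear_D1: "linear (D1 f x)"
  unfolding D1_def by (rule linearI) (simp_all add: scaleR_left_distrib sum.distrib scaleR_sum_right)

lemmas D1_simps = linear_add[OF linear_D1] linear_diff[OF linear_D1] linear_scale[OF linear_D1]
  linear_0[OF linear_D1] linear_neg[OF linear_D1]

lemma D2_commute: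
  fixes f :: "real ^ 'n \<Rightarrow> 'b::euclidean_space"
  assumes "f real_analytic_on U" "x \<in> U"
  shows "D2 f x v w = D2 f x w v"
proof -
  have "D2 f x v w = (\<Sum>j\<in>UNIV. \<Sum>k\<in>UNIV. v $ j *\<^sub>R w $ k *\<^sub>R pd k (pd j f) x)"
    by (simp add: D2_def D1_def scaleR_sum_right)
  also have "\<dots> = (\<Sum>k\<in>UNIV. \<Sum>j\<in>UNIV. v $ j *\<^sub>R w $ k *\<^sub>R pd k (pd j f) x)" by (rule sum.swap)
  also have "\<dots> = (\<Sum>k\<in>UNIV. \<Sum>j\<in>UNIV. w $ k *\<^sub>R v $ j *\<^sub>R pd j (pd k f) x)"
    by (simp add: pd_commute[OF assms, symmetric] mult.commute)
  also have "\<dots> = D2 f x w v" by (simp add: D2_def D1_def scaleR_sum_right)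
  finally show ?thesis .
qed

lemma linear_D2_left: "linear (\<lambda>v. D2 f x v w)"
  unfolding D2_def by (rule linearI) (simp_all add: scaleR_left_distrib sum.distrib scaleR_sum_right)

lemma linear_D2_right: "linear (D2 f x v)"
  unfolding D2_def
  by (rule linearI) (simp_all add: D1_simps scaleR_right_distrib sum.distrib scaleR_sum_right mult_ac)

lemma bounded_bilinear_D2: "bounded_bilinear (D2 f x)"
  for f :: "real ^ 'n \<Rightarrow> 'b::euclidean_space"
  by (intro bilinear_conv_bounded_bilinear[THEN iffD1])
     (simp add: bilinear_def linear_D2_left linear_D2_right)

lemmas D2_simps = linear_add[OF linear_D2_left] linear_diff[OF linear_D2_left] linear_scale[OF linear_D2_left]
  linear_0[OF linear_D2_left] linear_neg[OF linear_D2_left] linear_add[OF linear_D2_right] linear_diff[OF linear_D2_right] linear_scale[OF linear_D2_right]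
  linear_0[OF linear_D2_right] linear_neg[OF linear_D2_right]

lemma has_derivative_D1_fun:
  fixes f :: "real ^ 'n \<Rightarrow> 'b::euclidean_space" and g :: "real ^ 'n \<Rightarrow> real ^ 'n"
  assumes "f real_analytic_on U" "(g has_derivative g') (at x)" "x \<in> U"
  shows "((\<lambda>x. D1 f x (g x)) has_derivative (\<lambda>h. D2 f x (g x) h + D1 f x (g' h))) (at x)"
proof -
  have "((\<lambda>x. \<Sum>j\<in>UNIV. g x $ j *\<^sub>R pd j f x) has_derivative
     (\<lambda>h. \<Sum>j\<in>UNIV. g x $ j *\<^sub>R D1 (pd j f) x h + (g' h $ j) *\<^sub>R pd j f x)) (at x)"
    by (intro has_derivative_sum has_derivative_scaleR has_derivative_D1[OF real_analytic_on_pd[OF assms(1)] assms(3)]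
       bounded_linear.has_derivative[OF bounded_linear_vec_nth] assms(2))
  thus ?thesis unfolding D1_def[abs_def] D2_def by (simp add: sum.distrib)
qed

lemma vf_bracket_D1:
  fixes f :: "real ^ 'n \<Rightarrow> real ^ 'n"
  assumes "f real_analytic_on U" "g real_analytic_on U" "x \<in> U"
  shows "vf_bracket f g x = D1 g x (f x) - D1 f x (g x)"
  unfolding vf_bracket_def using assms by (simp add: frechet_derivative_D1)

lemma real_analytic_on_cong:
  assumes "open U" "\<And>x. x \<in> U \<Longrightarrow> f x = g x" "f real_analytic_on U"
  shows "g real_analytic_on U"
  unfolding real_analytic_on_iff_has_ps
proof
  fix p assume p: "p \<in> U"
  with assms obtain \<rho> c where *: "\<rho> > 0" "has_ps f p \<rho> c" by (meson real_analytic_has_psE)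
  obtain e where e: "e > 0" "ball p e \<subseteq> U" using assms(1) p openE by blast
  \<comment> \<open>A cube of this half-width lies in the ball of radius e, because the norm is at
    most the sum of the absolute values of the coordinates.\<close>
  define r where "r = min \<rho> (e / real CARD('a))"
  have r: "r > 0" using * e by (simp add: r_def)
  have "x \<in> U" if "\<And>i. \<bar>x $ i - p $ i\<bar> < r" for x
  proof -
    have "norm (x - p) \<le> (\<Sum>i\<in>UNIV. \<bar>(x - p) $ i\<bar>)" by (rule norm_le_l1_cart)
    also have "\<dots> < (\<Sum>i\<in>(UNIV::'a set). e / real CARD('a))"
      by (rule sum_strict_mono) (use that in \<open>auto simp: r_def\<close>)
    also have "\<dots> = e" by simp
    finally show ?thesis using e by (auto simp: dist_norm norm_minus_commute)
  qed
  hence "has_ps g p r c" using has_ps_mono[OF *(2), of r] assms(2) unfolding has_ps_def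
    by (simp add: r_def)
  thus "\<exists>\<rho>>0. \<exists>c. has_ps g p \<rho> c" using r by blast
qed

lemma real_analytic_on_D1:
  fixes f :: "real ^ 'n \<Rightarrow> 'b::euclidean_space"
  assumes "f real_analytic_on U" "g real_analytic_on U"
  shows "(\<lambda>x. D1 f x (g x)) real_analytic_on U"
  unfolding D1_def
  by (intro real_analytic_on_sum real_analytic_on_scaleR real_analytic_on_pd assms
    real_analytic_on_bounded_linear[OF bounded_linear_vec_nth])

lemma real_analytic_on_const_scaleR:
  "f real_analytic_on U \<Longrightarrow> (\<lambda>x. c *\<^sub>R f x) real_analytic_on U"
  by (rule real_analytic_on_bounded_linear[OF bounded_linear_scaleR_right])

lemma real_analytic_on_diff:
  assumes "f real_analytic_on U" "g real_analytic_on U"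
  shows "(\<lambda>x. f x - g x) real_analytic_on U"
  using real_analytic_on_add[OF assms(1) real_analytic_on_const_scaleR[OF assms(2), of "-1"]] by simp

lemma real_analytic_on_vf_bracket:
  fixes f g :: "real ^ 'n \<Rightarrow> real ^ 'n"
  assumes "open U" "f real_analytic_on U" "g real_analytic_on U"
  shows "vf_bracket f g real_analytic_on U"
  by (rule real_analytic_on_cong[OF assms(1) _ real_analytic_on_diff[OF real_analytic_on_D1[OF assms(3,2)] real_analytic_on_D1[OF assms(2,3)]]])
     (simp add: vf_bracket_D1[OF assms(2,3)])

lemma D1_cong:
  fixes f :: "real ^ 'n \<Rightarrow> 'b::euclidean_space"
  assumes "open U" "\<And>x. x \<in> U \<Longrightarrow> f x = g x" "f real_analytic_on U" "x \<in> U"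
  shows "D1 g x = D1 f x"
proof -
  have "(g has_derivative D1 f x) (at x)"
    by (rule has_derivative_transform_within_open[OF has_derivative_D1[OF assms(3,4)] assms(1,4)]) (use assms in auto)
  moreover have "(g has_derivative D1 g x) (at x)"
    by (rule has_derivative_D1[OF real_analytic_on_cong[OF assms(1-3)] assms(4)])
  ultimately show ?thesis by (metis has_derivative_unique)
qed

lemma vf_bracket_cong:
  fixes f g :: "real ^ 'n \<Rightarrow> real ^ 'n"
  assumes "open U" "f real_analytic_on U" "g real_analytic_on U" "x \<in> U"
    "\<And>x. x \<in> U \<Longrightarrow> f x = f' x" "\<And>x. x \<in> U \<Longrightarrow> g x = g' x"
  shows "vf_bracket f' g' x = vf_bracket f g x"
proof -
  have "f' real_analytic_on U" "g' real_analytic_on U"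
    using real_analytic_on_cong assms by blast+
  thus ?thesis using assms
    by (simp add: vf_bracket_D1[where U = U] D1_cong[OF assms(1,5,2)] D1_cong[OF assms(1,6,3)])
qed

lemma D1_vf_bracket:
  fixes f g :: "real ^ 'n \<Rightarrow> real ^ 'n"
  assumes "open U" "f real_analytic_on U" "g real_analytic_on U" "x \<in> U"
  shows "D1 (vf_bracket f g) x h =
    D2 g x (f x) h + D1 g x (D1 f x h) - (D2 f x (g x) h + D1 f x (D1 g x h))"
proof -
  have "((\<lambda>x. D1 g x (f x) - D1 f x (g x)) has_derivative
    (\<lambda>h. D2 g x (f x) h + D1 g x (D1 f x h) - (D2 f x (g x) h + D1 f x (D1 g x h)))) (at x)"
    by (intro has_derivative_diff has_derivative_D1_fun[where U = U] has_derivative_D1[where U = U] assms)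
  hence 1: "(vf_bracket f g has_derivative
    (\<lambda>h. D2 g x (f x) h + D1 g x (D1 f x h) - (D2 f x (g x) h + D1 f x (D1 g x h)))) (at x)"
    by (rule has_derivative_transform_within_open[OF _ assms(1,4)]) (simp add: vf_bracket_D1[OF assms(2,3)])
  have 2: "(vf_bracket f g has_derivative D1 (vf_bracket f g) x) (at x)"
    by (rule has_derivative_D1[OF real_analytic_on_vf_bracket[OF assms(1-3)] assms(4)])
  from fun_cong[OF has_derivative_unique[OF 2 1]] show ?thesis .
qed

text \<open>After expansion the terms with two first derivatives cancel by linearity, and those with
  a second derivative cancel because it is symmetric.\<close>

lemma vf_bracket_jacobi:
  fixes f g h :: "real ^ 'n \<Rightarrow> real ^ 'n"
  assumes "open U" "f real_analytic_on U" "g real_analytic_on U" "h real_analytic_on U" "x \<in> U"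
  shows "vf_bracket f (vf_bracket g h) x + (vf_bracket g (vf_bracket h f) x + vf_bracket h (vf_bracket f g) x) = 0"
proof -
  note A = assms(2-4) assms(2-4)[THEN real_analytic_on_vf_bracket[OF assms(1)]]
  have "vf_bracket a (vf_bracket b c) x = 
     D2 c x (b x) (a x) + D1 c x (D1 b x (a x)) - (D2 b x (c x) (a x) + D1 b x (D1 c x (a x)))
     - D1 a x (D1 c x (b x) - D1 b x (c x))"
    if "a real_analytic_on U" "b real_analytic_on U" "c real_analytic_on U" for a b c
    using that assms(1,5)
    by (simp add: vf_bracket_D1[OF that(1) real_analytic_on_vf_bracket[OF assms(1) that(2,3)]]
        vf_bracket_D1[OF that(2,3)] D1_vf_bracket[OF assms(1) that(2,3)])
  note * = this
  show ?thesis
    using assms(2-5) by (simp add: * D1_simps D2_commute[OF assms(2,5), of "h x" "g x"]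
      D2_commute[OF assms(3,5), of "h x" "f x"] D2_commute[OF assms(4,5), of "g x" "f x"])
qed

section \<open>The homomorphism from the free Lie algebra to vector fields\<close>

fun lterm_vf :: "(indet \<Rightarrow> real ^ 'n \<Rightarrow> real ^ 'n) \<Rightarrow> lterm \<Rightarrow> real ^ 'n \<Rightarrow> real ^ 'n" where
  "lterm_vf F LZero = (\<lambda>x. 0)"
| "lterm_vf F (LGen g) = F g"
| "lterm_vf F (LAdd s t) = (\<lambda>x. lterm_vf F s x + lterm_vf F t x)"
| "lterm_vf F (LScale c s) = (\<lambda>x. c *\<^sub>R lterm_vf F s x)"
| "lterm_vf F (LBr s t) = vf_bracket (lterm_vf F s) (lterm_vf F t)"

lemma real_analytic_on_lterm_vf:
  assumes "open U" "\<And>g. F g real_analytic_on U"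
  shows "lterm_vf F t real_analytic_on U"
  by (induction t) (auto intro!: assms real_analytic_on_zero real_analytic_on_add
    real_analytic_on_const_scaleR real_analytic_on_vf_bracket)

lemma D1_add: "D1 (\<lambda>x. f x + g x) x v = D1 f x v + D1 g x v"
  if "f real_analytic_on U" "g real_analytic_on U" "x \<in> U" for f g :: "real ^ 'n \<Rightarrow> 'b::euclidean_space"
  using fun_cong[OF has_derivative_unique[OF has_derivative_D1[OF real_analytic_on_add[OF that(1,2)] that(3)]
    has_derivative_add[OF has_derivative_D1[OF that(1,3)] has_derivative_D1[OF that(2,3)]]]] .

lemma D1_scaleR: "D1 (\<lambda>x. c *\<^sub>R f x) x v = c *\<^sub>R D1 f x v"
  if "f real_analytic_on U" "x \<in> U" for f :: "real ^ 'n \<Rightarrow> 'b::euclidean_space"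
  using fun_cong[OF has_derivative_unique[OF has_derivative_D1[OF real_analytic_on_const_scaleR[OF that(1)] that(2)]
    has_derivative_scaleR_right[OF has_derivative_D1[OF that(1,2)]]]] .

text \<open>Soundness of the Lie axioms for analytic vector fields. Equality is claimed only on U;
  since U is open, equal fields have equal derivatives there, which gives the congruence rule for
  brackets.\<close>

lemma lie_eq_lterm_vf:
  fixes F :: "indet \<Rightarrow> real ^ 'n \<Rightarrow> real ^ 'n"
  assumes "open U" "\<And>g. F g real_analytic_on U"
  shows "lie_eq s t \<Longrightarrow> x \<in> U \<Longrightarrow> lterm_vf F s x = lterm_vf F t x"
proof (induction arbitrary: x rule: lie_eq.induct)
  note A = real_analytic_on_lterm_vf[of U F, OF assms]
  { case (cong_br s s' t t')
    have "vf_bracket (lterm_vf F s') (lterm_vf F t') x = vf_bracket (lterm_vf F s) (lterm_vf F t) x"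
      by (rule vf_bracket_cong[OF assms(1) A A cong_br.prems]) (use cong_br.IH in blast)+
    thus ?case by simp }
  { case (br_add_left s t u)
    thus ?case by (simp add: vf_bracket_D1[where U = U] A real_analytic_on_add D1_add[where U = U] D1_simps) }
  { case (br_add_right s t u)
    thus ?case by (simp add: vf_bracket_D1[where U = U] A real_analytic_on_add D1_add[where U = U] D1_simps) }
  { case (br_scale_left s t u)
    thus ?case by (simp add: vf_bracket_D1[where U = U] A real_analytic_on_const_scaleR D1_scaleR[where U = U] D1_simps scaleR_diff_right) }
  { case (br_scale_right s t u)
    thus ?case by (simp add: vf_bracket_D1[where U = U] A real_analytic_on_const_scaleR D1_scaleR[where U = U] D1_simps scaleR_diff_right) }
  { case (jacobi s t u) thus ?case using vf_bracket_jacobi[OF assms(1) A A A jacobi.prems] by simp }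
qed (auto simp: algebra_simps vf_bracket_def)

text \<open>\<open>Lam\<close> is defined by choice, so existence has to be shown: evaluate a
  representative of each class; by \<open>lie_eq_lterm_vf\<close> the values on U do not depend on
  it.\<close>

lemma Lam_props:
  assumes "open U" "f0 real_analytic_on U" "f1 real_analytic_on U" "f2 real_analytic_on U"
  shows "vf_lie_hom U (Lam U f0 f1 f2)"
    and "\<And>x. x \<in> U \<Longrightarrow> Lam U f0 f1 f2 (lie_gen X0) x = f0 x"
    and "\<And>x. x \<in> U \<Longrightarrow> Lam U f0 f1 f2 (lie_gen X1) x = f1 x"
    and "\<And>x. x \<in> U \<Longrightarrow> Lam U f0 f1 f2 (lie_gen X2) x = f2 x"
proof -
  define F where "F g = (case g of X0 \<Rightarrow> f0 | X1 \<Rightarrow> f1 | X2 \<Rightarrow> f2)" for g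
  have F: "F g real_analytic_on U" for g using assms by (cases g) (auto simp: F_def)
  define \<Lambda> where "\<Lambda> a = lterm_vf F (rep_free_lie a)" for a
  note A = real_analytic_on_lterm_vf[of U F, OF assms(1) F]
  have \<Lambda>: "\<Lambda> a x = lterm_vf F t x" if "x \<in> U" "a = abs_free_lie t" for a t x
  proof -
    have "lie_eq (rep_free_lie a) t" unfolding that(2)
      by (meson Quotient_free_lie Quotient_rep_abs lie_eq.refl)
    thus ?thesis unfolding \<Lambda>_def using lie_eq_lterm_vf[of U F, OF assms(1) F] that(1) by blast
  qed
  have rep: "a = abs_free_lie (rep_free_lie a)" for a
    by (metis Quotient_free_lie Quotient_abs_rep)
  have "vf_lie_hom U \<Lambda>"
    unfolding vf_lie_hom_def
  proof (intro conjI allI ballI)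
    show "\<Lambda> a real_analytic_on U" for a unfolding \<Lambda>_def by (rule A)
    fix a b and x assume x: "x \<in> U"
    have "a + b = abs_free_lie (LAdd (rep_free_lie a) (rep_free_lie b))"
      by (metis plus_free_lie.abs_eq rep)
    from \<Lambda>[OF x this] show "\<Lambda> (a + b) x = \<Lambda> a x + \<Lambda> b x" by (simp add: \<Lambda>_def)
    have "lie_bracket a b = abs_free_lie (LBr (rep_free_lie a) (rep_free_lie b))"
      by (metis lie_bracket.abs_eq rep)
    from \<Lambda>[OF x this] show "\<Lambda> (lie_bracket a b) x = vf_bracket (\<Lambda> a) (\<Lambda> b) x" by (simp add: \<Lambda>_def)
  next
    fix r a and x assume x: "x \<in> U"
    have "r *\<^sub>R a = abs_free_lie (LScale r (rep_free_lie a))"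
      by (metis scaleR_free_lie.abs_eq rep)
    from \<Lambda>[OF x this] show "\<Lambda> (r *\<^sub>R a) x = r *\<^sub>R \<Lambda> a x" by (simp add: \<Lambda>_def)
  qed
  moreover have "\<forall>x\<in>U. \<Lambda> (lie_gen X0) x = f0 x \<and> \<Lambda> (lie_gen X1) x = f1 x \<and> \<Lambda> (lie_gen X2) x = f2 x"
    using \<Lambda>[OF _ lie_gen.abs_eq] by (auto simp: F_def)
  ultimately have "\<exists>\<Lambda>. vf_lie_hom U \<Lambda> \<and>
      (\<forall>x\<in>U. \<Lambda> (lie_gen X0) x = f0 x \<and> \<Lambda> (lie_gen X1) x = f1 x \<and> \<Lambda> (lie_gen X2) x = f2 x)" by blast
  from someI_ex[OF this, folded Lam_def]
  show "vf_lie_hom U (Lam U f0 f1 f2)"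
    "\<And>x. x \<in> U \<Longrightarrow> Lam U f0 f1 f2 (lie_gen X0) x = f0 x"
    "\<And>x. x \<in> U \<Longrightarrow> Lam U f0 f1 f2 (lie_gen X1) x = f1 x"
    "\<And>x. x \<in> U \<Longrightarrow> Lam U f0 f1 f2 (lie_gen X2) x = f2 x" by blast+
qed

section \<open>Lipschitz and Taylor estimates on a ball\<close>

lemma real_analytic_bounded:
  fixes f :: "real ^ 'n \<Rightarrow> 'b::euclidean_space"
  assumes "f real_analytic_on U" "cball 0 R \<subseteq> U"
  shows "\<exists>K. \<forall>x\<in>cball 0 R. norm (f x) \<le> K"
proof -
  have "continuous_on (cball 0 R) f"
    using has_derivative_D1[OF assms(1)] assms(2) by (intro has_derivative_continuous_on) blast
  hence "bounded (f ` cball 0 R)" by (intro compact_imp_bounded compact_continuous_image) auto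
  thus ?thesis by (auto simp: bounded_iff)
qed

lemma norm_D1_le:
  fixes f :: "real ^ 'n \<Rightarrow> 'b::euclidean_space"
  assumes "\<And>j. norm (pd j f x) \<le> M"
  shows "norm (D1 f x h) \<le> (real CARD('n) * M) * norm h"
proof -
  have "norm (D1 f x h) \<le> (\<Sum>j\<in>UNIV. \<bar>h $ j\<bar> * norm (pd j f x))"
    unfolding D1_def by (rule order_trans[OF norm_sum]) simp
  also have "\<dots> \<le> (\<Sum>j\<in>(UNIV::'n set). norm h * M)"
    by (intro sum_mono mult_mono assms component_le_norm_cart) auto
  finally show ?thesis by (simp add: mult_ac)
qed

lemma real_analytic_lipschitz:
  fixes f :: "real ^ 'n \<Rightarrow> 'b::euclidean_space"
  assumes "f real_analytic_on U" "cball 0 R \<subseteq> U"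
  shows "\<exists>K. \<forall>x\<in>cball 0 R. \<forall>y\<in>cball 0 R. norm (f x - f y) \<le> K * norm (x - y)"
proof -
  have "\<exists>M. \<forall>j. \<forall>x\<in>cball 0 R. norm (pd j f x) \<le> M"
  proof -
    have "\<forall>j. \<exists>M. \<forall>x\<in>cball 0 R. norm (pd j f x) \<le> M"
      using real_analytic_bounded[OF real_analytic_on_pd[OF assms(1)] assms(2)] by blast
    then obtain M where M: "\<And>j x. x \<in> cball 0 R \<Longrightarrow> norm (pd j f x) \<le> M j" by metis
    have "M j \<le> (\<Sum>j\<in>UNIV. \<bar>M j\<bar>)" for j
      by (rule order_trans[OF abs_ge_self]) (rule member_le_sum, auto)
    with M show ?thesis by (meson order_trans)
  qed
  then obtain M where M: "\<And>j x. x \<in> cball 0 R \<Longrightarrow> norm (pd j f x) \<le> M" by blast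
  have "norm (f x - f y) \<le> (real CARD('n) * M) * norm (x - y)" if "x \<in> cball 0 R" "y \<in> cball 0 R" for x y
  proof (rule differentiable_bound[OF convex_cball _ _ that])
    fix z assume z: "z \<in> cball (0 :: real ^ 'n) R"
    show "(f has_derivative D1 f z) (at z within cball 0 R)"
      using has_derivative_D1[OF assms(1)] z assms(2) by blast
    show "onorm (D1 f z) \<le> real CARD('n) * M"
      by (rule onorm_le) (rule norm_D1_le[OF M[OF z]])
  qed
  thus ?thesis by blast
qed

lemma finite_bound_all:
  fixes P :: "'i::finite \<Rightarrow> real \<Rightarrow> bool"
  assumes "\<And>i. \<exists>K. P i K" "\<And>i K K'. P i K \<Longrightarrow> K \<le> K' \<Longrightarrow> P i K'"
  shows "\<exists>K. \<forall>i. P i K"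
proof -
  obtain M where M: "\<And>i. P i (M i)" using assms(1) by metis
  have "M j \<le> (\<Sum>j\<in>UNIV. \<bar>M j\<bar>)" for j
    by (rule order_trans[OF abs_ge_self]) (rule member_le_sum, auto)
  thus ?thesis using M assms(2) by blast
qed

text \<open>Mean value inequality for the Taylor error on the ball of radius |x| instead of R: there
  its derivative is O(|x|), since the partial derivatives are Lipschitz.\<close>

lemma real_analytic_taylor1:
  fixes f :: "real ^ 'n \<Rightarrow> 'b::euclidean_space"
  assumes f: "f real_analytic_on U" and R: "cball 0 R \<subseteq> U"
  shows "\<exists>K. \<forall>x\<in>cball 0 R. norm (f x - f 0 - D1 f 0 x) \<le> K * norm x ^ 2"
proof -
  have "\<exists>K. \<forall>j. \<forall>x\<in>cball 0 R. \<forall>y\<in>cball 0 R. norm (pd j f x - pd j f y) \<le> K * norm (x - y)"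
    by (intro finite_bound_all real_analytic_lipschitz[OF real_analytic_on_pd[OF f] R])
       (meson mult_right_mono norm_ge_zero order_trans)
  then obtain K where K: "\<And>j x y. x \<in> cball 0 R \<Longrightarrow> y \<in> cball 0 R \<Longrightarrow> norm (pd j f x - pd j f y) \<le> K * norm (x - y)"
    by blast
  have "norm (f x - f 0 - D1 f 0 x) \<le> (real CARD('n) * \<bar>K\<bar>) * norm x ^ 2" if x: "x \<in> cball 0 R" for x
  proof -
    have sub: "cball 0 (norm x) \<subseteq> cball (0 :: real ^ 'n) R" using x by auto
    have "norm ((f x - f 0 - D1 f 0 x) - (f 0 - f 0 - D1 f 0 0)) \<le> (real CARD('n) * (\<bar>K\<bar> * norm x)) * norm (x - 0)"
    proof (rule differentiable_bound[OF convex_cball[of 0 "norm x"], where f' = "\<lambda>y h. D1 f y h - 0 - D1 f 0 h"])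
      fix y :: "real ^ 'n" assume y: "y \<in> cball 0 (norm x)"
      have yU: "y \<in> U" "0 \<in> cball (0 :: real ^ 'n) R" "y \<in> cball 0 R" "norm y \<le> norm x" using sub R y x
        by (auto intro: order_trans[OF norm_ge_zero])
      show "((\<lambda>x. f x - f 0 - D1 f 0 x) has_derivative (\<lambda>h. D1 f y h - 0 - D1 f 0 h)) (at y within cball 0 (norm x))"
        by (intro has_derivative_diff has_derivative_D1[OF f yU(1)] has_derivative_const
           bounded_linear.has_derivative[OF linear_conv_bounded_linear[THEN iffD1, OF linear_D1] has_derivative_ident])
      show "onorm (\<lambda>h. D1 f y h - 0 - D1 f 0 h) \<le> real CARD('n) * (\<bar>K\<bar> * norm x)"
      proof (rule onorm_le)
        fix h
        have "D1 f y h - 0 - D1 f 0 h = (\<Sum>j\<in>UNIV. h $ j *\<^sub>R (pd j f y - pd j f 0))"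
          by (simp add: D1_def scaleR_diff_right sum_subtractf)
        also have "norm \<dots> \<le> (\<Sum>j\<in>UNIV. \<bar>h $ j\<bar> * norm (pd j f y - pd j f 0))"
          by (rule order_trans[OF norm_sum]) simp
        also have "\<dots> \<le> (\<Sum>j\<in>(UNIV::'n set). norm h * (\<bar>K\<bar> * norm x))"
        proof (intro sum_mono mult_mono component_le_norm_cart)
          fix j
          have "norm (pd j f y - pd j f 0) \<le> K * norm (y - 0)" by (rule K[OF yU(3,2)])
          also have "\<dots> \<le> \<bar>K\<bar> * norm x" using yU(4) by (intro mult_mono) auto
          finally show "norm (pd j f y - pd j f 0) \<le> \<bar>K\<bar> * norm x" .
        qed auto
        finally show "norm (D1 f y h - 0 - D1 f 0 h) \<le> real CARD('n) * (\<bar>K\<bar> * norm x) * norm h" by (simp add: mult_ac)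
      qed
    qed auto
    thus ?thesis by (simp add: D1_simps power2_eq_square mult_ac)
  qed
  thus ?thesis by blast
qed

text \<open>The same argument one order higher. The derivative of the Taylor error in direction h
  combines, with coefficients h_j, the first order Taylor errors of the partial derivatives;
  symmetry of \<open>D2\<close> merges the two terms that come from the quadratic part.\<close>

lemma real_analytic_taylor2:
  fixes f :: "real ^ 'n \<Rightarrow> 'b::euclidean_space"
  assumes f: "f real_analytic_on U" and R: "cball 0 R \<subseteq> U" and R0: "0 \<le> R"
  shows "\<exists>K. \<forall>x\<in>cball 0 R. norm (f x - f 0 - D1 f 0 x - (1/2) *\<^sub>R D2 f 0 x x) \<le> K * norm x ^ 3"
proof -
  have U0: "0 \<in> U" using R R0 by auto
  have "\<exists>K. \<forall>j. \<forall>x\<in>cball 0 R. norm (pd j f x - pd j f 0 - D1 (pd j f) 0 x) \<le> K * norm x ^ 2"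
    by (intro finite_bound_all real_analytic_taylor1[OF real_analytic_on_pd[OF f] R])
       (meson mult_right_mono zero_le_power2 order_trans)
  then obtain K where K: "\<And>j x. x \<in> cball 0 R \<Longrightarrow> norm (pd j f x - pd j f 0 - D1 (pd j f) 0 x) \<le> K * norm x ^ 2"
    by blast
  have "norm (f x - f 0 - D1 f 0 x - (1/2) *\<^sub>R D2 f 0 x x) \<le> (real CARD('n) * \<bar>K\<bar>) * norm x ^ 3" if x: "x \<in> cball 0 R" for x
  proof -
    have sub: "cball 0 (norm x) \<subseteq> cball (0 :: real ^ 'n) R" using x by auto
    have "norm ((f x - f 0 - D1 f 0 x - (1/2) *\<^sub>R D2 f 0 x x) - (f 0 - f 0 - D1 f 0 0 - (1/2) *\<^sub>R D2 f 0 0 0)) \<le> (real CARD('n) * (\<bar>K\<bar> * norm x ^ 2)) * norm (x - 0)"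
    proof (rule differentiable_bound[OF convex_cball[of 0 "norm x"],
          where f' = "\<lambda>y h. D1 f y h - 0 - D1 f 0 h - (1/2) *\<^sub>R (D2 f 0 y h + D2 f 0 h y)"])
      fix y :: "real ^ 'n" assume y: "y \<in> cball 0 (norm x)"
      have yU: "y \<in> U" "0 \<in> cball (0 :: real ^ 'n) R" "y \<in> cball 0 R" "norm y \<le> norm x" using sub R y x
        by (auto intro: order_trans[OF norm_ge_zero])
      show "((\<lambda>x. f x - f 0 - D1 f 0 x - (1/2) *\<^sub>R D2 f 0 x x) has_derivative
          (\<lambda>h. D1 f y h - 0 - D1 f 0 h - (1/2) *\<^sub>R (D2 f 0 y h + D2 f 0 h y))) (at y within cball 0 (norm x))"
        by (intro has_derivative_diff has_derivative_D1[OF f yU(1)] has_derivative_const has_derivative_scaleR_right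
           bounded_bilinear.FDERIV[OF bounded_bilinear_D2] has_derivative_ident
           bounded_linear.has_derivative[OF linear_conv_bounded_linear[THEN iffD1, OF linear_D1] has_derivative_ident])
      show "onorm (\<lambda>h. D1 f y h - 0 - D1 f 0 h - (1/2) *\<^sub>R (D2 f 0 y h + D2 f 0 h y)) \<le> real CARD('n) * (\<bar>K\<bar> * norm x ^ 2)"
      proof (rule onorm_le)
        fix h
        have "D1 f y h - 0 - D1 f 0 h - (1/2) *\<^sub>R (D2 f 0 y h + D2 f 0 h y) = D1 f y h - D1 f 0 h - D2 f 0 h y"
          by (simp add: D2_commute[OF f U0, of y h] flip: scaleR_2)
        also have "\<dots> = (\<Sum>j\<in>UNIV. h $ j *\<^sub>R (pd j f y - pd j f 0 - D1 (pd j f) 0 y))"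
          by (simp add: D1_def[of f] D2_def scaleR_diff_right sum_subtractf)
        also have "norm \<dots> \<le> (\<Sum>j\<in>UNIV. \<bar>h $ j\<bar> * norm (pd j f y - pd j f 0 - D1 (pd j f) 0 y))"
          by (rule order_trans[OF norm_sum]) simp
        also have "\<dots> \<le> (\<Sum>j\<in>(UNIV::'n set). norm h * (\<bar>K\<bar> * norm x ^ 2))"
        proof (intro sum_mono mult_mono component_le_norm_cart)
          fix j
          have "norm (pd j f y - pd j f 0 - D1 (pd j f) 0 y) \<le> K * norm y ^ 2" by (rule K[OF yU(3)])
          also have "\<dots> \<le> \<bar>K\<bar> * norm x ^ 2" using yU(4) by (intro mult_mono power_mono) auto
          finally show "norm (pd j f y - pd j f 0 - D1 (pd j f) 0 y) \<le> \<bar>K\<bar> * norm x ^ 2" .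
        qed auto
        finally show "norm (D1 f y h - 0 - D1 f 0 h - (1/2) *\<^sub>R (D2 f 0 y h + D2 f 0 h y)) \<le> real CARD('n) * (\<bar>K\<bar> * norm x ^ 2) * norm h"
          by (simp add: mult_ac)
      qed
    qed auto
    thus ?thesis by (simp add: D1_simps D2_simps power2_eq_square power3_eq_cube mult_ac)
  qed
  thus ?thesis by blast
qed

section \<open>Evaluation of the brackets at the origin\<close>

lemma app0_Suc: "app0 b (Suc k) = Brk (app0 b k) (Ind X0)" and app0_0 [simp]: "app0 b 0 = b"
  by (simp_all add: app0_def)

lemma len_app0: "len (app0 b l) = len b + l"
  by (induction l) (simp_all add: app0_Suc)

lemma len_W_br: "len (W_br i (Suc k) l) = 2 * k + 3 + l"
  by (simp add: W_br_def M_br_def len_app0)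

lemma len_C_br: "len (C_br j l) = j + 2 + l"
  by (cases "even j") (auto simp: C_br_def M_br_def len_app0 elim!: evenE oddE)

lemma exists_control_system:
  fixes f0 f1 f2 :: "real ^ 'n \<Rightarrow> real ^ 'n"
  assumes U: "open U" "0 \<in> U" and f: "f0 real_analytic_on U" "f1 real_analytic_on U" "f2 real_analytic_on U"
    and f00: "f0 0 = 0"
  shows "\<exists>R K. cball 0 R \<subseteq> U \<and> control_system f0 f1 f2 (D1 f0 0) (D2 f0 0) (f1 0) (f2 0) (D1 f1 0) (D1 f2 0) R K"
proof -
  obtain R where R: "0 < R" "cball 0 R \<subseteq> U" using U open_contains_cball by blast
  note l = real_analytic_lipschitz[OF _ R(2)] and t1 = real_analytic_taylor1[OF _ R(2)] and bd = real_analytic_bounded[OF _ R(2)]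
  obtain k0 where k0: "\<forall>x\<in>cball 0 R. \<forall>y\<in>cball 0 R. norm (f0 x - f0 y) \<le> k0 * norm (x - y)" using l[OF f(1)] by blast
  obtain k1 where k1: "\<forall>x\<in>cball 0 R. \<forall>y\<in>cball 0 R. norm (f1 x - f1 y) \<le> k1 * norm (x - y)" using l[OF f(2)] by blast
  obtain k2 where k2: "\<forall>x\<in>cball 0 R. \<forall>y\<in>cball 0 R. norm (f2 x - f2 y) \<le> k2 * norm (x - y)" using l[OF f(3)] by blast
  obtain k3 where k3: "\<forall>x\<in>cball 0 R. norm (f1 x) \<le> k3" using bd[OF f(2)] by blast
  obtain k4 where k4: "\<forall>x\<in>cball 0 R. norm (f2 x) \<le> k4" using bd[OF f(3)] by blast
  obtain k5 where k5: "\<forall>x\<in>cball 0 R. norm (f0 x - f0 0 - D1 f0 0 x - (1/2) *\<^sub>R D2 f0 0 x x) \<le> k5 * norm x ^ 3"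
    using real_analytic_taylor2[OF f(1) R(2)] R(1) by fastforce
  obtain k6 where k6: "\<forall>x\<in>cball 0 R. norm (f0 x - f0 0 - D1 f0 0 x) \<le> k6 * norm x ^ 2" using t1[OF f(1)] by blast
  obtain k7 where k7: "\<forall>x\<in>cball 0 R. norm (f1 x - f1 0 - D1 f1 0 x) \<le> k7 * norm x ^ 2" using t1[OF f(2)] by blast
  obtain k8 where k8: "\<forall>x\<in>cball 0 R. norm (f2 x - f2 0 - D1 f2 0 x) \<le> k8 * norm x ^ 2" using t1[OF f(3)] by blast
  obtain k9 where k9: "\<And>x. norm (D1 f0 0 x) \<le> norm x * k9"
    using bounded_linear.bounded[OF linear_conv_bounded_linear[THEN iffD1, OF linear_D1[of f0 0]]] by blast
  define K where "K = Max {1, k0, k1, k2, k3, k4, k5, k6, k7, k8, k9}"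
  have K: "1 \<le> K" "k0 \<le> K" "k1 \<le> K" "k2 \<le> K" "k3 \<le> K" "k4 \<le> K" "k5 \<le> K" "k6 \<le> K" "k7 \<le> K" "k8 \<le> K" "k9 \<le> K"
    unfolding K_def by (rule Max_ge; simp)+
  have up: "a \<le> K * c" if "a \<le> k * c" "k \<le> K" "0 \<le> c" for a k c
    using that(1) mult_right_mono[OF that(2,3)] by (rule order_trans)
  have "control_system f0 f1 f2 (D1 f0 0) (D2 f0 0) (f1 0) (f2 0) (D1 f1 0) (D1 f2 0) R K"
  proof (rule control_system.intro)
    show "0 < R" "1 \<le> K" "f0 0 = 0" using R K f00 by auto
    show "linear (D1 f0 0)" "linear (D1 f1 0)" "linear (D1 f2 0)" by (rule linear_D1)+
    show "bounded_bilinear (D2 f0 0)" by (rule bounded_bilinear_D2)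
    show "D2 f0 0 x y = D2 f0 0 y x" for x y by (rule D2_commute[OF f(1) U(2)])
    fix x :: "real ^ 'n"
    show "norm (D1 f0 0 x) \<le> K * norm x"
      by (rule up[of _ k9]) (use k9[of x] K in \<open>auto simp: mult.commute\<close>)
    assume x: "norm x \<le> R"
    hence x': "x \<in> cball 0 R" by simp
    show "norm (f1 x) \<le> K" "norm (f2 x) \<le> K" using k3 k4 x' K by (meson order_trans)+
    show "norm (f0 x - D1 f0 0 x - (1 / 2) *\<^sub>R D2 f0 0 x x) \<le> K * norm x ^ 3"
      by (rule up[of _ k5]) (use k5[rule_format, OF x'] K f00 in auto)
    show "norm (f0 x - D1 f0 0 x) \<le> K * norm x ^ 2"
      by (rule up[of _ k6]) (use k6[rule_format, OF x'] K f00 in auto)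
    show "norm (f1 x - f1 0 - D1 f1 0 x) \<le> K * norm x ^ 2"
      by (rule up[of _ k7]) (use k7[rule_format, OF x'] K in auto)
    show "norm (f2 x - f2 0 - D1 f2 0 x) \<le> K * norm x ^ 2"
      by (rule up[of _ k8]) (use k8[rule_format, OF x'] K in auto)
    fix y :: "real ^ 'n" assume "norm y \<le> R"
    hence y': "y \<in> cball 0 R" by simp
    show "norm (f0 x - f0 y) \<le> K * norm (x - y)" by (rule up[of _ k0]) (use k0 x' y' K in auto)
    show "norm (f1 x - f1 y) \<le> K * norm (x - y)" by (rule up[of _ k1]) (use k1 x' y' K in auto)
    show "norm (f2 x - f2 y) \<le> K * norm (x - y)" by (rule up[of _ k2]) (use k2 x' y' K in auto)
  qed
  with R show ?thesis by blast
qed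

text \<open>R and K come from an existence statement and are therefore fixed as parameters;
  \<open>cball_U\<close> keeps the trajectories in the domain U.\<close>

locale analytic_system =
  fixes U :: "(real ^ 'n) set" and f0 f1 f2 :: "real ^ 'n \<Rightarrow> real ^ 'n" and R K :: real
  assumes U: "open U" "0 \<in> U"
    and analytic: "f0 real_analytic_on U" "f1 real_analytic_on U" "f2 real_analytic_on U"
    and f0_0': "f0 0 = 0" and cball_U: "cball 0 R \<subseteq> U"
    and cs: "control_system f0 f1 f2 (D1 f0 0) (D2 f0 0) (f1 0) (f2 0) (D1 f1 0) (D1 f2 0) R K"
begin

sublocale control_system f0 f1 f2 "D1 f0 0" "D2 f0 0" "f1 0" "f2 0" "D1 f1 0" "D1 f2 0" R K
  by (rule cs)

abbreviation "\<Lambda> \<equiv> Lam U f0 f1 f2"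
abbreviation "fb \<equiv> f_br U f0 f1 f2"

lemmas Lam = Lam_props[OF U(1) analytic]

lemma Lam_analytic: "\<Lambda> a real_analytic_on U"
  using Lam(1) by (simp add: vf_lie_hom_def)

lemma Lam_add: "x \<in> U \<Longrightarrow> \<Lambda> (a + b) x = \<Lambda> a x + \<Lambda> b x"
  and Lam_scaleR: "x \<in> U \<Longrightarrow> \<Lambda> (r *\<^sub>R a) x = r *\<^sub>R \<Lambda> a x"
  and Lam_bracket: "x \<in> U \<Longrightarrow> \<Lambda> (lie_bracket a b) x = vf_bracket (\<Lambda> a) (\<Lambda> b) x"
  using Lam(1) by (simp_all add: vf_lie_hom_def)

lemma Lam_bracket_X0:
  assumes x: "x \<in> U" shows "\<Lambda> (lie_bracket a (lie_gen X0)) x = vf_bracket (\<Lambda> a) f0 x"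
  using vf_bracket_cong[OF U(1) Lam_analytic[of a] analytic(1) x, of "\<Lambda> a" "\<Lambda> (lie_gen X0)"] Lam(2) Lam_bracket[OF x]
  by simp

text \<open>Since f0 vanishes at the origin, bracketing with X0 acts there as A; this ties the X0
  appended to brackets to the invariance of the reachable vectors under A.\<close>

lemma Lam_bracket_X0_at_0: "\<Lambda> (lie_bracket a (lie_gen X0)) 0 = D1 f0 0 (\<Lambda> a 0)"
  using Lam_bracket_X0[OF U(2), of a] vf_bracket_D1[OF Lam_analytic[of a] analytic(1) U(2)]
  by (simp add: f0_0' linear_0[OF linear_D1])

text \<open>At 0 the second derivative of \<Lambda> a is paired with f0 0 = 0 and disappears; what
  remains is the recursion of \<open>J1\<close> and \<open>J2\<close>.\<close>

lemma D1_Lam_bracket_X0: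
  "D1 (\<Lambda> (lie_bracket a (lie_gen X0))) 0 h =
    D2 f0 0 (\<Lambda> a 0) h + D1 f0 0 (D1 (\<Lambda> a) 0 h) - D1 (\<Lambda> a) 0 (D1 f0 0 h)"
proof -
  have "D1 (\<Lambda> (lie_bracket a (lie_gen X0))) 0 = D1 (vf_bracket (\<Lambda> a) f0) 0"
    by (rule D1_cong[OF U(1) _ real_analytic_on_vf_bracket[OF U(1) Lam_analytic analytic(1)] U(2)])
       (simp add: Lam_bracket_X0)
  thus ?thesis
    using D1_vf_bracket[OF U(1) Lam_analytic[of a] analytic(1) U(2), of h]
    by (simp add: f0_0' linear_0[OF linear_D2_left])
qed

lemma fb_app0: "fb (app0 b l) 0 = (D1 f0 0 ^^ l) (fb b 0)"
  by (induction l) (simp_all add: app0_Suc f_br_def Lam_bracket_X0_at_0)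

lemma fb_M1: "fb (M_br X1 k) 0 = c1 k"
  unfolding M_br_def fb_app0 c1_def by (simp add: f_br_def Lam(3)[OF U(2)])

lemma fb_M2: "fb (M_br X2 k) 0 = c2 k"
  unfolding M_br_def fb_app0 c2_def by (simp add: f_br_def Lam(4)[OF U(2)])

lemma M_br_Suc: "M_br i (Suc k) = Brk (M_br i k) (Ind X0)"
  by (simp add: M_br_def app0_Suc)

lemma D1_fb_M1: "D1 (fb (M_br X1 k)) 0 = J1 k"
proof (induction k)
  case 0
  have "D1 (\<Lambda> (lie_gen X1)) 0 = D1 f1 0"
    by (rule D1_cong[OF U(1) _ analytic(2) U(2)]) (simp add: Lam(3))
  thus ?case by (simp add: M_br_def f_br_def)
next
  case (Suc k)
  show ?case
    using D1_Lam_bracket_X0[of "e_br (M_br X1 k)"] Suc fb_M1[of k] by (simp add: M_br_Suc f_br_def fun_eq_iff)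
qed

lemma D1_fb_M2: "D1 (fb (M_br X2 k)) 0 = J2 k"
proof (induction k)
  case 0
  have "D1 (\<Lambda> (lie_gen X2)) 0 = D1 f2 0"
    by (rule D1_cong[OF U(1) _ analytic(3) U(2)]) (simp add: Lam(4))
  thus ?case by (simp add: M_br_def f_br_def)
next
  case (Suc k)
  show ?case
    using D1_Lam_bracket_X0[of "e_br (M_br X2 k)"] Suc fb_M2[of k] by (simp add: M_br_Suc f_br_def fun_eq_iff)
qed

lemma fb_Brk_at_0: "fb (Brk a b) 0 = D1 (fb b) 0 (fb a 0) - D1 (fb a) 0 (fb b 0)"
  unfolding f_br_def e_br.simps Lam_bracket[OF U(2)]
  by (rule vf_bracket_D1[OF Lam_analytic Lam_analytic U(2)])

lemma fb_W: "fb (W_br X1 (Suc k) 0) 0 = Wvec1 k" "fb (W_br X2 (Suc k) 0) 0 = Wvec2 k"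
  by (simp_all add: W_br_def fb_Brk_at_0 fb_M1 fb_M2 D1_fb_M1 D1_fb_M2 Wvec1_def Wvec2_def del: J1.simps J2.simps)

text \<open>The sign (-1)^j in the bracket is the orientation that integration by parts produces:
  for odd j the factor with X2 comes first, as in \<open>Codd\<close>.\<close>

lemma fb_C: "fb (C_br j l) 0 = (D1 f0 0 ^^ l) (Cvec j)"
proof -
  have "fb (signed j (Brk (M_br X1 ((j + 1) div 2)) (M_br X2 (j div 2)))) 0 = Cvec j"
  proof (cases "even j")
    case True
    hence "(j + 1) div 2 = j div 2" by (elim evenE) simp
    thus ?thesis using True
      by (simp add: fb_Brk_at_0 fb_M1 fb_M2 D1_fb_M1 D1_fb_M2 Cvec_def Ceven_def)
  next
    case False
    hence "(j + 1) div 2 = Suc (j div 2)" by (elim oddE) simp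
    thus ?thesis using False
      by (simp add: fb_Brk_at_0 fb_M1 fb_M2 D1_fb_M1 D1_fb_M2 Cvec_def Codd_def del: J1.simps J2.simps)
  qed
  thus ?thesis unfolding C_br_def fb_app0 by simp
qed

text \<open>Multiples of X0 have bracket 0, which is again a multiple of X0.\<close>

lemma e_br_only_X0: "occ12 b = 0 \<Longrightarrow> \<exists>c. e_br b = c *\<^sub>R lie_gen X0"
proof (induction b)
  case (Ind g)
  hence "g = X0" by (cases g) (auto simp: occ12_def)
  thus ?case by (auto intro: exI[of _ 1])
next
  case (Brk a b)
  hence "occ12 a = 0" "occ12 b = 0" by (auto simp: occ12_def)
  then obtain c d where "e_br a = c *\<^sub>R lie_gen X0" "e_br b = d *\<^sub>R lie_gen X0" using Brk.IH by blast
  thus ?case by (intro exI[of _ 0]) (simp add: lie_bracket_simps)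
qed

lemma lie_bracket_skew: "lie_bracket a b = - lie_bracket b a"
proof -
  have "lie_bracket (a + b) (a + b) = lie_bracket a b + lie_bracket b a"
    unfolding lie_bracket_simps(1,2) by (simp add: lie_bracket_simps(5))
  thus ?thesis using lie_bracket_simps(5)[of "a + b"] by (simp add: eq_neg_iff_add_eq_0)
qed

text \<open>A composite bracket with a single control indeterminate has a factor built from X0
  alone, which is a multiple of X0. Up to a scalar the bracket then applies A to the other
  factor.\<close>

lemma fb_degree_one: "occ12 b = 1 \<Longrightarrow> fb b 0 \<in> reachable_set m"
proof (induction b)
  case (Ind g)
  hence "g = X1 \<or> g = X2" by (cases g) (auto simp: occ12_def)
  thus ?case using Lam(3,4)[OF U(2)] b_reachable by (auto simp: f_br_def)
next
  case (Brk a b)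
  have cl: "r *\<^sub>R D1 f0 0 x \<in> reachable_set m" if "x \<in> reachable_set m" for x r
    using reachable_set_A[OF that] subspace_scale[OF subspace_reachable_set] by blast
  have "occ12 a + occ12 b = 1" using Brk.prems by (simp add: occ12_def)
  then consider "occ12 a = 1" "occ12 b = 0" | "occ12 a = 0" "occ12 b = 1" by linarith
  thus ?case
  proof cases
    case 1
    then obtain c where c: "e_br b = c *\<^sub>R lie_gen X0" using e_br_only_X0 by blast
    have "fb (Brk a b) 0 = c *\<^sub>R D1 f0 0 (fb a 0)"
      by (simp add: f_br_def c lie_bracket_simps Lam_scaleR[OF U(2)] Lam_bracket_X0_at_0)
    thus ?thesis using cl[OF Brk.IH(1)[OF 1(1)]] by simp
  next
    case 2
    then obtain c where c: "e_br a = c *\<^sub>R lie_gen X0" using e_br_only_X0 by blast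
    have "lie_bracket (e_br a) (e_br b) = (- c) *\<^sub>R lie_bracket (e_br b) (lie_gen X0)"
      by (subst lie_bracket_skew) (simp add: c lie_bracket_simps)
    hence "fb (Brk a b) 0 = (- c) *\<^sub>R D1 f0 0 (fb b 0)"
      by (simp only: f_br_def e_br.simps Lam_scaleR[OF U(2)] Lam_bracket_X0_at_0)
    thus ?thesis using cl[OF Brk.IH(2)[OF 2(2)], of "- c"] by simp
  qed
qed

lemma S1_reachable: "S1_at0 U f0 f1 f2 \<subseteq> reachable_set m"
proof -
  have "\<Lambda> a 0 \<in> reachable_set m" if "a \<in> S1_X" for a
  proof -
    have "subspace {a. \<Lambda> a 0 \<in> reachable_set m}"
    proof (rule subspaceI)
      have "\<Lambda> 0 0 = 0" using Lam_scaleR[OF U(2), of 0 0] by simp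
      thus "0 \<in> {a. \<Lambda> a 0 \<in> reachable_set m}" using subspace_0[OF subspace_reachable_set] by simp
    qed (auto simp: Lam_add[OF U(2)] Lam_scaleR[OF U(2)] intro: subspace_add[OF subspace_reachable_set] subspace_scale[OF subspace_reachable_set])
    moreover have "{e_br b |b. occ12 b = 1} \<subseteq> {a. \<Lambda> a 0 \<in> reachable_set m}"
      using fb_degree_one by (auto simp: f_br_def)
    ultimately have "span {e_br b |b. occ12 b = 1} \<subseteq> {a. \<Lambda> a 0 \<in> reachable_set m}" by (rule span_minimal[rotated])
    thus ?thesis using that unfolding S1_X_def by blast
  qed
  thus ?thesis by (auto simp: S1_at0_def)
qed

text \<open>The bad brackets that occur have length 2 k + 3 \<le> j + 2 \<le> |b|, so they lie in
  \<open>S1_at0\<close> and are reachable; the l appended X0 amount to l applications of A.\<close>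

lemma good_reachable:
  assumes good: "b \<in> B2_good" and bad: "\<And>a. a \<in> B2_bad \<Longrightarrow> len a \<le> len b \<Longrightarrow> fb a 0 \<in> S1_at0 U f0 f1 f2"
  shows "fb b 0 \<in> reachable_set m"
proof -
  obtain j l where b: "b = C_br j l" using good by (auto simp: B2_good_def)
  have "Cvec j \<in> reachable_set m"
  proof (rule Cvec_reachable)
    fix k assume k: "2 * k + 3 \<le> j + 2"
    have "fb (W_br i (Suc k) 0) 0 \<in> reachable_set m" if "i \<in> {X1, X2}" for i
    proof -
      have "W_br i (Suc k) 0 \<in> B2_bad" using that unfolding B2_bad_def by fastforce
      moreover have "len (W_br i (Suc k) 0) \<le> len b" using k by (simp add: b len_W_br len_C_br)
      ultimately show ?thesis using bad S1_reachable by blast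
    qed
    from this[of X1] this[of X2] show "Wvec1 k \<in> reachable_set m \<and> Wvec2 k \<in> reachable_set m"
      by (simp add: fb_W)
  qed
  hence "(D1 f0 0 ^^ l) (Cvec j) \<in> reachable_set m" by (induction l) (auto intro: reachable_set_A)
  thus ?thesis by (simp add: b fb_C)
qed

end

section \<open>Controllability\<close>

lemma pulse_family_equicontinuous_all:
  assumes D: "pulse_family m \<rho> C s D" and "0 < \<epsilon>"
  shows "\<exists>\<delta>>0. \<forall>k\<le>m. \<forall>y z. norm y \<le> \<rho> \<longrightarrow> norm z \<le> \<rho> \<longrightarrow> dist y z < \<delta> \<longrightarrow> (\<forall>t. norm (D k y t - D k z t) < \<epsilon>)"
proof -
  have "\<forall>k. \<exists>\<delta>. k \<le> m \<longrightarrow> \<delta> > 0 \<and> (\<forall>y z. norm y \<le> \<rho> \<longrightarrow> norm z \<le> \<rho> \<longrightarrow> dist y z < \<delta> \<longrightarrow> (\<forall>t. norm (D k y t - D k z t) < \<epsilon>))"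
    using pulse_family_equicontinuous[OF D _ assms(2)] by blast
  then obtain \<delta> where \<delta>: "\<And>k. k \<le> m \<Longrightarrow> \<delta> k > 0 \<and> (\<forall>y z. norm y \<le> \<rho> \<longrightarrow> norm z \<le> \<rho> \<longrightarrow> dist y z < \<delta> k \<longrightarrow> (\<forall>t. norm (D k y t - D k z t) < \<epsilon>))"
    by metis
  have min: "Min (\<delta> ` {..m}) \<le> \<delta> k" if "k \<le> m" for k using that by simp
  have "0 < Min (\<delta> ` {..m})" using \<delta> by simp
  thus ?thesis using \<delta> min by (intro exI[of _ "Min (\<delta> ` {..m})"]) (meson less_le_trans)
qed

definition shifted :: "(nat \<Rightarrow> 'a \<Rightarrow> real \<Rightarrow> real \<times> real) \<Rightarrow> real \<Rightarrow> 'a \<Rightarrow> (real \<Rightarrow> real) \<times> (real \<Rightarrow> real)" where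
  "shifted D T z = (\<lambda>t. fst (D 0 z (t - T)), \<lambda>t. snd (D 0 z (t - T)))"

text \<open>Applied to a pulse and to the difference of two pulses. The factor 2 (m + 1) counts two
  controls with derivatives of order 0 to m.\<close>

lemma W_norm2_le:
  fixes E :: "nat \<Rightarrow> real \<Rightarrow> real \<times> real"
  assumes der: "\<And>k t. k < m \<Longrightarrow> (E k has_vector_derivative E (Suc k) t) (at t)"
    and cont: "\<And>k. k \<le> m \<Longrightarrow> continuous_on UNIV (E k)" and T: "0 < T"
    and B: "\<And>k t. k \<le> m \<Longrightarrow> norm (E k t) \<le> B"
    and bdry: "\<And>k t. k \<le> m \<Longrightarrow> t \<le> - T \<or> 0 \<le> t \<Longrightarrow> E k t = 0"
  shows "(\<lambda>t. fst (E 0 (t - T))) \<in> W0_space m T" "(\<lambda>t. snd (E 0 (t - T))) \<in> W0_space m T"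
    and "W_norm2 m T (\<lambda>t. fst (E 0 (t - T)), \<lambda>t. snd (E 0 (t - T))) \<le> ennreal (2 * (real (m + 1) * B))"
proof -
  have B0: "0 \<le> B" using B[of 0 0] norm_ge_zero order_trans by blast
  have c: "continuous_on UNIV (\<lambda>t. E k (t - T))" if "k \<le> m" for k
    by (rule continuous_on_compose2[OF cont[OF that]]) (auto intro!: continuous_intros)
  have d: "((\<lambda>t. E k (t - T)) has_vector_derivative E (Suc k) (t - T)) (at t)" if "k < m" for k t
  proof -
    have "((\<lambda>t. t - T) has_vector_derivative 1) (at t)" by (auto intro!: derivative_eq_intros)
    from vector_diff_chain_at[OF this der[OF that]] show ?thesis by (simp add: o_def)
  qed
  define Df where "Df k t = fst (E k (t - T))" for k t
  define Ds where "Ds k t = snd (E k (t - T))" for k t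
  have f: "Df 0 \<in> W0_space m T" "W_norm m T (Df 0) \<le> ennreal (real (m + 1) * B)"
  proof -
    have 1: "(Df k has_real_derivative Df (Suc k) t) (at t)" if "k < m" for k t
      unfolding has_real_derivative_iff_has_vector_derivative Df_def
      by (rule bounded_linear.has_vector_derivative[OF bounded_linear_fst d[OF that]])
    have 2: "continuous_on UNIV (Df k)" if "k \<le> m" for k
      unfolding Df_def by (intro continuous_on_fst c that)
    have 3: "\<bar>Df k t\<bar> \<le> B" if "k \<le> m" for k t
      using B[OF that, of "t - T"] norm_fst_le[of "fst (E k (t - T))" "snd (E k (t - T))"] by (simp add: Df_def)
    have 4: "Df k 0 = 0" "Df k T = 0" if "k < m" for k using bdry[of k] that by (auto simp: Df_def)
    show "Df 0 \<in> W0_space m T" "W_norm m T (Df 0) \<le> ennreal (real (m + 1) * B)"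
      using W0_space_classical[of m Df T B, OF 1 2 T 3 4] W_norm_classical[of m Df T B, OF 1 2 T 3 4] by auto
  qed
  have s: "Ds 0 \<in> W0_space m T" "W_norm m T (Ds 0) \<le> ennreal (real (m + 1) * B)"
  proof -
    have 1: "(Ds k has_real_derivative Ds (Suc k) t) (at t)" if "k < m" for k t
      unfolding has_real_derivative_iff_has_vector_derivative Ds_def
      by (rule bounded_linear.has_vector_derivative[OF bounded_linear_snd d[OF that]])
    have 2: "continuous_on UNIV (Ds k)" if "k \<le> m" for k
      unfolding Ds_def by (intro continuous_on_snd c that)
    have 3: "\<bar>Ds k t\<bar> \<le> B" if "k \<le> m" for k t
      using B[OF that, of "t - T"] norm_snd_le[of "snd (E k (t - T))" "fst (E k (t - T))"] by (simp add: Ds_def)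
    have 4: "Ds k 0 = 0" "Ds k T = 0" if "k < m" for k using bdry[of k] that by (auto simp: Ds_def)
    show "Ds 0 \<in> W0_space m T" "W_norm m T (Ds 0) \<le> ennreal (real (m + 1) * B)"
      using W0_space_classical[of m Ds T B, OF 1 2 T 3 4] W_norm_classical[of m Ds T B, OF 1 2 T 3 4] by auto
  qed
  show "(\<lambda>t. fst (E 0 (t - T))) \<in> W0_space m T" "(\<lambda>t. snd (E 0 (t - T))) \<in> W0_space m T"
    using f(1) s(1) by (simp_all add: Df_def[abs_def] Ds_def[abs_def])
  have "W_norm2 m T (Df 0, Ds 0) \<le> ennreal (real (m + 1) * B) + ennreal (real (m + 1) * B)"
    unfolding W_norm2_def using add_mono[OF f(2) s(2)] by simp
  also have "\<dots> = ennreal (2 * (real (m + 1) * B))"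
    using B0 by (subst ennreal_plus[symmetric]) auto
  finally show "W_norm2 m T (\<lambda>t. fst (E 0 (t - T)), \<lambda>t. snd (E 0 (t - T))) \<le> ennreal (2 * (real (m + 1) * B))"
    by (simp add: Df_def[abs_def] Ds_def[abs_def])
qed

context analytic_system
begin

lemma pulse_family_W0:
  assumes D: "pulse_family m \<rho> C s D" and z: "norm z \<le> \<rho>" and T: "0 < T" "C * norm z powr s \<le> T"
  shows "shifted D T z \<in> W0_space m T \<times> W0_space m T"
    and "W_norm2 m T (shifted D T z) \<le> ennreal (2 * (real (m + 1) * (C * norm z powr s)))"
proof -
  note w = W_norm2_le[of m "\<lambda>k. D k z" T "C * norm z powr s"]
  have 1: "(D k z has_vector_derivative D (Suc k) z t) (at t)" if "k < m" for k t using pulse_familyD(4)[OF D that z] .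
  have 2: "continuous_on UNIV (D k z)" if "k \<le> m" for k using pulse_family_continuous[OF D z that] .
  have 3: "norm (D k z t) \<le> C * norm z powr s" if "k \<le> m" for k t using pulse_familyD(6)[OF D that z] .
  have 4: "D k z t = 0" if "k \<le> m" "t \<le> - T \<or> 0 \<le> t" for k t
    by (rule pulse_familyD(7)[OF D that(1) z]) (use that(2) T in auto)
  show "shifted D T z \<in> W0_space m T \<times> W0_space m T"
    "W_norm2 m T (shifted D T z) \<le> ennreal (2 * (real (m + 1) * (C * norm z powr s)))"
    using w[OF 1 2 T(1) 3 4] by (simp_all add: shifted_def)
qed

text \<open>The state rests at 0 until the pulse begins at time T - \<delta>. So T may exceed
  \<theta>, although \<open>traj\<close> is controlled only on [-\<theta>, 0].\<close>

lemma pulse_family_solution: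
  assumes D: "pulse_family m \<rho> C s D" and z: "norm z \<le> \<rho>" and adm: "admissible (D 0 z)"
    and T: "0 < T" "C * norm z powr s \<le> T" "C * norm z powr s \<le> \<theta>"
  shows "\<exists>x. is_solution U f0 f1 f2 T (shifted D T z) 0 x \<and> x T = End (D 0 z)"
proof -
  define \<delta> where "\<delta> = C * norm z powr s"
  have \<delta>: "0 \<le> \<delta>" "\<delta> \<le> T" "\<delta> \<le> \<theta>" using T pulse_familyD(2)[OF D] by (auto simp: \<delta>_def)
  define h where "h = T - \<delta>"
  have h: "0 \<le> h" "h \<le> T" using \<delta> by (auto simp: h_def)
  let ?w = "D 0 z"
  have zero: "?w t = 0" if "t \<le> - \<delta>" for t
    using pulse_familyD(7)[OF D _ z, of 0 t] that by (simp add: \<delta>_def)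
  \<comment> \<open>\<open>max t h\<close> freezes the trajectory at its value 0 until the pulse
    starts.\<close>
  define x where "x t = traj ?w (max t h - T)" for t
  have s: "sol ?w (- \<delta>) 0 (traj ?w)" by (rule sol_subinterval[OF traj(1)[OF adm]]) (use \<delta> in auto)
  have tr0: "traj ?w (- \<delta>) = 0" by (rule traj_before[where \<delta> = \<delta>, OF adm zero]) (use \<delta> in auto)
  have x_before: "x t = 0" if "t \<le> h" for t using that tr0 by (simp add: x_def h_def max_def)
  have x_after: "x t = traj ?w (t - T)" if "h \<le> t" for t using that by (simp add: x_def max_def)
  have contx: "continuous_on {0..T} x"
  proof -
    have "continuous_on {-\<delta>..0} (traj ?w)"
      using s unfolding sol_def by (intro continuous_on_vector_derivative) blast
    thus ?thesis unfolding x_def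
      by (rule continuous_on_compose2) (use \<delta> h in \<open>auto intro!: continuous_intros simp: h_def\<close>)
  qed
  have xR: "norm (x t) \<le> R" if "t \<in> {0..T}" for t
    using s that h unfolding sol_def x_def by (auto simp: h_def max_def)
  hence xU: "x ` {0..T} \<subseteq> U" using cball_U by auto
  let ?g = "\<lambda>t. F (x t) (?w (t - T))"
  have g0: "?g t = 0" if "t \<le> h" for t
    using x_before[OF that] zero[of "t - T"] that by (simp add: h_def F_0)
  have int: "(?g has_integral (x t - 0)) {0..t}" if t: "t \<in> {0..T}" for t
  proof (cases "t \<le> h")
    case True
    have "(?g has_integral 0) {0..t}" by (rule has_integral_is_0) (use g0 True in auto)
    thus ?thesis using x_before[OF True] by simp
  next
    case False
    have 1: "(?g has_integral 0) {0..h}" by (rule has_integral_is_0) (use g0 in auto)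
    have "sol (\<lambda>t. ?w (t + - T)) h T (\<lambda>t. traj ?w (t + - T))"
      by (rule sol_shift) (use s in \<open>simp add: h_def\<close>)
    hence sh: "sol (\<lambda>t. ?w (t - T)) h t (\<lambda>t. traj ?w (t - T))"
      using sol_subinterval[of _ h T _ h t] t by simp
    have 2: "(?g has_integral (x t - x h)) {h..t}"
    proof (rule fundamental_theorem_of_calculus)
      fix r assume r: "r \<in> {h..t}"
      have "((\<lambda>t. traj ?w (t - T)) has_vector_derivative F (traj ?w (r - T)) (?w (r - T))) (at r within {h..t})"
        using sh r by (auto simp: sol_def)
      hence "(x has_vector_derivative F (traj ?w (r - T)) (?w (r - T))) (at r within {h..t})"
        by (rule has_vector_derivative_transform[OF r, rotated]) (simp add: x_after)
      thus "(x has_vector_derivative ?g r) (at r within {h..t})" using x_after[of r] r by simp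
    qed (use False in simp)
    have "(?g has_integral (0 + (x t - x h))) {0..t}"
      by (rule has_integral_combine[OF _ _ 1 2]) (use False h in auto)
    thus ?thesis using x_before[of h] by simp
  qed
  have "is_solution U f0 f1 f2 T (shifted D T z) 0 x"
    unfolding is_solution_def using contx xU int by (simp add: shifted_def F_def)
  moreover have "x T = End ?w" using h by (simp add: x_after End_def)
  ultimately show ?thesis by blast
qed

lemma pulse_family_W_continuous:
  assumes D: "pulse_family m \<rho> C s D" and Z: "\<And>z. z \<in> Z \<Longrightarrow> norm z \<le> \<rho> \<and> C * norm z powr s \<le> T" and T: "0 < T"
  shows "W_continuous_on m T Z (shifted D T)"
  unfolding W_continuous_on_def
proof (intro ballI allI impI)
  fix z :: real and \<epsilon> :: real assume z: "z \<in> Z" and \<epsilon>: "\<epsilon> > 0"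
  \<comment> \<open>Chosen so that the bound 2 (m + 1) \<epsilon>' equals \<epsilon> / 2, strictly
    below \<epsilon>.\<close>
  define \<epsilon>' where "\<epsilon>' = \<epsilon> / (4 * real (m + 1))"
  have \<epsilon>': "\<epsilon>' > 0" using \<epsilon> by (simp add: \<epsilon>'_def)
  obtain \<delta> where \<delta>: "\<delta> > 0" "\<And>k y z t. k \<le> m \<Longrightarrow> norm y \<le> \<rho> \<Longrightarrow> norm z \<le> \<rho> \<Longrightarrow> dist y z < \<delta> \<Longrightarrow> norm (D k y t - D k z t) < \<epsilon>'"
    using pulse_family_equicontinuous_all[OF D \<epsilon>'] by blast
  have "W_norm2 m T (\<lambda>t. fst (shifted D T y) t - fst (shifted D T z) t, \<lambda>t. snd (shifted D T y) t - snd (shifted D T z) t) < ennreal \<epsilon>"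
    if y: "y \<in> Z" "\<bar>y - z\<bar> < \<delta>" for y
  proof -
    have n: "norm y \<le> \<rho>" "norm z \<le> \<rho>" using Z y(1) z by auto
    define E where "E k t = D k y t - D k z t" for k t
    have "W_norm2 m T (\<lambda>t. fst (E 0 (t - T)), \<lambda>t. snd (E 0 (t - T))) \<le> ennreal (2 * (real (m + 1) * \<epsilon>'))"
    proof (rule W_norm2_le(3)[OF _ _ T])
      show "(E k has_vector_derivative E (Suc k) t) (at t)" if "k < m" for k t
        unfolding E_def[abs_def] by (intro has_vector_derivative_diff pulse_familyD(4)[OF D that] n)
      show "continuous_on UNIV (E k)" if "k \<le> m" for k
        unfolding E_def[abs_def] by (intro continuous_on_diff pulse_family_continuous[OF D _ that] n)
      show "norm (E k t) \<le> \<epsilon>'" if "k \<le> m" for k t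
        using \<delta>(2)[OF that n, of t] y(2) by (simp add: E_def dist_norm)
      show "E k t = 0" if "k \<le> m" "t \<le> - T \<or> 0 \<le> t" for k t
      proof -
        have "D k y t = 0" by (rule pulse_familyD(7)[OF D that(1) n(1)]) (use that(2) Z[OF y(1)] in auto)
        moreover have "D k z t = 0" by (rule pulse_familyD(7)[OF D that(1) n(2)]) (use that(2) Z[OF z] in auto)
        ultimately show ?thesis by (simp add: E_def)
      qed
    qed
    also have "2 * (real (m + 1) * \<epsilon>') = \<epsilon> / 2"
    proof -
      have "2 * (n * (\<epsilon> / (4 * n))) = \<epsilon> / 2" if "n \<noteq> 0" for n :: real using that by simp
      from this[of "real (m + 1)"] show ?thesis unfolding \<epsilon>'_def by linarith
    qed
    also have "ennreal (\<epsilon> / 2) < ennreal \<epsilon>" using \<epsilon> by (intro ennreal_lessI) auto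
    finally show ?thesis by (simp add: shifted_def E_def)
  qed
  thus "\<exists>\<delta>>0. \<forall>y\<in>Z. \<bar>y - z\<bar> < \<delta> \<longrightarrow>
      W_norm2 m T (\<lambda>t. fst (shifted D T y) t - fst (shifted D T z) t, \<lambda>t. snd (shifted D T y) t - snd (shifted D T z) t) < ennreal \<epsilon>"
    using \<delta>(1) by blast
qed

lemma pulse_family_small_radius:
  fixes D :: "nat \<Rightarrow> 'a::euclidean_space \<Rightarrow> real \<Rightarrow> real \<times> real"
  assumes D: "pulse_family m \<rho> C s D" and e: "bigo0 (1 + s) e" and T: "0 < T"
  obtains M r where "0 < M" "0 < r" "r \<le> \<rho>"
    "\<And>z :: 'a. norm z \<le> r \<Longrightarrow> C * norm z powr s \<le> min T (min \<theta> \<eta>0) \<and> norm (e z) \<le> M * norm z powr (1 + s)"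
proof -
  note pos = pulse_familyD(1-3)[OF D]
  have mn: "0 < min T (min \<theta> \<eta>0)" using T \<theta>_pos \<eta>0_pos by simp
  obtain r1 where r1: "0 < r1" "\<And>z :: 'a. norm z \<le> r1 \<Longrightarrow> C * norm z powr s \<le> min T (min \<theta> \<eta>0)"
    using powr_small[OF pos(2,3) mn, where 'a = 'a] by blast
  obtain M where M: "0 \<le> M" "\<forall>\<^sub>F z in nhds 0. norm (e z) \<le> M * norm z powr (1 + s)" using e by (rule bigo0E)
  obtain r2 where r2: "r2 > 0" "\<And>z. norm z < r2 \<Longrightarrow> norm (e z) \<le> M * norm z powr (1 + s)"
    using M(2) unfolding eventually_nhds_metric by (auto simp: dist_norm)
  define r where "r = min \<rho> (min r1 (r2 / 2))"
  have r: "0 < r" "r \<le> \<rho>" "r \<le> r1" "r < r2" using pos r1(1) r2(1) by (auto simp: r_def min_def)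
  show ?thesis
  proof (rule that[of "M + 1" r])
    fix z :: 'a assume z: "norm z \<le> r"
    have "norm (e z) \<le> M * norm z powr (1 + s)" using r2(2)[of z] z r by simp
    also have "\<dots> \<le> (M + 1) * norm z powr (1 + s)" by (intro mult_right_mono) auto
    finally show "C * norm z powr s \<le> min T (min \<theta> \<eta>0) \<and> norm (e z) \<le> (M + 1) * norm z powr (1 + s)"
      using r1(2)[of z] z r by simp
  qed (use M r in auto)
qed

lemma reachable_vector_if:
  assumes "\<xi> \<in> reachable_set m"
  shows "reachable_vector U f0 f1 f2 m \<xi>"
proof -
  have "reachable_map m (\<lambda>z :: real. z *\<^sub>R \<xi>)" using assms by (simp add: reachable_set_def)
  then obtain \<rho> C s D where D: "pulse_family m \<rho> C s (D :: nat \<Rightarrow> real \<Rightarrow> real \<Rightarrow> real \<times> real)"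
    "bigo0 (1 + s) (\<lambda>z. End (D 0 z) - z *\<^sub>R \<xi>)" "0 < s" by (rule reachable_mapE)
  show ?thesis
    unfolding reachable_vector_def
  \<comment> \<open>A constant map can serve as \<Xi>: the leading term z \<xi> of the end point is
    the same for every T.\<close>
  proof (intro exI[of _ "\<lambda>_. \<xi>"] conjI allI impI)
    fix T :: real assume T: "0 < T"
    obtain M r where Mr: "0 < M" "0 < r" "r \<le> \<rho>"
      "\<And>z. norm z \<le> r \<Longrightarrow> C * norm z powr s \<le> min T (min \<theta> \<eta>0) \<and> norm (End (D 0 z) - z *\<^sub>R \<xi>) \<le> M * norm z powr (1 + s)"
      using pulse_family_small_radius[OF D(1,2) T] by blast
    define C' where "C' = max M (2 * (real (m + 1) * C))"
    have Z: "norm z \<le> \<rho>" "C * norm z powr s \<le> T" "C * norm z powr s \<le> \<theta>" "C * norm z powr s \<le> \<eta>0"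
      "norm (End (D 0 z) - z *\<^sub>R \<xi>) \<le> M * norm z powr (1 + s)" if "z \<in> {-r<..<r}" for z
      using Mr(4)[of z] Mr(3) that by auto
    show "\<exists>C>0. \<exists>\<rho>>0. \<exists>s>0. \<exists>w. (\<forall>z\<in>{- \<rho><..<\<rho>}. w z \<in> W0_space m T \<times> W0_space m T) \<and>
        W_continuous_on m T {- \<rho><..<\<rho>} w \<and>
        (\<forall>z\<in>{- \<rho><..<\<rho>}. (\<exists>x. is_solution U f0 f1 f2 T (w z) 0 x \<and> norm (x T - z *\<^sub>R \<xi>) \<le> C * \<bar>z\<bar> powr (1 + s)) \<and>
          W_norm2 m T (w z) \<le> ennreal (C * \<bar>z\<bar> powr s))"
    proof (rule exI[of _ C'], rule conjI, goal_cases)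
      case 1
      show ?case using Mr by (auto simp: C'_def less_max_iff_disj)
    next
      case 2
      show ?case
      proof (rule exI[of _ r], rule conjI[OF Mr(2)], rule exI[of _ s], rule conjI[OF D(3)],
          rule exI[of _ "shifted D T"], intro conjI ballI)
      show "W_continuous_on m T {- r<..<r} (shifted D T)"
        by (rule pulse_family_W_continuous[OF D(1) _ T]) (use Z in auto)
      fix z assume z: "z \<in> {-r<..<r}"
      show "shifted D T z \<in> W0_space m T \<times> W0_space m T" by (rule pulse_family_W0(1)[OF D(1) Z(1)[OF z] T Z(2)[OF z]])
      have "admissible (D 0 z)" by (rule pulse_family_admissible[OF D(1) Z(1,4)[OF z]])
      from pulse_family_solution[OF D(1) Z(1)[OF z] this T Z(2,3)[OF z]] obtain x
        where x: "is_solution U f0 f1 f2 T (shifted D T z) 0 x" "x T = End (D 0 z)" by blast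
      have "M * \<bar>z\<bar> powr (1 + s) \<le> C' * \<bar>z\<bar> powr (1 + s)" by (intro mult_right_mono) (auto simp: C'_def)
      hence "norm (x T - z *\<^sub>R \<xi>) \<le> C' * \<bar>z\<bar> powr (1 + s)" using Z(5)[OF z] x(2) by simp
      with x(1) show "\<exists>x. is_solution U f0 f1 f2 T (shifted D T z) 0 x \<and> norm (x T - z *\<^sub>R \<xi>) \<le> C' * \<bar>z\<bar> powr (1 + s)" by blast
      have "2 * (real (m + 1) * C) * \<bar>z\<bar> powr s \<le> C' * \<bar>z\<bar> powr s" by (intro mult_right_mono) (auto simp: C'_def)
      hence "ennreal (2 * (real (m + 1) * (C * norm z powr s))) \<le> ennreal (C' * \<bar>z\<bar> powr s)"
        by (intro ennreal_leI) (simp add: mult.assoc)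
      with pulse_family_W0(2)[OF D(1) Z(1)[OF z] T Z(2)[OF z]] show "W_norm2 m T (shifted D T z) \<le> ennreal (C' * \<bar>z\<bar> powr s)"
        by (rule order_trans)
      qed
    qed
  qed auto
qed

lemma W0_STLC_if:
  assumes all: "reachable_set m = UNIV"
  shows "W0_STLC U f0 f1 f2 m"
  unfolding W0_STLC_def
proof (intro allI impI)
  fix T \<epsilon> :: real assume T: "0 < T" and \<epsilon>: "0 < \<epsilon>"
  \<comment> \<open>The identity as reachable map: a single family whose parameter is, to leading
    order, the target itself.\<close>
  have "reachable_map m (\<lambda>z. z)" by (rule reachable_map_linear) (use all in \<open>auto intro: linear_id[unfolded id_def]\<close>)
  then obtain \<rho> C s D where D: "pulse_family m \<rho> C s (D :: nat \<Rightarrow> real ^ 'n \<Rightarrow> real \<Rightarrow> real \<times> real)"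
    "bigo0 (1 + s) (\<lambda>z. End (D 0 z) - z)" "0 < s" by (rule reachable_mapE)
  obtain M r0 where Mr: "0 < M" "0 < r0" "r0 \<le> \<rho>"
    "\<And>z. norm z \<le> r0 \<Longrightarrow> C * norm z powr s \<le> min T (min \<theta> \<eta>0) \<and> norm (End (D 0 z) - z) \<le> M * norm z powr (1 + s)"
    using pulse_family_small_radius[OF D(1,2) T] by blast
  have C: "0 < C" using pulse_familyD(2)[OF D(1)] .
  have pos: "0 < 2 * (real (m + 1) * C)" "0 < (1 / 2 :: real)" using C by auto
  obtain r1 where r1: "0 < r1" "\<And>z :: real ^ 'n. norm z \<le> r1 \<Longrightarrow> (2 * (real (m + 1) * C)) * norm z powr s \<le> \<epsilon>"
    using powr_small[OF pos(1) D(3) \<epsilon>, where 'a = "real ^ 'n"] by blast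
  obtain r2 where r2: "0 < r2" "\<And>z :: real ^ 'n. norm z \<le> r2 \<Longrightarrow> M * norm z powr s \<le> 1 / 2"
    using powr_small[OF Mr(1) D(3) pos(2), where 'a = "real ^ 'n"] by blast
  define r where "r = min r0 (min r1 r2)"
  have r: "0 < r" "r \<le> r0" "r \<le> r1" "r \<le> r2" using Mr(2) r1(1) r2(1) by (auto simp: r_def)
  have Z: "norm z \<le> \<rho>" "C * norm z powr s \<le> T" "C * norm z powr s \<le> \<theta>" "C * norm z powr s \<le> \<eta>0"
    "norm (End (D 0 z) - z) \<le> r / 2" if "norm z \<le> r" for z
  proof -
    show "norm z \<le> \<rho>" "C * norm z powr s \<le> T" "C * norm z powr s \<le> \<theta>" "C * norm z powr s \<le> \<eta>0"
      using Mr(4)[of z] Mr(3) that r by auto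
    have "norm (End (D 0 z) - z) \<le> (M * norm z powr s) * norm z"
      using Mr(4)[of z] that r by (simp add: powr_add powr_one_gt_zero_iff mult_ac)
    also have "\<dots> \<le> (1 / 2) * r" using r2(2)[of z] that r by (intro mult_mono) auto
    finally show "norm (End (D 0 z) - z) \<le> r / 2" by simp
  qed
  have D': "pulse_family m (min 1 r) C s D"
    by (rule pulse_family_mono[OF D(1)]) (use r Mr D(3) in auto)
  define R1 where "R1 = min 1 r"
  have R1: "0 < R1" "R1 \<le> r" using r by (auto simp: R1_def)
  have cont: "continuous_on (cball 0 R1) (\<lambda>z. End (D 0 z))"
  proof (rule continuous_on_End_pulse_family[OF D'[folded R1_def]])
    \<comment> \<open>The smallness estimate is about vectors; a vector of norm \<open>R1\<close>
      transfers it to the number.\<close>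
    obtain z :: "real ^ 'n" where "norm z = R1" using R1(1) vector_choose_size[of R1] by auto
    with Z(4)[of z] R1 show "C * R1 powr s \<le> \<eta>0" by simp
  qed
  have Z1: "norm (End (D 0 z) - z) \<le> R1 / 2" if "norm z \<le> R1" for z
  proof -
    have "norm (End (D 0 z) - z) \<le> (M * norm z powr s) * norm z"
      using Mr(4)[of z] that r R1 by (simp add: powr_add powr_one_gt_zero_iff mult_ac)
    also have "\<dots> \<le> (1 / 2) * R1" using r2(2)[of z] that r R1 by (intro mult_mono) auto
    finally show ?thesis by simp
  qed
  show "\<exists>\<delta>>0. \<forall>xf\<in>ball 0 \<delta>. \<exists>u\<in>W0_space m T. \<exists>v\<in>W0_space m T. \<exists>x.
        W_norm2 m T (u, v) \<le> ennreal \<epsilon> \<and> is_solution U f0 f1 f2 T (u, v) 0 x \<and> x T = xf"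
  proof (intro exI[of _ "R1 / 2"] conjI ballI)
    show "0 < R1 / 2" using R1 by simp
    fix xf :: "real ^ 'n" assume xf: "xf \<in> ball 0 (R1 / 2)"
    \<comment> \<open>A fixed point of this map satisfies \<open>End (D 0 z) = xf\<close>. The map
      sends the ball into itself because |End z - z| \<le> R1 / 2 and |xf| < R1 / 2.\<close>
    have "\<exists>z\<in>cball 0 R1. (z - End (D 0 z)) + xf = z"
    proof -
      have c: "continuous_on (cball 0 R1) (\<lambda>z. (z - End (D 0 z)) + xf)"
        by (intro continuous_intros cont)
      have im: "(\<lambda>z. (z - End (D 0 z)) + xf) \<in> cball 0 R1 \<rightarrow> cball 0 R1"
      proof
        fix z :: "real ^ 'n" assume "z \<in> cball 0 R1"
        hence "norm (End (D 0 z) - z) \<le> R1 / 2" using Z1 by simp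
        hence "norm ((z - End (D 0 z)) + xf) \<le> R1 / 2 + R1 / 2"
          using xf by (intro order_trans[OF norm_triangle_ineq add_mono]) (auto simp: norm_minus_commute)
        thus "(z - End (D 0 z)) + xf \<in> cball 0 R1" by simp
      qed
      obtain z where "z \<in> cball 0 R1" "(z - End (D 0 z)) + xf = z"
        by (rule brouwer[OF compact_cball convex_cball _ c im]) (use R1(1) in auto)
      thus ?thesis by blast
    qed
    then obtain z where z: "norm z \<le> R1" "End (D 0 z) = xf" by auto
    have zr: "norm z \<le> r" using z R1 by simp
    have adm: "admissible (D 0 z)" by (rule pulse_family_admissible[OF D(1) Z(1,4)[OF zr]])
    from pulse_family_solution[OF D(1) Z(1)[OF zr] adm T Z(2,3)[OF zr]] obtain x
      where x: "is_solution U f0 f1 f2 T (shifted D T z) 0 x" "x T = End (D 0 z)" by blast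
    have w: "shifted D T z \<in> W0_space m T \<times> W0_space m T" by (rule pulse_family_W0(1)[OF D(1) Z(1)[OF zr] T Z(2)[OF zr]])
    have "W_norm2 m T (shifted D T z) \<le> ennreal (2 * (real (m + 1) * (C * norm z powr s)))"
      by (rule pulse_family_W0(2)[OF D(1) Z(1)[OF zr] T Z(2)[OF zr]])
    also have "\<dots> \<le> ennreal \<epsilon>"
      using r1(2)[of z] zr r by (intro ennreal_leI) (simp add: mult.assoc)
    finally have n: "W_norm2 m T (shifted D T z) \<le> ennreal \<epsilon>" .
    show "\<exists>u\<in>W0_space m T. \<exists>v\<in>W0_space m T. \<exists>x.
        W_norm2 m T (u, v) \<le> ennreal \<epsilon> \<and> is_solution U f0 f1 f2 T (u, v) 0 x \<and> x T = xf"
    proof (intro bexI exI conjI)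
      show "W_norm2 m T (fst (shifted D T z), snd (shifted D T z)) \<le> ennreal \<epsilon>" using n by simp
      show "is_solution U f0 f1 f2 T (fst (shifted D T z), snd (shifted D T z)) 0 x" using x(1) by simp
      show "x T = xf" using x(2) z(2) by simp
    qed (use w in \<open>auto simp: mem_Times_iff\<close>)
  qed
qed

end

theorem theorem2p15:
  fixes U :: "(real ^ 'n) set"
    and f0 f1 f2 :: "real ^ 'n \<Rightarrow> real ^ 'n"
    and r L :: nat
    and b :: "nat \<Rightarrow> br"
  assumes "1 \<le> L"
    and "open U" and "0 \<in> U"
    and "f0 real_analytic_on U" and "f1 real_analytic_on U" and "f2 real_analytic_on U"
    and "f0 0 = 0"
    and "r = dim (S1_at0 U f0 f1 f2)" and "r < CARD('n)"
    and "\<forall>i\<in>{r+1..CARD('n)}. b i \<in> B2_good"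
    and "Max ((\<lambda>i. len (b i)) ` {r+1..CARD('n)}) = L"
    and "S1_at0 U f0 f1 f2 \<inter> span ((\<lambda>i. f_br U f0 f1 f2 (b i) 0) ` {r+1..CARD('n)}) = {0}"
    and "{x + y |x y. x \<in> S1_at0 U f0 f1 f2 \<and>
            y \<in> span ((\<lambda>i. f_br U f0 f1 f2 (b i) 0) ` {r+1..CARD('n)})} = UNIV"
  shows "(\<forall>j\<in>{r+1..CARD('n)}.
            (\<forall>a\<in>B2_bad. len a \<le> len (b j) \<longrightarrow> f_br U f0 f1 f2 a 0 \<in> S1_at0 U f0 f1 f2) \<longrightarrow>
            (\<forall>m. reachable_vector U f0 f1 f2 m (f_br U f0 f1 f2 (b j) 0))) \<and>
         ((\<forall>a\<in>B2_bad. len a \<le> L \<longrightarrow> f_br U f0 f1 f2 a 0 \<in> S1_at0 U f0 f1 f2) \<longrightarrow>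
            smooth_STLC U f0 f1 f2)"
proof -
  obtain R K where RK: "cball 0 R \<subseteq> U"
    "control_system f0 f1 f2 (D1 f0 0) (D2 f0 0) (f1 0) (f2 0) (D1 f1 0) (D1 f2 0) R K"
    using exists_control_system[OF assms(2-7)] by blast
  interpret analytic_system U f0 f1 f2 R K
    by (rule analytic_system.intro) (use assms(2-7) RK in auto)
  show ?thesis
  proof (intro conjI ballI impI allI)
    fix j m assume j: "j \<in> {r+1..CARD('n)}"
      and bad: "\<forall>a\<in>B2_bad. len a \<le> len (b j) \<longrightarrow> fb a 0 \<in> S1_at0 U f0 f1 f2"
    have "fb (b j) 0 \<in> reachable_set m"
      by (rule good_reachable) (use assms(10) j bad in auto)
    thus "reachable_vector U f0 f1 f2 m (fb (b j) 0)" by (rule reachable_vector_if)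
  next
    assume bad: "\<forall>a\<in>B2_bad. len a \<le> L \<longrightarrow> fb a 0 \<in> S1_at0 U f0 f1 f2"
    \<comment> \<open>Every vector is the sum of an element of \<open>S1_at0\<close> and a
      combination of the given good brackets, and both parts are reachable.\<close>
    have "reachable_set m = UNIV" for m
    proof -
      have "fb (b i) 0 \<in> reachable_set m" if i: "i \<in> {r+1..CARD('n)}" for i
      proof (rule good_reachable)
        show "b i \<in> B2_good" using assms(10) i by blast
        have "len (b i) \<le> L" unfolding assms(11)[symmetric] using i by (intro Max_ge) auto
        thus "fb a 0 \<in> S1_at0 U f0 f1 f2" if "a \<in> B2_bad" "len a \<le> len (b i)" for a
          using bad that by auto
      qed
      hence sp: "span ((\<lambda>i. fb (b i) 0) ` {r+1..CARD('n)}) \<subseteq> reachable_set m"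
        by (intro span_minimal subspace_reachable_set) blast
      have "v \<in> reachable_set m" for v
      proof -
        have "v \<in> {x + y |x y. x \<in> S1_at0 U f0 f1 f2 \<and> y \<in> span ((\<lambda>i. fb (b i) 0) ` {r+1..CARD('n)})}"
          unfolding assms(13) by simp
        then obtain x y where "v = x + y" "x \<in> S1_at0 U f0 f1 f2" "y \<in> span ((\<lambda>i. fb (b i) 0) ` {r+1..CARD('n)})" by blast
        thus ?thesis using S1_reachable sp subspace_add[OF subspace_reachable_set] by blast
      qed
      thus ?thesis by blast
    qed
    thus "smooth_STLC U f0 f1 f2" unfolding smooth_STLC_def using W0_STLC_if by blast
  qed
qed

end
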